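(* Let $G$ be a finite group, and let $j\colon \mathcal D(G)\to \mathbf B_\bullet(G)$ be the bivariant functor from finite left $G$-sets to the additive completion of the conjugation biset category of $G$. A Mackey functor $\mathcal M\colon \mathcal D(G)\to \mathcal Ab$ factors through $j\colon \mathcal D(G)\to\mathbf B_\bullet(G)$ if and only if $\mathcal M$ is conjugation invariant.
   Context: $G$ is a finite group; $\mathcal Ab$ is the category of abelian groups; $\mathcal D(G)$ is the category of finite left $G$-sets and $G$-maps. Bivariant functor. A bivariant functor $\mathcal M=(\mathcal M_*,\mathcal M^* )$ is a pair consisting of a covariant functor $\mathcal M_*$ and a contravariant functor $\mathcal M^*$ which agree on objects (write $\mathcal M(S)$ for the common value). For a morphism $\varphi$ write $\varphi_{\mathcal M}=\mathcal M_*(\varphi)$ and $\varphi^{\mathcal M}=\mathcal M^*(\varphi)$. Mackey functor. A Mackey functor is a bivariant functor $\mathcal M\colon\mathcal D(G)\to\mathcal Ab$ such that: (M1) for every pullback square of finite $G$-sets with $\Psi\colon S\to S_1$, $\Phi\colon S\to S_2$, $\varphi\colon S_1\to T$, $\psi\colon S_2\to T$, one has $\varphi^{\mathcal M}\circ\psi_{\mathcal M}=\Psi_{\mathcal M}\circ\Phi^{\mathcal M}$; (M2) the embeddings of $S_1,S_2$ in $S_1\sqcup S_2$ induce an isomorphism $\mathcal M^*(S_1\sqcup S_2)\to\mathcal M^*(S_1)\oplus\mathcal M^*(S_2)$, and $\mathcal M(\emptyset)=0$. Conjugation invariance. $\mathcal M$ is conjugation invariant if for every subgroup $H\subseteq G$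 and every $z\in C_G(H)$ (the centralizer), the $G$-map $\varphi_z\colon G/H\to G/H$, $eH\mapsto zH$, satisfies $\mathcal M_*(\varphi_z)=\mathrm{id}$. Bisets. For subgroups $H_1,H_2\subseteq G$, a finite $H_2$-$H_1$ biset is a finite set with commuting left $H_2$- and right $H_1$-actions; it is bifree if both actions are free, and indecomposable if it is nonempty and $X=H_2xH_1$ for some $x$. For a bifree biset $X$ and $x\in X$ put $L_x=\{h_2\in H_2: h_2x\in xH_1\}$, let $\gamma_{X,x}(h_2)$ be the unique $h_1\in H_1$ with $h_2x=xh_1$ for $h_2\in L_x$, and let $K_x=\gamma_{X,x}(L_x)\subseteq H_1$; then $\gamma_{X,x}\colon L_x\to K_x$ is an isomorphism of groups. A bifree biset $X$ is a conjugation biset if for each $x\in X$ there is $g\in G$ with $g^{-1}L_xg=K_x$ and $\gamma_{X,x}(h)=g^{-1}hg$ for all $h\in L_x$ (it suffices to check one $x$ in each component $H_2xH_1$). The category $\mathbf B_\bullet(G)$. $\mathbf B(G)$ has the subgroups of $G$ as objects, and $\mathrm{Hom}_{\mathbf B(G)}(H_1,H_2)$ is the Grothendieck group, under disjoint union, of isomorphism classes of finite $H_2$-$H_1$ conjugation bisets; composition is induced by the balanced product $X\circ Y=X\times_{H_2}Y$ for $X$ an $H_3$-$H_2$ biset and $Y$ an $H_2$-$H_1$ biset. $\mathbf B_\bullet(G)$ is the free additive completion of $\mathbf B(G)$: objects are finite ordered tuples of subgroups of $G$ (including the empty tuple), and morphisms are matrices of morphisms of $\mathbf B(G)$. The bivariant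 functor $j=(j_*,j^* )$. Choose for each finite $G$-set $S$ an ordered list $b_1,\dots,b_k$ of base points, one in each $G$-orbit (the choice being made compatibly with disjoint unions, the list for $S\sqcup T$ being the concatenation of those for $S$ and $T$); let $H_i$ be the stabilizer of $b_i$ and put $j(S)=(H_1,\dots,H_k)$. Let $\varphi\colon S\to T$ be a $G$-map, let $c_1,\dots,c_m$ be the base points of $T$ with stabilizers $K_1,\dots,K_m$, and write $\varphi(b_i)=g_ic_{f(i)}$ with $g_i\in G$, so that $g_i^{-1}H_ig_i\subseteq K_{f(i)}$. The component of $j_*(\varphi)$ from $H_i$ to $K_{f(i)}$ is the set $K_{f(i)}$, as a $K_{f(i)}$-$H_i$ biset with actions $k'\cdot k\cdot h=k'k\,(g_i^{-1}hg_i)$; all other components are $0$ (the class of the empty biset). The component of $j^*(\varphi)$ from $K_{f(i)}$ to $H_i$ is the set $K_{f(i)}$, as an $H_i$-$K_{f(i)}$ biset with actions $h\cdot k\cdot k'=(g_i^{-1}hg_i)kk'$; all other components are $0$. Factorization. For a functor $F\colon\mathbf B_\bullet(G)\to\mathcal Ab$, $F\circ j$ denotes the bivariant functor $(F\circ j_*,F\circ j^* )$. "$\mathcal M$ factors through $j$" means that $\mathcal M=F\circ j$ for some additive functor $F\colon\mathbf B_\bullet(G)\to\mathcal Ab$.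
   Formalization: "Factors through j" is read as M being naturally isomorphic to F∘j as a bivariant functor, not equal to it; with literal equality the "if" direction fails, since M(S) and M(T) may be isomorphic but different groups when j(S) = j(T). *)

theory Defs
  imports "HOL-Algebra.Group_Action" "HOL-Algebra.Left_Coset" "HOL-Algebra.FiniteProduct"
begin

section \<open>Categories and functors\<close>

text \<open>\<open>cat_comp C X Y Z g f\<close> is the composite \<open>g \<circ> f\<close> of \<open>f : X \<rightarrow> Y\<close> and \<open>g : Y \<rightarrow> Z\<close>.\<close>

record ('o, 'm) cat =
  cat_obj :: "'o set"
  cat_hom :: "'o \<Rightarrow> 'o \<Rightarrow> 'm set"
  cat_id :: "'o \<Rightarrow> 'm"
  cat_comp :: "'o \<Rightarrow> 'o \<Rightarrow> 'o \<Rightarrow> 'm \<Rightarrow> 'm \<Rightarrow> 'm"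

text \<open>Preadditive categories: \<open>hom_grp C X Y\<close> is the abelian group structure on
  \<open>cat_hom C X Y\<close>, written multiplicatively as everywhere in HOL-Algebra.\<close>

record ('o, 'm) preadd_cat = "('o, 'm) cat" +
  hom_grp :: "'o \<Rightarrow> 'o \<Rightarrow> 'm monoid"

record ('o, 'm, 'p, 'n) func =
  fobj :: "'o \<Rightarrow> 'p"
  farr :: "'o \<Rightarrow> 'o \<Rightarrow> 'm \<Rightarrow> 'n"

definition is_functor ::
    "('o, 'm, 'r) cat_scheme \<Rightarrow> ('p, 'n, 's) cat_scheme \<Rightarrow> ('o, 'm, 'p, 'n) func \<Rightarrow> bool" where
  "is_functor C D F \<longleftrightarrow>
     (\<forall>X\<in>cat_obj C. fobj F X \<in> cat_obj D) \<and>
     (\<forall>X\<in>cat_obj C. \<forall>Y\<in>cat_obj C. \<forall>f\<in>cat_hom C X Y.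
        farr F X Y f \<in> cat_hom D (fobj F X) (fobj F Y)) \<and>
     (\<forall>X\<in>cat_obj C. farr F X X (cat_id C X) = cat_id D (fobj F X)) \<and>
     (\<forall>X\<in>cat_obj C. \<forall>Y\<in>cat_obj C. \<forall>Z\<in>cat_obj C.
        \<forall>f\<in>cat_hom C X Y. \<forall>g\<in>cat_hom C Y Z.
          farr F X Z (cat_comp C X Y Z g f) =
            cat_comp D (fobj F X) (fobj F Y) (fobj F Z) (farr F Y Z g) (farr F X Y f))"

definition additive_functor ::
    "('o, 'm, 'r) preadd_cat_scheme \<Rightarrow> ('p, 'n, 's) preadd_cat_scheme \<Rightarrow>
     ('o, 'm, 'p, 'n) func \<Rightarrow> bool" where
  "additive_functor C D F \<longleftrightarrow> is_functor C D F \<and>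
     (\<forall>X\<in>cat_obj C. \<forall>Y\<in>cat_obj C. \<forall>f\<in>cat_hom C X Y. \<forall>g\<in>cat_hom C X Y.
        farr F X Y (f \<otimes>\<^bsub>hom_grp C X Y\<^esub> g) =
          farr F X Y f \<otimes>\<^bsub>hom_grp D (fobj F X) (fobj F Y)\<^esub> farr F X Y g)"

text \<open>For \<open>f : X \<rightarrow> Y\<close>, \<open>bcov M X Y f : M(X) \<rightarrow> M(Y)\<close> is the covariant part and
  \<open>bcon M X Y f : M(Y) \<rightarrow> M(X)\<close> the contravariant part.\<close>

record ('o, 'm, 'p, 'n) bifunc =
  bobj :: "'o \<Rightarrow> 'p"
  bcov :: "'o \<Rightarrow> 'o \<Rightarrow> 'm \<Rightarrow> 'n"
  bcon :: "'o \<Rightarrow> 'o \<Rightarrow> 'm \<Rightarrow> 'n"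

definition op_cat :: "('o, 'm, 'r) cat_scheme \<Rightarrow> ('o, 'm) cat" where
  "op_cat C = \<lparr>cat_obj = cat_obj C, cat_hom = (\<lambda>X Y. cat_hom C Y X), cat_id = cat_id C,
     cat_comp = (\<lambda>X Y Z g f. cat_comp C Z Y X f g)\<rparr>"

definition bivariant_functor ::
    "('o, 'm, 'r) cat_scheme \<Rightarrow> ('p, 'n, 's) cat_scheme \<Rightarrow> ('o, 'm, 'p, 'n) bifunc \<Rightarrow> bool" where
  "bivariant_functor C D M \<longleftrightarrow>
     is_functor C D \<lparr>fobj = bobj M, farr = bcov M\<rparr> \<and>
     is_functor (op_cat C) D \<lparr>fobj = bobj M, farr = (\<lambda>X Y. bcon M Y X)\<rparr>"

definition func_bifunc_comp ::
    "('p, 'n, 'q, 'l) func \<Rightarrow> ('o, 'm, 'p, 'n) bifunc \<Rightarrow> ('o, 'm, 'q, 'l) bifunc" where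
  "func_bifunc_comp F J =
     \<lparr>bobj = (\<lambda>X. fobj F (bobj J X)),
      bcov = (\<lambda>X Y f. farr F (bobj J X) (bobj J Y) (bcov J X Y f)),
      bcon = (\<lambda>X Y f. farr F (bobj J Y) (bobj J X) (bcon J X Y f))\<rparr>"

definition cat_iso :: "('o, 'm, 'r) cat_scheme \<Rightarrow> 'o \<Rightarrow> 'o \<Rightarrow> 'm set" where
  "cat_iso C X Y = {f \<in> cat_hom C X Y. \<exists>g\<in>cat_hom C Y X.
     cat_comp C X Y X g f = cat_id C X \<and> cat_comp C Y X Y f g = cat_id C Y}"

text \<open>Isomorphism of bivariant functors: one family of isomorphisms, natural with respect
  to both the covariant and the contravariant parts.\<close>

definition bifunc_isomorphic ::
    "('o, 'm, 'r) cat_scheme \<Rightarrow> ('p, 'n, 's) cat_scheme \<Rightarrow>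
     ('o, 'm, 'p, 'n) bifunc \<Rightarrow> ('o, 'm, 'p, 'n) bifunc \<Rightarrow> bool" where
  "bifunc_isomorphic C D M N \<longleftrightarrow>
     (\<exists>\<theta>. (\<forall>X\<in>cat_obj C. \<theta> X \<in> cat_iso D (bobj M X) (bobj N X)) \<and>
       (\<forall>X\<in>cat_obj C. \<forall>Y\<in>cat_obj C. \<forall>f\<in>cat_hom C X Y.
          cat_comp D (bobj M X) (bobj M Y) (bobj N Y) (\<theta> Y) (bcov M X Y f) =
            cat_comp D (bobj M X) (bobj N X) (bobj N Y) (bcov N X Y f) (\<theta> X) \<and>
          cat_comp D (bobj M Y) (bobj M X) (bobj N X) (\<theta> X) (bcon M X Y f) =
            cat_comp D (bobj M Y) (bobj N Y) (bobj N X) (bcon N X Y f) (\<theta> Y)))"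

text \<open>\<open>is_pullback C S S1 S2 T \<Psi> \<Phi> \<phi> \<psi>\<close>: the square with \<open>\<Psi> : S \<rightarrow> S1\<close>, \<open>\<Phi> : S \<rightarrow> S2\<close>,
  \<open>\<phi> : S1 \<rightarrow> T\<close>, \<open>\<psi> : S2 \<rightarrow> T\<close> is a pullback square.\<close>

definition is_pullback ::
    "('o, 'm, 'r) cat_scheme \<Rightarrow> 'o \<Rightarrow> 'o \<Rightarrow> 'o \<Rightarrow> 'o \<Rightarrow> 'm \<Rightarrow> 'm \<Rightarrow> 'm \<Rightarrow> 'm \<Rightarrow> bool" where
  "is_pullback C S S1 S2 T \<Psi> \<Phi> \<phi> \<psi> \<longleftrightarrow>
     S \<in> cat_obj C \<and> S1 \<in> cat_obj C \<and> S2 \<in> cat_obj C \<and> T \<in> cat_obj C \<and>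
     \<Psi> \<in> cat_hom C S S1 \<and> \<Phi> \<in> cat_hom C S S2 \<and> \<phi> \<in> cat_hom C S1 T \<and> \<psi> \<in> cat_hom C S2 T \<and>
     cat_comp C S S1 T \<phi> \<Psi> = cat_comp C S S2 T \<psi> \<Phi> \<and>
     (\<forall>X\<in>cat_obj C. \<forall>u\<in>cat_hom C X S1. \<forall>v\<in>cat_hom C X S2.
        cat_comp C X S1 T \<phi> u = cat_comp C X S2 T \<psi> v \<longrightarrow>
        (\<exists>!w. w \<in> cat_hom C X S \<and> cat_comp C X S S1 \<Psi> w = u \<and> cat_comp C X S S2 \<Phi> w = v))"

text \<open>Abelian groups with underlying set contained in the type \<open>'a\<close>; homomorphisms are
  made extensional, so that equality of functions is equality of morphisms.\<close>

definition Ab :: "('a monoid, 'a \<Rightarrow> 'a) preadd_cat" where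
  "Ab =
     \<lparr>cat_obj = {A. comm_group A},
      cat_hom = (\<lambda>A B. hom A B \<inter> extensional (carrier A)),
      cat_id = (\<lambda>A. \<lambda>x\<in>carrier A. x),
      cat_comp = (\<lambda>A B C g f. compose (carrier A) g f),
      hom_grp = (\<lambda>A B.
        \<lparr>carrier = hom A B \<inter> extensional (carrier A),
         mult = (\<lambda>f g. \<lambda>x\<in>carrier A. f x \<otimes>\<^bsub>B\<^esub> g x),
         one = (\<lambda>x\<in>carrier A. \<one>\<^bsub>B\<^esub>)\<rparr>)\<rparr>"

text \<open>The free additive completion of \<open>C\<close>. A morphism from \<open>Xs\<close> to \<open>Ys\<close> is a matrix whose
  \<open>(j, i)\<close> entry (row \<open>j\<close>, column \<open>i\<close>) is a morphism from \<open>Xs ! i\<close> to \<open>Ys ! j\<close>.\<close>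

abbreviation mat_index :: "'o list \<Rightarrow> 'o list \<Rightarrow> (nat \<times> nat) set" where
  "mat_index Xs Ys \<equiv> {..<length Ys} \<times> {..<length Xs}"

definition mat_hom ::
    "('o, 'm, 'r) preadd_cat_scheme \<Rightarrow> 'o list \<Rightarrow> 'o list \<Rightarrow> (nat \<times> nat \<Rightarrow> 'm) set" where
  "mat_hom C Xs Ys = (\<Pi>\<^sub>E (j, i)\<in>mat_index Xs Ys. cat_hom C (Xs ! i) (Ys ! j))"

definition additive_completion ::
    "('o, 'm, 'r) preadd_cat_scheme \<Rightarrow> ('o list, nat \<times> nat \<Rightarrow> 'm) preadd_cat" where
  "additive_completion C =
     \<lparr>cat_obj = lists (cat_obj C),
      cat_hom = mat_hom C,
      cat_id = (\<lambda>Xs. \<lambda>(j, i)\<in>mat_index Xs Xs.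
        if i = j then cat_id C (Xs ! i) else \<one>\<^bsub>hom_grp C (Xs ! i) (Xs ! j)\<^esub>),
      cat_comp = (\<lambda>Xs Ys Zs B A. \<lambda>(l, i)\<in>mat_index Xs Zs.
        finprod (hom_grp C (Xs ! i) (Zs ! l))
          (\<lambda>j. cat_comp C (Xs ! i) (Ys ! j) (Zs ! l) (B (l, j)) (A (j, i))) {..<length Ys}),
      hom_grp = (\<lambda>Xs Ys.
        \<lparr>carrier = mat_hom C Xs Ys,
         mult = (\<lambda>A B. \<lambda>(j, i)\<in>mat_index Xs Ys.
           A (j, i) \<otimes>\<^bsub>hom_grp C (Xs ! i) (Ys ! j)\<^esub> B (j, i)),
         one = (\<lambda>(j, i)\<in>mat_index Xs Ys. \<one>\<^bsub>hom_grp C (Xs ! i) (Ys ! j)\<^esub>)\<rparr>)\<rparr>"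

section \<open>Finite \<open>G\<close>-sets\<close>

text \<open>Points of finite \<open>G\<close>-sets live in one fixed infinite type that contains the cosets
  of subgroups and is closed under disjoint unions. Every finite \<open>G\<close>-set is isomorphic
  to one of this form.\<close>

datatype 'g pt = Coset "'g set" | InL "'g pt" | InR "'g pt"

type_synonym 'g gset = "'g pt set \<times> ('g \<Rightarrow> 'g pt \<Rightarrow> 'g pt)"

text \<open>Extensionality in the group argument makes equality of pairs equality of \<open>G\<close>-sets;
  \<^const>\<open>group_action\<close> already requires it in the point argument.\<close>

definition finite_gset :: "('g, 'k) monoid_scheme \<Rightarrow> 'g gset \<Rightarrow> bool" where
  "finite_gset G S \<longleftrightarrow>
     finite (fst S) \<and> group_action G (fst S) (snd S) \<and> snd S \<in> extensional (carrier G)"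

definition gmaps :: "('g, 'k) monoid_scheme \<Rightarrow> 'g gset \<Rightarrow> 'g gset \<Rightarrow> ('g pt \<Rightarrow> 'g pt) set" where
  "gmaps G S T = {\<phi> \<in> fst S \<rightarrow>\<^sub>E fst T.
     \<forall>g\<in>carrier G. \<forall>x\<in>fst S. \<phi> (snd S g x) = snd T g (\<phi> x)}"

definition Gsets :: "('g, 'k) monoid_scheme \<Rightarrow> ('g gset, 'g pt \<Rightarrow> 'g pt) cat" where
  "Gsets G =
     \<lparr>cat_obj = {S. finite_gset G S},
      cat_hom = gmaps G,
      cat_id = (\<lambda>S. \<lambda>x\<in>fst S. x),
      cat_comp = (\<lambda>S T U \<psi> \<phi>. compose (fst S) \<psi> \<phi>)\<rparr>"

definition empty_gset :: "('g, 'k) monoid_scheme \<Rightarrow> 'g gset" where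
  "empty_gset G = ({}, \<lambda>g\<in>carrier G. \<lambda>x\<in>{}. x)"

definition gset_sum :: "('g, 'k) monoid_scheme \<Rightarrow> 'g gset \<Rightarrow> 'g gset \<Rightarrow> 'g gset" where
  "gset_sum G S T =
     (InL ` fst S \<union> InR ` fst T,
      \<lambda>g\<in>carrier G. \<lambda>x\<in>InL ` fst S \<union> InR ` fst T.
        case x of InL a \<Rightarrow> InL (snd S g a) | InR b \<Rightarrow> InR (snd T g b))"

definition coset_gset :: "('g, 'k) monoid_scheme \<Rightarrow> 'g set \<Rightarrow> 'g gset" where
  "coset_gset G H =
     (Coset ` (lcosets\<^bsub>G\<^esub> H),
      \<lambda>g\<in>carrier G. \<lambda>x\<in>Coset ` (lcosets\<^bsub>G\<^esub> H). case x of Coset C \<Rightarrow> Coset (g <#\<^bsub>G\<^esub> C))"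

section \<open>Mackey functors\<close>

type_synonym ('g, 'a) gset_bifunc = "('g gset, 'g pt \<Rightarrow> 'g pt, 'a monoid, 'a \<Rightarrow> 'a) bifunc"

definition mackey_functor :: "('g, 'k) monoid_scheme \<Rightarrow> ('g, 'a) gset_bifunc \<Rightarrow> bool" where
  "mackey_functor G M \<longleftrightarrow>
     bivariant_functor (Gsets G) Ab M \<and>
     (\<forall>S S1 S2 T \<Psi> \<Phi> \<phi> \<psi>. is_pullback (Gsets G) S S1 S2 T \<Psi> \<Phi> \<phi> \<psi> \<longrightarrow>
        cat_comp Ab (bobj M S2) (bobj M T) (bobj M S1) (bcon M S1 T \<phi>) (bcov M S2 T \<psi>) =
        cat_comp Ab (bobj M S2) (bobj M S) (bobj M S1) (bcov M S S1 \<Psi>) (bcon M S S2 \<Phi>)) \<and>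
     (\<forall>S1 S2. finite_gset G S1 \<longrightarrow> finite_gset G S2 \<longrightarrow>
        (\<lambda>x. (bcon M S1 (gset_sum G S1 S2) (\<lambda>s\<in>fst S1. InL s) x,
              bcon M S2 (gset_sum G S1 S2) (\<lambda>s\<in>fst S2. InR s) x))
          \<in> iso (bobj M (gset_sum G S1 S2)) (bobj M S1 \<times>\<times> bobj M S2)) \<and>
     carrier (bobj M (empty_gset G)) = {\<one>\<^bsub>bobj M (empty_gset G)\<^esub>}"

definition centralizer :: "('g, 'k) monoid_scheme \<Rightarrow> 'g set \<Rightarrow> 'g set" where
  "centralizer G H = {z \<in> carrier G. \<forall>h\<in>H. z \<otimes>\<^bsub>G\<^esub> h = h \<otimes>\<^bsub>G\<^esub> z}"

text \<open>A \<open>G\<close>-map on \<open>G/H\<close> is determined by its value at \<open>eH\<close>, so exactly one \<open>\<phi>\<close> is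
  considered for each \<open>H\<close> and \<open>z\<close>.\<close>

definition conjugation_invariant ::
    "('g, 'k) monoid_scheme \<Rightarrow> ('g, 'a) gset_bifunc \<Rightarrow> bool" where
  "conjugation_invariant G M \<longleftrightarrow>
     (\<forall>H z. subgroup H G \<longrightarrow> z \<in> centralizer G H \<longrightarrow>
        (\<forall>\<phi>\<in>gmaps G (coset_gset G H) (coset_gset G H).
           \<phi> (Coset H) = Coset (z <#\<^bsub>G\<^esub> H) \<longrightarrow>
           bcov M (coset_gset G H) (coset_gset G H) \<phi> = cat_id Ab (bobj M (coset_gset G H))))"

section \<open>Conjugation bisets\<close>

record ('g, 'x) biset =
  bpts :: "'x set"
  lact :: "'g \<Rightarrow> 'x \<Rightarrow> 'x"
  ract :: "'x \<Rightarrow> 'g \<Rightarrow> 'x"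

definition finite_biset ::
    "('g, 'k) monoid_scheme \<Rightarrow> 'g set \<Rightarrow> 'g set \<Rightarrow> ('g, 'x) biset \<Rightarrow> bool" where
  "finite_biset G H2 H1 X \<longleftrightarrow>
     finite (bpts X) \<and>
     (\<forall>h\<in>H2. \<forall>x\<in>bpts X. lact X h x \<in> bpts X) \<and>
     (\<forall>x\<in>bpts X. lact X \<one>\<^bsub>G\<^esub> x = x) \<and>
     (\<forall>h\<in>H2. \<forall>h'\<in>H2. \<forall>x\<in>bpts X. lact X (h \<otimes>\<^bsub>G\<^esub> h') x = lact X h (lact X h' x)) \<and>
     (\<forall>h\<in>H1. \<forall>x\<in>bpts X. ract X x h \<in> bpts X) \<and>
     (\<forall>x\<in>bpts X. ract X x \<one>\<^bsub>G\<^esub> = x) \<and>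
     (\<forall>h\<in>H1. \<forall>h'\<in>H1. \<forall>x\<in>bpts X. ract X x (h \<otimes>\<^bsub>G\<^esub> h') = ract X (ract X x h) h') \<and>
     (\<forall>h2\<in>H2. \<forall>h1\<in>H1. \<forall>x\<in>bpts X. ract X (lact X h2 x) h1 = lact X h2 (ract X x h1))"

definition bifree ::
    "('g, 'k) monoid_scheme \<Rightarrow> 'g set \<Rightarrow> 'g set \<Rightarrow> ('g, 'x) biset \<Rightarrow> bool" where
  "bifree G H2 H1 X \<longleftrightarrow>
     (\<forall>h\<in>H2. \<forall>x\<in>bpts X. lact X h x = x \<longrightarrow> h = \<one>\<^bsub>G\<^esub>) \<and>
     (\<forall>h\<in>H1. \<forall>x\<in>bpts X. ract X x h = x \<longrightarrow> h = \<one>\<^bsub>G\<^esub>)"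

definition bi_L :: "'g set \<Rightarrow> 'g set \<Rightarrow> ('g, 'x) biset \<Rightarrow> 'x \<Rightarrow> 'g set" where
  "bi_L H2 H1 X x = {h2 \<in> H2. \<exists>h1\<in>H1. lact X h2 x = ract X x h1}"

definition bi_gamma :: "'g set \<Rightarrow> ('g, 'x) biset \<Rightarrow> 'x \<Rightarrow> 'g \<Rightarrow> 'g" where
  "bi_gamma H1 X x h2 = (THE h1. h1 \<in> H1 \<and> lact X h2 x = ract X x h1)"

definition bi_K :: "'g set \<Rightarrow> 'g set \<Rightarrow> ('g, 'x) biset \<Rightarrow> 'x \<Rightarrow> 'g set" where
  "bi_K H2 H1 X x = bi_gamma H1 X x ` bi_L H2 H1 X x"

definition conj_biset ::
    "('g, 'k) monoid_scheme \<Rightarrow> 'g set \<Rightarrow> 'g set \<Rightarrow> ('g, 'x) biset \<Rightarrow> bool" where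
  "conj_biset G H2 H1 X \<longleftrightarrow>
     finite_biset G H2 H1 X \<and> bifree G H2 H1 X \<and>
     (\<forall>x\<in>bpts X. \<exists>g\<in>carrier G.
        (\<lambda>h. inv\<^bsub>G\<^esub> g \<otimes>\<^bsub>G\<^esub> h \<otimes>\<^bsub>G\<^esub> g) ` bi_L H2 H1 X x = bi_K H2 H1 X x \<and>
        (\<forall>h\<in>bi_L H2 H1 X x. bi_gamma H1 X x h = inv\<^bsub>G\<^esub> g \<otimes>\<^bsub>G\<^esub> h \<otimes>\<^bsub>G\<^esub> g))"

definition biset_isomorphic ::
    "'g set \<Rightarrow> 'g set \<Rightarrow> ('g, 'x) biset \<Rightarrow> ('g, 'y) biset \<Rightarrow> bool" where
  "biset_isomorphic H2 H1 X Y \<longleftrightarrow>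
     (\<exists>f. bij_betw f (bpts X) (bpts Y) \<and>
        (\<forall>h\<in>H2. \<forall>x\<in>bpts X. f (lact X h x) = lact Y h (f x)) \<and>
        (\<forall>h\<in>H1. \<forall>x\<in>bpts X. f (ract X x h) = ract Y (f x) h))"

text \<open>The isomorphism class of a finite biset on points of any type is represented by the
  set of all isomorphic bisets on natural numbers.\<close>

type_synonym 'g biset_class = "('g, nat) biset set"

definition biset_cls ::
    "('g, 'k) monoid_scheme \<Rightarrow> 'g set \<Rightarrow> 'g set \<Rightarrow> ('g, 'x) biset \<Rightarrow> 'g biset_class" where
  "biset_cls G H2 H1 X = {Y. finite_biset G H2 H1 Y \<and> biset_isomorphic H2 H1 X Y}"

definition empty_biset :: "('g, nat) biset" where
  "empty_biset = \<lparr>bpts = {}, lact = (\<lambda>_ x. x), ract = (\<lambda>x _. x)\<rparr>"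

definition biset_sum :: "('g, 'x) biset \<Rightarrow> ('g, 'y) biset \<Rightarrow> ('g, 'x + 'y) biset" where
  "biset_sum X Y =
     \<lparr>bpts = bpts X <+> bpts Y,
      lact = (\<lambda>h. map_sum (lact X h) (lact Y h)),
      ract = (\<lambda>z h. map_sum (\<lambda>x. ract X x h) (\<lambda>y. ract Y y h) z)\<rparr>"

text \<open>The balanced product over \<open>H\<close>. The relation identifying \<open>(x h, y)\<close> with \<open>(x, h y)\<close>
  is already an equivalence relation, because \<open>H\<close> is a group.\<close>

definition balanced_rel ::
    "'g set \<Rightarrow> ('g, 'x) biset \<Rightarrow> ('g, 'y) biset \<Rightarrow> (('x \<times> 'y) \<times> ('x \<times> 'y)) set" where
  "balanced_rel H X Y =
     {((ract X x h, y), (x, lact Y h y)) | x h y. x \<in> bpts X \<and> h \<in> H \<and> y \<in> bpts Y}"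

definition balanced_product ::
    "'g set \<Rightarrow> ('g, 'x) biset \<Rightarrow> ('g, 'y) biset \<Rightarrow> ('g, ('x \<times> 'y) set) biset" where
  "balanced_product H X Y =
     \<lparr>bpts = (bpts X \<times> bpts Y) // balanced_rel H X Y,
      lact = (\<lambda>h C. (\<lambda>(x, y). (lact X h x, y)) ` C),
      ract = (\<lambda>C h. (\<lambda>(x, y). (x, ract Y y h)) ` C)\<rparr>"

definition reg_biset :: "('g, 'k) monoid_scheme \<Rightarrow> 'g set \<Rightarrow> ('g, 'g) biset" where
  "reg_biset G H = \<lparr>bpts = H, lact = (\<lambda>h x. h \<otimes>\<^bsub>G\<^esub> x), ract = (\<lambda>x h. x \<otimes>\<^bsub>G\<^esub> h)\<rparr>"

section \<open>The category of conjugation bisets\<close>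

text \<open>Operations on equivalence classes are written as unions over all representatives;
  the classes united coincide.\<close>

definition groth_rel :: "('c, 'k) monoid_scheme \<Rightarrow> (('c \<times> 'c) \<times> ('c \<times> 'c)) set" where
  "groth_rel A = {((a, b), (c, d)) | a b c d.
     a \<in> carrier A \<and> b \<in> carrier A \<and> c \<in> carrier A \<and> d \<in> carrier A \<and>
     (\<exists>k\<in>carrier A. a \<otimes>\<^bsub>A\<^esub> d \<otimes>\<^bsub>A\<^esub> k = c \<otimes>\<^bsub>A\<^esub> b \<otimes>\<^bsub>A\<^esub> k)}"

definition grothendieck_group :: "('c, 'k) monoid_scheme \<Rightarrow> (('c \<times> 'c) set) monoid" where
  "grothendieck_group A =
     \<lparr>carrier = (carrier A \<times> carrier A) // groth_rel A,
      mult = (\<lambda>\<xi> \<eta>. \<Union>(a, b)\<in>\<xi>. \<Union>(c, d)\<in>\<eta>. groth_rel A `` {(a \<otimes>\<^bsub>A\<^esub> c, b \<otimes>\<^bsub>A\<^esub> d)}),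
      one = groth_rel A `` {(\<one>\<^bsub>A\<^esub>, \<one>\<^bsub>A\<^esub>)}\<rparr>"

definition groth_of :: "('c, 'k) monoid_scheme \<Rightarrow> 'c \<Rightarrow> ('c \<times> 'c) set" where
  "groth_of A a = groth_rel A `` {(a, \<one>\<^bsub>A\<^esub>)}"

definition biset_monoid ::
    "('g, 'k) monoid_scheme \<Rightarrow> 'g set \<Rightarrow> 'g set \<Rightarrow> 'g biset_class monoid" where
  "biset_monoid G H2 H1 =
     \<lparr>carrier = {biset_cls G H2 H1 X | X :: ('g, nat) biset. conj_biset G H2 H1 X},
      mult = (\<lambda>\<xi> \<eta>. \<Union>X\<in>\<xi>. \<Union>Y\<in>\<eta>. biset_cls G H2 H1 (biset_sum X Y)),
      one = biset_cls G H2 H1 (empty_biset :: ('g, nat) biset)\<rparr>"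

type_synonym 'g virtual_biset = "('g biset_class \<times> 'g biset_class) set"

definition virtual_bisets ::
    "('g, 'k) monoid_scheme \<Rightarrow> 'g set \<Rightarrow> 'g set \<Rightarrow> 'g virtual_biset monoid" where
  "virtual_bisets G H2 H1 = grothendieck_group (biset_monoid G H2 H1)"

definition virtual_cls ::
    "('g, 'k) monoid_scheme \<Rightarrow> 'g set \<Rightarrow> 'g set \<Rightarrow> ('g, 'x) biset \<Rightarrow> 'g virtual_biset" where
  "virtual_cls G H2 H1 X = groth_of (biset_monoid G H2 H1) (biset_cls G H2 H1 X)"

definition biset_cls_comp ::
    "('g, 'k) monoid_scheme \<Rightarrow> 'g set \<Rightarrow> 'g set \<Rightarrow> 'g set \<Rightarrow>
     'g biset_class \<Rightarrow> 'g biset_class \<Rightarrow> 'g biset_class" where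
  "biset_cls_comp G H3 H2 H1 \<xi> \<eta> =
     (\<Union>X\<in>\<xi>. \<Union>Y\<in>\<eta>. biset_cls G H3 H1 (balanced_product H2 X Y))"

text \<open>The biadditive extension
  \<open>([a] - [b]) \<circ> ([c] - [d]) = [a \<circ> c \<squnion> b \<circ> d] - [a \<circ> d \<squnion> b \<circ> c]\<close>.\<close>

definition virtual_comp ::
    "('g, 'k) monoid_scheme \<Rightarrow> 'g set \<Rightarrow> 'g set \<Rightarrow> 'g set \<Rightarrow>
     'g virtual_biset \<Rightarrow> 'g virtual_biset \<Rightarrow> 'g virtual_biset" where
  "virtual_comp G H3 H2 H1 \<xi> \<eta> =
     (\<Union>(a, b)\<in>\<xi>. \<Union>(c, d)\<in>\<eta>. groth_rel (biset_monoid G H3 H1) ``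
        {(biset_cls_comp G H3 H2 H1 a c \<otimes>\<^bsub>biset_monoid G H3 H1\<^esub> biset_cls_comp G H3 H2 H1 b d,
          biset_cls_comp G H3 H2 H1 a d \<otimes>\<^bsub>biset_monoid G H3 H1\<^esub> biset_cls_comp G H3 H2 H1 b c)})"

text \<open>Morphisms from \<open>H1\<close> to \<open>H2\<close> are classes of \<open>H2\<close>-\<open>H1\<close> bisets, hence the exchanged
  arguments below.\<close>

definition B_cat :: "('g, 'k) monoid_scheme \<Rightarrow> ('g set, 'g virtual_biset) preadd_cat" where
  "B_cat G =
     \<lparr>cat_obj = {H. subgroup H G},
      cat_hom = (\<lambda>H1 H2. carrier (virtual_bisets G H2 H1)),
      cat_id = (\<lambda>H. virtual_cls G H H (reg_biset G H)),
      cat_comp = (\<lambda>H1 H2 H3. virtual_comp G H3 H2 H1),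
      hom_grp = (\<lambda>H1 H2. virtual_bisets G H2 H1)\<rparr>"

definition B_bullet ::
    "('g, 'k) monoid_scheme \<Rightarrow> ('g set list, nat \<times> nat \<Rightarrow> 'g virtual_biset) preadd_cat" where
  "B_bullet G = additive_completion (B_cat G)"

section \<open>The bivariant functor \<open>j\<close>\<close>

text \<open>Such choices exist: for instance, fix a linear order on \<open>'g set\<close>, extend it to
  \<open>'g pt\<close> so that \<open>InL\<close> and \<open>InR\<close> are monotone and every \<open>InL x\<close> precedes every \<open>InR y\<close>,
  and list the smallest elements of the orbits in increasing order.\<close>

definition base_point_choice ::
    "('g, 'k) monoid_scheme \<Rightarrow> ('g gset \<Rightarrow> 'g pt list) \<Rightarrow> bool" where
  "base_point_choice G bp \<longleftrightarrow>
     (\<forall>S. finite_gset G S \<longrightarrow>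
        set (bp S) \<subseteq> fst S \<and>
        (\<forall>\<Omega>\<in>orbits G (fst S) (snd S). \<exists>!i. i < length (bp S) \<and> bp S ! i \<in> \<Omega>)) \<and>
     (\<forall>S T. finite_gset G S \<longrightarrow> finite_gset G T \<longrightarrow>
        bp (gset_sum G S T) = map InL (bp S) @ map InR (bp T))"

definition j_obj :: "('g, 'k) monoid_scheme \<Rightarrow> ('g gset \<Rightarrow> 'g pt list) \<Rightarrow> 'g gset \<Rightarrow> 'g set list" where
  "j_obj G bp S = map (stabilizer G (snd S)) (bp S)"

definition cov_biset :: "('g, 'k) monoid_scheme \<Rightarrow> 'g set \<Rightarrow> 'g \<Rightarrow> ('g, 'g) biset" where
  "cov_biset G K g =
     \<lparr>bpts = K,
      lact = (\<lambda>k' k. k' \<otimes>\<^bsub>G\<^esub> k),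
      ract = (\<lambda>k h. k \<otimes>\<^bsub>G\<^esub> (inv\<^bsub>G\<^esub> g \<otimes>\<^bsub>G\<^esub> h \<otimes>\<^bsub>G\<^esub> g))\<rparr>"

definition con_biset :: "('g, 'k) monoid_scheme \<Rightarrow> 'g set \<Rightarrow> 'g \<Rightarrow> ('g, 'g) biset" where
  "con_biset G K g =
     \<lparr>bpts = K,
      lact = (\<lambda>h k. (inv\<^bsub>G\<^esub> g \<otimes>\<^bsub>G\<^esub> h \<otimes>\<^bsub>G\<^esub> g) \<otimes>\<^bsub>G\<^esub> k),
      ract = (\<lambda>k k'. k \<otimes>\<^bsub>G\<^esub> k')\<rparr>"

text \<open>The \<open>l\<close>-th base point \<open>c\<close> of \<open>T\<close> is the one in the orbit of \<open>\<phi> b\<close>, where \<open>b\<close> is the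
  \<open>i\<close>-th base point of \<open>S\<close>, iff \<open>transporter\<close> is nonempty; the isomorphism classes of the
  bisets do not depend on the element \<open>g\<close> selected from it.\<close>

definition transporter :: "('g, 'k) monoid_scheme \<Rightarrow> 'g gset \<Rightarrow> 'g pt \<Rightarrow> 'g pt \<Rightarrow> 'g set" where
  "transporter G T c y = {g \<in> carrier G. y = snd T g c}"

definition j_functor ::
    "('g, 'k) monoid_scheme \<Rightarrow> ('g gset \<Rightarrow> 'g pt list) \<Rightarrow>
     ('g gset, 'g pt \<Rightarrow> 'g pt, 'g set list, nat \<times> nat \<Rightarrow> 'g virtual_biset) bifunc" where
  "j_functor G bp =
     \<lparr>bobj = j_obj G bp,
      bcov = (\<lambda>S T \<phi>. \<lambda>(l, i)\<in>mat_index (j_obj G bp S) (j_obj G bp T).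
        let H = j_obj G bp S ! i; K = j_obj G bp T ! l;
            P = transporter G T (bp T ! l) (\<phi> (bp S ! i))
        in if P \<noteq> {} then virtual_cls G K H (cov_biset G K (SOME g. g \<in> P))
           else virtual_cls G K H (empty_biset :: ('g, nat) biset)),
      bcon = (\<lambda>S T \<phi>. \<lambda>(i, l)\<in>mat_index (j_obj G bp T) (j_obj G bp S).
        let H = j_obj G bp S ! i; K = j_obj G bp T ! l;
            P = transporter G T (bp T ! l) (\<phi> (bp S ! i))
        in if P \<noteq> {} then virtual_cls G H K (con_biset G K (SOME g. g \<in> P))
           else virtual_cls G H K (empty_biset :: ('g, nat) biset))\<rparr>"

text \<open>The equation \<open>M = F \<circ> j\<close> is an identity up to natural isomorphism of bivariant
  functors. Equality on the nose would force \<open>M S\<close> and \<open>M T\<close> to be the same group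
  whenever the base points of \<open>S\<close> and \<open>T\<close> have the same stabilizers.\<close>

definition factors_through_j ::
    "('g, 'k) monoid_scheme \<Rightarrow> ('g gset \<Rightarrow> 'g pt list) \<Rightarrow> ('g, 'a) gset_bifunc \<Rightarrow> bool" where
  "factors_through_j G bp M \<longleftrightarrow>
     (\<exists>F. additive_functor (B_bullet G) Ab F \<and>
          bifunc_isomorphic (Gsets G) Ab M (func_bifunc_comp F (j_functor G bp)))"

end

theory Submission
  imports Defs
begin

text \<open>A bifree biset \<open>X\<close> is a conjugation biset iff it admits a biequivariant map \<open>\<gamma> : X \<rightarrow> G\<close>.
  A span \<open>G/H1 \<leftarrow> Z \<rightarrow> G/H2\<close> of finite \<open>G\<close>-sets gives the biset of pairs \<open>(z, g)\<close> with
  \<open>z\<close> over \<open>eH2\<close> and over \<open>gH1\<close>; every conjugation biset arises in this way, disjoint unions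
  correspond to disjoint unions and pullbacks to balanced products. Spans act on a Mackey
  functor by \<open>(p2)\<^sub>* (p1)\<^sup>*\<close>. Two spans with isomorphic bisets differ by an isomorphism of the
  apices and an endomorphism \<open>\<zeta>\<close> of \<open>Z\<close> that moves each point by an element centralizing its
  stabilizer, so under conjugation invariance they act equally and the action descends to
  bisets. The functor \<open>F\<close> sends \<open>(H\<^sub>1, \<dots>, H\<^sub>k)\<close> to \<open>M(G/H\<^sub>1 \<squnion> \<dots> \<squnion> G/H\<^sub>k)\<close>.
  Conversely \<open>j\<close> sends \<open>\<phi>\<^sub>z\<close> to an identity.\<close>

text \<open>Every Mackey functor acts on spans; the question is when this action descends to bisets.
  The biset of a span carries a canonical \<gamma>, the projection to \<open>G\<close>, but as a
  biset it only remembers that some \<gamma> exists. If \<gamma> and \<gamma>' are two choices on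
  one biset and \<open>h x = x h1\<close>, then both \<open>\<gamma> x\<close> and
  \<open>\<gamma>' x\<close> conjugate \<open>h\<close> to \<open>h1\<close>, so
  \<open>\<gamma>' x \<otimes> inv (\<gamma> x)\<close> commutes with \<open>h\<close>. The
  ambiguity is one centralizing element for each point, and this is what produces \<zeta>.
  Conjugation invariance speaks only of pushforward along self-maps of \<open>G/H\<close>, whereas
  \<zeta> lives on an arbitrary \<open>Z\<close> and acts by restriction. Both gaps are closed by
  detection on orbits: an element of \<open>M(Z)\<close> is determined by its restrictions to the
  orbits of \<open>Z\<close>. The same principle reduces each identity about \<open>F\<close> to one
  about components, where it becomes matrix arithmetic. A recurring technical point is that fibre
  products and quotients have to be encoded again inside the fixed type
  \<open>'g pt\<close>.\<close>

locale fin_group = group G for G :: "('g, 'k) monoid_scheme" (structure) +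
  assumes fin_carrier: "finite (carrier G)"

lemma (in group) mult_inv_cancel:
  assumes "x \<in> carrier G" "y \<in> carrier G"
  shows "x \<otimes> (inv x \<otimes> y) = y" "inv x \<otimes> (x \<otimes> y) = y"
  using assms by (simp_all flip: m_assoc)

section \<open>Bisets\<close>

lemma biset_isomorphicI:
  assumes "bij_betw f (bpts X) (bpts Y)"
    and "\<And>h x. h \<in> H2 \<Longrightarrow> x \<in> bpts X \<Longrightarrow> f (lact X h x) = lact Y h (f x)"
    and "\<And>h x. h \<in> H1 \<Longrightarrow> x \<in> bpts X \<Longrightarrow> f (ract X x h) = ract Y (f x) h"
  shows "biset_isomorphic H2 H1 X Y"
  using assms unfolding biset_isomorphic_def by blast

lemma biset_isomorphic_trans:
  assumes "biset_isomorphic H2 H1 X Y" "biset_isomorphic H2 H1 Y Z"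
  shows "biset_isomorphic H2 H1 X Z"
proof -
  obtain f g where f: "bij_betw f (bpts X) (bpts Y)"
      "\<forall>h\<in>H2. \<forall>x\<in>bpts X. f (lact X h x) = lact Y h (f x)"
      "\<forall>h\<in>H1. \<forall>x\<in>bpts X. f (ract X x h) = ract Y (f x) h"
    and g: "bij_betw g (bpts Y) (bpts Z)"
      "\<forall>h\<in>H2. \<forall>x\<in>bpts Y. g (lact Y h x) = lact Z h (g x)"
      "\<forall>h\<in>H1. \<forall>x\<in>bpts Y. g (ract Y x h) = ract Z (g x) h"
    using assms unfolding biset_isomorphic_def by blast
  show ?thesis
    by (rule biset_isomorphicI[of "g \<circ> f"])
      (use f g in \<open>auto intro: bij_betw_trans dest: bij_betwE\<close>)
qed

lemma finite_bisetD:
  assumes "finite_biset G H2 H1 X"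
  shows "finite (bpts X)"
    and "\<And>h x. h \<in> H2 \<Longrightarrow> x \<in> bpts X \<Longrightarrow> lact X h x \<in> bpts X"
    and "\<And>x. x \<in> bpts X \<Longrightarrow> lact X \<one>\<^bsub>G\<^esub> x = x"
    and "\<And>h h' x. h \<in> H2 \<Longrightarrow> h' \<in> H2 \<Longrightarrow> x \<in> bpts X \<Longrightarrow>
           lact X (h \<otimes>\<^bsub>G\<^esub> h') x = lact X h (lact X h' x)"
    and "\<And>h x. h \<in> H1 \<Longrightarrow> x \<in> bpts X \<Longrightarrow> ract X x h \<in> bpts X"
    and "\<And>x. x \<in> bpts X \<Longrightarrow> ract X x \<one>\<^bsub>G\<^esub> = x"
    and "\<And>h h' x. h \<in> H1 \<Longrightarrow> h' \<in> H1 \<Longrightarrow> x \<in> bpts X \<Longrightarrow>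
           ract X x (h \<otimes>\<^bsub>G\<^esub> h') = ract X (ract X x h) h'"
    and "\<And>h2 h1 x. h2 \<in> H2 \<Longrightarrow> h1 \<in> H1 \<Longrightarrow> x \<in> bpts X \<Longrightarrow>
           ract X (lact X h2 x) h1 = lact X h2 (ract X x h1)"
  using assms unfolding finite_biset_def by auto

lemma biset_isomorphic_sym:
  assumes X: "finite_biset G H2 H1 X" and iso: "biset_isomorphic H2 H1 X Y"
  shows "biset_isomorphic H2 H1 Y X"
proof -
  obtain f where f: "bij_betw f (bpts X) (bpts Y)"
      "\<forall>h\<in>H2. \<forall>x\<in>bpts X. f (lact X h x) = lact Y h (f x)"
      "\<forall>h\<in>H1. \<forall>x\<in>bpts X. f (ract X x h) = ract Y (f x) h"
    using iso unfolding biset_isomorphic_def by blast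
  let ?g = "inv_into (bpts X) f"
  have g: "?g y \<in> bpts X" "f (?g y) = y" if "y \<in> bpts Y" for y
    using f(1) that by (auto simp: bij_betw_def inv_into_into f_inv_into_f)
  have gf: "?g (f x) = x" if "x \<in> bpts X" for x
    using f(1) that by (simp add: bij_betw_def)
  show ?thesis
  proof (rule biset_isomorphicI[of ?g])
    show "bij_betw ?g (bpts Y) (bpts X)"
      using f(1) by (rule bij_betw_inv_into)
    show "?g (lact Y h y) = lact X h (?g y)" if "h \<in> H2" "y \<in> bpts Y" for h y
      using gf[of "lact X h (?g y)"] f(2) g[OF that(2)] that finite_bisetD(2)[OF X] by auto
    show "?g (ract Y y h) = ract X (?g y) h" if "h \<in> H1" "y \<in> bpts Y" for h y
      using gf[of "ract X (?g y) h"] f(3) g[OF that(2)] that finite_bisetD(5)[OF X] by auto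
  qed
qed

text \<open>Isomorphism classes contain only bisets on natural numbers, so a biset with points of
  another type needs a renamed copy there.\<close>

lemma ex_nat_biset:
  assumes X: "finite_biset G H2 H1 X"
  shows "\<exists>Y :: ('g, nat) biset. biset_isomorphic H2 H1 X Y"
proof -
  obtain f :: "_ \<Rightarrow> nat" where f: "inj_on f (bpts X)"
    using finite_bisetD(1)[OF X] finite_imp_inj_to_nat_seg by blast
  define Y where "Y = \<lparr>bpts = f ` bpts X,
    lact = (\<lambda>h n. f (lact X h (inv_into (bpts X) f n))),
    ract = (\<lambda>n h. f (ract X (inv_into (bpts X) f n) h))\<rparr>"
  have "biset_isomorphic H2 H1 X Y"
    by (rule biset_isomorphicI[of f]) (use f in \<open>auto simp: Y_def bij_betw_def\<close>)
  then show ?thesis by blast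
qed

section \<open>Conjugation bisets and biequivariant maps to \<open>G\<close>\<close>

context fin_group
begin

lemma finite_biset_isomorphic:
  assumes H: "subgroup H2 G" "subgroup H1 G"
    and X: "finite_biset G H2 H1 X" and iso: "biset_isomorphic H2 H1 X Y"
  shows "finite_biset G H2 H1 Y"
proof -
  note XD = finite_bisetD[OF X]
  obtain f where f: "bij_betw f (bpts X) (bpts Y)"
      and fl: "\<And>h x. h \<in> H2 \<Longrightarrow> x \<in> bpts X \<Longrightarrow> lact Y h (f x) = f (lact X h x)"
      and fr: "\<And>h x. h \<in> H1 \<Longrightarrow> x \<in> bpts X \<Longrightarrow> ract Y (f x) h = f (ract X x h)"
    using iso unfolding biset_isomorphic_def by metis
  have Y: "bpts Y = f ` bpts X" using f by (simp add: bij_betw_def)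
  note S = subgroup.m_closed[OF H(1)] subgroup.m_closed[OF H(2)]
    subgroup.one_closed[OF H(1)] subgroup.one_closed[OF H(2)]
  show ?thesis
    unfolding finite_biset_def Y
    by (auto simp: fl fr XD S)
qed

text \<open>Here \<open>G\<close> carries left and right multiplication. The definition of a
  conjugation biset asks for a conjugating element at each point separately; \<gamma> chooses all of
  them at once, compatibly with both actions. In this form the property passes to sums and to
  isomorphic bisets by composing functions.\<close>

definition equivariant :: "'g set \<Rightarrow> 'g set \<Rightarrow> ('g, 'x) biset \<Rightarrow> ('x \<Rightarrow> 'g) \<Rightarrow> bool" where
  "equivariant H2 H1 X \<gamma> \<longleftrightarrow> (\<forall>x\<in>bpts X. \<gamma> x \<in> carrier G \<and>
     (\<forall>h\<in>H2. \<gamma> (lact X h x) = h \<otimes> \<gamma> x) \<and> (\<forall>h\<in>H1. \<gamma> (ract X x h) = \<gamma> x \<otimes> h))"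

text \<open>Translation in a group is free, and \<gamma> turns a point fixed by \<open>h\<close>
  into a group element fixed by translation with \<open>h\<close>.\<close>

lemma bifree_if_equivariant:
  assumes H: "subgroup H2 G" "subgroup H1 G" and \<gamma>: "equivariant H2 H1 X \<gamma>"
  shows "bifree G H2 H1 X"
  unfolding bifree_def
proof (intro conjI ballI impI)
  fix h x assume "h \<in> H2" "x \<in> bpts X" "lact X h x = x"
  then have "h \<otimes> \<gamma> x = \<gamma> x" "h \<in> carrier G" "\<gamma> x \<in> carrier G"
    using \<gamma> H unfolding equivariant_def by (metis subgroup.mem_carrier)+
  then show "h = \<one>" by simp
next
  fix h x assume "h \<in> H1" "x \<in> bpts X" "ract X x h = x"
  then have "\<gamma> x \<otimes> h = \<gamma> x" "h \<in> carrier G" "\<gamma> x \<in> carrier G"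
    using \<gamma> H unfolding equivariant_def by (metis subgroup.mem_carrier)+
  then show "h = \<one>" by simp
qed

text \<open>From \<open>h x = x h1\<close> follows
  \<open>h \<otimes> \<gamma> x = \<gamma> x \<otimes> h1\<close>, so \<open>h1\<close> is the
  conjugate of \<open>h\<close> by \<open>\<gamma> x\<close>, and \<open>\<gamma> x\<close> is the
  group element required at \<open>x\<close>.\<close>

lemma conj_biset_if_equivariant:
  assumes H: "subgroup H2 G" "subgroup H1 G" and X: "finite_biset G H2 H1 X"
    and \<gamma>: "equivariant H2 H1 X \<gamma>"
  shows "conj_biset G H2 H1 X"
  unfolding conj_biset_def
proof (intro conjI ballI)
  show "finite_biset G H2 H1 X" by fact
  show "bifree G H2 H1 X" using bifree_if_equivariant[OF H \<gamma>] .
  fix x assume x: "x \<in> bpts X"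
  then have gx: "\<gamma> x \<in> carrier G" using \<gamma> unfolding equivariant_def by blast
  have eq: "bi_gamma H1 X x h = inv (\<gamma> x) \<otimes> h \<otimes> \<gamma> x" if "h \<in> bi_L H2 H1 X x" for h
  proof -
    obtain h1 where h: "h \<in> H2" "h1 \<in> H1" "lact X h x = ract X x h1"
      using \<open>h \<in> bi_L H2 H1 X x\<close> unfolding bi_L_def by blast
    have *: "h' = inv (\<gamma> x) \<otimes> h \<otimes> \<gamma> x" if "h' \<in> H1" "lact X h x = ract X x h'" for h'
    proof -
      have "h \<otimes> \<gamma> x = \<gamma> x \<otimes> h'" using \<gamma> x that h(1) unfolding equivariant_def by metis
      moreover have "h \<in> carrier G" "h' \<in> carrier G"
        using H h(1) that(1) by (auto dest: subgroup.mem_carrier)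
      ultimately show ?thesis using gx
        by (metis inv_closed inv_solve_left m_assoc m_closed)
    qed
    show ?thesis unfolding bi_gamma_def
    proof (rule the_equality)
      show "inv (\<gamma> x) \<otimes> h \<otimes> \<gamma> x \<in> H1 \<and> lact X h x = ract X x (inv (\<gamma> x) \<otimes> h \<otimes> \<gamma> x)"
        using *[OF h(2,3)] h by simp
    qed (use * in blast)
  qed
  then show "\<exists>g\<in>carrier G. (\<lambda>h. inv g \<otimes> h \<otimes> g) ` bi_L H2 H1 X x = bi_K H2 H1 X x \<and>
        (\<forall>h\<in>bi_L H2 H1 X x. bi_gamma H1 X x h = inv g \<otimes> h \<otimes> g)"
    using gx unfolding bi_K_def by (intro bexI[of _ "\<gamma> x"] conjI image_cong) auto
qed

text \<open>Pick a point \<open>r\<close> in each component and a conjugating element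
  \<open>c r\<close> there; biequivariance then dictates the value
  \<open>h2 \<otimes> c r \<otimes> h1\<close> at \<open>h2 r h1\<close>. The work is to show that
  this value does not depend on the presentation of the point.\<close>

lemma ex_equivariant_if_conj_biset:
  assumes H: "subgroup H2 G" "subgroup H1 G" and X: "conj_biset G H2 H1 X"
  shows "\<exists>\<gamma>. equivariant H2 H1 X \<gamma>"
proof -
  have fb: "finite_biset G H2 H1 X" and bf: "bifree G H2 H1 X" using X by (auto simp: conj_biset_def)
  note XD = finite_bisetD[OF fb]
  note H2C = subgroup.mem_carrier[OF H(1)] and H1C = subgroup.mem_carrier[OF H(2)]
  note S2 = subgroup.m_closed[OF H(1)] subgroup.one_closed[OF H(1)] subgroup.m_inv_closed[OF H(1)]
  note S1 = subgroup.m_closed[OF H(2)] subgroup.one_closed[OF H(2)] subgroup.m_inv_closed[OF H(2)]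
  define orb where "orb x = {ract X (lact X h2 x) h1 | h2 h1. h2 \<in> H2 \<and> h1 \<in> H1}" for x
  \<comment> \<open>The choice is made from the set \<open>orb x\<close> alone, hence
    \<open>rep\<close> is constant on components.\<close>
  define rep where "rep x = (SOME y. y \<in> orb x)" for x
  have orb_sub: "orb (ract X (lact X k2 x) k1) \<subseteq> orb x"
    if "x \<in> bpts X" "k2 \<in> H2" "k1 \<in> H1" for x k2 k1
  proof
    fix y assume "y \<in> orb (ract X (lact X k2 x) k1)"
    then obtain h2 h1 where h: "h2 \<in> H2" "h1 \<in> H1"
      and y: "y = ract X (lact X h2 (ract X (lact X k2 x) k1)) h1" unfolding orb_def by blast
    have "y = ract X (lact X (h2 \<otimes> k2) x) (k1 \<otimes> h1)"
      using that h by (simp add: y XD S1 S2)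
    then show "y \<in> orb x" unfolding orb_def using that h S1 S2 by blast
  qed
  have orb_back: "x = ract X (lact X (inv k2) (ract X (lact X k2 x) k1)) (inv k1)"
    if "x \<in> bpts X" "k2 \<in> H2" "k1 \<in> H1" for x k2 k1
  proof -
    have "lact X (inv k2) (ract X (lact X k2 x) k1) = ract X (lact X (inv k2 \<otimes> k2) x) k1"
      using that by (simp add: XD S1 S2)
    also have "\<dots> = ract X x k1" using that by (simp add: XD H2C)
    also have "ract X (ract X x k1) (inv k1) = ract X x (k1 \<otimes> inv k1)"
      using that by (simp add: XD S1 S2)
    also have "\<dots> = x" using that by (simp add: XD H1C)
    finally show ?thesis by simp
  qed
  have orb_eq: "orb (ract X (lact X k2 x) k1) = orb x"
    if "x \<in> bpts X" "k2 \<in> H2" "k1 \<in> H1" for x k2 k1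
    using orb_sub[OF that] orb_sub[of "ract X (lact X k2 x) k1" "inv k2" "inv k1"]
      orb_back[OF that] that by (simp add: XD S1 S2)
  have rep: "rep x \<in> bpts X \<and> (\<exists>k2\<in>H2. \<exists>k1\<in>H1. x = ract X (lact X k2 (rep x)) k1)"
    if x: "x \<in> bpts X" for x
  proof -
    have "x = ract X (lact X \<one> x) \<one>" using XD x by simp
    then have "x \<in> orb x" unfolding orb_def using S1 S2 by blast
    then have "rep x \<in> orb x" unfolding rep_def by (rule someI)
    then obtain k2 k1 where "k2 \<in> H2" "k1 \<in> H1" and r: "rep x = ract X (lact X k2 x) k1"
      unfolding orb_def by blast
    then have k: "inv k2 \<in> H2" "inv k1 \<in> H1" "rep x \<in> bpts X"
        "x = ract X (lact X (inv k2) (rep x)) (inv k1)"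
      using orb_back[OF x] x S1 S2 by (simp_all add: XD r)
    show ?thesis
      by (rule conjI[OF k(3)], rule bexI[OF _ k(1)], rule bexI[OF _ k(2)], rule k(4))
  qed
  obtain c where c: "\<forall>x\<in>bpts X. c x \<in> carrier G \<and>
      (\<forall>h\<in>bi_L H2 H1 X x. bi_gamma H1 X x h = inv (c x) \<otimes> h \<otimes> c x)"
    using X unfolding conj_biset_def by metis
  \<comment> \<open>Two presentations of one point differ by \<open>inv k2 \<otimes> h2\<close> on
    the left and \<open>k1 \<otimes> inv h1\<close> on the right. The first lies in
    \<open>bi_L\<close>, \<open>bi_gamma\<close> sends it to the second, and by the choice of
    \<open>c\<close> this is conjugation by \<open>c x\<close>.\<close>
  have wd: "h2 \<otimes> c x \<otimes> h1 = k2 \<otimes> c x \<otimes> k1"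
    if x: "x \<in> bpts X" and h: "h2 \<in> H2" "k2 \<in> H2" "h1 \<in> H1" "k1 \<in> H1"
      and eq: "ract X (lact X h2 x) h1 = ract X (lact X k2 x) k1" for x h2 h1 k2 k1
  proof -
    have "lact X (inv k2) (ract X (ract X (lact X h2 x) h1) (inv h1)) =
          lact X (inv k2) (ract X (ract X (lact X k2 x) k1) (inv h1))" using eq by simp
    moreover have "lact X (inv k2) (ract X (ract X (lact X h2 x) h1) (inv h1)) =
        lact X (inv k2 \<otimes> h2) (ract X x (h1 \<otimes> inv h1))"
      using x h by (simp add: XD S1 S2)
    moreover have "lact X (inv k2) (ract X (ract X (lact X k2 x) k1) (inv h1)) =
        lact X (inv k2 \<otimes> k2) (ract X x (k1 \<otimes> inv h1))"
      using x h by (simp add: XD S1 S2)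
    ultimately have L: "lact X (inv k2 \<otimes> h2) x = ract X x (k1 \<otimes> inv h1)"
      using x h by (simp add: XD S1 S2 H1C H2C)
    \<comment> \<open>Freeness of the right action gives the uniqueness behind the
      \<open>THE\<close> in \<open>bi_gamma\<close>.\<close>
    have uniq: "h' = k1 \<otimes> inv h1" if h': "h' \<in> H1" "lact X (inv k2 \<otimes> h2) x = ract X x h'" for h'
    proof -
      have "ract X (ract X x h') (inv (k1 \<otimes> inv h1)) = ract X (ract X x (k1 \<otimes> inv h1)) (inv (k1 \<otimes> inv h1))"
        using L h' by simp
      then have "ract X x (h' \<otimes> inv (k1 \<otimes> inv h1)) = ract X x (k1 \<otimes> inv h1 \<otimes> inv (k1 \<otimes> inv h1))"
        using x h h' by (simp only: XD S1)
      also have "\<dots> = x" using x h by (simp add: r_inv H1C XD)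
      finally have "h' \<otimes> inv (k1 \<otimes> inv h1) = \<one>"
        using x h h' by (intro bf[unfolded bifree_def, THEN conjunct2, rule_format]) (auto intro!: S1)
      then show ?thesis
        using h h' H1C inv_equality[of h' "inv (k1 \<otimes> inv h1)"] by (simp add: S1)
    qed
    have "inv k2 \<otimes> h2 \<in> bi_L H2 H1 X x"
      unfolding bi_L_def using L S1(1)[OF h(4) S1(3)[OF h(3)]] S2(1)[OF S2(3)[OF h(2)] h(1)] by blast
    then have "bi_gamma H1 X x (inv k2 \<otimes> h2) = inv (c x) \<otimes> (inv k2 \<otimes> h2) \<otimes> c x"
      using c x by blast
    moreover have "bi_gamma H1 X x (inv k2 \<otimes> h2) = k1 \<otimes> inv h1"
      unfolding bi_gamma_def
      by (rule the_equality, rule conjI[OF S1(1)[OF h(4) S1(3)[OF h(3)]] L], elim conjE, rule uniq)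
    ultimately have E: "k1 \<otimes> inv h1 = inv (c x) \<otimes> (inv k2 \<otimes> h2) \<otimes> c x" by simp
    have C: "c x \<in> carrier G" "h1 \<in> carrier G" "h2 \<in> carrier G" "k1 \<in> carrier G" "k2 \<in> carrier G"
      using c x h H1C H2C by auto
    have "k2 \<otimes> c x \<otimes> k1 = k2 \<otimes> c x \<otimes> (k1 \<otimes> inv h1) \<otimes> h1"
      using C by (simp add: m_assoc)
    also have "\<dots> = h2 \<otimes> c x \<otimes> h1"
      unfolding E using C by (simp add: m_assoc mult_inv_cancel)
    finally show ?thesis by simp
  qed
  define \<gamma> where "\<gamma> x = (SOME g. \<exists>h2\<in>H2. \<exists>h1\<in>H1. x = ract X (lact X h2 (rep x)) h1 \<and>
      g = h2 \<otimes> c (rep x) \<otimes> h1)" for x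
  have \<gamma>: "\<gamma> x = h2 \<otimes> c (rep x) \<otimes> h1"
    if x: "x \<in> bpts X" "h2 \<in> H2" "h1 \<in> H1" "x = ract X (lact X h2 (rep x)) h1" for x h2 h1
    unfolding \<gamma>_def
  proof (rule some_equality)
    show "\<exists>h2'\<in>H2. \<exists>h1'\<in>H1. x = ract X (lact X h2' (rep x)) h1' \<and>
      h2 \<otimes> c (rep x) \<otimes> h1 = h2' \<otimes> c (rep x) \<otimes> h1'"
      by (rule bexI[OF _ x(2)], rule bexI[OF _ x(3)], rule conjI[OF x(4) refl])
  next
    fix g assume "\<exists>h2\<in>H2. \<exists>h1\<in>H1. x = ract X (lact X h2 (rep x)) h1 \<and> g = h2 \<otimes> c (rep x) \<otimes> h1"
    then show "g = h2 \<otimes> c (rep x) \<otimes> h1"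
      using wd[of "rep x"] conjunct1[OF rep[OF x(1)]] x by metis
  qed
  have \<gamma>_rl: "\<gamma> x \<in> carrier G \<and> \<gamma> (ract X (lact X k2 x) k1) = k2 \<otimes> \<gamma> x \<otimes> k1"
    if x: "x \<in> bpts X" and k: "k2 \<in> H2" "k1 \<in> H1" for x k2 k1
  proof -
    obtain h2 h1 where h: "h2 \<in> H2" "h1 \<in> H1" "x = ract X (lact X h2 (rep x)) h1"
      and r: "rep x \<in> bpts X"
      using rep[OF x] by (elim conjE bexE) (rule that)
    let ?y = "ract X (lact X k2 x) k1"
    have ry: "rep ?y = rep x" unfolding rep_def using orb_eq[OF x k] by simp
    have "?y = ract X (lact X k2 (ract X (lact X h2 (rep x)) h1)) k1" using h(3) by simp
    also have "\<dots> = ract X (lact X (k2 \<otimes> h2) (rep x)) (h1 \<otimes> k1)"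
      using h(1,2) k r by (simp add: XD S1 S2)
    finally have y: "?y = ract X (lact X (k2 \<otimes> h2) (rep x)) (h1 \<otimes> k1)" .
    have "?y = ract X (lact X (k2 \<otimes> h2) (rep ?y)) (h1 \<otimes> k1)" by (subst ry) (rule y)
    then have "\<gamma> ?y = (k2 \<otimes> h2) \<otimes> c (rep x) \<otimes> (h1 \<otimes> k1)"
      using \<gamma>[of ?y "k2 \<otimes> h2" "h1 \<otimes> k1"] x h(1,2) k ry by (simp add: XD S1 S2)
    moreover have "\<gamma> x = h2 \<otimes> c (rep x) \<otimes> h1" by (rule \<gamma>[OF x h])
    ultimately show ?thesis using c r h(1,2) k H1C H2C by (auto simp: m_assoc)
  qed
  have "equivariant H2 H1 X \<gamma>"
    unfolding equivariant_def
  proof (intro ballI conjI)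
    fix x assume x: "x \<in> bpts X"
    show "\<gamma> x \<in> carrier G" using \<gamma>_rl[OF x] S1 S2 by blast
    then show "\<gamma> (lact X h x) = h \<otimes> \<gamma> x" if "h \<in> H2" for h
      using \<gamma>_rl[OF x that S1(2)] x that by (simp add: XD H2C)
    show "\<gamma> (ract X x h) = \<gamma> x \<otimes> h" if "h \<in> H1" for h
      using \<gamma>_rl[OF x S2(2) that] x that \<open>\<gamma> x \<in> carrier G\<close> by (simp add: XD H1C)
  qed
  then show ?thesis by blast
qed

text \<open>A biequivariant map on \<open>X\<close> is pulled back along the inverse
  isomorphism.\<close>

lemma conj_biset_isomorphic:
  assumes H: "subgroup H2 G" "subgroup H1 G"
    and X: "conj_biset G H2 H1 X" and iso: "biset_isomorphic H2 H1 X Y"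
  shows "conj_biset G H2 H1 Y"
proof -
  have fX: "finite_biset G H2 H1 X" using X by (simp only: conj_biset_def)
  have fY: "finite_biset G H2 H1 Y" using finite_biset_isomorphic[OF H fX iso] .
  obtain g where g: "bij_betw g (bpts Y) (bpts X)"
      "\<And>h x. h \<in> H2 \<Longrightarrow> x \<in> bpts Y \<Longrightarrow> g (lact Y h x) = lact X h (g x)"
      "\<And>h x. h \<in> H1 \<Longrightarrow> x \<in> bpts Y \<Longrightarrow> g (ract Y x h) = ract X (g x) h"
    using biset_isomorphic_sym[OF fX iso] unfolding biset_isomorphic_def by blast
  obtain \<gamma> where "equivariant H2 H1 X \<gamma>" using ex_equivariant_if_conj_biset[OF H X] by blast
  then have "equivariant H2 H1 Y (\<gamma> \<circ> g)"
    using g unfolding equivariant_def by (auto dest: bij_betwE)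
  then show ?thesis using conj_biset_if_equivariant[OF H fY] by blast
qed

end

section \<open>The Grothendieck group of a commutative monoid\<close>

definition groth_cls :: "('c, 'k) monoid_scheme \<Rightarrow> 'c \<Rightarrow> 'c \<Rightarrow> ('c \<times> 'c) set" where
  "groth_cls A a b = groth_rel A `` {(a, b)}"

text \<open>The extension of an additive \<open>v\<close> to differences,
  \<open>[a] - [b] \<mapsto> v a - v b\<close>, evaluated at a chosen representative. For additive
  \<open>v\<close> into an abelian group, \<open>groth_lift_cls\<close> shows that the choice is
  immaterial.\<close>

definition groth_lift ::
    "('c, 'k) monoid_scheme \<Rightarrow> ('b, 'l) monoid_scheme \<Rightarrow> ('c \<Rightarrow> 'b) \<Rightarrow> ('c \<times> 'c) set \<Rightarrow> 'b" where
  "groth_lift A B v \<xi> = (let p = SOME p. p \<in> \<xi> in v (fst p) \<otimes>\<^bsub>B\<^esub> inv\<^bsub>B\<^esub> v (snd p))"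

context comm_monoid
begin

lemma groth_rel_iff:
  "((a, b), (c, d)) \<in> groth_rel G \<longleftrightarrow>
    a \<in> carrier G \<and> b \<in> carrier G \<and> c \<in> carrier G \<and> d \<in> carrier G \<and>
     (\<exists>k\<in>carrier G. a \<otimes> d \<otimes> k = c \<otimes> b \<otimes> k)"
  unfolding groth_rel_def by auto

lemma groth_rel_equiv: "equiv (carrier G \<times> carrier G) (groth_rel G)"
proof (rule equivI)
  show "groth_rel G \<subseteq> (carrier G \<times> carrier G) \<times> carrier G \<times> carrier G"
    unfolding groth_rel_def by auto
  show "refl_on (carrier G \<times> carrier G) (groth_rel G)"
    by (rule refl_onI) (auto simp: groth_rel_iff)
  show "sym (groth_rel G)"
    by (rule symI) (auto simp: groth_rel_iff split: prod.splits, metis)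
  show "trans (groth_rel G)"
  proof (rule transI)
    fix p q r assume "(p, q) \<in> groth_rel G" "(q, r) \<in> groth_rel G"
    then obtain a b c d e f k l where p: "p = (a, b)" "q = (c, d)" "r = (e, f)"
      and C: "a \<in> carrier G" "b \<in> carrier G" "c \<in> carrier G" "d \<in> carrier G"
        "e \<in> carrier G" "f \<in> carrier G" "k \<in> carrier G" "l \<in> carrier G"
      and k: "a \<otimes> d \<otimes> k = c \<otimes> b \<otimes> k" and l: "c \<otimes> f \<otimes> l = e \<otimes> d \<otimes> l"
      by (cases p, cases q, cases r) (auto simp: groth_rel_iff)
    \<comment> \<open>The monoid need not be cancellative, so the witness for the composite relation
      contains the middle element \<open>d\<close> besides \<open>k\<close> and
      \<open>l\<close>.\<close>
    have "a \<otimes> f \<otimes> (d \<otimes> k \<otimes> l) = (a \<otimes> d \<otimes> k) \<otimes> (f \<otimes> l)" using C by (simp add: m_ac)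
    also have "\<dots> = (c \<otimes> f \<otimes> l) \<otimes> (b \<otimes> k)" unfolding k using C by (simp add: m_ac)
    also have "\<dots> = e \<otimes> b \<otimes> (d \<otimes> k \<otimes> l)" unfolding l using C by (simp add: m_ac)
    finally show "(p, r) \<in> groth_rel G"
      unfolding p groth_rel_iff using C by blast
  qed
qed

lemma groth_cls_eq_iff:
  assumes "a \<in> carrier G" "b \<in> carrier G" "c \<in> carrier G" "d \<in> carrier G"
  shows "groth_cls G a b = groth_cls G c d \<longleftrightarrow> (\<exists>k\<in>carrier G. a \<otimes> d \<otimes> k = c \<otimes> b \<otimes> k)"
  unfolding groth_cls_def using assms eq_equiv_class_iff[OF groth_rel_equiv, of "(a, b)" "(c, d)"]
  by (simp add: groth_rel_iff)

lemma groth_cls_memD: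
  assumes "(c, d) \<in> groth_cls G a b"
  shows "c \<in> carrier G" "d \<in> carrier G" "groth_cls G c d = groth_cls G a b"
proof -
  have *: "((a, b), (c, d)) \<in> groth_rel G" using assms by (simp add: groth_cls_def)
  then show "c \<in> carrier G" "d \<in> carrier G" by (auto simp: groth_rel_iff)
  show "groth_cls G c d = groth_cls G a b"
    unfolding groth_cls_def using equiv_class_eq[OF groth_rel_equiv *] by simp
qed

lemma groth_cls_self:
  assumes "a \<in> carrier G" "b \<in> carrier G"
  shows "(a, b) \<in> groth_cls G a b"
  unfolding groth_cls_def using assms by (auto simp: groth_rel_iff)

lemma groth_carrierE:
  assumes "\<xi> \<in> carrier (grothendieck_group G)"
  obtains a b where "a \<in> carrier G" "b \<in> carrier G" "\<xi> = groth_cls G a b"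
  using assms unfolding grothendieck_group_def groth_cls_def by (auto elim!: quotientE)

lemma groth_cls_closed:
  assumes "a \<in> carrier G" "b \<in> carrier G"
  shows "groth_cls G a b \<in> carrier (grothendieck_group G)"
  using assms unfolding grothendieck_group_def groth_cls_def by (auto intro!: quotientI)

lemma groth_one: "\<one>\<^bsub>grothendieck_group G\<^esub> = groth_cls G \<one> \<one>"
  by (simp add: grothendieck_group_def groth_cls_def)

text \<open>All classes united in the definition of the product coincide: the product of the two
  witnesses is a witness for the product.\<close>

lemma groth_mult:
  assumes C: "a \<in> carrier G" "b \<in> carrier G" "c \<in> carrier G" "d \<in> carrier G"
  shows "groth_cls G a b \<otimes>\<^bsub>grothendieck_group G\<^esub> groth_cls G c d = groth_cls G (a \<otimes> c) (b \<otimes> d)"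
proof -
  have eq: "groth_cls G (a' \<otimes> c') (b' \<otimes> d') = groth_cls G (a \<otimes> c) (b \<otimes> d)"
    if m: "(a', b') \<in> groth_cls G a b" "(c', d') \<in> groth_cls G c d" for a' b' c' d'
  proof -
    note D = groth_cls_memD[OF m(1)] groth_cls_memD[OF m(2)]
    obtain k l where kl: "k \<in> carrier G" "l \<in> carrier G"
      and k: "a' \<otimes> b \<otimes> k = a \<otimes> b' \<otimes> k" and l: "c' \<otimes> d \<otimes> l = c \<otimes> d' \<otimes> l"
      using D C by (auto simp: groth_cls_eq_iff)
    have "a' \<otimes> c' \<otimes> (b \<otimes> d) \<otimes> (k \<otimes> l) = (a' \<otimes> b \<otimes> k) \<otimes> (c' \<otimes> d \<otimes> l)"
      using C D(1,2,4,5) kl by (simp add: m_ac)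
    also have "\<dots> = a \<otimes> c \<otimes> (b' \<otimes> d') \<otimes> (k \<otimes> l)"
      unfolding k l using C D(1,2,4,5) kl by (simp add: m_ac)
    finally show ?thesis using C D(1,2,4,5) kl by (auto simp: groth_cls_eq_iff)
  qed
  have "groth_cls G a b \<otimes>\<^bsub>grothendieck_group G\<^esub> groth_cls G c d =
      (\<Union>(a', b')\<in>groth_cls G a b. \<Union>(c', d')\<in>groth_cls G c d. groth_cls G (a' \<otimes> c') (b' \<otimes> d'))"
    by (simp add: grothendieck_group_def groth_cls_def)
  also have "\<dots> = groth_cls G (a \<otimes> c) (b \<otimes> d)"
    using eq groth_cls_self[OF C(1,2)] groth_cls_self[OF C(3,4)] by blast
  finally show ?thesis .
qed

lemma groth_comm_group: "comm_group (grothendieck_group G)"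
proof (rule comm_groupI)
  fix x y z
  assume x: "x \<in> carrier (grothendieck_group G)" and y: "y \<in> carrier (grothendieck_group G)"
  obtain a b where ab: "a \<in> carrier G" "b \<in> carrier G" "x = groth_cls G a b"
    using x by (rule groth_carrierE)
  obtain c d where cd: "c \<in> carrier G" "d \<in> carrier G" "y = groth_cls G c d"
    using y by (rule groth_carrierE)
  show "x \<otimes>\<^bsub>grothendieck_group G\<^esub> y \<in> carrier (grothendieck_group G)"
    using ab cd by (simp add: groth_mult groth_cls_closed)
  show "x \<otimes>\<^bsub>grothendieck_group G\<^esub> y = y \<otimes>\<^bsub>grothendieck_group G\<^esub> x"
    using ab cd by (simp add: groth_mult m_comm)
  show "x \<otimes>\<^bsub>grothendieck_group G\<^esub> y \<otimes>\<^bsub>grothendieck_group G\<^esub> z =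
      x \<otimes>\<^bsub>grothendieck_group G\<^esub> (y \<otimes>\<^bsub>grothendieck_group G\<^esub> z)"
    if "z \<in> carrier (grothendieck_group G)"
    using that ab cd by (auto elim!: groth_carrierE simp: groth_mult m_assoc)
next
  show "\<one>\<^bsub>grothendieck_group G\<^esub> \<in> carrier (grothendieck_group G)"
    by (simp add: groth_one groth_cls_closed)
next
  fix x assume "x \<in> carrier (grothendieck_group G)"
  then obtain a b where ab: "a \<in> carrier G" "b \<in> carrier G" "x = groth_cls G a b"
    by (rule groth_carrierE)
  then show "\<one>\<^bsub>grothendieck_group G\<^esub> \<otimes>\<^bsub>grothendieck_group G\<^esub> x = x"
    by (simp add: groth_one groth_mult)
  have "groth_cls G b a \<otimes>\<^bsub>grothendieck_group G\<^esub> x = \<one>\<^bsub>grothendieck_group G\<^esub>"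
    using ab by (auto simp: groth_one groth_mult groth_cls_eq_iff m_comm)
  then show "\<exists>y\<in>carrier (grothendieck_group G).
      y \<otimes>\<^bsub>grothendieck_group G\<^esub> x = \<one>\<^bsub>grothendieck_group G\<^esub>"
    using ab groth_cls_closed by blast
qed

text \<open>After applying \<open>v\<close> the auxiliary term \<open>k\<close> of the relation
  cancels, because the target is a group.\<close>

lemma groth_lift_cls:
  assumes B: "comm_group B" and v: "v \<in> carrier G \<rightarrow> carrier B"
    and vm: "\<And>a b. a \<in> carrier G \<Longrightarrow> b \<in> carrier G \<Longrightarrow> v (a \<otimes> b) = v a \<otimes>\<^bsub>B\<^esub> v b"
    and ab: "a \<in> carrier G" "b \<in> carrier G"
  shows "groth_lift G B v (groth_cls G a b) = v a \<otimes>\<^bsub>B\<^esub> inv\<^bsub>B\<^esub> v b"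
proof -
  interpret B: comm_group B by fact
  obtain c d where cd: "(SOME p. p \<in> groth_cls G a b) = (c, d)"
    by (cases "SOME p. p \<in> groth_cls G a b") (rule that)
  then have m: "(c, d) \<in> groth_cls G a b"
    using someI[of "\<lambda>p. p \<in> groth_cls G a b", OF groth_cls_self[OF ab]] by simp
  note D = groth_cls_memD[OF m]
  obtain k where k: "k \<in> carrier G" "c \<otimes> b \<otimes> k = a \<otimes> d \<otimes> k"
    using D ab by (auto simp: groth_cls_eq_iff)
  have V: "v a \<in> carrier B" "v b \<in> carrier B" "v c \<in> carrier B" "v d \<in> carrier B" "v k \<in> carrier B"
    using v ab D k by auto
  have "v (c \<otimes> b \<otimes> k) = v (a \<otimes> d \<otimes> k)" using k by simp
  then have "v c \<otimes>\<^bsub>B\<^esub> v b \<otimes>\<^bsub>B\<^esub> v k = v a \<otimes>\<^bsub>B\<^esub> v d \<otimes>\<^bsub>B\<^esub> v k"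
    using ab D(1,2) k(1) by (simp add: vm)
  then have e: "v c \<otimes>\<^bsub>B\<^esub> v b = v a \<otimes>\<^bsub>B\<^esub> v d" using V by simp
  have "v c \<otimes>\<^bsub>B\<^esub> inv\<^bsub>B\<^esub> v d = (v c \<otimes>\<^bsub>B\<^esub> v b) \<otimes>\<^bsub>B\<^esub> (inv\<^bsub>B\<^esub> v b \<otimes>\<^bsub>B\<^esub> inv\<^bsub>B\<^esub> v d)"
    using V by (simp add: B.m_assoc B.mult_inv_cancel)
  also have "\<dots> = (v a \<otimes>\<^bsub>B\<^esub> inv\<^bsub>B\<^esub> v b) \<otimes>\<^bsub>B\<^esub> (v d \<otimes>\<^bsub>B\<^esub> inv\<^bsub>B\<^esub> v d)"
    unfolding e using V by (simp only: B.m_ac B.inv_closed B.m_closed)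
  also have "\<dots> = v a \<otimes>\<^bsub>B\<^esub> inv\<^bsub>B\<^esub> v b" using V by simp
  finally show ?thesis by (simp add: groth_lift_def cd)
qed

lemma groth_lift_mult:
  assumes B: "comm_group B" and v: "v \<in> carrier G \<rightarrow> carrier B"
    and vm: "\<And>a b. a \<in> carrier G \<Longrightarrow> b \<in> carrier G \<Longrightarrow> v (a \<otimes> b) = v a \<otimes>\<^bsub>B\<^esub> v b"
    and \<xi>: "\<xi> \<in> carrier (grothendieck_group G)" and \<eta>: "\<eta> \<in> carrier (grothendieck_group G)"
  shows "groth_lift G B v (\<xi> \<otimes>\<^bsub>grothendieck_group G\<^esub> \<eta>) = groth_lift G B v \<xi> \<otimes>\<^bsub>B\<^esub> groth_lift G B v \<eta>"
    and "groth_lift G B v \<xi> \<in> carrier B"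
proof -
  interpret B: comm_group B by fact
  obtain a b where ab: "a \<in> carrier G" "b \<in> carrier G" "\<xi> = groth_cls G a b"
    using \<xi> by (rule groth_carrierE)
  obtain c d where cd: "c \<in> carrier G" "d \<in> carrier G" "\<eta> = groth_cls G c d"
    using \<eta> by (rule groth_carrierE)
  have V: "v a \<in> carrier B" "v b \<in> carrier B" "v c \<in> carrier B" "v d \<in> carrier B"
    using v ab cd by auto
  show "groth_lift G B v \<xi> \<in> carrier B"
    using ab V by (simp add: groth_lift_cls[OF B v vm])
  show "groth_lift G B v (\<xi> \<otimes>\<^bsub>grothendieck_group G\<^esub> \<eta>) = groth_lift G B v \<xi> \<otimes>\<^bsub>B\<^esub> groth_lift G B v \<eta>"
    using ab cd V by (simp add: groth_mult groth_lift_cls[OF B v vm] vm B.inv_mult B.m_ac)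
qed

end

text \<open>Well-definedness of the composition of differences, isolated from bisets: all terms of
  the union coincide. Representatives are changed in one argument at a time.\<close>

lemma groth_bilinear:
  assumes A: "comm_monoid A" and B: "comm_monoid B" and C: "comm_monoid C"
    and closed: "\<And>a b. a \<in> carrier A \<Longrightarrow> b \<in> carrier B \<Longrightarrow> t a b \<in> carrier C"
    and l: "\<And>a a' b. a \<in> carrier A \<Longrightarrow> a' \<in> carrier A \<Longrightarrow> b \<in> carrier B \<Longrightarrow>
        t (a \<otimes>\<^bsub>A\<^esub> a') b = t a b \<otimes>\<^bsub>C\<^esub> t a' b"
    and r: "\<And>a b b'. a \<in> carrier A \<Longrightarrow> b \<in> carrier B \<Longrightarrow> b' \<in> carrier B \<Longrightarrow>
        t a (b \<otimes>\<^bsub>B\<^esub> b') = t a b \<otimes>\<^bsub>C\<^esub> t a b'"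
    and c: "a \<in> carrier A" "b \<in> carrier A" "c \<in> carrier B" "d \<in> carrier B"
  shows "(\<Union>(a, b)\<in>groth_cls A a b. \<Union>(c, d)\<in>groth_cls B c d.
        groth_rel C `` {(t a c \<otimes>\<^bsub>C\<^esub> t b d, t a d \<otimes>\<^bsub>C\<^esub> t b c)}) =
      groth_cls C (t a c \<otimes>\<^bsub>C\<^esub> t b d) (t a d \<otimes>\<^bsub>C\<^esub> t b c)"
proof -
  interpret A: comm_monoid A by fact
  interpret B: comm_monoid B by fact
  interpret C: comm_monoid C by fact
  let ?g = "\<lambda>a b c d. groth_cls C (t a c \<otimes>\<^bsub>C\<^esub> t b d) (t a d \<otimes>\<^bsub>C\<^esub> t b c)"
  have 1: "?g a' b' c' d' = ?g a b c' d'"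
    if m: "(a', b') \<in> groth_cls A a b" and cd: "c' \<in> carrier B" "d' \<in> carrier B" for a' b' c' d'
  proof -
    note D = A.groth_cls_memD[OF m]
    obtain k where k: "k \<in> carrier A" and E: "a' \<otimes>\<^bsub>A\<^esub> b \<otimes>\<^bsub>A\<^esub> k = a \<otimes>\<^bsub>A\<^esub> b' \<otimes>\<^bsub>A\<^esub> k"
      using D c by (auto simp: A.groth_cls_eq_iff)
    \<comment> \<open>The relation is used forwards at \<open>c'\<close> and backwards at
      \<open>d'\<close>. The product of the two equations is the relation wanted, and the leftover
      factors \<open>t k c'\<close> and \<open>t k d'\<close> form its witness.\<close>
    have E': "t a' x \<otimes>\<^bsub>C\<^esub> t b x \<otimes>\<^bsub>C\<^esub> t k x = t a x \<otimes>\<^bsub>C\<^esub> t b' x \<otimes>\<^bsub>C\<^esub> t k x" if "x \<in> carrier B" for x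
      using arg_cong[OF E, of "\<lambda>u. t u x"] that c D(1,2) k by (simp add: l)
    note cl = closed[OF c(1)] closed[OF c(2)] closed[OF D(1)] closed[OF D(2)] closed[OF k]
    have "(t a' c' \<otimes>\<^bsub>C\<^esub> t b' d') \<otimes>\<^bsub>C\<^esub> (t a d' \<otimes>\<^bsub>C\<^esub> t b c') \<otimes>\<^bsub>C\<^esub> (t k c' \<otimes>\<^bsub>C\<^esub> t k d') =
        (t a' c' \<otimes>\<^bsub>C\<^esub> t b c' \<otimes>\<^bsub>C\<^esub> t k c') \<otimes>\<^bsub>C\<^esub> (t a d' \<otimes>\<^bsub>C\<^esub> t b' d' \<otimes>\<^bsub>C\<^esub> t k d')"
      using cl cd by (simp add: C.m_ac)
    also have "\<dots> = (t a c' \<otimes>\<^bsub>C\<^esub> t b' c' \<otimes>\<^bsub>C\<^esub> t k c') \<otimes>\<^bsub>C\<^esub> (t a' d' \<otimes>\<^bsub>C\<^esub> t b d' \<otimes>\<^bsub>C\<^esub> t k d')"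
      using E' cd by simp
    also have "\<dots> = (t a c' \<otimes>\<^bsub>C\<^esub> t b d') \<otimes>\<^bsub>C\<^esub> (t a' d' \<otimes>\<^bsub>C\<^esub> t b' c') \<otimes>\<^bsub>C\<^esub> (t k c' \<otimes>\<^bsub>C\<^esub> t k d')"
      using cl cd by (simp add: C.m_ac)
    finally show ?thesis
      using cl cd by (subst C.groth_cls_eq_iff) (auto intro!: bexI[of _ "t k c' \<otimes>\<^bsub>C\<^esub> t k d'"])
  qed
  have 2: "?g a b c' d' = ?g a b c d" if m: "(c', d') \<in> groth_cls B c d" for c' d'
  proof -
    note D = B.groth_cls_memD[OF m]
    obtain k where k: "k \<in> carrier B" and E: "c' \<otimes>\<^bsub>B\<^esub> d \<otimes>\<^bsub>B\<^esub> k = c \<otimes>\<^bsub>B\<^esub> d' \<otimes>\<^bsub>B\<^esub> k"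
      using D c by (auto simp: B.groth_cls_eq_iff)
    have E': "t x c' \<otimes>\<^bsub>C\<^esub> t x d \<otimes>\<^bsub>C\<^esub> t x k = t x c \<otimes>\<^bsub>C\<^esub> t x d' \<otimes>\<^bsub>C\<^esub> t x k" if "x \<in> carrier A" for x
      using arg_cong[OF E, of "\<lambda>u. t x u"] that c D(1,2) k by (simp add: r)
    note cl = closed[OF _ c(3)] closed[OF _ c(4)] closed[OF _ D(1)] closed[OF _ D(2)] closed[OF _ k]
    have "(t a c' \<otimes>\<^bsub>C\<^esub> t b d') \<otimes>\<^bsub>C\<^esub> (t a d \<otimes>\<^bsub>C\<^esub> t b c) \<otimes>\<^bsub>C\<^esub> (t a k \<otimes>\<^bsub>C\<^esub> t b k) =
        (t a c' \<otimes>\<^bsub>C\<^esub> t a d \<otimes>\<^bsub>C\<^esub> t a k) \<otimes>\<^bsub>C\<^esub> (t b c \<otimes>\<^bsub>C\<^esub> t b d' \<otimes>\<^bsub>C\<^esub> t b k)"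
      using cl c by (simp add: C.m_ac)
    also have "\<dots> = (t a c \<otimes>\<^bsub>C\<^esub> t a d' \<otimes>\<^bsub>C\<^esub> t a k) \<otimes>\<^bsub>C\<^esub> (t b c' \<otimes>\<^bsub>C\<^esub> t b d \<otimes>\<^bsub>C\<^esub> t b k)"
      using E' c by simp
    also have "\<dots> = (t a c \<otimes>\<^bsub>C\<^esub> t b d) \<otimes>\<^bsub>C\<^esub> (t a d' \<otimes>\<^bsub>C\<^esub> t b c') \<otimes>\<^bsub>C\<^esub> (t a k \<otimes>\<^bsub>C\<^esub> t b k)"
      using cl c by (simp add: C.m_ac)
    finally show ?thesis
      using cl c by (subst C.groth_cls_eq_iff) (auto intro!: bexI[of _ "t a k \<otimes>\<^bsub>C\<^esub> t b k"])
  qed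
  have "?g a' b' c' d' = ?g a b c d"
    if "(a', b') \<in> groth_cls A a b" "(c', d') \<in> groth_cls B c d" for a' b' c' d'
    using 1[OF that(1)] 2[OF that(2)] B.groth_cls_memD[OF that(2)] by simp
  then show ?thesis
    using A.groth_cls_self[OF c(1,2)] B.groth_cls_self[OF c(3,4)]
    unfolding groth_cls_def[of C, symmetric] by blast
qed

section \<open>Isomorphism classes of bisets\<close>

lemma biset_sum_simps:
  "bpts (biset_sum X Y) = bpts X <+> bpts Y"
  "lact (biset_sum X Y) h (Inl x) = Inl (lact X h x)"
  "lact (biset_sum X Y) h (Inr y) = Inr (lact Y h y)"
  "ract (biset_sum X Y) (Inl x) h = Inl (ract X x h)"
  "ract (biset_sum X Y) (Inr y) h = Inr (ract Y y h)"
  by (simp_all add: biset_sum_def)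

lemma biset_sum_cong:
  assumes "biset_isomorphic H2 H1 X X'" "biset_isomorphic H2 H1 Y Y'"
  shows "biset_isomorphic H2 H1 (biset_sum X Y) (biset_sum X' Y')"
proof -
  obtain f where f: "bij_betw f (bpts X) (bpts X')"
      "\<And>h x. h \<in> H2 \<Longrightarrow> x \<in> bpts X \<Longrightarrow> f (lact X h x) = lact X' h (f x)"
      "\<And>h x. h \<in> H1 \<Longrightarrow> x \<in> bpts X \<Longrightarrow> f (ract X x h) = ract X' (f x) h"
    using assms(1) unfolding biset_isomorphic_def by blast
  obtain g where g: "bij_betw g (bpts Y) (bpts Y')"
      "\<And>h x. h \<in> H2 \<Longrightarrow> x \<in> bpts Y \<Longrightarrow> g (lact Y h x) = lact Y' h (g x)"
      "\<And>h x. h \<in> H1 \<Longrightarrow> x \<in> bpts Y \<Longrightarrow> g (ract Y x h) = ract Y' (g x) h"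
    using assms(2) unfolding biset_isomorphic_def by blast
  show ?thesis
  proof (rule biset_isomorphicI[of "map_sum f g"])
    show "bij_betw (map_sum f g) (bpts (biset_sum X Y)) (bpts (biset_sum X' Y'))"
    proof (rule bij_betw_imageI)
      show "inj_on (map_sum f g) (bpts (biset_sum X Y))"
        unfolding biset_sum_simps
        by (rule inj_onI) (auto elim!: PlusE dest: inj_onD[OF bij_betw_imp_inj_on[OF f(1)]]
            inj_onD[OF bij_betw_imp_inj_on[OF g(1)]])
      show "map_sum f g ` bpts (biset_sum X Y) = bpts (biset_sum X' Y')"
        unfolding biset_sum_simps Plus_def image_Un image_image map_sum.simps
          bij_betw_imp_surj_on[OF f(1), symmetric] bij_betw_imp_surj_on[OF g(1), symmetric] ..
    qed
  qed (auto simp: biset_sum_simps f g)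
qed

lemma biset_sum_comm: "biset_isomorphic H2 H1 (biset_sum X Y) (biset_sum Y X)"
proof (rule biset_isomorphicI[of "case_sum Inr Inl"])
  show "bij_betw (case_sum Inr Inl) (bpts (biset_sum X Y)) (bpts (biset_sum Y X))"
    by (rule bij_betw_byWitness[of _ "case_sum Inr Inl"]) (auto simp: biset_sum_simps)
qed (auto simp: biset_sum_simps)

lemma biset_sum_assoc:
  "biset_isomorphic H2 H1 (biset_sum (biset_sum X Y) Z) (biset_sum X (biset_sum Y Z))"
proof -
  let ?f = "case_sum (case_sum Inl (Inr \<circ> Inl)) (Inr \<circ> Inr)"
  show ?thesis
  proof (rule biset_isomorphicI[of ?f])
    show "bij_betw ?f (bpts (biset_sum (biset_sum X Y) Z)) (bpts (biset_sum X (biset_sum Y Z)))"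
      by (rule bij_betw_byWitness[of _ "case_sum (Inl \<circ> Inl) (case_sum (Inl \<circ> Inr) Inr)"])
        (auto simp: biset_sum_simps)
  qed (auto simp: biset_sum_simps)
qed

lemma biset_sum_empty: "biset_isomorphic H2 H1 (biset_sum empty_biset X) X"
proof (rule biset_isomorphicI[of "case_sum undefined id"])
  show "bij_betw (case_sum undefined id) (bpts (biset_sum empty_biset X)) (bpts X)"
    by (rule bij_betw_byWitness[of _ Inr]) (auto simp: biset_sum_simps empty_biset_def)
qed (auto simp: biset_sum_simps empty_biset_def)

lemma finite_biset_sum:
  assumes "finite_biset G H2 H1 X" "finite_biset G H2 H1 Y"
  shows "finite_biset G H2 H1 (biset_sum X Y)"
  using assms unfolding finite_biset_def by (auto simp: biset_sum_simps)

lemma finite_biset_empty: "finite_biset G H2 H1 (empty_biset :: ('g, nat) biset)"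
  by (simp add: finite_biset_def empty_biset_def)

text \<open>A relaxed presentation of the balanced product: \<open>P\<close> is any biset with a map
  \<open>X \<times> Y \<rightarrow> P\<close> whose fibres are the classes of the balanced relation.\<close>

definition balanced_model where
  "balanced_model H3 H2 H1 X Y P m \<longleftrightarrow>
     (\<forall>p\<in>bpts P. \<exists>x\<in>bpts X. \<exists>y\<in>bpts Y. p = m x y) \<and>
     (\<forall>x\<in>bpts X. \<forall>y\<in>bpts Y. m x y \<in> bpts P \<and>
        (\<forall>h\<in>H3. m (lact X h x) y = lact P h (m x y)) \<and>
        (\<forall>h\<in>H1. m x (ract Y y h) = ract P (m x y) h) \<and>
        (\<forall>x'\<in>bpts X. \<forall>y'\<in>bpts Y.
           m x y = m x' y' \<longleftrightarrow> (\<exists>h\<in>H2. x = ract X x' h \<and> y' = lact Y h y)))"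

lemma balanced_modelD:
  assumes "balanced_model H3 H2 H1 X Y P m"
  shows "\<And>p. p \<in> bpts P \<Longrightarrow> \<exists>x\<in>bpts X. \<exists>y\<in>bpts Y. p = m x y"
    and "\<And>x y. x \<in> bpts X \<Longrightarrow> y \<in> bpts Y \<Longrightarrow> m x y \<in> bpts P"
    and "\<And>x y h. x \<in> bpts X \<Longrightarrow> y \<in> bpts Y \<Longrightarrow> h \<in> H3 \<Longrightarrow> m (lact X h x) y = lact P h (m x y)"
    and "\<And>x y h. x \<in> bpts X \<Longrightarrow> y \<in> bpts Y \<Longrightarrow> h \<in> H1 \<Longrightarrow> m x (ract Y y h) = ract P (m x y) h"
    and "\<And>x y x' y'. x \<in> bpts X \<Longrightarrow> y \<in> bpts Y \<Longrightarrow> x' \<in> bpts X \<Longrightarrow> y' \<in> bpts Y \<Longrightarrow>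
      m x y = m x' y' \<longleftrightarrow> (\<exists>h\<in>H2. x = ract X x' h \<and> y' = lact Y h y)"
  using assms unfolding balanced_model_def by simp_all

text \<open>The union defining \<open>biset_cls_comp\<close> runs over all representatives, so a
  model for one pair of bisets has to serve every isomorphic pair with the same
  \<open>P\<close>.\<close>

lemma balanced_model_iso:
  assumes m: "balanced_model H3 H2 H1 X Y P m"
    and X: "finite_biset G H3 H2 X'" and Y: "finite_biset G H2 H1 Y'"
    and f: "biset_isomorphic H3 H2 X' X" and g: "biset_isomorphic H2 H1 Y' Y"
  shows "\<exists>m'. balanced_model H3 H2 H1 X' Y' P m'"
proof -
  note mD = balanced_modelD[OF m] and XD = finite_bisetD[OF X] and YD = finite_bisetD[OF Y]
  obtain f where f: "bij_betw f (bpts X') (bpts X)"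
      and fl: "\<And>h x. h \<in> H3 \<Longrightarrow> x \<in> bpts X' \<Longrightarrow> f (lact X' h x) = lact X h (f x)"
      and fr: "\<And>h x. h \<in> H2 \<Longrightarrow> x \<in> bpts X' \<Longrightarrow> f (ract X' x h) = ract X (f x) h"
    using f unfolding biset_isomorphic_def by blast
  obtain g where g: "bij_betw g (bpts Y') (bpts Y)"
      and gl: "\<And>h x. h \<in> H2 \<Longrightarrow> x \<in> bpts Y' \<Longrightarrow> g (lact Y' h x) = lact Y h (g x)"
      and gr: "\<And>h x. h \<in> H1 \<Longrightarrow> x \<in> bpts Y' \<Longrightarrow> g (ract Y' x h) = ract Y (g x) h"
    using g unfolding biset_isomorphic_def by blast
  have fm: "x \<in> bpts X' \<Longrightarrow> f x \<in> bpts X" and gm: "y \<in> bpts Y' \<Longrightarrow> g y \<in> bpts Y" for x y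
    using f g by (auto dest: bij_betwE)
  have fi: "x \<in> bpts X' \<Longrightarrow> x' \<in> bpts X' \<Longrightarrow> f x = f x' \<longleftrightarrow> x = x'" for x x'
    using f by (auto simp: bij_betw_def inj_on_eq_iff)
  have gi: "x \<in> bpts Y' \<Longrightarrow> x' \<in> bpts Y' \<Longrightarrow> g x = g x' \<longleftrightarrow> x = x'" for x x'
    using g by (auto simp: bij_betw_def inj_on_eq_iff)
  have fs: "bpts X = f ` bpts X'" and gs: "bpts Y = g ` bpts Y'"
    using f g by (auto simp: bij_betw_def)
  have "balanced_model H3 H2 H1 X' Y' P (\<lambda>x y. m (f x) (g y))"
    unfolding balanced_model_def
  proof (intro conjI ballI)
    fix p assume "p \<in> bpts P"
    then show "\<exists>x\<in>bpts X'. \<exists>y\<in>bpts Y'. p = m (f x) (g y)"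
      using mD(1)[of p] unfolding fs gs by blast
  next
    fix x y x' y' assume c: "x \<in> bpts X'" "y \<in> bpts Y'" "x' \<in> bpts X'" "y' \<in> bpts Y'"
    have "m (f x) (g y) = m (f x') (g y') \<longleftrightarrow>
        (\<exists>h\<in>H2. f x = ract X (f x') h \<and> g y' = lact Y h (g y))"
      using c by (intro mD(5)) (auto simp: fm gm)
    also have "\<dots> \<longleftrightarrow> (\<exists>h\<in>H2. x = ract X' x' h \<and> y' = lact Y' h y)"
    proof (intro bex_cong refl)
      fix h assume "h \<in> H2"
      then show "f x = ract X (f x') h \<and> g y' = lact Y h (g y) \<longleftrightarrow> x = ract X' x' h \<and> y' = lact Y' h y"
        using c fi[of x "ract X' x' h"] gi[of y' "lact Y' h y"] by (simp add: fr gl XD YD)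
    qed
    finally show "m (f x) (g y) = m (f x') (g y') \<longleftrightarrow>
      (\<exists>h\<in>H2. x = ract X' x' h \<and> y' = lact Y' h y)" .
  qed (simp_all add: mD fm gm fl gr)
  then show ?thesis by blast
qed

text \<open>Balanced products distribute over sums; this and its mirror image are the source of
  biadditivity of the composition of classes.\<close>

lemma balanced_model_suml:
  assumes m: "balanced_model H3 H2 H1 X Y P m" and n: "balanced_model H3 H2 H1 X' Y P' n"
  shows "balanced_model H3 H2 H1 (biset_sum X X') Y (biset_sum P P')
    (\<lambda>z y. case z of Inl x \<Rightarrow> Inl (m x y) | Inr x \<Rightarrow> Inr (n x y))"
    (is "balanced_model _ _ _ ?X _ ?P ?m")
  unfolding balanced_model_def
proof (intro conjI)
  show "\<forall>p\<in>bpts ?P. \<exists>z\<in>bpts ?X. \<exists>y\<in>bpts Y. p = ?m z y"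
  proof
    fix p assume "p \<in> bpts ?P"
    then consider q where "q \<in> bpts P" "p = Inl q" | q where "q \<in> bpts P'" "p = Inr q"
      by (auto simp: biset_sum_simps)
    then show "\<exists>z\<in>bpts ?X. \<exists>y\<in>bpts Y. p = ?m z y"
    proof cases
      case 1
      then obtain x y where "x \<in> bpts X" "y \<in> bpts Y" "q = m x y"
        using balanced_modelD(1)[OF m] by blast
      then show ?thesis using 1 by (intro bexI[of _ "Inl x"] bexI[of _ y]) (auto simp: biset_sum_simps)
    next
      case 2
      then obtain x y where "x \<in> bpts X'" "y \<in> bpts Y" "q = n x y"
        using balanced_modelD(1)[OF n] by blast
      then show ?thesis using 2 by (intro bexI[of _ "Inr x"] bexI[of _ y]) (auto simp: biset_sum_simps)
    qed
  qed
qed (auto simp: biset_sum_simps balanced_modelD(2-)[OF m] balanced_modelD(2-)[OF n])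

lemma balanced_model_sumr:
  assumes m: "balanced_model H3 H2 H1 X Y P m" and n: "balanced_model H3 H2 H1 X Y' P' n"
  shows "balanced_model H3 H2 H1 X (biset_sum Y Y') (biset_sum P P')
    (\<lambda>x z. case z of Inl y \<Rightarrow> Inl (m x y) | Inr y \<Rightarrow> Inr (n x y))"
    (is "balanced_model _ _ _ _ ?Y ?P ?m")
  unfolding balanced_model_def
proof (intro conjI)
  show "\<forall>p\<in>bpts ?P. \<exists>x\<in>bpts X. \<exists>z\<in>bpts ?Y. p = ?m x z"
  proof
    fix p assume "p \<in> bpts ?P"
    then consider q where "q \<in> bpts P" "p = Inl q" | q where "q \<in> bpts P'" "p = Inr q"
      by (auto simp: biset_sum_simps)
    then show "\<exists>x\<in>bpts X. \<exists>z\<in>bpts ?Y. p = ?m x z"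
    proof cases
      case 1
      then obtain x y where "x \<in> bpts X" "y \<in> bpts Y" "q = m x y"
        using balanced_modelD(1)[OF m] by blast
      then show ?thesis using 1 by (intro bexI[of _ "Inl y"] bexI[of _ x]) (auto simp: biset_sum_simps)
    next
      case 2
      then obtain x y where "x \<in> bpts X" "y \<in> bpts Y'" "q = n x y"
        using balanced_modelD(1)[OF n] by blast
      then show ?thesis using 2 by (intro bexI[of _ "Inr y"] bexI[of _ x]) (auto simp: biset_sum_simps)
    qed
  qed
qed (auto simp: biset_sum_simps balanced_modelD(2-)[OF m] balanced_modelD(2-)[OF n])

section \<open>Balanced products and the monoid of isomorphism classes\<close>

context fin_group
begin

text \<open>The isomorphism sends \<open>p\<close> to its fibre under \<open>m\<close>, which is a
  class of the balanced relation.\<close>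

lemma balanced_product_iso:
  assumes H: "subgroup H3 G" "subgroup H2 G" "subgroup H1 G"
    and X: "finite_biset G H3 H2 X" and Y: "finite_biset G H2 H1 Y" and P: "finite_biset G H3 H1 P"
    and m: "balanced_model H3 H2 H1 X Y P m"
  shows "biset_isomorphic H3 H1 P (balanced_product H2 X Y)"
proof -
  note mD = balanced_modelD[OF m] and XD = finite_bisetD[OF X] and YD = finite_bisetD[OF Y]
    and PD = finite_bisetD[OF P]
  define f where "f p = {(x, y). x \<in> bpts X \<and> y \<in> bpts Y \<and> m x y = p}" for p
  \<comment> \<open>The balanced relation is exactly the kernel of \<open>m\<close>, so the class of
    \<open>(x, y)\<close> is the fibre over \<open>m x y\<close>.\<close>
  have rel: "balanced_rel H2 X Y = {((x, y), (x', y')). x \<in> bpts X \<and> y \<in> bpts Y \<and>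
      x' \<in> bpts X \<and> y' \<in> bpts Y \<and> m x y = m x' y'}" (is "_ = ?R")
  proof
    show "balanced_rel H2 X Y \<subseteq> ?R"
      unfolding balanced_rel_def using mD(5) by (auto simp: XD YD)
    show "?R \<subseteq> balanced_rel H2 X Y"
      unfolding balanced_rel_def using mD(5) by auto
  qed
  have cls: "balanced_rel H2 X Y `` {(x, y)} = f (m x y)" if "x \<in> bpts X" "y \<in> bpts Y" for x y
    unfolding rel f_def using that by auto
  have quot: "(bpts X \<times> bpts Y) // balanced_rel H2 X Y = f ` bpts P"
  proof (rule subset_antisym; rule subsetI)
    fix C assume "C \<in> (bpts X \<times> bpts Y) // balanced_rel H2 X Y"
    then show "C \<in> f ` bpts P" by (auto elim!: quotientE simp: cls mD(2))
  next
    fix C assume "C \<in> f ` bpts P"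
    then obtain p where p: "p \<in> bpts P" "C = f p" by blast
    then obtain x y where "x \<in> bpts X" "y \<in> bpts Y" "p = m x y" using mD(1) by blast
    then show "C \<in> (bpts X \<times> bpts Y) // balanced_rel H2 X Y"
      using p by (auto simp flip: cls intro: quotientI)
  qed
  show ?thesis
  proof (rule biset_isomorphicI[of f])
    \<comment> \<open>Fibres are nonempty since \<open>m\<close> is onto, so distinct points have
      distinct fibres.\<close>
    have "inj_on f (bpts P)"
    proof (rule inj_onI)
      fix p q assume pq: "p \<in> bpts P" "q \<in> bpts P" "f p = f q"
      obtain x y where xy: "x \<in> bpts X" "y \<in> bpts Y" "p = m x y" using mD(1) pq by blast
      then have "(x, y) \<in> f p" by (simp add: f_def)
      then show "p = q" using xy pq by (auto simp: f_def)
    qed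
    then show "bij_betw f (bpts P) (bpts (balanced_product H2 X Y))"
      by (simp add: balanced_product_def quot bij_betw_def)
    show "f (lact P h p) = lact (balanced_product H2 X Y) h (f p)"
      if h: "h \<in> H3" and p: "p \<in> bpts P" for h p
    proof -
      have hc: "h \<in> carrier G" "inv h \<in> H3"
        using H(1) h by (auto intro: subgroup.mem_carrier subgroup.m_inv_closed)
      \<comment> \<open>Translation by \<open>h\<close> maps the fibre over \<open>p\<close> into
        the fibre over its translate; translating back by \<open>inv h\<close> shows that it is
        onto.\<close>
      have "(x, y) \<in> (\<lambda>(x, y). (lact X h x, y)) ` f p"
        if xy: "x \<in> bpts X" "y \<in> bpts Y" "m x y = lact P h p" for x y
      proof (rule image_eqI[of _ _ "(lact X (inv h) x, y)"])
        show "(x, y) = (case (lact X (inv h) x, y) of (x, y) \<Rightarrow> (lact X h x, y))"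
          using XD(4)[OF h hc(2) xy(1)] hc xy by (simp add: XD)
        show "(lact X (inv h) x, y) \<in> f p"
          using PD(4)[OF hc(2) h p] hc xy p by (simp add: f_def XD PD mD(3))
      qed
      then show ?thesis
        using h by (auto simp: balanced_product_def f_def XD mD)
    qed
    show "f (ract P p h) = ract (balanced_product H2 X Y) (f p) h"
      if h: "h \<in> H1" and p: "p \<in> bpts P" for h p
    proof -
      have hc: "h \<in> carrier G" "inv h \<in> H1"
        using H(3) h by (auto intro: subgroup.mem_carrier subgroup.m_inv_closed)
      have "(x, y) \<in> (\<lambda>(x, y). (x, ract Y y h)) ` f p"
        if xy: "x \<in> bpts X" "y \<in> bpts Y" "m x y = ract P p h" for x y
      proof (rule image_eqI[of _ _ "(x, ract Y y (inv h))"])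
        show "(x, y) = (case (x, ract Y y (inv h)) of (x, y) \<Rightarrow> (x, ract Y y h))"
          using YD(7)[OF hc(2) h xy(2)] hc xy by (simp add: YD)
        show "(x, ract Y y (inv h)) \<in> f p"
          using PD(7)[OF h hc(2) p] hc xy p by (simp add: f_def YD PD mD(4))
      qed
      then show ?thesis
        using h by (auto simp: balanced_product_def f_def YD mD)
    qed
  qed
qed

lemma biset_cls_memD:
  assumes "Y \<in> biset_cls G H2 H1 X"
  shows "finite_biset G H2 H1 Y" "biset_isomorphic H2 H1 X Y"
  using assms by (auto simp: biset_cls_def)

lemma biset_cls_eqI:
  assumes "finite_biset G H2 H1 X" "biset_isomorphic H2 H1 X Y"
  shows "biset_cls G H2 H1 X = biset_cls G H2 H1 Y"
  unfolding biset_cls_def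
  using biset_isomorphic_trans[OF assms(2)] biset_isomorphic_trans[OF biset_isomorphic_sym[OF assms]]
  by auto

text \<open>Operations on classes are unions over representatives; on an empty class they would
  collapse to the empty set.\<close>

lemma biset_cls_nonempty:
  assumes H: "subgroup H2 G" "subgroup H1 G" and X: "finite_biset G H2 H1 X"
  obtains Y where "Y \<in> biset_cls G H2 H1 X"
  using ex_nat_biset[OF X] finite_biset_isomorphic[OF H X] unfolding biset_cls_def by blast

text \<open>Equal classes have a common member, and it links \<open>X\<close> to
  \<open>Y\<close>.\<close>

lemma biset_cls_eqD:
  assumes H: "subgroup H2 G" "subgroup H1 G"
    and X: "finite_biset G H2 H1 X" and Y: "finite_biset G H2 H1 Y"
    and eq: "biset_cls G H2 H1 X = biset_cls G H2 H1 Y"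
  shows "biset_isomorphic H2 H1 X Y"
proof -
  obtain Z where Z: "Z \<in> biset_cls G H2 H1 X" by (rule biset_cls_nonempty[OF H X])
  then have "biset_isomorphic H2 H1 X Z" "biset_isomorphic H2 H1 Y Z"
    using eq by (simp_all add: biset_cls_memD(2))
  then show ?thesis
    using biset_isomorphic_trans biset_isomorphic_sym[OF Y] by blast
qed

lemma conj_bisetD: "conj_biset G H2 H1 X \<Longrightarrow> finite_biset G H2 H1 X"
  by (simp add: conj_biset_def)

lemma biset_cls_closed:
  assumes H: "subgroup H2 G" "subgroup H1 G" and X: "conj_biset G H2 H1 X"
  shows "biset_cls G H2 H1 X \<in> carrier (biset_monoid G H2 H1)"
proof -
  note fX = conj_bisetD[OF X]
  obtain Y where Y: "Y \<in> biset_cls G H2 H1 X" by (rule biset_cls_nonempty[OF H fX])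
  have "conj_biset G H2 H1 Y" "biset_cls G H2 H1 X = biset_cls G H2 H1 Y"
    using biset_cls_memD[OF Y] conj_biset_isomorphic[OF H X] biset_cls_eqI[OF fX] by auto
  then show ?thesis unfolding biset_monoid_def by auto
qed

lemma biset_monoidE:
  assumes "\<xi> \<in> carrier (biset_monoid G H2 H1)"
  obtains X :: "('g, nat) biset" where "conj_biset G H2 H1 X" "\<xi> = biset_cls G H2 H1 X"
  using assms unfolding biset_monoid_def by auto

lemma biset_cls_mult:
  assumes H: "subgroup H2 G" "subgroup H1 G"
    and X: "finite_biset G H2 H1 X" and Y: "finite_biset G H2 H1 Y"
  shows "biset_cls G H2 H1 X \<otimes>\<^bsub>biset_monoid G H2 H1\<^esub> biset_cls G H2 H1 Y =
    biset_cls G H2 H1 (biset_sum X Y)"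
proof -
  obtain X' where X': "X' \<in> biset_cls G H2 H1 X" by (rule biset_cls_nonempty[OF H X])
  obtain Y' where Y': "Y' \<in> biset_cls G H2 H1 Y" by (rule biset_cls_nonempty[OF H Y])
  have "biset_cls G H2 H1 (biset_sum X' Y') = biset_cls G H2 H1 (biset_sum X Y)"
    if "X' \<in> biset_cls G H2 H1 X" "Y' \<in> biset_cls G H2 H1 Y" for X' Y'
    using biset_cls_memD[OF that(1)] biset_cls_memD[OF that(2)]
    by (intro biset_cls_eqI[symmetric] finite_biset_sum biset_sum_cong X Y)
  then show ?thesis using X' Y' unfolding biset_monoid_def by auto
qed

lemma conj_biset_sum:
  assumes H: "subgroup H2 G" "subgroup H1 G"
    and X: "conj_biset G H2 H1 X" and Y: "conj_biset G H2 H1 Y"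
  shows "conj_biset G H2 H1 (biset_sum X Y)"
proof -
  obtain \<gamma> \<delta> where "equivariant H2 H1 X \<gamma>" "equivariant H2 H1 Y \<delta>"
    using ex_equivariant_if_conj_biset[OF H X] ex_equivariant_if_conj_biset[OF H Y] by blast
  then have "equivariant H2 H1 (biset_sum X Y) (case_sum \<gamma> \<delta>)"
    unfolding equivariant_def by (auto simp: biset_sum_simps)
  then show ?thesis
    using X Y by (intro conj_biset_if_equivariant[OF H]) (auto intro: finite_biset_sum conj_bisetD)
qed

lemma conj_biset_empty:
  assumes H: "subgroup H2 G" "subgroup H1 G"
  shows "conj_biset G H2 H1 (empty_biset :: ('g, nat) biset)"
  by (rule conj_biset_if_equivariant[OF H finite_biset_empty, of undefined])
    (simp add: equivariant_def empty_biset_def)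

lemma biset_monoid_comm_monoid:
  assumes H: "subgroup H2 G" "subgroup H1 G"
  shows "comm_monoid (biset_monoid G H2 H1)"
proof (rule comm_monoidI)
  have one: "\<one>\<^bsub>biset_monoid G H2 H1\<^esub> = biset_cls G H2 H1 (empty_biset :: ('g, nat) biset)"
    by (simp add: biset_monoid_def)
  show "\<one>\<^bsub>biset_monoid G H2 H1\<^esub> \<in> carrier (biset_monoid G H2 H1)"
    unfolding one by (intro biset_cls_closed H conj_biset_empty)
  fix x y z
  assume x: "x \<in> carrier (biset_monoid G H2 H1)"
  obtain X :: "('g, nat) biset" where X: "conj_biset G H2 H1 X" "x = biset_cls G H2 H1 X"
    using x by (rule biset_monoidE)
  note fX = conj_bisetD[OF X(1)]
  show "\<one>\<^bsub>biset_monoid G H2 H1\<^esub> \<otimes>\<^bsub>biset_monoid G H2 H1\<^esub> x = x"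
    unfolding one X(2) biset_cls_mult[OF H finite_biset_empty fX]
    by (intro biset_cls_eqI finite_biset_sum finite_biset_empty fX biset_sum_empty)
  assume y: "y \<in> carrier (biset_monoid G H2 H1)"
  obtain Y :: "('g, nat) biset" where Y: "conj_biset G H2 H1 Y" "y = biset_cls G H2 H1 Y"
    using y by (rule biset_monoidE)
  note fY = conj_bisetD[OF Y(1)]
  show "x \<otimes>\<^bsub>biset_monoid G H2 H1\<^esub> y \<in> carrier (biset_monoid G H2 H1)"
    unfolding X(2) Y(2) biset_cls_mult[OF H fX fY]
    by (intro biset_cls_closed H conj_biset_sum X Y)
  show "x \<otimes>\<^bsub>biset_monoid G H2 H1\<^esub> y = y \<otimes>\<^bsub>biset_monoid G H2 H1\<^esub> x"
    unfolding X(2) Y(2) biset_cls_mult[OF H fX fY] biset_cls_mult[OF H fY fX]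
    by (intro biset_cls_eqI finite_biset_sum fX fY biset_sum_comm)
  assume z: "z \<in> carrier (biset_monoid G H2 H1)"
  obtain Z :: "('g, nat) biset" where Z: "conj_biset G H2 H1 Z" "z = biset_cls G H2 H1 Z"
    using z by (rule biset_monoidE)
  note fZ = conj_bisetD[OF Z(1)]
  show "x \<otimes>\<^bsub>biset_monoid G H2 H1\<^esub> y \<otimes>\<^bsub>biset_monoid G H2 H1\<^esub> z =
      x \<otimes>\<^bsub>biset_monoid G H2 H1\<^esub> (y \<otimes>\<^bsub>biset_monoid G H2 H1\<^esub> z)"
    unfolding X(2) Y(2) Z(2) biset_cls_mult[OF H fX fY] biset_cls_mult[OF H fY fZ]
      biset_cls_mult[OF H finite_biset_sum[OF fX fY] fZ]
      biset_cls_mult[OF H fX finite_biset_sum[OF fY fZ]]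
    by (intro biset_cls_eqI finite_biset_sum fX fY fZ biset_sum_assoc)
qed

text \<open>The factors and \<open>P\<close> may have points of any types, so composites can be read
  off directly from the bisets of spans.\<close>

lemma biset_cls_comp_model:
  assumes H: "subgroup H3 G" "subgroup H2 G" "subgroup H1 G"
    and X: "finite_biset G H3 H2 X" and Y: "finite_biset G H2 H1 Y" and P: "finite_biset G H3 H1 P"
    and m: "balanced_model H3 H2 H1 X Y P m"
  shows "biset_cls_comp G H3 H2 H1 (biset_cls G H3 H2 X) (biset_cls G H2 H1 Y) = biset_cls G H3 H1 P"
proof -
  obtain X' where X': "X' \<in> biset_cls G H3 H2 X" by (rule biset_cls_nonempty[OF H(1,2) X])
  obtain Y' where Y': "Y' \<in> biset_cls G H2 H1 Y" by (rule biset_cls_nonempty[OF H(2,3) Y])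
  have "biset_cls G H3 H1 (balanced_product H2 X' Y') = biset_cls G H3 H1 P"
    if "X' \<in> biset_cls G H3 H2 X" "Y' \<in> biset_cls G H2 H1 Y" for X' Y'
  proof -
    note X' = biset_cls_memD[OF that(1)] and Y' = biset_cls_memD[OF that(2)]
    obtain m' where "balanced_model H3 H2 H1 X' Y' P m'"
      using balanced_model_iso[OF m X'(1) Y'(1) biset_isomorphic_sym[OF X X'(2)]
          biset_isomorphic_sym[OF Y Y'(2)]] by blast
    then show ?thesis
      using biset_cls_eqI[OF P balanced_product_iso[OF H X'(1) Y'(1) P]] by simp
  qed
  then show ?thesis using X' Y' unfolding biset_cls_comp_def by blast
qed

end

section \<open>Finite $G$-sets\<close>

lemma gmapsD:
  assumes "\<phi> \<in> gmaps G S T"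
  shows "\<And>x. x \<in> fst S \<Longrightarrow> \<phi> x \<in> fst T"
    and "\<And>g x. g \<in> carrier G \<Longrightarrow> x \<in> fst S \<Longrightarrow> \<phi> (snd S g x) = snd T g (\<phi> x)"
    and "\<phi> \<in> extensional (fst S)"
  using assms unfolding gmaps_def by (auto simp: PiE_iff)

lemma gmapsI:
  assumes "\<And>x. x \<in> fst S \<Longrightarrow> \<phi> x \<in> fst T"
    and "\<And>g x. g \<in> carrier G \<Longrightarrow> x \<in> fst S \<Longrightarrow> \<phi> (snd S g x) = snd T g (\<phi> x)"
    and "\<phi> \<in> extensional (fst S)"
  shows "\<phi> \<in> gmaps G S T"
  using assms unfolding gmaps_def by (auto simp: PiE_iff)

lemma gmaps_eqI:
  assumes "\<phi> \<in> gmaps G S T" "\<psi> \<in> gmaps G S T'" "\<And>x. x \<in> fst S \<Longrightarrow> \<phi> x = \<psi> x"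
  shows "\<phi> = \<psi>"
  using assms by (intro extensionalityI[of _ "fst S"]) (auto dest: gmapsD)

context fin_group
begin

lemma finite_gset_finite: "finite_gset G S \<Longrightarrow> finite (fst S)"
  by (simp add: finite_gset_def)

lemma gset_closed: "finite_gset G S \<Longrightarrow> g \<in> carrier G \<Longrightarrow> x \<in> fst S \<Longrightarrow> snd S g x \<in> fst S"
  unfolding finite_gset_def by (meson group_action.element_image)

lemma gset_one: "finite_gset G S \<Longrightarrow> x \<in> fst S \<Longrightarrow> snd S \<one> x = x"
  unfolding finite_gset_def by (metis group_action.id_eq_one restrict_apply')

lemma gset_mult:
  "finite_gset G S \<Longrightarrow> g \<in> carrier G \<Longrightarrow> h \<in> carrier G \<Longrightarrow> x \<in> fst S \<Longrightarrow>
    snd S (g \<otimes> h) x = snd S g (snd S h x)"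
  unfolding finite_gset_def by (meson group_action.composition_rule)

lemma gset_inv:
  assumes "finite_gset G S" "g \<in> carrier G" "x \<in> fst S"
  shows "snd S (inv g) (snd S g x) = x" "snd S g (snd S (inv g) x) = x"
  using assms by (simp_all flip: gset_mult add: gset_one)

lemma gset_inv_iff:
  assumes "finite_gset G S" "g \<in> carrier G" "x \<in> fst S" "y \<in> fst S"
  shows "snd S g x = y \<longleftrightarrow> x = snd S (inv g) y"
  using assms gset_inv by metis

text \<open>Turns the bare action laws into a homomorphism to \<open>BijGroup\<close>; bijectivity
  comes from \<open>inv g\<close>, and the restrictions supply the extensionality built into
  \<open>finite_gset\<close>.\<close>

lemma finite_gsetI:
  assumes fin: "finite E"
    and closed: "\<And>g x. g \<in> carrier G \<Longrightarrow> x \<in> E \<Longrightarrow> a g x \<in> E"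
    and one: "\<And>x. x \<in> E \<Longrightarrow> a \<one> x = x"
    and mult: "\<And>g h x. g \<in> carrier G \<Longrightarrow> h \<in> carrier G \<Longrightarrow> x \<in> E \<Longrightarrow> a (g \<otimes> h) x = a g (a h x)"
  shows "finite_gset G (E, \<lambda>g\<in>carrier G. \<lambda>x\<in>E. a g x)"
proof -
  have inv: "a (inv g) (a g x) = x" "a g (a (inv g) x) = x" if "g \<in> carrier G" "x \<in> E" for g x
    using that by (simp_all flip: mult add: one)
  have bij: "(\<lambda>x\<in>E. a g x) \<in> Bij E" if "g \<in> carrier G" for g
    unfolding Bij_def using that closed inv
    by (auto intro!: bij_betw_byWitness[of _ "a (inv g)"])
  have "(\<lambda>g\<in>carrier G. \<lambda>x\<in>E. a g x) \<in> hom G (BijGroup E)"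
    by (rule homI)
      (auto simp: bij BijGroup_def compose_def mult closed intro!: restrict_ext)
  then have "group_action G E (\<lambda>g\<in>carrier G. \<lambda>x\<in>E. a g x)"
    by (simp add: group_action_def group_hom_def group_hom_axioms_def is_group group_BijGroup)
  then show ?thesis using fin by (simp add: finite_gset_def)
qed

lemma gmaps_compose:
  assumes "\<phi> \<in> gmaps G S T" "\<psi> \<in> gmaps G T U" "finite_gset G S"
  shows "compose (fst S) \<psi> \<phi> \<in> gmaps G S U"
  using assms by (intro gmapsI) (auto simp: compose_eq gmapsD gset_closed compose_def)

lemma gmaps_id: "finite_gset G S \<Longrightarrow> (\<lambda>x\<in>fst S. x) \<in> gmaps G S S"
  by (intro gmapsI) (auto simp: gset_closed)

text \<open>Quotients of actions on an arbitrary type, realised inside \<open>'g pt\<close>. The equivalence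
  relation is the kernel of \<open>k\<close>, which may take values in any type.\<close>

lemma gset_quotient:
  fixes k :: "'b \<Rightarrow> 'c"
  assumes fin: "finite B"
    and closed: "\<And>g x. g \<in> carrier G \<Longrightarrow> x \<in> B \<Longrightarrow> a g x \<in> B"
    and one: "\<And>x. x \<in> B \<Longrightarrow> k (a \<one> x) = k x"
    and mult: "\<And>g h x. g \<in> carrier G \<Longrightarrow> h \<in> carrier G \<Longrightarrow> x \<in> B \<Longrightarrow>
      k (a (g \<otimes> h) x) = k (a g (a h x))"
    and ker: "\<And>g x y. g \<in> carrier G \<Longrightarrow> x \<in> B \<Longrightarrow> y \<in> B \<Longrightarrow> k x = k y \<Longrightarrow> k (a g x) = k (a g y)"
  obtains Z :: "'g gset" and q where "finite_gset G Z" "fst Z = q ` B"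
    "\<And>x y. x \<in> B \<Longrightarrow> y \<in> B \<Longrightarrow> q x = q y \<longleftrightarrow> k x = k y"
    "\<And>g x. g \<in> carrier G \<Longrightarrow> x \<in> B \<Longrightarrow> snd Z g (q x) = q (a g x)"
proof -
  \<comment> \<open>The points \<open>(InL ^^ n) (Coset {})\<close> are an infinite supply inside
    \<open>'g pt\<close>, enough to encode the finitely many values of \<open>k\<close>.\<close>
  have "inj (\<lambda>n::nat. (InL ^^ n) (Coset {}) :: 'g pt)"
  proof (rule injI)
    fix m n :: nat
    show "(InL ^^ m) (Coset {}) = (InL ^^ n) (Coset {} :: 'g pt) \<Longrightarrow> m = n"
    proof (induction m arbitrary: n)
      case 0 then show ?case by (cases n) auto
    next
      case (Suc m) then show ?case by (cases n) auto
    qed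
  qed
  moreover obtain f :: "'c \<Rightarrow> nat" where "inj_on f (k ` B)"
    using finite_imp_inj_to_nat_seg[of "k ` B"] fin by blast
  ultimately have "inj_on (\<lambda>c. (InL ^^ f c) (Coset {}) :: 'g pt) (k ` B)"
    unfolding inj_on_def by blast
  then obtain e :: "'c \<Rightarrow> 'g pt" where e: "inj_on e (k ` B)" by blast
  define q where "q x = e (k x)" for x
  have q: "q x = q y \<longleftrightarrow> k x = k y" if "x \<in> B" "y \<in> B" for x y
    unfolding q_def using that e by (auto simp: inj_on_eq_iff)
  define s where "s z = (SOME x. x \<in> B \<and> z = q x)" for z
  have s: "s z \<in> B \<and> z = q (s z)" if "z \<in> q ` B" for z
    unfolding s_def by (rule someI_ex) (use that in blast)
  \<comment> \<open>The action is read off at the representative \<open>s z\<close>; the hypothesis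
    \<open>ker\<close> makes the result independent of it.\<close>
  define act where "act g z = q (a g (s z))" for g z
  have act: "act g (q x) = q (a g x)" if g: "g \<in> carrier G" and x: "x \<in> B" for g x
  proof -
    have "s (q x) \<in> B" "q x = q (s (q x))" using s x by auto
    then have "k (a g (s (q x))) = k (a g x)" using q x ker[OF g] by metis
    then show ?thesis unfolding act_def q_def by simp
  qed
  define Z :: "'g gset" where "Z = (q ` B, \<lambda>g\<in>carrier G. \<lambda>z\<in>q ` B. act g z)"
  have "finite_gset G Z"
    unfolding Z_def
  proof (rule finite_gsetI)
    show "act \<one> z = z" if "z \<in> q ` B" for z
      using that q one closed by (auto simp: act)
    show "act (g \<otimes> h) z = act g (act h z)"
      if "g \<in> carrier G" "h \<in> carrier G" "z \<in> q ` B" for g h z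
      using that q mult closed by (auto simp: act)
  qed (use fin closed in \<open>auto simp: act\<close>)
  moreover have "snd Z g (q x) = q (a g x)" if "g \<in> carrier G" "x \<in> B" for g x
    using that by (simp add: Z_def act)
  ultimately show thesis using that[of Z q] q by (simp add: Z_def)
qed

lemma gmap_lift:
  fixes q :: "'b \<Rightarrow> 'g pt"
  assumes Z: "finite_gset G Z" and qB: "fst Z = q ` B"
    and closed: "\<And>g x. g \<in> carrier G \<Longrightarrow> x \<in> B \<Longrightarrow> a g x \<in> B"
    and qa: "\<And>g x. g \<in> carrier G \<Longrightarrow> x \<in> B \<Longrightarrow> snd Z g (q x) = q (a g x)"
    and f: "\<And>x. x \<in> B \<Longrightarrow> f x \<in> fst T"
    and fa: "\<And>g x. g \<in> carrier G \<Longrightarrow> x \<in> B \<Longrightarrow> f (a g x) = snd T g (f x)"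
    and ker: "\<And>x y. x \<in> B \<Longrightarrow> y \<in> B \<Longrightarrow> q x = q y \<Longrightarrow> f x = f y"
  obtains F where "F \<in> gmaps G Z T" "\<And>x. x \<in> B \<Longrightarrow> F (q x) = f x"
proof -
  define F where "F = (\<lambda>z\<in>fst Z. f (SOME x. x \<in> B \<and> z = q x))"
  have F: "F (q x) = f x" if x: "x \<in> B" for x
  proof -
    have "(SOME y. y \<in> B \<and> q x = q y) \<in> B \<and> q x = q (SOME y. y \<in> B \<and> q x = q y)"
      by (rule someI_ex) (use x in blast)
    then have "f (SOME y. y \<in> B \<and> q x = q y) = f x" using ker x by metis
    then show ?thesis using x by (simp add: F_def qB)
  qed
  have "F \<in> gmaps G Z T"
  proof (rule gmapsI)
    show "F \<in> extensional (fst Z)" by (simp add: F_def)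
    show "F z \<in> fst T" if "z \<in> fst Z" for z using that f F by (auto simp: qB)
    show "F (snd Z g z) = snd T g (F z)" if "g \<in> carrier G" "z \<in> fst Z" for g z
      using that closed by (auto simp: qB F qa fa)
  qed
  then show thesis using that F by blast
qed

text \<open>The usual fibre product consists of pairs, which are not points of type
  \<open>'g pt\<close>; \<open>gset_quotient\<close> with the identity as \<open>k\<close> encodes
  it there.\<close>

lemma gset_pullback:
  assumes S: "finite_gset G S" "finite_gset G S'" and \<phi>: "\<phi> \<in> gmaps G S T" "\<phi>' \<in> gmaps G S' T"
  obtains W \<Psi> \<Phi> where "finite_gset G W" "\<Psi> \<in> gmaps G W S" "\<Phi> \<in> gmaps G W S'"
    "\<And>w. w \<in> fst W \<Longrightarrow> \<phi> (\<Psi> w) = \<phi>' (\<Phi> w)"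
    "\<And>x y. x \<in> fst S \<Longrightarrow> y \<in> fst S' \<Longrightarrow> \<phi> x = \<phi>' y \<Longrightarrow> \<exists>!w. w \<in> fst W \<and> \<Psi> w = x \<and> \<Phi> w = y"
proof -
  define B where "B = {(x, y). x \<in> fst S \<and> y \<in> fst S' \<and> \<phi> x = \<phi>' y}"
  define a where "a g = map_prod (snd S g) (snd S' g)" for g
  have closed: "a g p \<in> B" if "g \<in> carrier G" "p \<in> B" for g p
    using that S by (auto simp: a_def B_def gset_closed gmapsD[OF \<phi>(1)] gmapsD[OF \<phi>(2)])
  have "finite B"
    by (rule finite_subset[of _ "fst S \<times> fst S'"]) (auto simp: B_def S finite_gset_finite)
  then obtain W q where W: "finite_gset G W" "fst W = q ` B"
    and q: "\<And>x y. x \<in> B \<Longrightarrow> y \<in> B \<Longrightarrow> q x = q y \<longleftrightarrow> id x = id y"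
    and qa: "\<And>g x. g \<in> carrier G \<Longrightarrow> x \<in> B \<Longrightarrow> snd W g (q x) = q (a g x)"
    by (rule gset_quotient[of B a id])
      (auto simp: closed, auto simp: a_def B_def S gset_one gset_mult)
  obtain \<Psi> where \<Psi>: "\<Psi> \<in> gmaps G W S" "\<And>x. x \<in> B \<Longrightarrow> \<Psi> (q x) = fst x"
    by (rule gmap_lift[OF W closed qa, of fst S]) (auto simp: q, auto simp: B_def a_def)
  obtain \<Phi> where \<Phi>: "\<Phi> \<in> gmaps G W S'" "\<And>x. x \<in> B \<Longrightarrow> \<Phi> (q x) = snd x"
    by (rule gmap_lift[OF W closed qa, of snd S']) (auto simp: q, auto simp: B_def a_def)
  show thesis
  proof (rule that[OF W(1) \<Psi>(1) \<Phi>(1)])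
    show "\<phi> (\<Psi> w) = \<phi>' (\<Phi> w)" if "w \<in> fst W" for w
      using that by (auto simp: W \<Psi> \<Phi>) (auto simp: B_def)
    show "\<exists>!w. w \<in> fst W \<and> \<Psi> w = x \<and> \<Phi> w = y"
      if "x \<in> fst S" "y \<in> fst S'" "\<phi> x = \<phi>' y" for x y
    proof (rule ex1I[of _ "q (x, y)"])
      have B: "(x, y) \<in> B" using that by (simp add: B_def)
      then show "q (x, y) \<in> fst W \<and> \<Psi> (q (x, y)) = x \<and> \<Phi> (q (x, y)) = y"
        by (simp add: W \<Psi> \<Phi>)
      show "w = q (x, y)" if "w \<in> fst W \<and> \<Psi> w = x \<and> \<Phi> w = y" for w
        using that B by (auto simp: W \<Psi> \<Phi>)
    qed
  qed
qed

subsection \<open>Coset spaces\<close>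

definition pc :: "'g set \<Rightarrow> 'g \<Rightarrow> 'g pt" where
  "pc H a = Coset (a <# H)"

abbreviation cosets :: "'g set \<Rightarrow> 'g gset" where
  "cosets H \<equiv> coset_gset G H"

lemma pc_eq_iff:
  assumes H: "subgroup H G" and ab: "a \<in> carrier G" "b \<in> carrier G"
  shows "pc H a = pc H b \<longleftrightarrow> (\<exists>h\<in>H. b = a \<otimes> h)"
proof
  assume "pc H a = pc H b"
  then have "b \<in> a <# H" using lcos_self[OF ab(2) H] by (simp add: pc_def)
  then show "\<exists>h\<in>H. b = a \<otimes> h" by (auto simp: l_coset_def)
next
  assume "\<exists>h\<in>H. b = a \<otimes> h"
  then obtain h where h: "h \<in> H" "b = a \<otimes> h" by blast
  have "h <# H = H" using H h(1) by (meson group.coset_join3 is_group subgroup.mem_carrier)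
  then have "b <# H = a <# H"
    using lcos_m_assoc[OF subgroup.subset[OF H] ab(1), of h] subgroup.mem_carrier[OF H h(1)] h(2) by simp
  then show "pc H a = pc H b" by (simp add: pc_def)
qed

lemma pc_one: "subgroup H G \<Longrightarrow> pc H \<one> = Coset H"
  by (simp add: pc_def lcos_mult_one subgroup.subset)

lemma pc_absorb: "subgroup H G \<Longrightarrow> a \<in> carrier G \<Longrightarrow> h \<in> H \<Longrightarrow> pc H (a \<otimes> h) = pc H a"
  by (subst eq_commute, subst pc_eq_iff) (auto intro: subgroup.mem_carrier)

lemma fst_cosets: "fst (cosets H) = pc H ` carrier G"
  by (auto simp: coset_gset_def LCOSETS_def pc_def)

lemma snd_cosets:
  assumes "subgroup H G" "g \<in> carrier G" "a \<in> carrier G"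
  shows "snd (cosets H) g (pc H a) = pc H (g \<otimes> a)"
  using assms subgroup.subset[OF assms(1)]
  by (auto simp: coset_gset_def LCOSETS_def lcos_m_assoc pc_def)

lemma finite_gset_cosets:
  assumes H: "subgroup H G"
  shows "finite_gset G (cosets H)"
proof -
  have "cosets H = (fst (cosets H), \<lambda>g\<in>carrier G. \<lambda>x\<in>fst (cosets H). case x of Coset C \<Rightarrow> Coset (g <# C))"
    by (simp add: coset_gset_def)
  moreover have "finite_gset G \<dots>"
    using subgroup.subset[OF H]
    by (intro finite_gsetI) (auto simp: fst_cosets fin_carrier lcos_m_assoc m_assoc pc_def)
  ultimately show ?thesis by metis
qed

text \<open>The \<open>G\<close>-map on \<open>G/H\<close> with \<open>eH \<mapsto> s\<close>, that
  is \<open>aH \<mapsto> a s\<close>. It is meaningful when \<open>H\<close> fixes \<open>s\<close>,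
  since then the selected \<open>a\<close> does not matter.\<close>

definition orbit_map :: "'g gset \<Rightarrow> 'g set \<Rightarrow> 'g pt \<Rightarrow> 'g pt \<Rightarrow> 'g pt" where
  "orbit_map S H s = (\<lambda>p\<in>fst (cosets H). snd S (SOME a. a \<in> carrier G \<and> p = pc H a) s)"

lemma orbit_map:
  assumes H: "subgroup H G" and S: "finite_gset G S" and s: "s \<in> fst S"
    and stab: "\<And>h. h \<in> H \<Longrightarrow> snd S h s = s"
  shows "orbit_map S H s \<in> gmaps G (cosets H) S"
    and "\<And>a. a \<in> carrier G \<Longrightarrow> orbit_map S H s (pc H a) = snd S a s"
proof -
  show *: "orbit_map S H s (pc H a) = snd S a s" if a: "a \<in> carrier G" for a
  proof -
    let ?b = "SOME b. b \<in> carrier G \<and> pc H a = pc H b"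
    have b: "?b \<in> carrier G" "pc H a = pc H ?b"
      using someI[of "\<lambda>b. b \<in> carrier G \<and> pc H a = pc H b" a] a by auto
    then obtain h where "h \<in> H" "?b = a \<otimes> h" using pc_eq_iff[OF H a b(1)] by blast
    then have "snd S ?b s = snd S a s"
      using gset_mult[OF S a _ s, of h] stab subgroup.mem_carrier[OF H] by simp
    then show ?thesis using a by (simp add: orbit_map_def fst_cosets)
  qed
  show "orbit_map S H s \<in> gmaps G (cosets H) S"
  proof (rule gmapsI)
    show "orbit_map S H s \<in> extensional (fst (cosets H))" by (simp add: orbit_map_def)
  qed (auto simp: fst_cosets * snd_cosets H S s gset_closed gset_mult)
qed

text \<open>The base coset generates \<open>G/H\<close> under the action.\<close>

lemma gmaps_cosets_eqI:
  assumes H: "subgroup H G" and f: "f \<in> gmaps G (cosets H) S" "f' \<in> gmaps G (cosets H) S"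
    and eq: "f (pc H \<one>) = f' (pc H \<one>)"
  shows "f = f'"
proof (rule gmaps_eqI[OF f])
  fix x assume "x \<in> fst (cosets H)"
  then obtain a where a: "a \<in> carrier G" "x = pc H a" by (auto simp: fst_cosets)
  then have "x = snd (cosets H) a (pc H \<one>)" by (simp add: snd_cosets H)
  then show "f x = f' x" using gmapsD(2)[OF f(1) a(1)] gmapsD(2)[OF f(2) a(1)] eq
    by (simp add: fst_cosets)
qed

lemma stabilizer_subgroup:
  assumes S: "finite_gset G S" and s: "s \<in> fst S"
  shows "subgroup (stabilizer G (snd S) s) G"
  using S s unfolding finite_gset_def by (meson group_action.stabilizer_subgroup)

lemma stabilizerD:
  "h \<in> stabilizer G (snd S) s \<Longrightarrow> h \<in> carrier G" "h \<in> stabilizer G (snd S) s \<Longrightarrow> snd S h s = s"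
  by (auto simp: stabilizer_def)

text \<open>The orbit of \<open>s\<close>, parametrized by the cosets of its stabilizer.\<close>

definition stab_map :: "'g gset \<Rightarrow> 'g pt \<Rightarrow> 'g pt \<Rightarrow> 'g pt" where
  "stab_map S s = orbit_map S (stabilizer G (snd S) s) s"

lemma stab_map:
  assumes S: "finite_gset G S" and s: "s \<in> fst S"
  shows "stab_map S s \<in> gmaps G (cosets (stabilizer G (snd S) s)) S"
    and "\<And>a. a \<in> carrier G \<Longrightarrow> stab_map S s (pc (stabilizer G (snd S) s) a) = snd S a s"
    and "inj_on (stab_map S s) (fst (cosets (stabilizer G (snd S) s)))"
proof -
  let ?H = "stabilizer G (snd S) s"
  have H: "subgroup ?H G" using stabilizer_subgroup[OF S s] .
  note om = orbit_map[OF H S s stabilizerD(2), folded stab_map_def]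
  show "stab_map S s \<in> gmaps G (cosets ?H) S" using om(1) by blast
  show *: "stab_map S s (pc ?H a) = snd S a s" if "a \<in> carrier G" for a using om(2) that by blast
  show "inj_on (stab_map S s) (fst (cosets ?H))"
  proof (rule inj_onI)
    fix x y assume "x \<in> fst (cosets ?H)" "y \<in> fst (cosets ?H)" and eq: "stab_map S s x = stab_map S s y"
    then obtain a b where ab: "a \<in> carrier G" "b \<in> carrier G" "x = pc ?H a" "y = pc ?H b"
      by (auto simp: fst_cosets)
    then have "snd S a s = snd S b s" using eq by (simp add: *)
    then have "snd S (inv a \<otimes> b) s = s"
      using ab S s by (simp add: gset_mult gset_inv flip: \<open>snd S a s = snd S b s\<close>)
    then have "inv a \<otimes> b \<in> ?H" using ab by (simp add: stabilizer_def)
    moreover have "b = a \<otimes> (inv a \<otimes> b)" using ab by (simp add: mult_inv_cancel)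
    ultimately show "x = y" using ab pc_eq_iff[OF H ab(1,2)] by blast
  qed
qed

subsection \<open>Disjoint unions\<close>

lemma finite_gset_sum:
  assumes "finite_gset G S" "finite_gset G T"
  shows "finite_gset G (gset_sum G S T)"
  unfolding gset_sum_def using assms
  by (intro finite_gsetI) (auto simp: finite_gset_finite gset_closed gset_one gset_mult)

lemma gset_sum_simps:
  "fst (gset_sum G S T) = InL ` fst S \<union> InR ` fst T"
  "g \<in> carrier G \<Longrightarrow> x \<in> fst S \<Longrightarrow> snd (gset_sum G S T) g (InL x) = InL (snd S g x)"
  "g \<in> carrier G \<Longrightarrow> y \<in> fst T \<Longrightarrow> snd (gset_sum G S T) g (InR y) = InR (snd T g y)"
  by (auto simp: gset_sum_def)

lemma gmaps_InL: "finite_gset G S \<Longrightarrow> (\<lambda>x\<in>fst S. InL x) \<in> gmaps G S (gset_sum G S T)"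
  by (intro gmapsI) (auto simp: gset_sum_simps gset_closed)

lemma gmaps_InR: "finite_gset G T \<Longrightarrow> (\<lambda>x\<in>fst T. InR x) \<in> gmaps G T (gset_sum G S T)"
  by (intro gmapsI) (auto simp: gset_sum_simps gset_closed)

definition copair :: "'g gset \<Rightarrow> 'g gset \<Rightarrow> ('g pt \<Rightarrow> 'g pt) \<Rightarrow> ('g pt \<Rightarrow> 'g pt) \<Rightarrow> 'g pt \<Rightarrow> 'g pt" where
  "copair S T p q = (\<lambda>z\<in>fst (gset_sum G S T). case z of InL x \<Rightarrow> p x | InR y \<Rightarrow> q y)"

lemma copair_simps:
  "x \<in> fst S \<Longrightarrow> copair S T p q (InL x) = p x"
  "y \<in> fst T \<Longrightarrow> copair S T p q (InR y) = q y"
  by (auto simp: copair_def gset_sum_simps)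

lemma gmaps_copair:
  assumes "finite_gset G S" "finite_gset G T" "p \<in> gmaps G S U" "q \<in> gmaps G T U"
  shows "copair S T p q \<in> gmaps G (gset_sum G S T) U"
proof (rule gmapsI)
  show "copair S T p q \<in> extensional (fst (gset_sum G S T))" by (simp add: copair_def)
qed (use assms in \<open>auto simp: gset_sum_simps copair_simps gmapsD gset_closed\<close>)

lemma finite_gset_empty: "finite_gset G (empty_gset G)"
  unfolding empty_gset_def by (rule finite_gsetI) auto

text \<open>By extensionality there is only one \<open>G\<close>-set without points, so the
  vanishing axiom, which is stated for \<open>empty_gset\<close>, applies to each of them.\<close>

lemma empty_gsetI:
  assumes S: "finite_gset G S" and e: "fst S = {}"
  shows "S = empty_gset G"
proof -
  have "group_action G {} (snd S)" "snd S \<in> extensional (carrier G)"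
    using S e by (auto simp: finite_gset_def)
  then have "snd S g \<in> extensional {}" if "g \<in> carrier G" for g
    using that group_action.bij_prop0 by (fastforce simp: Bij_def)
  then have "snd S = (\<lambda>g\<in>carrier G. \<lambda>x\<in>{}. x)"
    using \<open>snd S \<in> extensional (carrier G)\<close>
    by (intro extensionalityI[of _ "carrier G"]) (auto intro!: extensionalityI[of _ "{}"])
  then show ?thesis using e by (simp add: empty_gset_def prod_eq_iff)
qed

lemma gmaps_empty: "fst S = {} \<Longrightarrow> (\<lambda>x. undefined) \<in> gmaps G S T"
  by (rule gmapsI) auto

end

section \<open>Spans of $G$-sets and conjugation bisets\<close>

context fin_group
begin

definition is_span :: "'g set \<Rightarrow> 'g set \<Rightarrow> 'g gset \<Rightarrow> ('g pt \<Rightarrow> 'g pt) \<Rightarrow> ('g pt \<Rightarrow> 'g pt) \<Rightarrow> bool" where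
  "is_span H2 H1 Z p1 p2 \<longleftrightarrow>
     finite_gset G Z \<and> p1 \<in> gmaps G Z (cosets H1) \<and> p2 \<in> gmaps G Z (cosets H2)"

text \<open>The fibre of \<open>p2\<close> over the base point of \<open>G/H2\<close>, pulled back along \<open>G \<rightarrow> G/H1\<close>.
  The second projection is biequivariant, which makes this a conjugation biset.\<close>

definition span_biset ::
    "'g set \<Rightarrow> 'g set \<Rightarrow> 'g gset \<Rightarrow> ('g pt \<Rightarrow> 'g pt) \<Rightarrow> ('g pt \<Rightarrow> 'g pt) \<Rightarrow> ('g, 'g pt \<times> 'g) biset" where
  "span_biset H2 H1 Z p1 p2 =
     \<lparr>bpts = {(z, g). z \<in> fst Z \<and> g \<in> carrier G \<and> p2 z = pc H2 \<one> \<and> p1 z = pc H1 g},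
      lact = (\<lambda>h (z, g). (snd Z h z, h \<otimes> g)),
      ract = (\<lambda>(z, g) h. (z, g \<otimes> h))\<rparr>"

lemma span_biset_simps:
  "(z, g) \<in> bpts (span_biset H2 H1 Z p1 p2) \<longleftrightarrow>
    z \<in> fst Z \<and> g \<in> carrier G \<and> p2 z = pc H2 \<one> \<and> p1 z = pc H1 g"
  "lact (span_biset H2 H1 Z p1 p2) h (z, g) = (snd Z h z, h \<otimes> g)"
  "ract (span_biset H2 H1 Z p1 p2) (z, g) h = (z, g \<otimes> h)"
  by (simp_all add: span_biset_def)

lemma conj_biset_span_biset:
  assumes H: "subgroup H2 G" "subgroup H1 G" and Z: "is_span H2 H1 Z p1 p2"
  shows "conj_biset G H2 H1 (span_biset H2 H1 Z p1 p2)"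
proof -
  let ?X = "span_biset H2 H1 Z p1 p2"
  have Z: "finite_gset G Z" and p1: "p1 \<in> gmaps G Z (cosets H1)" and p2: "p2 \<in> gmaps G Z (cosets H2)"
    using Z by (auto simp: is_span_def)
  note H2C = subgroup.mem_carrier[OF H(1)] and H1C = subgroup.mem_carrier[OF H(2)]
  have "finite (bpts ?X)"
    by (rule finite_subset[of _ "fst Z \<times> carrier G"])
      (auto simp: span_biset_def finite_gset_finite Z fin_carrier)
  moreover have "pc H2 h = pc H2 \<one>" if "h \<in> H2" for h
    using pc_absorb[OF H(1) one_closed that] that H2C by simp
  ultimately have "finite_biset G H2 H1 ?X"
    using H2C H1C H
    by (auto simp: finite_biset_def span_biset_simps gset_closed gset_one gset_mult Z m_assoc
        gmapsD[OF p1] gmapsD[OF p2] snd_cosets pc_absorb)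
  moreover have "equivariant H2 H1 ?X snd"
    using H2C H1C by (auto simp: equivariant_def span_biset_simps)
  ultimately show ?thesis by (rule conj_biset_if_equivariant[OF H])
qed

text \<open>Conversely a conjugation biset \<open>X\<close> comes from \<open>Z = G \<times>\<^bsub>H2\<^esub> (X/H1)\<close>, and an equivariant
  \<open>\<gamma> : X \<rightarrow> G\<close> supplies the second leg \<open>[a, x] \<mapsto> a \<gamma>(x) H1\<close>.\<close>

lemma ex_span_if_conj_biset:
  fixes X :: "('g, 'x) biset"
  assumes H: "subgroup H2 G" "subgroup H1 G" and X: "conj_biset G H2 H1 X"
  obtains Z p1 p2 where "is_span H2 H1 Z p1 p2" "biset_isomorphic H2 H1 X (span_biset H2 H1 Z p1 p2)"
proof -
  note XD = finite_bisetD[OF conj_bisetD[OF X]]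
  note H2C = subgroup.mem_carrier[OF H(1)] and H1C = subgroup.mem_carrier[OF H(2)]
  note S2 = subgroup.m_closed[OF H(1)] subgroup.one_closed[OF H(1)] subgroup.m_inv_closed[OF H(1)]
  note S1 = subgroup.m_closed[OF H(2)] subgroup.one_closed[OF H(2)] subgroup.m_inv_closed[OF H(2)]
  obtain \<gamma> where \<gamma>: "equivariant H2 H1 X \<gamma>" using ex_equivariant_if_conj_biset[OF H X] by blast
  have \<gamma>D: "\<And>x. x \<in> bpts X \<Longrightarrow> \<gamma> x \<in> carrier G"
    "\<And>h x. h \<in> H2 \<Longrightarrow> x \<in> bpts X \<Longrightarrow> \<gamma> (lact X h x) = h \<otimes> \<gamma> x"
    "\<And>h x. h \<in> H1 \<Longrightarrow> x \<in> bpts X \<Longrightarrow> \<gamma> (ract X x h) = \<gamma> x \<otimes> h"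
    using \<gamma> by (auto simp: equivariant_def)
  define B where "B = carrier G \<times> bpts X"
  \<comment> \<open>One relation performs both quotients, the one by \<open>H2\<close> and the one
    by \<open>H1\<close>: it identifies \<open>(b h2, x)\<close> with
    \<open>(b, h2 x h1)\<close>.\<close>
  define R where "R = {((a, x), (b, y)). a \<in> carrier G \<and> b \<in> carrier G \<and> x \<in> bpts X \<and> y \<in> bpts X \<and>
    (\<exists>h2\<in>H2. \<exists>h1\<in>H1. a = b \<otimes> h2 \<and> y = ract X (lact X h2 x) h1)}"
  have RI: "((a, x), (b, y)) \<in> R"
    if "b \<in> carrier G" "x \<in> bpts X" "h2 \<in> H2" "h1 \<in> H1" "a = b \<otimes> h2" "y = ract X (lact X h2 x) h1"
    for a b x y h2 h1
  proof -
    have "a \<in> carrier G" "y \<in> bpts X" using that H2C by (simp_all add: XD)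
    then show ?thesis unfolding R_def using that by blast
  qed
  have R: "equiv B R"
  proof (rule equivI)
    show "R \<subseteq> B \<times> B" by (auto simp: R_def B_def)
    show "refl_on B R"
    proof (rule refl_onI)
      fix p assume "p \<in> B"
      then show "(p, p) \<in> R" using S1(2) S2(2)
        by (auto simp: R_def B_def XD intro!: bexI[of _ \<one>])
    qed
    show "sym R"
    proof (rule symI)
      fix p q assume "(p, q) \<in> R"
      then obtain a x b y h2 h1 where p: "p = (a, x)" "q = (b, y)" and C: "a \<in> carrier G"
        "b \<in> carrier G" "x \<in> bpts X" "y \<in> bpts X" and h: "h2 \<in> H2" "h1 \<in> H1"
        and e: "a = b \<otimes> h2" "y = ract X (lact X h2 x) h1" unfolding R_def by blast
      have "b = a \<otimes> inv h2" using C h H2C by (simp add: e m_assoc)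
      moreover have "ract X (lact X (inv h2) y) (inv h1) =
          ract X (lact X (inv h2 \<otimes> h2) x) (h1 \<otimes> inv h1)"
        using C(3) h by (simp add: e XD S1 S2)
      then have "x = ract X (lact X (inv h2) y) (inv h1)"
        using C(3) h H1C H2C by (simp add: XD)
      ultimately show "(q, p) \<in> R" unfolding R_def p using C h S1 S2 by blast
    qed
    show "trans R"
    proof (rule transI)
      fix p q r assume "(p, q) \<in> R" "(q, r) \<in> R"
      then obtain a x b y c z h2 h1 k2 k1 where p: "p = (a, x)" "q = (b, y)" "r = (c, z)"
        and C: "a \<in> carrier G" "b \<in> carrier G" "c \<in> carrier G" "x \<in> bpts X" "y \<in> bpts X" "z \<in> bpts X"
        and h: "h2 \<in> H2" "h1 \<in> H1" "k2 \<in> H2" "k1 \<in> H1"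
        and e: "a = b \<otimes> h2" "y = ract X (lact X h2 x) h1" "b = c \<otimes> k2" "z = ract X (lact X k2 y) k1"
        unfolding R_def by blast
      have "a = c \<otimes> (k2 \<otimes> h2)" using C(3) h H2C by (simp add: e m_assoc)
      moreover have "z = ract X (lact X (k2 \<otimes> h2) x) (h1 \<otimes> k1)"
        using C(4) h by (simp add: e XD S1 S2)
      ultimately show "(p, r) \<in> R" unfolding R_def p using C h S1 S2 by blast
    qed
  qed
  define act where "act g = map_prod (\<lambda>a. g \<otimes> a) (\<lambda>x :: 'x. x)" for g
  define k where "k p = R `` {p}" for p
  have k: "k p = k q \<longleftrightarrow> (p, q) \<in> R" if "p \<in> B" "q \<in> B" for p q
    unfolding k_def using eq_equiv_class_iff[OF R that] .
  have closed: "act g p \<in> B" if "g \<in> carrier G" "p \<in> B" for g p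
    using that by (auto simp: act_def B_def)
  have ker: "k (act g p) = k (act g q)" if "g \<in> carrier G" "p \<in> B" "q \<in> B" "k p = k q" for g p q
  proof -
    have "(act g p, act g q) \<in> R"
      using that k[OF that(2,3)] H2C by (force simp: R_def act_def m_assoc)
    then show ?thesis using k closed that by blast
  qed
  have fB: "finite B" by (simp add: B_def fin_carrier XD)
  obtain Z q where Z: "finite_gset G Z" "fst Z = q ` B"
    and q: "\<And>x y. x \<in> B \<Longrightarrow> y \<in> B \<Longrightarrow> q x = q y \<longleftrightarrow> k x = k y"
    and qa: "\<And>g x. g \<in> carrier G \<Longrightarrow> x \<in> B \<Longrightarrow> snd Z g (q x) = q (act g x)"
    by (rule gset_quotient[of B act k, OF fB closed _ _ ker])
      (auto simp: B_def act_def m_assoc)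
  have qR: "q p = q r \<longleftrightarrow> (p, r) \<in> R" if "p \<in> B" "r \<in> B" for p r using that q k by blast
  obtain p2 where p2: "p2 \<in> gmaps G Z (cosets H2)" "\<And>p. p \<in> B \<Longrightarrow> p2 (q p) = pc H2 (fst p)"
  proof (rule gmap_lift[OF Z closed qa, of "\<lambda>p. pc H2 (fst p)" "cosets H2"])
    fix p r assume "p \<in> B" "r \<in> B" "q p = q r"
    then show "pc H2 (fst p) = pc H2 (fst r)"
      using qR[of p r] H by (auto simp: R_def pc_absorb)
  qed (auto simp: B_def act_def fst_cosets snd_cosets H)
  \<comment> \<open>\<gamma> turns the right factor \<open>h1\<close> of the relation into right
    multiplication by \<open>h1\<close>, which the coset of \<open>H1\<close> absorbs.\<close>
  obtain p1 where p1: "p1 \<in> gmaps G Z (cosets H1)"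
      "\<And>p. p \<in> B \<Longrightarrow> p1 (q p) = pc H1 (fst p \<otimes> \<gamma> (snd p))"
  proof (rule gmap_lift[OF Z closed qa, of "\<lambda>p. pc H1 (fst p \<otimes> \<gamma> (snd p))" "cosets H1"])
    fix p r assume pr: "p \<in> B" "r \<in> B" "q p = q r"
    then obtain a x b y h2 h1 where p: "p = (a, x)" "r = (b, y)" and C: "a \<in> carrier G"
        "b \<in> carrier G" "x \<in> bpts X" "y \<in> bpts X" and h: "h2 \<in> H2" "h1 \<in> H1"
        and e: "a = b \<otimes> h2" "y = ract X (lact X h2 x) h1" using qR[of p r] unfolding R_def by blast
    have "b \<otimes> \<gamma> y = (a \<otimes> \<gamma> x) \<otimes> h1"
      using C h H2C H1C by (simp add: e \<gamma>D XD m_assoc)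
    then show "pc H1 (fst p \<otimes> \<gamma> (snd p)) = pc H1 (fst r \<otimes> \<gamma> (snd r))"
      using C h H \<gamma>D by (simp add: p pc_absorb)
  qed (auto simp: B_def act_def fst_cosets snd_cosets H \<gamma>D m_assoc)
  \<comment> \<open>The class of \<open>(\<one>, x)\<close> forgets the right action of
    \<open>H1\<close>; the coordinate \<open>\<gamma> x\<close> restores what is lost.\<close>
  define f where "f x = (q (\<one>, x), \<gamma> x)" for x
  let ?Y = "span_biset H2 H1 Z p1 p2"
  have inB: "(\<one>, x) \<in> B" if "x \<in> bpts X" for x using that by (simp add: B_def)
  have mem: "f x \<in> bpts ?Y" if "x \<in> bpts X" for x
    using that inB[OF that] by (simp add: f_def span_biset_simps Z p1(2) p2(2) \<gamma>D)
  have "biset_isomorphic H2 H1 X ?Y"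
  proof (rule biset_isomorphicI[of f])
    have inj: "inj_on f (bpts X)"
    proof (rule inj_onI)
      fix x y assume xy: "x \<in> bpts X" "y \<in> bpts X" "f x = f y"
      then have "((\<one>, x), (\<one>, y)) \<in> R" "\<gamma> x = \<gamma> y" using qR inB by (auto simp: f_def)
      then obtain h2 h1 where h: "h2 \<in> H2" "h1 \<in> H1" "\<one> = \<one> \<otimes> h2" "y = ract X (lact X h2 x) h1"
        unfolding R_def by blast
      then have "h2 = \<one>" using H2C by simp
      then have y: "y = ract X x h1" using h xy by (simp add: XD)
      then have "\<gamma> x \<otimes> h1 = \<gamma> x" using \<gamma>D(3)[OF h(2) xy(1)] \<open>\<gamma> x = \<gamma> y\<close> by simp
      then have "h1 = \<one>" using \<gamma>D(1)[OF xy(1)] H1C[OF h(2)] by simp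
      then show "x = y" using y xy by (simp add: XD)
    qed
    moreover have "bpts ?Y \<subseteq> f ` bpts X"
    proof
      fix w assume "w \<in> bpts ?Y"
      then obtain z g where w: "w = (z, g)" "z \<in> fst Z" "g \<in> carrier G" "p2 z = pc H2 \<one>" "p1 z = pc H1 g"
        by (cases w) (auto simp: span_biset_simps)
      then obtain a x where ax: "a \<in> carrier G" "x \<in> bpts X" "z = q (a, x)" by (auto simp: Z B_def)
      then have aB: "(a, x) \<in> B" by (simp add: B_def)
      \<comment> \<open>Lying over the base point forces \<open>a\<close> into \<open>H2\<close>, so
        \<open>a\<close> can be moved across to \<open>x\<close>; a factor from \<open>H1\<close>
        then adjusts the second coordinate to \<open>g\<close>.\<close>
      have "pc H2 \<one> = pc H2 a" using w ax p2(2)[OF aB] by simp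
      then have a: "a \<in> H2" using ax H2C by (auto simp: pc_eq_iff[OF H(1)])
      have y: "lact X a x \<in> bpts X" using a ax by (simp add: XD)
      have "z = q (\<one>, lact X a x)"
        unfolding ax(3) qR[OF aB inB[OF y]]
        by (rule RI[of _ _ a \<one>]) (use ax a y S1(2) in \<open>auto simp: XD\<close>)
      moreover have "pc H1 (a \<otimes> \<gamma> x) = pc H1 g" using w ax p1(2)[OF aB] by simp
      then obtain h where h: "h \<in> H1" "g = a \<otimes> \<gamma> x \<otimes> h"
        using ax w \<gamma>D by (auto simp: pc_eq_iff[OF H(2)])
      moreover have y': "ract X (lact X a x) h \<in> bpts X" using y h by (simp add: XD)
      moreover have "q (\<one>, lact X a x) = q (\<one>, ract X (lact X a x) h)"
        unfolding qR[OF inB[OF y] inB[OF y']]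
        by (rule RI[of _ _ \<one> h]) (use y h S2(2) y' in \<open>auto simp: XD\<close>)
      ultimately have "w = f (ract X (lact X a x) h)"
        using a ax y by (simp add: f_def w(1) \<gamma>D)
      then show "w \<in> f ` bpts X" using y' by blast
    qed
    ultimately show "bij_betw f (bpts X) (bpts ?Y)" using mem by (auto simp: bij_betw_def)
    show "f (lact X h x) = lact ?Y h (f x)" if h: "h \<in> H2" and x: "x \<in> bpts X" for h x
    proof -
      have B: "(h, x) \<in> B" "(\<one>, lact X h x) \<in> B" using h x H2C by (auto simp: B_def XD)
      have "q (h, x) = q (\<one>, lact X h x)"
        unfolding qR[OF B] by (rule RI[of _ _ h \<one>]) (use x h S1(2) H2C in \<open>auto simp: XD\<close>)
      then show ?thesis using x h H2C inB[OF x] by (simp add: f_def span_biset_simps \<gamma>D qa act_def)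
    qed
    show "f (ract X x h) = ract ?Y (f x) h" if h: "h \<in> H1" and x: "x \<in> bpts X" for h x
    proof -
      have B: "(\<one>, x) \<in> B" "(\<one>, ract X x h) \<in> B" using h x by (auto simp: B_def XD)
      have "q (\<one>, x) = q (\<one>, ract X x h)"
        unfolding qR[OF B] by (rule RI[of _ _ \<one> h]) (use x h S2(2) in \<open>auto simp: XD\<close>)
      then show ?thesis using x h by (simp add: f_def span_biset_simps \<gamma>D)
    qed
  qed
  then show thesis using that[of Z p1 p2] Z p1 p2 by (simp add: is_span_def)
qed

lemma span_biset_sum:
  assumes H: "subgroup H2 G" and S: "is_span H2 H1 Z p1 p2" "is_span H2 H1 Z' p1' p2'"
  shows "is_span H2 H1 (gset_sum G Z Z') (copair Z Z' p1 p1') (copair Z Z' p2 p2')"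
    and "biset_isomorphic H2 H1 (biset_sum (span_biset H2 H1 Z p1 p2) (span_biset H2 H1 Z' p1' p2'))
      (span_biset H2 H1 (gset_sum G Z Z') (copair Z Z' p1 p1') (copair Z Z' p2 p2'))"
proof -
  show "is_span H2 H1 (gset_sum G Z Z') (copair Z Z' p1 p1') (copair Z Z' p2 p2')"
    using S by (auto simp: is_span_def intro: finite_gset_sum gmaps_copair)
  show "biset_isomorphic H2 H1 (biset_sum (span_biset H2 H1 Z p1 p2) (span_biset H2 H1 Z' p1' p2'))
      (span_biset H2 H1 (gset_sum G Z Z') (copair Z Z' p1 p1') (copair Z Z' p2 p2'))"
    (is "biset_isomorphic _ _ (biset_sum ?X ?X') ?Y")
  proof (rule biset_isomorphicI[of "case_sum (\<lambda>(z, g). (InL z, g)) (\<lambda>(z, g). (InR z, g))"])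
    show "bij_betw (case_sum (\<lambda>(z, g). (InL z, g)) (\<lambda>(z, g). (InR z, g))) (bpts (biset_sum ?X ?X')) (bpts ?Y)"
      by (rule bij_betw_byWitness[of _ "\<lambda>(w, g). case w of InL z \<Rightarrow> Inl (z, g) | InR z \<Rightarrow> Inr (z, g)"])
        (auto simp: biset_sum_simps span_biset_simps gset_sum_simps copair_simps)
  qed (auto simp: biset_sum_simps span_biset_simps gset_sum_simps subgroup.mem_carrier[OF H])
qed

lemma span_biset_pullback:
  assumes H: "subgroup H3 G" "subgroup H2 G" "subgroup H1 G"
    and Z: "is_span H3 H2 Z p1 p2" and Z': "is_span H2 H1 Z' p1' p2'"
    and W: "finite_gset G W" "\<Psi> \<in> gmaps G W Z" "\<Phi> \<in> gmaps G W Z'"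
      "\<And>w. w \<in> fst W \<Longrightarrow> p1 (\<Psi> w) = p2' (\<Phi> w)"
      "\<And>x y. x \<in> fst Z \<Longrightarrow> y \<in> fst Z' \<Longrightarrow> p1 x = p2' y \<Longrightarrow> \<exists>!w. w \<in> fst W \<and> \<Psi> w = x \<and> \<Phi> w = y"
  shows "\<exists>m. balanced_model H3 H2 H1 (span_biset H3 H2 Z p1 p2) (span_biset H2 H1 Z' p1' p2')
      (span_biset H3 H1 W (compose (fst W) p1' \<Phi>) (compose (fst W) p2 \<Psi>)) m"
proof -
  have Z: "finite_gset G Z" and p: "p1 \<in> gmaps G Z (cosets H2)" "p2 \<in> gmaps G Z (cosets H3)"
    and Z': "finite_gset G Z'" and p': "p1' \<in> gmaps G Z' (cosets H1)" "p2' \<in> gmaps G Z' (cosets H2)"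
    using assms(4,5) by (auto simp: is_span_def)
  note HC = subgroup.mem_carrier[OF H(1)] subgroup.mem_carrier[OF H(2)] subgroup.mem_carrier[OF H(3)]
  note gm = gmapsD[OF p(1)] gmapsD[OF p(2)] gmapsD[OF p'(1)] gmapsD[OF p'(2)] gmapsD[OF W(2)] gmapsD[OF W(3)]
  let ?X = "span_biset H3 H2 Z p1 p2" and ?Y = "span_biset H2 H1 Z' p1' p2'"
  let ?P = "span_biset H3 H1 W (compose (fst W) p1' \<Phi>) (compose (fst W) p2 \<Psi>)"
  define pr where "pr x y = (THE w. w \<in> fst W \<and> \<Psi> w = x \<and> \<Phi> w = y)" for x y
  have pr: "pr x y \<in> fst W" "\<Psi> (pr x y) = x" "\<Phi> (pr x y) = y"
    if "x \<in> fst Z" "y \<in> fst Z'" "p1 x = p2' y" for x y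
    using theI'[OF W(5)[OF that]] unfolding pr_def by auto
  have pr_eq: "w = pr (\<Psi> w) (\<Phi> w)" if "w \<in> fst W" for w
    using the1_equality[OF W(5)[OF gm(13)[OF that] gm(16)[OF that] W(4)[OF that]], of w] that
    unfolding pr_def by auto
  \<comment> \<open>Here \<open>z\<close> lies over the coset of \<open>g\<close> in
    \<open>G/H2\<close> and \<open>z'\<close> over the base point. Hence \<open>g z'\<close> is the
    translate of \<open>z'\<close> that pairs with \<open>z\<close> in the fibre product.\<close>
  define m where "m = (\<lambda>(z, g) (z', g'). (pr z (snd Z' g z'), g \<otimes> g'))"
  have ok: "z \<in> fst Z \<and> snd Z' g z' \<in> fst Z' \<and> p1 z = p2' (snd Z' g z')"
    if "(z, g) \<in> bpts ?X" "(z', g') \<in> bpts ?Y" for z g z' g'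
    using that Z' H by (auto simp: span_biset_simps gset_closed gm snd_cosets)
  have "balanced_model H3 H2 H1 ?X ?Y ?P m"
    unfolding balanced_model_def
  proof (intro conjI ballI)
    fix q assume "q \<in> bpts ?P"
    then obtain w c where q: "q = (w, c)" and w: "w \<in> fst W" "c \<in> carrier G" "p2 (\<Psi> w) = pc H3 \<one>"
      "p1' (\<Phi> w) = pc H1 c" by (cases q) (auto simp: span_biset_simps compose_eq)
    have \<Psi>w: "\<Psi> w \<in> fst Z" and \<Phi>w: "\<Phi> w \<in> fst Z'" using w gm by auto
    \<comment> \<open>A preimage under \<open>m\<close> arises by translating the second projection
      of \<open>w\<close> back over the base point with \<open>inv g\<close>.\<close>
    obtain g where g: "g \<in> carrier G" "p1 (\<Psi> w) = pc H2 g"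
      using gm(1)[OF \<Psi>w] by (auto simp: fst_cosets)
    have 1: "(\<Psi> w, g) \<in> bpts ?X" using w g \<Psi>w by (simp add: span_biset_simps)
    have 2: "(snd Z' (inv g) (\<Phi> w), inv g \<otimes> c) \<in> bpts ?Y"
      using w g \<Phi>w H Z' by (simp add: span_biset_simps gset_closed gm snd_cosets flip: W(4))
    have "q = m (\<Psi> w, g) (snd Z' (inv g) (\<Phi> w), inv g \<otimes> c)"
      using w g \<Phi>w Z' by (simp add: q m_def gset_inv mult_inv_cancel flip: pr_eq)
    then show "\<exists>x\<in>bpts ?X. \<exists>y\<in>bpts ?Y. q = m x y" using 1 2 by blast
  next
    fix x y assume x: "x \<in> bpts ?X" and y: "y \<in> bpts ?Y"
    obtain z g where xz: "x = (z, g)" by (cases x)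
    obtain u a where yu: "y = (u, a)" by (cases y)
    note X = x[unfolded xz span_biset_simps] and Y = y[unfolded yu span_biset_simps]
    note o = ok[OF x[unfolded xz] y[unfolded yu]]
    show "m x y \<in> bpts ?P"
      using o X Y H by (auto simp: m_def xz yu span_biset_simps pr compose_eq gm snd_cosets)
    show "m (lact ?X h x) y = lact ?P h (m x y)" if h: "h \<in> H3" for h
    proof -
      let ?w = "pr z (snd Z' g u)"
      have hc: "h \<in> carrier G" using h HC by blast
      have w: "?w \<in> fst W" "\<Psi> ?w = z" "\<Phi> ?w = snd Z' g u" using pr o by auto
      have "snd W h ?w = pr (snd Z h z) (snd Z' (h \<otimes> g) u)"
        using pr_eq[of "snd W h ?w"] w hc X Y Z' W(1) by (simp add: gset_closed gm gset_mult)
      then show ?thesis using X Y hc by (simp add: m_def xz yu span_biset_simps m_assoc)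
    qed
    show "m x (ract ?Y y h) = ract ?P (m x y) h" if h: "h \<in> H1" for h
      using X Y h HC by (simp add: m_def xz yu span_biset_simps m_assoc)
    fix x' y' assume x': "x' \<in> bpts ?X" and y': "y' \<in> bpts ?Y"
    obtain z' k where xz': "x' = (z', k)" by (cases x')
    obtain v b where yv: "y' = (v, b)" by (cases y')
    note X' = x'[unfolded xz' span_biset_simps] and Y' = y'[unfolded yv span_biset_simps]
    note o' = ok[OF x'[unfolded xz'] y'[unfolded yv]]
    show "m x y = m x' y' \<longleftrightarrow> (\<exists>h\<in>H2. x = ract ?X x' h \<and> y' = lact ?Y h y)"
    proof
      assume "m x y = m x' y'"
      then have e: "pr z (snd Z' g u) = pr z' (snd Z' k v)" and ga: "g \<otimes> a = k \<otimes> b"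
        by (auto simp: m_def xz yu xz' yv)
      \<comment> \<open>Equal points of \<open>W\<close> have equal projections. From
        \<open>z = z'\<close> the elements \<open>k\<close> and \<open>g\<close> represent the same
        coset of \<open>H2\<close>, which supplies the balancing element \<open>h\<close>.\<close>
      have zz: "z = z'" "snd Z' g u = snd Z' k v" using pr o o' e by metis+
      then have "pc H2 k = pc H2 g" using X X' by simp
      then obtain h where h: "h \<in> H2" "g = k \<otimes> h" using pc_eq_iff[OF H(2)] X X' by blast
      have hc: "h \<in> carrier G" using h HC by blast
      have "v = snd Z' (inv k) (snd Z' g u)" using zz X' Y' Z' by (simp add: gset_inv)
      also have "\<dots> = snd Z' h u"
        using X' Y h hc Z' by (simp add: mult_inv_cancel flip: gset_mult)
      finally have "v = snd Z' h u" .
      moreover have "b = h \<otimes> a"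
      proof -
        have "k \<otimes> (h \<otimes> a) = k \<otimes> b" using ga X' Y hc h by (simp add: m_assoc)
        then show ?thesis using X' Y' Y hc by simp
      qed
      ultimately show "\<exists>h\<in>H2. x = ract ?X x' h \<and> y' = lact ?Y h y"
        using h zz by (auto simp: xz yu xz' yv span_biset_simps)
    next
      assume "\<exists>h\<in>H2. x = ract ?X x' h \<and> y' = lact ?Y h y"
      then obtain h where h: "h \<in> H2" "z = z'" "g = k \<otimes> h" "v = snd Z' h u" "b = h \<otimes> a"
        by (auto simp: xz yu xz' yv span_biset_simps)
      then show "m x y = m x' y'"
        using X X' Y HC Z' by (simp add: m_def xz yu xz' yv gset_mult m_assoc)
    qed
  qed
  then show ?thesis by blast
qed

section \<open>The bisets in the definition of \<open>j\<close>, presented by spans\<close>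

lemma conj_orbit_map:
  assumes H: "subgroup K G" "subgroup H G" and g: "g \<in> carrier G"
    and sub: "\<And>h. h \<in> H \<Longrightarrow> inv g \<otimes> h \<otimes> g \<in> K"
  shows "orbit_map (cosets K) H (pc K g) \<in> gmaps G (cosets H) (cosets K)"
    and "\<And>a. a \<in> carrier G \<Longrightarrow> orbit_map (cosets K) H (pc K g) (pc H a) = pc K (a \<otimes> g)"
proof -
  have gK: "pc K g \<in> fst (cosets K)" using g by (simp add: fst_cosets)
  have stab: "snd (cosets K) h (pc K g) = pc K g" if h: "h \<in> H" for h
  proof -
    have hC: "h \<in> carrier G" using H(2) h by (rule subgroup.mem_carrier)
    have "h \<otimes> g = g \<otimes> (inv g \<otimes> h \<otimes> g)" using hC g by (simp add: m_assoc mult_inv_cancel)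
    then show ?thesis using pc_absorb[OF H(1) g sub[OF h]] hC g by (simp add: snd_cosets H)
  qed
  note om = orbit_map[OF H(2) finite_gset_cosets[OF H(1)] gK stab]
  show "orbit_map (cosets K) H (pc K g) \<in> gmaps G (cosets H) (cosets K)" by (rule om(1))
  show "orbit_map (cosets K) H (pc K g) (pc H a) = pc K (a \<otimes> g)" if "a \<in> carrier G" for a
    using that g by (simp add: om snd_cosets H)
qed

text \<open>The covariant biset belongs to the span whose first leg is the identity of
  \<open>G/H\<close> and whose second leg is \<open>aH \<mapsto> a g K\<close>.\<close>

lemma cov_biset_span:
  assumes H: "subgroup K G" "subgroup H G" and g: "g \<in> carrier G"
    and sub: "\<And>h. h \<in> H \<Longrightarrow> inv g \<otimes> h \<otimes> g \<in> K"
  shows "is_span K H (cosets H) (\<lambda>x\<in>fst (cosets H). x) (orbit_map (cosets K) H (pc K g))"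
    and "biset_isomorphic K H (cov_biset G K g)
      (span_biset K H (cosets H) (\<lambda>x\<in>fst (cosets H). x) (orbit_map (cosets K) H (pc K g)))"
proof -
  let ?id = "\<lambda>x\<in>fst (cosets H). x" and ?\<psi> = "orbit_map (cosets K) H (pc K g)"
  note KC = subgroup.mem_carrier[OF H(1)] and HC = subgroup.mem_carrier[OF H(2)]
  note \<psi> = conj_orbit_map[OF H g sub]
  show "is_span K H (cosets H) ?id ?\<psi>"
    using finite_gset_cosets[OF H(2)] gmaps_id \<psi>(1) by (simp add: is_span_def)
  \<comment> \<open>The second leg sends the coset of \<open>k \<otimes> inv g\<close> to
    \<open>kK\<close>, which is the base point of \<open>G/K\<close> exactly for
    \<open>k \<in> K\<close>.\<close>
  let ?f = "\<lambda>k. (pc H (k \<otimes> inv g), k \<otimes> inv g)"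
  let ?Y = "span_biset K H (cosets H) ?id ?\<psi>"
  have one: "pc K k = pc K \<one> \<longleftrightarrow> k \<in> K" if "k \<in> carrier G" for k
    using that KC pc_eq_iff[OF H(1) one_closed that] by auto
  have KgK: "k \<otimes> inv g \<otimes> g = k" if "k \<in> carrier G" for k using that g by (simp add: m_assoc)
  show "biset_isomorphic K H (cov_biset G K g) ?Y"
  proof (rule biset_isomorphicI[of ?f])
    show "bij_betw ?f (bpts (cov_biset G K g)) (bpts ?Y)"
    proof (rule bij_betw_byWitness[of _ "\<lambda>(z, b). b \<otimes> g"])
      show "?f ` bpts (cov_biset G K g) \<subseteq> bpts ?Y"
        using KC g by (auto simp: cov_biset_def span_biset_simps fst_cosets \<psi>(2) KgK one)
      show "(\<lambda>(z, b). b \<otimes> g) ` bpts ?Y \<subseteq> bpts (cov_biset G K g)"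
        using g by (auto simp: cov_biset_def span_biset_def \<psi>(2) one)
      show "\<forall>w\<in>bpts ?Y. ?f ((\<lambda>(z, b). b \<otimes> g) w) = w"
        using g by (auto simp: span_biset_def m_assoc)
    qed (use KC KgK in \<open>auto simp: cov_biset_def\<close>)
    show "?f (lact (cov_biset G K g) h x) = lact ?Y h (?f x)"
      if "h \<in> K" "x \<in> bpts (cov_biset G K g)" for h x
      using that KC g by (simp add: cov_biset_def span_biset_simps snd_cosets H m_assoc)
    show "?f (ract (cov_biset G K g) x h) = ract ?Y (?f x) h"
      if "h \<in> H" "x \<in> bpts (cov_biset G K g)" for h x
    proof -
      have "x \<otimes> (inv g \<otimes> h \<otimes> g) \<otimes> inv g = x \<otimes> inv g \<otimes> h"
        using that KC HC g by (simp add: cov_biset_def m_assoc)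
      then show ?thesis using that KC HC g
        by (simp add: cov_biset_def span_biset_simps pc_absorb H)
    qed
  qed
qed

text \<open>The two legs exchange roles. The fibre over the base point of \<open>G/H\<close> is now
  the single point \<open>eH\<close>, and the remaining coordinate runs through the representatives
  \<open>g \<otimes> k\<close> of its image \<open>gK\<close>.\<close>

lemma con_biset_span:
  assumes H: "subgroup K G" "subgroup H G" and g: "g \<in> carrier G"
    and sub: "\<And>h. h \<in> H \<Longrightarrow> inv g \<otimes> h \<otimes> g \<in> K"
  shows "is_span H K (cosets H) (orbit_map (cosets K) H (pc K g)) (\<lambda>x\<in>fst (cosets H). x)"
    and "biset_isomorphic H K (con_biset G K g)
      (span_biset H K (cosets H) (orbit_map (cosets K) H (pc K g)) (\<lambda>x\<in>fst (cosets H). x))"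
proof -
  let ?id = "\<lambda>x\<in>fst (cosets H). x" and ?\<psi> = "orbit_map (cosets K) H (pc K g)"
  note KC = subgroup.mem_carrier[OF H(1)] and HC = subgroup.mem_carrier[OF H(2)]
  note \<psi> = conj_orbit_map[OF H g sub]
  show "is_span H K (cosets H) ?\<psi> ?id"
    using finite_gset_cosets[OF H(2)] gmaps_id \<psi>(1) by (simp add: is_span_def)
  let ?f = "\<lambda>k. (pc H \<one>, g \<otimes> k)"
  let ?Y = "span_biset H K (cosets H) ?\<psi> ?id"
  show "biset_isomorphic H K (con_biset G K g) ?Y"
  proof (rule biset_isomorphicI[of ?f])
    show "bij_betw ?f (bpts (con_biset G K g)) (bpts ?Y)"
    proof (rule bij_betw_byWitness[of _ "\<lambda>(z, b). inv g \<otimes> b"])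
      show "?f ` bpts (con_biset G K g) \<subseteq> bpts ?Y"
        using KC g by (auto simp: con_biset_def span_biset_simps fst_cosets \<psi>(2) pc_absorb H)
      show "(\<lambda>(z, b). inv g \<otimes> b) ` bpts ?Y \<subseteq> bpts (con_biset G K g)"
      proof -
        have "inv g \<otimes> b \<in> K" if "b \<in> carrier G" "pc K g = pc K b" for b
          using that g KC pc_eq_iff[OF H(1) g that(1)] by (auto simp: mult_inv_cancel)
        then show ?thesis using g by (auto simp: con_biset_def span_biset_def \<psi>(2))
      qed
      show "\<forall>w\<in>bpts ?Y. ?f ((\<lambda>(z, b). inv g \<otimes> b) w) = w"
        using g by (auto simp: span_biset_def mult_inv_cancel)
    qed (use KC g in \<open>auto simp: con_biset_def mult_inv_cancel\<close>)
    show "?f (lact (con_biset G K g) h x) = lact ?Y h (?f x)"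
      if "h \<in> H" "x \<in> bpts (con_biset G K g)" for h x
      using that KC HC g pc_absorb[OF H(2) one_closed, of h]
      by (simp add: con_biset_def span_biset_simps snd_cosets H m_assoc mult_inv_cancel)
    show "?f (ract (con_biset G K g) x h) = ract ?Y (?f x) h"
      if "h \<in> K" "x \<in> bpts (con_biset G K g)" for h x
      using that KC g by (simp add: con_biset_def span_biset_simps m_assoc)
  qed
qed

text \<open>On the orbit of \<open>z\<close>, identified with \<open>G/L\<close> for the stabilizer
  \<open>L\<close> of \<open>z\<close>, such a \<zeta> is the map \<open>eL \<mapsto> cL\<close>
  from the definition of conjugation invariance. The element \<open>c\<close> may vary with the
  point.\<close>

definition central_map :: "'g gset \<Rightarrow> ('g pt \<Rightarrow> 'g pt) \<Rightarrow> bool" where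
  "central_map Z \<zeta> \<longleftrightarrow> \<zeta> \<in> gmaps G Z Z \<and>
     (\<forall>z\<in>fst Z. \<exists>c\<in>centralizer G (stabilizer G (snd Z) z). \<zeta> z = snd Z c z)"

section \<open>Recovering a span from its biset\<close>

lemma span_biset_cover:
  assumes H: "subgroup H2 G" "subgroup H1 G" and Z: "is_span H2 H1 Z p1 p2" and w: "w \<in> fst Z"
  obtains a z g where "a \<in> carrier G" "(z, g) \<in> bpts (span_biset H2 H1 Z p1 p2)" "w = snd Z a z"
proof -
  have Z: "finite_gset G Z" and p: "p1 \<in> gmaps G Z (cosets H1)" "p2 \<in> gmaps G Z (cosets H2)"
    using Z by (auto simp: is_span_def)
  note gm = gmapsD[OF p(1)] gmapsD[OF p(2)]
  obtain a where a: "a \<in> carrier G" "p2 w = pc H2 a" using gm(4)[OF w] by (auto simp: fst_cosets)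
  let ?z = "snd Z (inv a) w"
  have z: "?z \<in> fst Z" using Z a w by (simp add: gset_closed)
  then obtain g where g: "g \<in> carrier G" "p1 ?z = pc H1 g" using gm(1) by (auto simp: fst_cosets)
  have "(?z, g) \<in> bpts (span_biset H2 H1 Z p1 p2)"
    using z g a w H by (simp add: span_biset_simps gm snd_cosets)
  moreover have "w = snd Z a ?z" using a w Z by (simp add: gset_inv)
  ultimately show thesis using that a(1) by blast
qed

text \<open>The kernel of \<open>(a, (z, g)) \<mapsto> a z\<close> lies in the relation from which a
  span was built out of a biset. Maps out of \<open>Z\<close> can therefore be defined on
  \<open>G\<close> times the biset and checked against that relation.\<close>

lemma span_biset_rel:
  assumes H: "subgroup H2 G" "subgroup H1 G" and Z: "is_span H2 H1 Z p1 p2"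
    and ab: "a \<in> carrier G" "b \<in> carrier G"
    and zg: "(z, g) \<in> bpts (span_biset H2 H1 Z p1 p2)" "(z', g') \<in> bpts (span_biset H2 H1 Z p1 p2)"
    and e: "snd Z a z = snd Z b z'"
  shows "\<exists>h2\<in>H2. \<exists>h1\<in>H1. a = b \<otimes> h2 \<and> (z', g') =
    ract (span_biset H2 H1 Z p1 p2) (lact (span_biset H2 H1 Z p1 p2) h2 (z, g)) h1"
proof -
  have Z: "finite_gset G Z" and p: "p1 \<in> gmaps G Z (cosets H1)" "p2 \<in> gmaps G Z (cosets H2)"
    using Z by (auto simp: is_span_def)
  note gm = gmapsD[OF p(1)] gmapsD[OF p(2)]
  have X: "z \<in> fst Z" "g \<in> carrier G" "p2 z = pc H2 \<one>" "p1 z = pc H1 g"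
    and X': "z' \<in> fst Z" "g' \<in> carrier G" "p2 z' = pc H2 \<one>" "p1 z' = pc H1 g'"
    using zg by (auto simp: span_biset_simps)
  have "pc H2 b = p2 (snd Z b z')" using X' ab H by (simp add: gm snd_cosets)
  also have "\<dots> = pc H2 a" using X ab H by (simp add: gm snd_cosets flip: e)
  finally obtain h2 where h2: "h2 \<in> H2" "a = b \<otimes> h2" using pc_eq_iff[OF H(1) ab(2,1)] by blast
  have h2c: "h2 \<in> carrier G" using h2 subgroup.mem_carrier[OF H(1)] by blast
  have "z' = snd Z (inv b) (snd Z a z)" using X' ab Z by (simp add: e gset_inv)
  then have z': "z' = snd Z h2 z" using h2 h2c ab X Z by (simp add: gset_mult gset_inv gset_closed)
  have "pc H1 (h2 \<otimes> g) = p1 z'" using X h2c H by (simp add: z' gm snd_cosets)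
  then obtain h1 where "h1 \<in> H1" "g' = h2 \<otimes> g \<otimes> h1"
    using pc_eq_iff[OF H(2), of "h2 \<otimes> g" g'] X X' h2c by auto
  then show ?thesis using h2 z' by (auto simp: span_biset_simps)
qed

text \<open>An isomorphism \<open>f\<close> of bisets sends \<open>(z, g)\<close> to some
  \<open>(u, c)\<close> and need not preserve the \<open>G\<close>-coordinate. The map
  \<open>e\<close> extends \<open>z \<mapsto> u\<close>; it respects the second legs, but
  \<open>p1' u\<close> is the coset of \<open>c\<close> whereas \<open>p1 z\<close> is the coset of
  \<open>g\<close>. Moving \<open>z\<close> by \<open>c \<otimes> inv g\<close> corrects the value
  of \<open>p1\<close>, and this defines \<zeta>.\<close>

lemma span_biset_iso:
  assumes H: "subgroup H2 G" "subgroup H1 G"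
    and Z: "is_span H2 H1 Z p1 p2" and Z': "is_span H2 H1 Z' p1' p2'"
    and iso: "biset_isomorphic H2 H1 (span_biset H2 H1 Z p1 p2) (span_biset H2 H1 Z' p1' p2')"
  obtains e \<zeta> where "e \<in> gmaps G Z Z'" "bij_betw e (fst Z) (fst Z')" "central_map Z \<zeta>"
    "\<And>z. z \<in> fst Z \<Longrightarrow> p2' (e z) = p2 z" "\<And>z. z \<in> fst Z \<Longrightarrow> p1' (e z) = p1 (\<zeta> z)"
proof -
  have Z: "finite_gset G Z" and p: "p1 \<in> gmaps G Z (cosets H1)" "p2 \<in> gmaps G Z (cosets H2)"
    and Z': "finite_gset G Z'" and p': "p1' \<in> gmaps G Z' (cosets H1)" "p2' \<in> gmaps G Z' (cosets H2)"
    using assms(3,4) by (auto simp: is_span_def)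
  note H2C = subgroup.mem_carrier[OF H(1)] and H1C = subgroup.mem_carrier[OF H(2)]
  note gm = gmapsD[OF p(1)] gmapsD[OF p(2)] gmapsD[OF p'(1)] gmapsD[OF p'(2)]
  let ?X = "span_biset H2 H1 Z p1 p2" and ?Y = "span_biset H2 H1 Z' p1' p2'"
  note XD = finite_bisetD[OF conj_bisetD[OF conj_biset_span_biset[OF H assms(3)]]]
  note YD = finite_bisetD(8)[OF conj_bisetD[OF conj_biset_span_biset[OF H assms(4)]]]
  obtain f where f: "bij_betw f (bpts ?X) (bpts ?Y)"
      and fl: "\<And>h x. h \<in> H2 \<Longrightarrow> x \<in> bpts ?X \<Longrightarrow> f (lact ?X h x) = lact ?Y h (f x)"
      and fr: "\<And>h x. h \<in> H1 \<Longrightarrow> x \<in> bpts ?X \<Longrightarrow> f (ract ?X x h) = ract ?Y (f x) h"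
    using iso unfolding biset_isomorphic_def by blast
  define u where "u x = fst (f x)" for x
  define c where "c x = snd (f x)" for x
  have fx: "f x = (u x, c x)" for x by (simp add: u_def c_def)
  have uc: "u x \<in> fst Z'" "c x \<in> carrier G" "p2' (u x) = pc H2 \<one>" "p1' (u x) = pc H1 (c x)"
    if "x \<in> bpts ?X" for x
    using bij_betwE[OF f, rule_format, OF that] unfolding fx span_biset_simps by auto
  have x: "z \<in> fst Z" "g \<in> carrier G" "p2 z = pc H2 \<one>" "p1 z = pc H1 g" if "(z, g) \<in> bpts ?X" for z g
    using that by (auto simp: span_biset_simps)
  define B where "B = carrier G \<times> bpts ?X"
  define act where "act h = map_prod (\<lambda>a. h \<otimes> a) (\<lambda>x :: 'g pt \<times> 'g. x)" for h
  have closed: "act h b \<in> B" if "h \<in> carrier G" "b \<in> B" for h b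
    using that by (auto simp: B_def act_def)
  define q where "q = (\<lambda>(a, x :: 'g pt \<times> 'g). snd Z a (fst x))"
  have B: "\<exists>a z g. b = (a, z, g) \<and> a \<in> carrier G \<and> (z, g) \<in> bpts ?X" if "b \<in> B" for b
    using that by (cases b) (auto simp: B_def)
  have qB: "fst Z = q ` B"
  proof
    show "q ` B \<subseteq> fst Z" using Z by (auto simp: q_def B_def span_biset_simps gset_closed)
    show "fst Z \<subseteq> q ` B"
    proof
      fix w assume "w \<in> fst Z"
      then obtain a z g where "a \<in> carrier G" "(z, g) \<in> bpts ?X" "w = snd Z a z"
        by (rule span_biset_cover[OF H assms(3)])
      then show "w \<in> q ` B" by (force simp: B_def q_def)
    qed
  qed
  have cover: "\<exists>a z g. w = q (a, z, g) \<and> a \<in> carrier G \<and> (z, g) \<in> bpts ?X" if "w \<in> fst Z" for w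
    using that B unfolding qB by blast
  have qa: "snd Z h (q b) = q (act h b)" if "h \<in> carrier G" "b \<in> B" for h b
    using that Z by (auto simp: B_def q_def act_def gset_mult span_biset_simps)
  note rel = span_biset_rel[OF H assms(3)]
  have frel: "u (ract ?X (lact ?X h2 (z, g)) h1) = snd Z' h2 (u (z, g)) \<and>
      c (ract ?X (lact ?X h2 (z, g)) h1) = h2 \<otimes> c (z, g) \<otimes> h1"
    if "(z, g) \<in> bpts ?X" "h2 \<in> H2" "h1 \<in> H1" for z g h2 h1
  proof -
    have "f (ract ?X (lact ?X h2 (z, g)) h1) = ract ?Y (lact ?Y h2 (f (z, g))) h1"
      using that bij_betwE[OF f] by (simp add: fr fl XD YD)
    then show ?thesis by (simp add: fx span_biset_simps)
  qed
  obtain e where e: "e \<in> gmaps G Z Z'" "\<And>b. b \<in> B \<Longrightarrow> e (q b) = snd Z' (fst b) (u (snd b))"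
  proof (rule gmap_lift[OF Z qB closed qa, of "\<lambda>b. snd Z' (fst b) (u (snd b))" Z'])
    fix b b' assume b: "b \<in> B" "b' \<in> B" "q b = q b'"
    obtain a z g a' z' g' where bb: "b = (a, z, g)" "b' = (a', z', g')" "a \<in> carrier G" "a' \<in> carrier G"
      "(z, g) \<in> bpts ?X" "(z', g') \<in> bpts ?X" using B[OF b(1)] B[OF b(2)] by blast
    then obtain h2 h1 where h: "h2 \<in> H2" "h1 \<in> H1" "a = a' \<otimes> h2"
      "(z', g') = ract ?X (lact ?X h2 (z, g)) h1" using rel[of a a' z g z' g'] b(3) by (auto simp: q_def)
    then show "snd Z' (fst b) (u (snd b)) = snd Z' (fst b') (u (snd b'))"
      using frel[OF bb(5) h(1,2)] bb uc[OF bb(5)] H2C Z' by (simp add: gset_mult)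
  qed (auto simp: B_def act_def Z' uc gset_closed gset_mult)
  obtain \<zeta> where \<zeta>: "\<zeta> \<in> gmaps G Z Z"
    "\<And>b. b \<in> B \<Longrightarrow> \<zeta> (q b) = snd Z (fst b \<otimes> c (snd b) \<otimes> inv (snd (snd b))) (fst (snd b))"
  proof (rule gmap_lift[OF Z qB closed qa, of
        "\<lambda>b. snd Z (fst b \<otimes> c (snd b) \<otimes> inv (snd (snd b))) (fst (snd b))" Z])
    fix b b' assume b: "b \<in> B" "b' \<in> B" "q b = q b'"
    obtain a z g a' z' g' where bb: "b = (a, z, g)" "b' = (a', z', g')" "a \<in> carrier G" "a' \<in> carrier G"
      "(z, g) \<in> bpts ?X" "(z', g') \<in> bpts ?X" using B[OF b(1)] B[OF b(2)] by blast
    then obtain h2 h1 where h: "h2 \<in> H2" "h1 \<in> H1" "a = a' \<otimes> h2"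
      "(z', g') = ract ?X (lact ?X h2 (z, g)) h1" using rel[of a a' z g z' g'] b(3) by (auto simp: q_def)
    have zg: "z' = snd Z h2 z" "g' = h2 \<otimes> g \<otimes> h1" using h(4) by (auto simp: span_biset_simps)
    have C: "h2 \<in> carrier G" "h1 \<in> carrier G" "g \<in> carrier G" "c (z, g) \<in> carrier G" "z \<in> fst Z"
      using h H1C H2C x[OF bb(5)] uc[OF bb(5)] by auto
    \<comment> \<open>In the product of \<open>c\<close> and \<open>inv g\<close> the factor
      \<open>h1\<close> cancels, and \<open>h2\<close> accounts for the passage from
      \<open>a\<close>, \<open>z\<close> to \<open>a'\<close>, \<open>z'\<close>.\<close>
    have "c (z', g') = h2 \<otimes> c (z, g) \<otimes> h1" using frel[OF bb(5) h(1,2)] h(4) by simp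
    then have "a' \<otimes> c (z', g') \<otimes> inv g' \<otimes> h2 = a \<otimes> c (z, g) \<otimes> inv g"
      using C bb(4) by (simp add: zg(2) h(3) m_assoc mult_inv_cancel inv_mult_group)
    moreover have "snd Z (a' \<otimes> c (z', g') \<otimes> inv g') z' = snd Z (a' \<otimes> c (z', g') \<otimes> inv g' \<otimes> h2) z"
      unfolding zg(1) using C bb x[OF bb(6)] uc[OF bb(6)] Z by (simp add: gset_mult[OF Z, of _ h2] zg(1))
    ultimately show "snd Z (fst b \<otimes> c (snd b) \<otimes> inv (snd (snd b))) (fst (snd b)) =
        snd Z (fst b' \<otimes> c (snd b') \<otimes> inv (snd (snd b'))) (fst (snd b'))" by (simp add: bb)
  next
    fix b assume "b \<in> B"
    then obtain a z g where "b = (a, z, g)" "a \<in> carrier G" "(z, g) \<in> bpts ?X" using B by blast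
    then show "snd Z (fst b \<otimes> c (snd b) \<otimes> inv (snd (snd b))) (fst (snd b)) \<in> fst Z"
      "\<And>h. h \<in> carrier G \<Longrightarrow> snd Z (fst (act h b) \<otimes> c (snd (act h b)) \<otimes> inv (snd (snd (act h b))))
         (fst (snd (act h b))) = snd Z h (snd Z (fst b \<otimes> c (snd b) \<otimes> inv (snd (snd b))) (fst (snd b)))"
      using Z uc x by (simp_all add: act_def gset_closed m_assoc flip: gset_mult)
  qed (assumption | rule that)+
  show thesis
  proof (rule that[OF e(1)])
    show "p2' (e w) = p2 w" "p1' (e w) = p1 (\<zeta> w)" if "w \<in> fst Z" for w
    proof -
      obtain a z g where b: "w = q (a, z, g)" "a \<in> carrier G" "(z, g) \<in> bpts ?X"
        using cover[OF \<open>w \<in> fst Z\<close>] by blast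
      then have inB: "(a, z, g) \<in> B" by (simp add: B_def)
      note X = x[OF b(3)] and U = uc[OF b(3)]
      show "p2' (e w) = p2 w"
        using b(2) X U H unfolding b(1) e(2)[OF inB] by (simp add: q_def gm snd_cosets)
      show "p1' (e w) = p1 (\<zeta> w)"
        using b(2) X U H unfolding b(1) e(2)[OF inB] \<zeta>(2)[OF inB] by (simp add: gm snd_cosets m_assoc)
    qed
    show "central_map Z \<zeta>"
      unfolding central_map_def
    proof (intro conjI ballI \<zeta>(1))
      fix w assume "w \<in> fst Z"
      then obtain a z g where b: "w = q (a, z, g)" "a \<in> carrier G" "(z, g) \<in> bpts ?X"
        using cover by blast
      then have inB: "(a, z, g) \<in> B" by (simp add: B_def)
      note X = x[OF b(3)] and U = uc[OF b(3)]
      \<comment> \<open>At \<open>w = a z\<close> the centralizing element is the discrepancy at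
        \<open>z\<close>, conjugated by \<open>a\<close>.\<close>
      define d where "d = a \<otimes> c (z, g) \<otimes> inv g \<otimes> inv a"
      have dC: "d \<in> carrier G" using b X U by (simp add: d_def)
      have w: "w = snd Z a z" by (simp add: b q_def)
      have "\<zeta> w = snd Z (d \<otimes> a) z"
        unfolding b(1) \<zeta>(2)[OF inB] using b X U by (simp add: d_def m_assoc)
      then have "\<zeta> w = snd Z d w" using dC b X Z by (simp add: gset_mult w)
      moreover have "d \<otimes> s = s \<otimes> d" if s: "s \<in> stabilizer G (snd Z) w" for s
      proof -
        have sC: "s \<in> carrier G" and sw: "snd Z s w = w" using stabilizerD[OF s] by auto
        \<comment> \<open>An element \<open>s\<close> fixing \<open>w\<close> yields
          \<open>h2\<close> and \<open>h1\<close> that together fix the biset point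
          \<open>(z, g)\<close>. By equivariance of \<open>f\<close> they fix its image as well, so
          \<open>c\<close> and \<open>g\<close> are transformed alike and \<open>h2\<close> commutes
          with \<open>t\<close>, the product of \<open>c\<close> and \<open>inv g\<close>.\<close>
        have "snd Z (s \<otimes> a) z = snd Z a z" using sC sw b X Z by (simp add: gset_mult w)
        then obtain h2 h1 where h: "h2 \<in> H2" "h1 \<in> H1" "s \<otimes> a = a \<otimes> h2"
          "(z, g) = ract ?X (lact ?X h2 (z, g)) h1"
          using rel[of "s \<otimes> a" a z g z g] b sC by auto
        have C: "h2 \<in> carrier G" "h1 \<in> carrier G" "g \<in> carrier G" "c (z, g) \<in> carrier G"
          using h H1C H2C X U by auto
        have g: "g = h2 \<otimes> g \<otimes> h1" using h(4) by (simp add: span_biset_simps)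
        have cc: "c (z, g) = h2 \<otimes> c (z, g) \<otimes> h1"
          using frel[OF b(3) h(1,2)] by (simp flip: h(4))
        define t where "t = c (z, g) \<otimes> inv g"
        have tC: "t \<in> carrier G" using C by (simp add: t_def)
        have "t = (h2 \<otimes> c (z, g) \<otimes> h1) \<otimes> inv (h2 \<otimes> g \<otimes> h1)"
          unfolding t_def by (subst cc, subst (2) g, rule refl)
        also have "\<dots> = h2 \<otimes> t \<otimes> inv h2"
          using C by (simp add: t_def m_assoc mult_inv_cancel inv_mult_group)
        finally have "t \<otimes> h2 = h2 \<otimes> t \<otimes> inv h2 \<otimes> h2" by simp
        then have th: "t \<otimes> h2 = h2 \<otimes> t" using C tC by (simp add: m_assoc)
        have d: "d = a \<otimes> t \<otimes> inv a" using b C by (simp add: d_def t_def m_assoc)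
        have sa: "s = a \<otimes> h2 \<otimes> inv a" using sC b by (simp add: m_assoc flip: h(3))
        have "d \<otimes> s = a \<otimes> (t \<otimes> h2) \<otimes> inv a"
          unfolding d sa using b C tC by (simp add: m_assoc mult_inv_cancel)
        also have "\<dots> = s \<otimes> d"
          unfolding d sa th using b C tC by (simp add: m_assoc mult_inv_cancel)
        finally show ?thesis .
      qed
      ultimately show "\<exists>d\<in>centralizer G (stabilizer G (snd Z) w). \<zeta> w = snd Z d w"
        using dC unfolding centralizer_def by blast
    qed
    have eq: "e (snd Z a z) = snd Z' a (u (z, g))" if "a \<in> carrier G" "(z, g) \<in> bpts ?X" for a z g
      using that e(2)[of "(a, z, g)"] by (simp add: B_def q_def)
    have "inj_on e (fst Z)"
    proof (rule inj_onI)
      fix w w' assume w: "w \<in> fst Z" "w' \<in> fst Z" "e w = e w'"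
      obtain a z g where b: "a \<in> carrier G" "(z, g) \<in> bpts ?X" "w = snd Z a z"
        using w(1) by (rule span_biset_cover[OF H assms(3)])
      obtain a' z' g' where b': "a' \<in> carrier G" "(z', g') \<in> bpts ?X" "w' = snd Z a' z'"
        using w(2) by (rule span_biset_cover[OF H assms(3)])
      have Y: "(u (z, g), c (z, g)) \<in> bpts ?Y" "(u (z', g'), c (z', g')) \<in> bpts ?Y"
        using bij_betwE[OF f] b(2) b'(2) by (simp_all flip: fx)
      \<comment> \<open>Equality of the images is expressed by the kernel relation on the target
        biset and carried back through the injective \<open>f\<close>.\<close>
      have "snd Z' a (u (z, g)) = snd Z' a' (u (z', g'))"
        using w(3) b b' by (simp add: eq)
      then obtain h2 h1 where h: "h2 \<in> H2" "h1 \<in> H1" "a = a' \<otimes> h2"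
        and "f (z', g') = ract ?Y (lact ?Y h2 (f (z, g))) h1"
        using span_biset_rel[OF H assms(4) b(1) b'(1) Y] unfolding fx by blast
      then have "f (z', g') = f (ract ?X (lact ?X h2 (z, g)) h1)"
        using b(2) bij_betwE[OF f] by (simp add: fl fr XD YD)
      then have "(z', g') = ract ?X (lact ?X h2 (z, g)) h1"
        using bij_betw_imp_inj_on[OF f] b(2) b'(2) h by (simp only: inj_on_eq_iff XD)
      then have "z' = snd Z h2 z" by (simp add: span_biset_simps)
      then show "w = w'" using b b' h H2C x[OF b(2)] Z by (simp add: gset_mult)
    qed
    moreover have "fst Z' \<subseteq> e ` fst Z"
    proof
      fix w assume w: "w \<in> fst Z'"
      obtain a v d where b: "a \<in> carrier G" "(v, d) \<in> bpts ?Y" "w = snd Z' a v"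
        using w by (rule span_biset_cover[OF H assms(4)])
      then obtain z g where zg: "(z, g) \<in> bpts ?X" "f (z, g) = (v, d)"
        using bij_betw_imp_surj_on[OF f] by (metis imageE surj_pair)
      then have "w = e (snd Z a z)" using b eq by (simp add: fx)
      then show "w \<in> e ` fst Z" using b zg x[OF zg(1)] Z by (simp add: gset_closed)
    qed
    ultimately show "bij_betw e (fst Z) (fst Z')"
      using gmapsD(1)[OF e(1)] by (auto simp: bij_betw_def)
  qed
qed

end

section \<open>Mackey functors\<close>

lemma finprod_hom:
  assumes A: "comm_group A" and B: "comm_group B" and h: "h \<in> hom A B"
    and I: "finite I" and f: "\<And>i. i \<in> I \<Longrightarrow> f i \<in> carrier A"
  shows "h (finprod A f I) = finprod B (\<lambda>i. h (f i)) I"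
proof -
  interpret A: comm_group A by fact
  interpret B: comm_group B by fact
  interpret group_hom A B h using h by unfold_locales
  show ?thesis using I f
  proof (induction I)
    case (insert i I)
    then have "h (f i \<otimes>\<^bsub>A\<^esub> finprod A f I) = h (f i) \<otimes>\<^bsub>B\<^esub> finprod B (\<lambda>i. h (f i)) I"
      by (subst hom_mult) (auto intro: A.finprod_closed)
    then show ?case using insert
      by (simp add: A.finprod_insert B.finprod_insert Pi_def)
  qed simp
qed

lemma (in comm_monoid) finprod_swap:
  assumes "finite I" "finite J" "\<And>i j. i \<in> I \<Longrightarrow> j \<in> J \<Longrightarrow> f i j \<in> carrier G"
  shows "finprod G (\<lambda>i. finprod G (\<lambda>j. f i j) J) I = finprod G (\<lambda>j. finprod G (\<lambda>i. f i j) I) J"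
  using assms(1,3)
proof (induction I)
  case (insert i I)
  have "finprod G (\<lambda>j. finprod G (\<lambda>i. f i j) (insert i I)) J =
      finprod G (\<lambda>j. f i j \<otimes> finprod G (\<lambda>i. f i j) I) J"
    using insert by (intro finprod_cong') (auto intro!: finprod_closed)
  also have "\<dots> = finprod G (f i) J \<otimes> finprod G (\<lambda>j. finprod G (\<lambda>i. f i j) I) J"
    using insert by (intro finprod_multf) (auto intro!: finprod_closed)
  also have "\<dots> = finprod G (\<lambda>i. finprod G (f i) J) (insert i I)"
    using insert by (subst finprod_insert) (auto intro!: finprod_closed)
  finally show ?case by simp
qed simp

lemma is_functorD:
  assumes "is_functor C D F"
  shows "\<And>X. X \<in> cat_obj C \<Longrightarrow> fobj F X \<in> cat_obj D"
    and "\<And>X Y f. X \<in> cat_obj C \<Longrightarrow> Y \<in> cat_obj C \<Longrightarrow> f \<in> cat_hom C X Y \<Longrightarrow>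
      farr F X Y f \<in> cat_hom D (fobj F X) (fobj F Y)"
    and "\<And>X. X \<in> cat_obj C \<Longrightarrow> farr F X X (cat_id C X) = cat_id D (fobj F X)"
    and "\<And>X Y Z f g. X \<in> cat_obj C \<Longrightarrow> Y \<in> cat_obj C \<Longrightarrow> Z \<in> cat_obj C \<Longrightarrow>
      f \<in> cat_hom C X Y \<Longrightarrow> g \<in> cat_hom C Y Z \<Longrightarrow> farr F X Z (cat_comp C X Y Z g f) =
        cat_comp D (fobj F X) (fobj F Y) (fobj F Z) (farr F Y Z g) (farr F X Y f)"
  using assms unfolding is_functor_def by simp_all

section \<open>The Mackey axioms in terms of elements\<close>

locale mackey = fin_group G for G :: "('g, 'k) monoid_scheme" (structure) +
  fixes M :: "('g, 'a) gset_bifunc"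
  assumes mackey: "mackey_functor G M"
begin

abbreviation Mo :: "'g gset \<Rightarrow> 'a monoid" where "Mo \<equiv> bobj M"
abbreviation cov :: "'g gset \<Rightarrow> 'g gset \<Rightarrow> ('g pt \<Rightarrow> 'g pt) \<Rightarrow> 'a \<Rightarrow> 'a" where "cov \<equiv> bcov M"
abbreviation con :: "'g gset \<Rightarrow> 'g gset \<Rightarrow> ('g pt \<Rightarrow> 'g pt) \<Rightarrow> 'a \<Rightarrow> 'a" where "con \<equiv> bcon M"

lemma cov_functor: "is_functor (Gsets G) Ab \<lparr>fobj = bobj M, farr = bcov M\<rparr>"
  using mackey by (simp add: mackey_functor_def bivariant_functor_def)

lemma con_functor: "is_functor (op_cat (Gsets G)) Ab \<lparr>fobj = bobj M, farr = (\<lambda>X Y. bcon M Y X)\<rparr>"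
  using mackey by (simp add: mackey_functor_def bivariant_functor_def)

lemma Mo_comm_group: "finite_gset G S \<Longrightarrow> comm_group (Mo S)"
  using is_functorD(1)[OF cov_functor, of S] by (simp add: Gsets_def Ab_def)

lemma cov_hom:
  assumes "finite_gset G S" "finite_gset G T" "\<phi> \<in> gmaps G S T"
  shows "cov S T \<phi> \<in> hom (Mo S) (Mo T)" "cov S T \<phi> \<in> extensional (carrier (Mo S))"
  using is_functorD(2)[OF cov_functor, of S T \<phi>] assms by (simp_all add: Gsets_def Ab_def)

lemma con_hom:
  assumes "finite_gset G S" "finite_gset G T" "\<phi> \<in> gmaps G S T"
  shows "con S T \<phi> \<in> hom (Mo T) (Mo S)" "con S T \<phi> \<in> extensional (carrier (Mo T))"
  using is_functorD(2)[OF con_functor, of T S \<phi>] assms by (simp_all add: Gsets_def Ab_def op_cat_def)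

lemma cov_id: "finite_gset G S \<Longrightarrow> u \<in> carrier (Mo S) \<Longrightarrow> cov S S (\<lambda>x\<in>fst S. x) u = u"
  using is_functorD(3)[OF cov_functor, of S] by (simp add: Gsets_def Ab_def)

lemma con_id: "finite_gset G S \<Longrightarrow> u \<in> carrier (Mo S) \<Longrightarrow> con S S (\<lambda>x\<in>fst S. x) u = u"
  using is_functorD(3)[OF con_functor, of S] by (simp add: Gsets_def Ab_def op_cat_def)

lemma cov_compose:
  assumes "finite_gset G S" "finite_gset G T" "finite_gset G U"
    "\<phi> \<in> gmaps G S T" "\<psi> \<in> gmaps G T U" "u \<in> carrier (Mo S)"
  shows "cov S U (compose (fst S) \<psi> \<phi>) u = cov T U \<psi> (cov S T \<phi> u)"
  using is_functorD(4)[OF cov_functor, of S T U \<phi> \<psi>] assms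
  by (simp add: Gsets_def Ab_def compose_eq)

lemma con_compose:
  assumes "finite_gset G S" "finite_gset G T" "finite_gset G U"
    "\<phi> \<in> gmaps G S T" "\<psi> \<in> gmaps G T U" "u \<in> carrier (Mo U)"
  shows "con S U (compose (fst S) \<psi> \<phi>) u = con S T \<phi> (con T U \<psi> u)"
  using is_functorD(4)[OF con_functor, of U T S \<psi> \<phi>] assms
  by (simp add: Gsets_def Ab_def op_cat_def compose_eq)

lemma cov_closed:
  "finite_gset G S \<Longrightarrow> finite_gset G T \<Longrightarrow> \<phi> \<in> gmaps G S T \<Longrightarrow> u \<in> carrier (Mo S) \<Longrightarrow>
    cov S T \<phi> u \<in> carrier (Mo T)"
  by (rule hom_in_carrier[OF cov_hom(1)])

lemma con_closed:
  "finite_gset G S \<Longrightarrow> finite_gset G T \<Longrightarrow> \<phi> \<in> gmaps G S T \<Longrightarrow> u \<in> carrier (Mo T) \<Longrightarrow>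
    con S T \<phi> u \<in> carrier (Mo S)"
  by (rule hom_in_carrier[OF con_hom(1)])

lemma cov_mult:
  "finite_gset G S \<Longrightarrow> finite_gset G T \<Longrightarrow> \<phi> \<in> gmaps G S T \<Longrightarrow> u \<in> carrier (Mo S) \<Longrightarrow>
    v \<in> carrier (Mo S) \<Longrightarrow> cov S T \<phi> (u \<otimes>\<^bsub>Mo S\<^esub> v) = cov S T \<phi> u \<otimes>\<^bsub>Mo T\<^esub> cov S T \<phi> v"
  by (rule hom_mult[OF cov_hom(1)])

lemma con_mult:
  "finite_gset G S \<Longrightarrow> finite_gset G T \<Longrightarrow> \<phi> \<in> gmaps G S T \<Longrightarrow> u \<in> carrier (Mo T) \<Longrightarrow>
    v \<in> carrier (Mo T) \<Longrightarrow> con S T \<phi> (u \<otimes>\<^bsub>Mo T\<^esub> v) = con S T \<phi> u \<otimes>\<^bsub>Mo S\<^esub> con S T \<phi> v"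
  by (rule hom_mult[OF con_hom(1)])

lemma Mo_group: "finite_gset G S \<Longrightarrow> group (Mo S)"
  by (rule comm_group.axioms(2)[OF Mo_comm_group])

lemma cov_one:
  "finite_gset G S \<Longrightarrow> finite_gset G T \<Longrightarrow> \<phi> \<in> gmaps G S T \<Longrightarrow> cov S T \<phi> \<one>\<^bsub>Mo S\<^esub> = \<one>\<^bsub>Mo T\<^esub>"
  by (rule hom_one[OF cov_hom(1) Mo_group Mo_group])

lemma Mo_empty: "carrier (Mo (empty_gset G)) = {\<one>\<^bsub>Mo (empty_gset G)\<^esub>}"
  using mackey by (simp add: mackey_functor_def)

text \<open>Axiom (M1) for elements. A commuting square of \<open>G\<close>-sets that is a fibre
  product on points is a categorical pullback: the mediating map exists pointwise, and it is
  equivariant because its values are unique.\<close>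

lemma base_change:
  assumes S: "finite_gset G W" "finite_gset G S" "finite_gset G S'" "finite_gset G T"
    and \<phi>: "\<Psi> \<in> gmaps G W S" "\<Phi> \<in> gmaps G W S'" "\<phi> \<in> gmaps G S T" "\<phi>' \<in> gmaps G S' T"
    and comm: "\<And>w. w \<in> fst W \<Longrightarrow> \<phi> (\<Psi> w) = \<phi>' (\<Phi> w)"
    and univ: "\<And>x y. x \<in> fst S \<Longrightarrow> y \<in> fst S' \<Longrightarrow> \<phi> x = \<phi>' y \<Longrightarrow>
      \<exists>!w. w \<in> fst W \<and> \<Psi> w = x \<and> \<Phi> w = y"
    and u: "u \<in> carrier (Mo S')"
  shows "con S T \<phi> (cov S' T \<phi>' u) = cov W S \<Psi> (con W S' \<Phi> u)"
proof -
  note gm = gmapsD[OF \<phi>(1)] gmapsD[OF \<phi>(2)] gmapsD[OF \<phi>(3)] gmapsD[OF \<phi>(4)]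
  have "is_pullback (Gsets G) W S S' T \<Psi> \<Phi> \<phi> \<phi>'"
    unfolding is_pullback_def Gsets_def
  proof (simp add: S \<phi>, intro conjI allI ballI impI)
    show "compose (fst W) \<phi> \<Psi> = compose (fst W) \<phi>' \<Phi>"
      using comm by (auto simp: compose_def)
    fix X1 X2 a b
    assume X: "finite_gset G (X1, X2)" and a: "a \<in> gmaps G (X1, X2) S" and b: "b \<in> gmaps G (X1, X2) S'"
      and eq: "compose X1 \<phi> a = compose X1 \<phi>' b"
    have ab: "\<phi> (a x) = \<phi>' (b x)" if "x \<in> X1" for x
      using fun_cong[OF eq, of x] that by (simp add: compose_eq)
    note gab = gmapsD[OF a, simplified] gmapsD[OF b, simplified]
    define w where "w = (\<lambda>x\<in>X1. THE w. w \<in> fst W \<and> \<Psi> w = a x \<and> \<Phi> w = b x)"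
    have w: "w x \<in> fst W \<and> \<Psi> (w x) = a x \<and> \<Phi> (w x) = b x" if "x \<in> X1" for x
      using theI'[OF univ[OF gab(1) gab(4) ab]] that by (simp add: w_def)
    \<comment> \<open>Points of \<open>W\<close> are determined by their two projections;
      equivariance and uniqueness of the mediating map both rest on this.\<close>
    have uniq: "p = q" if "p \<in> fst W" "q \<in> fst W" "\<Psi> p = \<Psi> q" "\<Phi> p = \<Phi> q" for p q
      using univ[OF gm(1)[OF that(1)] gm(4)[OF that(1)] comm[OF that(1)]] that by metis
    have wg: "w \<in> gmaps G (X1, X2) W"
    proof (rule gmapsI)
      show "w \<in> extensional (fst (X1, X2))" by (simp add: w_def)
      show "w (snd (X1, X2) g x) = snd W g (w x)" if "g \<in> carrier G" "x \<in> fst (X1, X2)" for g x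
      proof (rule uniq)
        have X1: "X2 g x \<in> X1" using gset_closed[OF X that(1)] that by simp
        show "w (snd (X1, X2) g x) \<in> fst W" "snd W g (w x) \<in> fst W"
          using X1 w that S by (auto simp: gset_closed)
        show "\<Psi> (w (snd (X1, X2) g x)) = \<Psi> (snd W g (w x))"
          using X1 w that S by (simp add: gm gab)
        show "\<Phi> (w (snd (X1, X2) g x)) = \<Phi> (snd W g (w x))"
          using X1 w that S by (simp add: gm gab)
      qed
    qed (use w in simp)
    show "\<exists>!w. w \<in> gmaps G (X1, X2) W \<and> compose X1 \<Psi> w = a \<and> compose X1 \<Phi> w = b"
    proof (rule ex1I[of _ w])
      show "w \<in> gmaps G (X1, X2) W \<and> compose X1 \<Psi> w = a \<and> compose X1 \<Phi> w = b"
        using wg w gab by (auto simp: compose_def intro!: extensionalityI[of _ X1])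
      fix v assume v: "v \<in> gmaps G (X1, X2) W \<and> compose X1 \<Psi> v = a \<and> compose X1 \<Phi> v = b"
      show "v = w"
      proof (rule gmaps_eqI[OF conjunct1[OF v] wg])
        fix x assume "x \<in> fst (X1, X2)"
        then have x: "x \<in> X1" by simp
        have "\<Psi> (v x) = a x" "\<Phi> (v x) = b x"
          using fun_cong[OF conjunct1[OF conjunct2[OF v]], of x]
            fun_cong[OF conjunct2[OF conjunct2[OF v]], of x] x by (simp_all add: compose_eq)
        then show "v x = w x" using w[OF x] gmapsD(1)[OF conjunct1[OF v]] x by (simp add: uniq)
      qed
    qed
  qed
  then have "cat_comp Ab (Mo S') (Mo T) (Mo S) (con S T \<phi>) (cov S' T \<phi>') =
        cat_comp Ab (Mo S') (Mo W) (Mo S) (cov W S \<Psi>) (con W S' \<Phi>)"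
    using mackey unfolding mackey_functor_def by blast
  from fun_cong[OF this, of u] show ?thesis using u by (simp add: Ab_def compose_eq)
qed

text \<open>For bijective \<phi> the square with two sides \<phi> and two sides the identity of
  \<open>T\<close> is a pullback.\<close>

lemma cov_con_bij:
  assumes S: "finite_gset G S" "finite_gset G T" and \<phi>: "\<phi> \<in> gmaps G S T"
    and bij: "bij_betw \<phi> (fst S) (fst T)" and u: "u \<in> carrier (Mo T)"
  shows "cov S T \<phi> (con S T \<phi> u) = u"
proof -
  let ?id = "\<lambda>x\<in>fst T. x"
  have "con T T ?id (cov T T ?id u) = cov S T \<phi> (con S T \<phi> u)"
  proof (rule base_change[OF S(1) S(2) S(2) S(2) \<phi> \<phi> gmaps_id[OF S(2)] gmaps_id[OF S(2)] _ _ u])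
    fix x y assume "x \<in> fst T" "y \<in> fst T" "?id x = ?id y"
    then have xy: "x = y" "x \<in> \<phi> ` fst S" using bij by (auto simp: bij_betw_def)
    then obtain w where "w \<in> fst S" "\<phi> w = x" by blast
    then show "\<exists>!w. w \<in> fst S \<and> \<phi> w = x \<and> \<phi> w = y"
      using xy(1) bij by (intro ex1I[of _ w]) (auto simp: bij_betw_def inj_on_eq_iff)
  qed auto
  then show ?thesis using S u by (simp add: cov_id con_id)
qed

text \<open>Injectivity means that the pullback of \<phi> along itself is the diagonal copy of
  \<open>S\<close>.\<close>

lemma con_cov_inj:
  assumes S: "finite_gset G S" "finite_gset G T" and \<phi>: "\<phi> \<in> gmaps G S T"
    and inj: "inj_on \<phi> (fst S)" and u: "u \<in> carrier (Mo S)"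
  shows "con S T \<phi> (cov S T \<phi> u) = u"
proof -
  let ?id = "\<lambda>x\<in>fst S. x"
  have "con S T \<phi> (cov S T \<phi> u) = cov S S ?id (con S S ?id u)"
    by (rule base_change[OF S(1) S(1) S(1) S(2) gmaps_id[OF S(1)] gmaps_id[OF S(1)] \<phi> \<phi> _ _ u])
      (use inj in \<open>auto simp: inj_on_eq_iff\<close>)
  then show ?thesis using S u by (simp add: cov_id con_id)
qed

text \<open>Maps with disjoint images have empty pullback, so the composite factors through the
  trivial group \<open>M\<close> of the empty set.\<close>

lemma con_cov_disjoint:
  assumes S: "finite_gset G S" "finite_gset G S'" "finite_gset G T"
    and \<phi>: "\<phi> \<in> gmaps G S T" "\<phi>' \<in> gmaps G S' T"
    and disj: "\<phi> ` fst S \<inter> \<phi>' ` fst S' = {}" and u: "u \<in> carrier (Mo S')"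
  shows "con S T \<phi> (cov S' T \<phi>' u) = \<one>\<^bsub>Mo S\<^esub>"
proof -
  let ?E = "empty_gset G" and ?u = "\<lambda>x :: 'g pt. undefined :: 'g pt"
  have E: "fst ?E = {}" by (simp add: empty_gset_def)
  note m = gmaps_empty[OF E]
  have "con S T \<phi> (cov S' T \<phi>' u) = cov ?E S ?u (con ?E S' ?u u)"
    by (rule base_change[OF finite_gset_empty S(1) S(2) S(3) m m \<phi> _ _ u])
      (use disj E in \<open>auto simp: disjoint_iff\<close>)
  moreover have "con ?E S' ?u u \<in> carrier (Mo ?E)"
    by (rule con_closed[OF finite_gset_empty S(2) m u])
  then have "con ?E S' ?u u = \<one>\<^bsub>Mo ?E\<^esub>" using Mo_empty by simp
  ultimately show ?thesis using cov_one[OF finite_gset_empty S(1) m] by simp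
qed

section \<open>Additivity and detection on orbits\<close>

lemma sum_eqI:
  assumes S: "finite_gset G S" "finite_gset G T"
    and uv: "u \<in> carrier (Mo (gset_sum G S T))" "v \<in> carrier (Mo (gset_sum G S T))"
    and eq: "con S (gset_sum G S T) (\<lambda>x\<in>fst S. InL x) u = con S (gset_sum G S T) (\<lambda>x\<in>fst S. InL x) v"
      "con T (gset_sum G S T) (\<lambda>x\<in>fst T. InR x) u = con T (gset_sum G S T) (\<lambda>x\<in>fst T. InR x) v"
  shows "u = v"
proof -
  have "(\<lambda>x. (con S (gset_sum G S T) (\<lambda>s\<in>fst S. InL s) x,
              con T (gset_sum G S T) (\<lambda>s\<in>fst T. InR s) x))
          \<in> iso (Mo (gset_sum G S T)) (Mo S \<times>\<times> Mo T)"
    using mackey S unfolding mackey_functor_def by blast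
  then have "inj_on (\<lambda>x. (con S (gset_sum G S T) (\<lambda>s\<in>fst S. InL s) x,
              con T (gset_sum G S T) (\<lambda>s\<in>fst T. InR s) x)) (carrier (Mo (gset_sum G S T)))"
    by (auto simp: iso_def bij_betw_def)
  from inj_onD[OF this _ uv] eq show ?thesis by simp
qed

text \<open>Both sides have the same restrictions to the summands: pushing forward along an
  embedding and restricting along the same one changes nothing, while restricting along the other
  gives the neutral element.\<close>

lemma sum_decomp:
  assumes S: "finite_gset G S" "finite_gset G T" and u: "u \<in> carrier (Mo (gset_sum G S T))"
  shows "u = cov S (gset_sum G S T) (\<lambda>x\<in>fst S. InL x) (con S (gset_sum G S T) (\<lambda>x\<in>fst S. InL x) u)
      \<otimes>\<^bsub>Mo (gset_sum G S T)\<^esub>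
    cov T (gset_sum G S T) (\<lambda>x\<in>fst T. InR x) (con T (gset_sum G S T) (\<lambda>x\<in>fst T. InR x) u)"
    (is "u = ?a \<otimes>\<^bsub>Mo ?U\<^esub> ?b")
proof -
  have U: "finite_gset G ?U" using S by (rule finite_gset_sum)
  note L = gmaps_InL[OF S(1), of T] and R = gmaps_InR[OF S(2), of S]
  interpret MU: comm_group "Mo ?U" using Mo_comm_group[OF U] .
  interpret MS: comm_group "Mo S" using Mo_comm_group[OF S(1)] .
  interpret MT: comm_group "Mo T" using Mo_comm_group[OF S(2)] .
  have ab: "?a \<in> carrier (Mo ?U)" "?b \<in> carrier (Mo ?U)"
    using u S U L R by (auto intro!: cov_closed con_closed)
  have cl: "con S ?U (\<lambda>x\<in>fst S. InL x) u \<in> carrier (Mo S)" "con T ?U (\<lambda>x\<in>fst T. InR x) u \<in> carrier (Mo T)"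
    using u S U L R by (auto intro!: con_closed)
  show ?thesis
  proof (rule sum_eqI[OF S u])
    show "?a \<otimes>\<^bsub>Mo ?U\<^esub> ?b \<in> carrier (Mo ?U)" using ab by simp
    have "con S ?U (\<lambda>x\<in>fst S. InL x) ?a = con S ?U (\<lambda>x\<in>fst S. InL x) u"
      by (rule con_cov_inj[OF S(1) U L _ cl(1)]) (auto simp: inj_on_def)
    moreover have "con S ?U (\<lambda>x\<in>fst S. InL x) ?b = \<one>\<^bsub>Mo S\<^esub>"
      by (rule con_cov_disjoint[OF S U L R _ cl(2)]) auto
    ultimately show "con S ?U (\<lambda>x\<in>fst S. InL x) u = con S ?U (\<lambda>x\<in>fst S. InL x) (?a \<otimes>\<^bsub>Mo ?U\<^esub> ?b)"
      using con_mult[OF S(1) U L ab] cl by simp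
    have "con T ?U (\<lambda>x\<in>fst T. InR x) ?b = con T ?U (\<lambda>x\<in>fst T. InR x) u"
      by (rule con_cov_inj[OF S(2) U R _ cl(2)]) (auto simp: inj_on_def)
    moreover have "con T ?U (\<lambda>x\<in>fst T. InR x) ?a = \<one>\<^bsub>Mo T\<^esub>"
      by (rule con_cov_disjoint[OF S(2) S(1) U R L _ cl(1)]) auto
    ultimately show "con T ?U (\<lambda>x\<in>fst T. InR x) u = con T ?U (\<lambda>x\<in>fst T. InR x) (?a \<otimes>\<^bsub>Mo ?U\<^esub> ?b)"
      using con_mult[OF S(2) U R ab] cl by simp
  qed
qed

lemma con_bij_inj:
  assumes S: "finite_gset G S" "finite_gset G T" and \<phi>: "\<phi> \<in> gmaps G S T"
    and bij: "bij_betw \<phi> (fst S) (fst T)"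
    and uv: "u \<in> carrier (Mo T)" "v \<in> carrier (Mo T)" and eq: "con S T \<phi> u = con S T \<phi> v"
  shows "u = v"
  by (rule trans[OF cov_con_bij[OF S \<phi> bij uv(1), symmetric]])
    (simp only: eq cov_con_bij[OF S \<phi> bij uv(2)])

text \<open>Additivity (M2) splits off one orbit of \<open>Z\<close> at a time.\<close>

lemma orbits_eqI:
  assumes Z: "finite_gset G Z" and uv: "u \<in> carrier (Mo Z)" "v \<in> carrier (Mo Z)"
    and eq: "\<And>z. z \<in> fst Z \<Longrightarrow> con (cosets (stabilizer G (snd Z) z)) Z (stab_map Z z) u =
      con (cosets (stabilizer G (snd Z) z)) Z (stab_map Z z) v"
  shows "u = v"
  using assms
proof (induction "card (fst Z)" arbitrary: Z u v rule: less_induct)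
  case less
  note Z = less.prems(1) and uv = less.prems(2,3)
  show ?case
  proof (cases "fst Z = {}")
    case True
    then show ?thesis using empty_gsetI[OF Z] uv Mo_empty by simp
  next
    case False
    then obtain z0 where z0: "z0 \<in> fst Z" by blast
    let ?L = "stabilizer G (snd Z) z0"
    have L: "finite_gset G (cosets ?L)" by (rule finite_gset_cosets[OF stabilizer_subgroup[OF Z z0]])
    note sm = stab_map[OF Z z0]
    \<comment> \<open>The orbit of \<open>z0\<close> is split off. Its complement \<open>R\<close>
      is stable under the action and smaller, since it omits \<open>z0\<close>.\<close>
    define Orb where "Orb = stab_map Z z0 ` fst (cosets ?L)"
    have Orb: "Orb = (\<lambda>a. snd Z a z0) ` carrier G" unfolding Orb_def fst_cosets by (force simp: sm)
    define R where "R = fst Z - Orb"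
    have Rcl: "snd Z g x \<in> R" if g: "g \<in> carrier G" and x: "x \<in> R" for g x
    proof -
      have xZ: "x \<in> fst Z" using x by (simp add: R_def)
      have False if "snd Z g x \<in> Orb"
      proof -
        obtain a where "a \<in> carrier G" "snd Z g x = snd Z a z0" using \<open>snd Z g x \<in> Orb\<close> Orb by blast
        then have "x = snd Z (inv g \<otimes> a) z0" "inv g \<otimes> a \<in> carrier G"
          using gset_inv_iff[OF Z g xZ] g Z z0 by (auto simp: gset_closed gset_mult)
        then show False using x Orb by (auto simp: R_def)
      qed
      then show ?thesis using g xZ Z by (auto simp: R_def gset_closed)
    qed
    define ZR :: "'g gset" where "ZR = (R, \<lambda>g\<in>carrier G. \<lambda>x\<in>R. snd Z g x)"
    have ZR: "finite_gset G ZR"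
      unfolding ZR_def by (rule finite_gsetI) (use Z Rcl in \<open>auto simp: R_def finite_gset_finite gset_one gset_mult\<close>)
    have fR: "fst ZR = R" "\<And>g x. g \<in> carrier G \<Longrightarrow> x \<in> R \<Longrightarrow> snd ZR g x = snd Z g x"
      by (simp_all add: ZR_def)
    define i where "i = (\<lambda>x\<in>R. x)"
    have i: "i \<in> gmaps G ZR Z"
      by (rule gmapsI) (auto simp: i_def fR Rcl, simp add: R_def)
    let ?U = "gset_sum G (cosets ?L) ZR" and ?\<theta> = "copair (cosets ?L) ZR (stab_map Z z0) i"
    have U: "finite_gset G ?U" by (rule finite_gset_sum[OF L ZR])
    have \<theta>: "?\<theta> \<in> gmaps G ?U Z" by (rule gmaps_copair[OF L ZR sm(1) i])
    have bij: "bij_betw ?\<theta> (fst ?U) (fst Z)"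
    proof (rule bij_betw_imageI)
      have "stab_map Z z0 p \<noteq> i x" if "p \<in> fst (cosets ?L)" "x \<in> R" for p x
        using that by (auto simp: i_def R_def Orb_def)
      then show "inj_on ?\<theta> (fst ?U)"
        using sm(3) by (fastforce simp: inj_on_def gset_sum_simps copair_simps fR i_def)
      have "?\<theta> ` fst ?U = Orb \<union> R"
        by (force simp: gset_sum_simps image_Un image_image copair_simps fR i_def Orb_def)
      moreover have "Orb \<subseteq> fst Z" unfolding Orb using Z z0 by (auto simp: gset_closed)
      ultimately show "?\<theta> ` fst ?U = fst Z" by (auto simp: R_def)
    qed
    note InL = gmaps_InL[OF L, of ZR] and InR = gmaps_InR[OF ZR, of "cosets ?L"]
    have cL: "compose (fst (cosets ?L)) ?\<theta> (\<lambda>x\<in>fst (cosets ?L). InL x) = stab_map Z z0"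
      by (rule gmaps_eqI[OF gmaps_compose[OF InL \<theta> L] sm(1)]) (simp add: compose_eq copair_simps)
    have cR: "compose (fst ZR) ?\<theta> (\<lambda>x\<in>fst ZR. InR x) = i"
      by (rule gmaps_eqI[OF gmaps_compose[OF InR \<theta> ZR] i]) (simp add: compose_eq copair_simps)
    have iuv: "con ZR Z i u = con ZR Z i v"
    proof (rule less.hyps[OF _ ZR])
      have "z0 \<in> Orb" using Orb Z z0 by (force simp: gset_one)
      then show "card (fst ZR) < card (fst Z)"
        unfolding fR R_def using z0 finite_gset_finite[OF Z] by (intro psubset_card_mono) auto
      show "con ZR Z i u \<in> carrier (Mo ZR)" "con ZR Z i v \<in> carrier (Mo ZR)"
        using uv by (auto intro: con_closed[OF ZR Z i])
      fix z assume z: "z \<in> fst ZR"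
      then have zZ: "z \<in> fst Z" by (simp add: fR R_def)
      \<comment> \<open>Stabilizers and orbit maps in the complement are those of \<open>Z\<close>,
        so the hypothesis on \<open>Z\<close> passes to it.\<close>
      have st: "stabilizer G (snd ZR) z = stabilizer G (snd Z) z"
        using z fR by (auto simp: stabilizer_def)
      let ?K = "stabilizer G (snd Z) z"
      have K: "finite_gset G (cosets ?K)" by (rule finite_gset_cosets[OF stabilizer_subgroup[OF Z zZ]])
      note sR = stab_map[OF ZR z, unfolded st]
      have c: "compose (fst (cosets ?K)) i (stab_map ZR z) = stab_map Z z"
      proof (rule gmaps_eqI[OF gmaps_compose[OF sR(1) i K] stab_map(1)[OF Z zZ]])
        fix p assume p: "p \<in> fst (cosets ?K)"
        then obtain a where a: "a \<in> carrier G" "p = pc ?K a" by (auto simp: fst_cosets)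
        then show "compose (fst (cosets ?K)) i (stab_map ZR z) p = stab_map Z z p"
          using p z Rcl fR by (simp add: compose_eq sR stab_map(2)[OF Z zZ] i_def)
      qed
      have "con (cosets ?K) ZR (stab_map ZR z) (con ZR Z i w) = con (cosets ?K) Z (stab_map Z z) w"
        if "w \<in> carrier (Mo Z)" for w
        using con_compose[OF K ZR Z sR(1) i that] c by simp
      then show "con (cosets (stabilizer G (snd ZR) z)) ZR (stab_map ZR z) (con ZR Z i u) =
          con (cosets (stabilizer G (snd ZR) z)) ZR (stab_map ZR z) (con ZR Z i v)"
        unfolding st using uv less.prems(4)[OF zZ] by simp
    qed
    show "u = v"
    proof (rule con_bij_inj[OF U Z \<theta> bij uv], rule sum_eqI[OF L ZR])
      show "con ?U Z ?\<theta> u \<in> carrier (Mo ?U)" "con ?U Z ?\<theta> v \<in> carrier (Mo ?U)"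
        using uv by (auto intro: con_closed[OF U Z \<theta>])
    qed (use con_compose[OF L U Z InL \<theta>] con_compose[OF ZR U Z InR \<theta>] uv cL cR iuv
        less.prems(4)[OF z0] in simp_all)
  qed
qed

text \<open>Restriction to an orbit factors through a member of the cover: since
  \<open>\<iota> i\<close> is injective and equivariant, the stabilizer of
  \<open>\<iota> i y\<close> also fixes \<open>y\<close>, and the orbit map lifts to
  \<open>S i\<close>.\<close>

lemma cover_eqI:
  assumes Z: "finite_gset G Z" and uv: "u \<in> carrier (Mo Z)" "v \<in> carrier (Mo Z)"
    and S: "\<And>i. i \<in> I \<Longrightarrow> finite_gset G (S i)" and \<iota>: "\<And>i. i \<in> I \<Longrightarrow> \<iota> i \<in> gmaps G (S i) Z"
    and inj: "\<And>i. i \<in> I \<Longrightarrow> inj_on (\<iota> i) (fst (S i))" and cov: "fst Z \<subseteq> (\<Union>i\<in>I. \<iota> i ` fst (S i))"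
    and eq: "\<And>i. i \<in> I \<Longrightarrow> con (S i) Z (\<iota> i) u = con (S i) Z (\<iota> i) v"
  shows "u = v"
proof (rule orbits_eqI[OF Z uv])
  fix z assume z: "z \<in> fst Z"
  then obtain i y where i: "i \<in> I" and y: "y \<in> fst (S i)" "z = \<iota> i y" using cov by blast
  let ?K = "stabilizer G (snd Z) z"
  have K: "subgroup ?K G" by (rule stabilizer_subgroup[OF Z z])
  note gm = gmapsD[OF \<iota>[OF i]]
  have fix_y: "snd (S i) h y = y" if "h \<in> ?K" for h
  proof (rule inj_onD[OF inj[OF i]])
    show "\<iota> i (snd (S i) h y) = \<iota> i y" using stabilizerD[OF that] y gm by simp
  qed (use y stabilizerD[OF that] gset_closed[OF S[OF i]] in auto)
  note om = orbit_map[OF K S[OF i] y(1) fix_y]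
  have "compose (fst (cosets ?K)) (\<iota> i) (orbit_map (S i) ?K y) = stab_map Z z"
  proof (rule gmaps_eqI[OF gmaps_compose[OF om(1) \<iota>[OF i] finite_gset_cosets[OF K]] stab_map(1)[OF Z z]])
    fix p assume p: "p \<in> fst (cosets ?K)"
    then obtain a where a: "a \<in> carrier G" "p = pc ?K a" by (auto simp: fst_cosets)
    show "compose (fst (cosets ?K)) (\<iota> i) (orbit_map (S i) ?K y) p = stab_map Z z p"
      using p a y(1) by (simp add: compose_eq om gm stab_map(2)[OF Z z] flip: y(2))
  qed
  then show "con (cosets ?K) Z (stab_map Z z) u = con (cosets ?K) Z (stab_map Z z) v"
    using con_compose[OF finite_gset_cosets[OF K] S[OF i] Z om(1) \<iota>[OF i]] uv eq[OF i] by metis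
qed

text \<open>After restriction to the \<open>j\<close>-th member only the \<open>j\<close>-th term
  survives, and it returns the restriction of \<open>u\<close>.\<close>

lemma cover_decomp:
  assumes Z: "finite_gset G Z" and u: "u \<in> carrier (Mo Z)" and I: "finite I"
    and S: "\<And>i. i \<in> I \<Longrightarrow> finite_gset G (S i)" and \<iota>: "\<And>i. i \<in> I \<Longrightarrow> \<iota> i \<in> gmaps G (S i) Z"
    and inj: "\<And>i. i \<in> I \<Longrightarrow> inj_on (\<iota> i) (fst (S i))" and cov: "fst Z \<subseteq> (\<Union>i\<in>I. \<iota> i ` fst (S i))"
    and disj: "\<And>i j. i \<in> I \<Longrightarrow> j \<in> I \<Longrightarrow> i \<noteq> j \<Longrightarrow> \<iota> i ` fst (S i) \<inter> \<iota> j ` fst (S j) = {}"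
  shows "finprod (Mo Z) (\<lambda>i. cov (S i) Z (\<iota> i) (con (S i) Z (\<iota> i) u)) I = u"
proof -
  interpret MZ: comm_group "Mo Z" by (rule Mo_comm_group[OF Z])
  have cl: "con (S i) Z (\<iota> i) u \<in> carrier (Mo (S i))" if "i \<in> I" for i
    using con_closed[OF S[OF that] Z \<iota>[OF that] u] .
  have cl': "cov (S i) Z (\<iota> i) (con (S i) Z (\<iota> i) u) \<in> carrier (Mo Z)" if "i \<in> I" for i
    using cov_closed[OF S[OF that] Z \<iota>[OF that] cl[OF that]] .
  show ?thesis
  proof (rule cover_eqI[OF Z _ u S \<iota> inj cov])
    show "finprod (Mo Z) (\<lambda>i. cov (S i) Z (\<iota> i) (con (S i) Z (\<iota> i) u)) I \<in> carrier (Mo Z)"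
      using cl' by (intro MZ.finprod_closed) auto
    fix j assume j: "j \<in> I"
    interpret Mj: comm_group "Mo (S j)" by (rule Mo_comm_group[OF S[OF j]])
    have "con (S j) Z (\<iota> j) (finprod (Mo Z) (\<lambda>i. cov (S i) Z (\<iota> i) (con (S i) Z (\<iota> i) u)) I) =
        finprod (Mo (S j)) (\<lambda>i. con (S j) Z (\<iota> j) (cov (S i) Z (\<iota> i) (con (S i) Z (\<iota> i) u))) I"
      by (rule finprod_hom[OF Mo_comm_group[OF Z] Mo_comm_group[OF S[OF j]] con_hom(1)[OF S[OF j] Z \<iota>[OF j]] I cl'])
    also have "\<dots> = finprod (Mo (S j)) (\<lambda>i. if j = i then con (S i) Z (\<iota> i) u else \<one>\<^bsub>Mo (S j)\<^esub>) I"
    proof (rule Mj.finprod_cong')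
      fix i assume i: "i \<in> I"
      show "con (S j) Z (\<iota> j) (cov (S i) Z (\<iota> i) (con (S i) Z (\<iota> i) u)) =
          (if j = i then con (S i) Z (\<iota> i) u else \<one>\<^bsub>Mo (S j)\<^esub>)"
        using con_cov_inj[OF S[OF i] Z \<iota>[OF i] inj[OF i] cl[OF i]]
          con_cov_disjoint[OF S[OF j] S[OF i] Z \<iota>[OF j] \<iota>[OF i] disj[OF j i] cl[OF i]] by auto
    qed (use cl in auto)
    also have "\<dots> = con (S j) Z (\<iota> j) u"
    proof -
      have "finprod (Mo (S j)) (\<lambda>i. if j = i then con (S i) Z (\<iota> i) u else \<one>\<^bsub>Mo (S j)\<^esub>) I =
          finprod (Mo (S j)) (\<lambda>i. if j = i then con (S j) Z (\<iota> j) u else \<one>\<^bsub>Mo (S j)\<^esub>) I"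
        by (rule Mj.finprod_cong') (use cl[OF j] in auto)
      also have "\<dots> = con (S j) Z (\<iota> j) u"
        using Mj.finprod_singleton[OF j I, of "\<lambda>_. con (S j) Z (\<iota> j) u"] cl[OF j] by simp
      finally show ?thesis .
    qed
    finally show "con (S j) Z (\<iota> j) (finprod (Mo Z) (\<lambda>i. cov (S i) Z (\<iota> i) (con (S i) Z (\<iota> i) u)) I) =
      con (S j) Z (\<iota> j) u" .
  qed
qed

text \<open>On each orbit \<zeta> becomes one of the maps whose pushforward is the identity by
  hypothesis. That map is bijective, so pushforward after restriction along it is the identity, and
  hence restriction alone is too. Detection on orbits then yields the claim for
  \<open>Z\<close>.\<close>

lemma central_con:
  assumes conj: "conjugation_invariant G M" and Z: "finite_gset G Z" and \<zeta>: "central_map Z \<zeta>"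
    and u: "u \<in> carrier (Mo Z)"
  shows "con Z Z \<zeta> u = u"
proof -
  have \<zeta>g: "\<zeta> \<in> gmaps G Z Z" using \<zeta> by (simp add: central_map_def)
  show ?thesis
  proof (rule orbits_eqI[OF Z con_closed[OF Z Z \<zeta>g u] u])
    fix z assume z: "z \<in> fst Z"
    let ?L = "stabilizer G (snd Z) z"
    have L: "subgroup ?L G" by (rule stabilizer_subgroup[OF Z z])
    have Lg: "finite_gset G (cosets ?L)" by (rule finite_gset_cosets[OF L])
    note sm = stab_map[OF Z z]
    obtain c where c: "c \<in> centralizer G ?L" "\<zeta> z = snd Z c z"
      using \<zeta> z unfolding central_map_def by blast
    then have cC: "c \<in> carrier G" and cL: "\<And>h. h \<in> ?L \<Longrightarrow> c \<otimes> h = h \<otimes> c"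
      by (auto simp: centralizer_def)
    have fixc: "snd (cosets ?L) h (pc ?L c) = pc ?L c" if "h \<in> ?L" for h
      using that stabilizerD(1)[OF that] cC by (simp add: snd_cosets L pc_absorb flip: cL)
    have "pc ?L c \<in> fst (cosets ?L)" using cC by (simp add: fst_cosets)
    note om = orbit_map[OF L Lg this fixc]
    let ?\<phi> = "orbit_map (cosets ?L) ?L (pc ?L c)"
    \<comment> \<open>Right translation of representatives by \<open>inv c\<close> provides
      preimages; finiteness turns surjectivity into bijectivity.\<close>
    have "fst (cosets ?L) \<subseteq> ?\<phi> ` fst (cosets ?L)"
    proof
      fix p assume "p \<in> fst (cosets ?L)"
      then obtain a where a: "a \<in> carrier G" "p = pc ?L a" by (auto simp: fst_cosets)
      then have "?\<phi> (pc ?L (a \<otimes> inv c)) = p" using cC by (simp add: om snd_cosets L m_assoc)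
      then show "p \<in> ?\<phi> ` fst (cosets ?L)"
        using a cC by (intro image_eqI[of p ?\<phi> "pc ?L (a \<otimes> inv c)"]) (auto simp: fst_cosets)
    qed
    moreover have "?\<phi> ` fst (cosets ?L) \<subseteq> fst (cosets ?L)" using gmapsD(1)[OF om(1)] by blast
    ultimately have "?\<phi> ` fst (cosets ?L) = fst (cosets ?L)" by blast
    then have bij: "bij_betw ?\<phi> (fst (cosets ?L)) (fst (cosets ?L))"
      using finite_surj_inj[OF finite_gset_finite[OF Lg]] by (auto simp: bij_betw_def)
    have "?\<phi> (Coset ?L) = Coset (c <# ?L)"
      using om(2)[OF _ one_closed] cC by (simp add: pc_one L snd_cosets) (simp add: pc_def)
    then have "cov (cosets ?L) (cosets ?L) ?\<phi> = cat_id Ab (Mo (cosets ?L))"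
      using conj L c(1) om(1) unfolding conjugation_invariant_def by blast
    then have "con (cosets ?L) (cosets ?L) ?\<phi> w = w" if "w \<in> carrier (Mo (cosets ?L))" for w
      using cov_con_bij[OF Lg Lg om(1) bij that] con_closed[OF Lg Lg om(1) that] by (simp add: Ab_def)
    moreover have "compose (fst (cosets ?L)) \<zeta> (stab_map Z z) = compose (fst (cosets ?L)) (stab_map Z z) ?\<phi>"
    proof (rule gmaps_cosets_eqI[OF L gmaps_compose[OF sm(1) \<zeta>g Lg] gmaps_compose[OF om(1) sm(1) Lg]])
      have "pc ?L \<one> \<in> fst (cosets ?L)" by (simp add: fst_cosets)
      then show "compose (fst (cosets ?L)) \<zeta> (stab_map Z z) (pc ?L \<one>) =
          compose (fst (cosets ?L)) (stab_map Z z) ?\<phi> (pc ?L \<one>)"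
        using cC c(2) Z z by (simp add: compose_eq sm om snd_cosets L gset_one)
    qed
    ultimately show "con (cosets ?L) Z (stab_map Z z) (con Z Z \<zeta> u) = con (cosets ?L) Z (stab_map Z z) u"
      using con_compose[OF Lg Z Z sm(1) \<zeta>g u] con_compose[OF Lg Lg Z om(1) sm(1) u]
        con_closed[OF Lg Z sm(1) u] by simp
  qed
qed

end

section \<open>The action of virtual bisets\<close>

context fin_group
begin

text \<open>Statements about classes of conjugation bisets are reduced to spans through this
  presentation.\<close>

lemma biset_monoid_spanE:
  assumes H: "subgroup H2 G" "subgroup H1 G" and \<xi>: "\<xi> \<in> carrier (biset_monoid G H2 H1)"
  obtains Z p1 p2 where "is_span H2 H1 Z p1 p2" "\<xi> = biset_cls G H2 H1 (span_biset H2 H1 Z p1 p2)"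
proof -
  obtain X :: "('g, nat) biset" where X: "conj_biset G H2 H1 X" "\<xi> = biset_cls G H2 H1 X"
    using \<xi> by (rule biset_monoidE)
  obtain Z p1 p2 where Z: "is_span H2 H1 Z p1 p2" "biset_isomorphic H2 H1 X (span_biset H2 H1 Z p1 p2)"
    by (rule ex_span_if_conj_biset[OF H X(1)])
  show thesis
    using that[OF Z(1)] biset_cls_eqI[OF conj_bisetD[OF X(1)] Z(2)] unfolding X(2) by blast
qed

lemma finite_span_biset:
  assumes "subgroup H2 G" "subgroup H1 G" "is_span H2 H1 Z p1 p2"
  shows "finite_biset G H2 H1 (span_biset H2 H1 Z p1 p2)"
  by (rule conj_bisetD[OF conj_biset_span_biset[OF assms]])

lemma span_comp:
  assumes H: "subgroup H3 G" "subgroup H2 G" "subgroup H1 G"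
    and Z: "is_span H3 H2 Z p1 p2" and Z': "is_span H2 H1 Z' p1' p2'"
  obtains W \<Psi> \<Phi> m where "finite_gset G W" "\<Psi> \<in> gmaps G W Z" "\<Phi> \<in> gmaps G W Z'"
    "\<And>w. w \<in> fst W \<Longrightarrow> p1 (\<Psi> w) = p2' (\<Phi> w)"
    "\<And>x y. x \<in> fst Z \<Longrightarrow> y \<in> fst Z' \<Longrightarrow> p1 x = p2' y \<Longrightarrow> \<exists>!w. w \<in> fst W \<and> \<Psi> w = x \<and> \<Phi> w = y"
    "is_span H3 H1 W (compose (fst W) p1' \<Phi>) (compose (fst W) p2 \<Psi>)"
    "balanced_model H3 H2 H1 (span_biset H3 H2 Z p1 p2) (span_biset H2 H1 Z' p1' p2')
      (span_biset H3 H1 W (compose (fst W) p1' \<Phi>) (compose (fst W) p2 \<Psi>)) m"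
proof -
  have p: "finite_gset G Z" "p1 \<in> gmaps G Z (cosets H2)" "p2 \<in> gmaps G Z (cosets H3)"
    and p': "finite_gset G Z'" "p1' \<in> gmaps G Z' (cosets H1)" "p2' \<in> gmaps G Z' (cosets H2)"
    using Z Z' by (auto simp: is_span_def)
  obtain W \<Psi> \<Phi> where W: "finite_gset G W" "\<Psi> \<in> gmaps G W Z" "\<Phi> \<in> gmaps G W Z'"
    "\<And>w. w \<in> fst W \<Longrightarrow> p1 (\<Psi> w) = p2' (\<Phi> w)"
    "\<And>x y. x \<in> fst Z \<Longrightarrow> y \<in> fst Z' \<Longrightarrow> p1 x = p2' y \<Longrightarrow> \<exists>!w. w \<in> fst W \<and> \<Psi> w = x \<and> \<Phi> w = y"
    by (rule gset_pullback[OF p(1) p'(1) p(2) p'(3)]) blast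
  have S: "is_span H3 H1 W (compose (fst W) p1' \<Phi>) (compose (fst W) p2 \<Psi>)"
    using W gmaps_compose[OF W(2) p(3) W(1)] gmaps_compose[OF W(3) p'(2) W(1)] by (simp add: is_span_def)
  obtain m where m: "balanced_model H3 H2 H1 (span_biset H3 H2 Z p1 p2) (span_biset H2 H1 Z' p1' p2')
      (span_biset H3 H1 W (compose (fst W) p1' \<Phi>) (compose (fst W) p2 \<Psi>)) m"
    using span_biset_pullback[OF H Z Z' W] by blast
  show thesis by (rule that[OF W S m])
qed

lemma biset_cls_comp_closed:
  assumes H: "subgroup H3 G" "subgroup H2 G" "subgroup H1 G"
    and \<xi>: "\<xi> \<in> carrier (biset_monoid G H3 H2)" and \<eta>: "\<eta> \<in> carrier (biset_monoid G H2 H1)"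
  shows "biset_cls_comp G H3 H2 H1 \<xi> \<eta> \<in> carrier (biset_monoid G H3 H1)"
proof -
  obtain Z p1 p2 where Z: "is_span H3 H2 Z p1 p2" "\<xi> = biset_cls G H3 H2 (span_biset H3 H2 Z p1 p2)"
    by (rule biset_monoid_spanE[OF H(1,2) \<xi>])
  obtain Z' p1' p2' where Z': "is_span H2 H1 Z' p1' p2'" "\<eta> = biset_cls G H2 H1 (span_biset H2 H1 Z' p1' p2')"
    by (rule biset_monoid_spanE[OF H(2,3) \<eta>])
  obtain W \<Psi> \<Phi> m where W: "is_span H3 H1 W (compose (fst W) p1' \<Phi>) (compose (fst W) p2 \<Psi>)"
    and m: "balanced_model H3 H2 H1 (span_biset H3 H2 Z p1 p2) (span_biset H2 H1 Z' p1' p2')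
      (span_biset H3 H1 W (compose (fst W) p1' \<Phi>) (compose (fst W) p2 \<Psi>)) m"
    by (rule span_comp[OF H Z(1) Z'(1)])
  show ?thesis
    unfolding Z(2) Z'(2) biset_cls_comp_model[OF H finite_span_biset[OF H(1,2) Z(1)]
        finite_span_biset[OF H(2,3) Z'(1)] finite_span_biset[OF H(1,3) W] m]
    by (intro biset_cls_closed H conj_biset_span_biset W)
qed

text \<open>Sums of models are models for sums. Spans enter because their fibre products provide a
  model for every pair of factors.\<close>

lemma biset_cls_comp_mult_left:
  assumes H: "subgroup H3 G" "subgroup H2 G" "subgroup H1 G"
    and \<xi>: "\<xi> \<in> carrier (biset_monoid G H3 H2)" "\<xi>' \<in> carrier (biset_monoid G H3 H2)"
    and \<eta>: "\<eta> \<in> carrier (biset_monoid G H2 H1)"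
  shows "biset_cls_comp G H3 H2 H1 (\<xi> \<otimes>\<^bsub>biset_monoid G H3 H2\<^esub> \<xi>') \<eta> =
    biset_cls_comp G H3 H2 H1 \<xi> \<eta> \<otimes>\<^bsub>biset_monoid G H3 H1\<^esub> biset_cls_comp G H3 H2 H1 \<xi>' \<eta>"
proof -
  obtain Z p1 p2 where Z: "is_span H3 H2 Z p1 p2" "\<xi> = biset_cls G H3 H2 (span_biset H3 H2 Z p1 p2)"
    by (rule biset_monoid_spanE[OF H(1,2) \<xi>(1)])
  obtain Y q1 q2 where Y: "is_span H3 H2 Y q1 q2" "\<xi>' = biset_cls G H3 H2 (span_biset H3 H2 Y q1 q2)"
    by (rule biset_monoid_spanE[OF H(1,2) \<xi>(2)])
  obtain Z' p1' p2' where Z': "is_span H2 H1 Z' p1' p2'" "\<eta> = biset_cls G H2 H1 (span_biset H2 H1 Z' p1' p2')"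
    by (rule biset_monoid_spanE[OF H(2,3) \<eta>])
  obtain W \<Psi> \<Phi> m where W: "is_span H3 H1 W (compose (fst W) p1' \<Phi>) (compose (fst W) p2 \<Psi>)"
    and m: "balanced_model H3 H2 H1 (span_biset H3 H2 Z p1 p2) (span_biset H2 H1 Z' p1' p2')
      (span_biset H3 H1 W (compose (fst W) p1' \<Phi>) (compose (fst W) p2 \<Psi>)) m"
    by (rule span_comp[OF H Z(1) Z'(1)])
  obtain V \<Psi>' \<Phi>' n where V: "is_span H3 H1 V (compose (fst V) p1' \<Phi>') (compose (fst V) q2 \<Psi>')"
    and n: "balanced_model H3 H2 H1 (span_biset H3 H2 Y q1 q2) (span_biset H2 H1 Z' p1' p2')
      (span_biset H3 H1 V (compose (fst V) p1' \<Phi>') (compose (fst V) q2 \<Psi>')) n"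
    by (rule span_comp[OF H Y(1) Z'(1)])
  note f = finite_span_biset[OF H(1,2) Z(1)] finite_span_biset[OF H(1,2) Y(1)]
    finite_span_biset[OF H(2,3) Z'(1)] finite_span_biset[OF H(1,3) W] finite_span_biset[OF H(1,3) V]
  show ?thesis
    unfolding Z(2) Y(2) Z'(2) biset_cls_mult[OF H(1,2) f(1,2)]
      biset_cls_comp_model[OF H f(1,3,4) m] biset_cls_comp_model[OF H f(2,3,5) n]
      biset_cls_mult[OF H(1,3) f(4,5)]
    by (rule biset_cls_comp_model[OF H finite_biset_sum[OF f(1,2)] f(3) finite_biset_sum[OF f(4,5)]
          balanced_model_suml[OF m n]])
qed

lemma biset_cls_comp_mult_right:
  assumes H: "subgroup H3 G" "subgroup H2 G" "subgroup H1 G"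
    and \<xi>: "\<xi> \<in> carrier (biset_monoid G H3 H2)"
    and \<eta>: "\<eta> \<in> carrier (biset_monoid G H2 H1)" "\<eta>' \<in> carrier (biset_monoid G H2 H1)"
  shows "biset_cls_comp G H3 H2 H1 \<xi> (\<eta> \<otimes>\<^bsub>biset_monoid G H2 H1\<^esub> \<eta>') =
    biset_cls_comp G H3 H2 H1 \<xi> \<eta> \<otimes>\<^bsub>biset_monoid G H3 H1\<^esub> biset_cls_comp G H3 H2 H1 \<xi> \<eta>'"
proof -
  obtain Z p1 p2 where Z: "is_span H3 H2 Z p1 p2" "\<xi> = biset_cls G H3 H2 (span_biset H3 H2 Z p1 p2)"
    by (rule biset_monoid_spanE[OF H(1,2) \<xi>])
  obtain Z' p1' p2' where Z': "is_span H2 H1 Z' p1' p2'" "\<eta> = biset_cls G H2 H1 (span_biset H2 H1 Z' p1' p2')"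
    by (rule biset_monoid_spanE[OF H(2,3) \<eta>(1)])
  obtain Y q1 q2 where Y: "is_span H2 H1 Y q1 q2" "\<eta>' = biset_cls G H2 H1 (span_biset H2 H1 Y q1 q2)"
    by (rule biset_monoid_spanE[OF H(2,3) \<eta>(2)])
  obtain W \<Psi> \<Phi> m where W: "is_span H3 H1 W (compose (fst W) p1' \<Phi>) (compose (fst W) p2 \<Psi>)"
    and m: "balanced_model H3 H2 H1 (span_biset H3 H2 Z p1 p2) (span_biset H2 H1 Z' p1' p2')
      (span_biset H3 H1 W (compose (fst W) p1' \<Phi>) (compose (fst W) p2 \<Psi>)) m"
    by (rule span_comp[OF H Z(1) Z'(1)])
  obtain V \<Psi>' \<Phi>' n where V: "is_span H3 H1 V (compose (fst V) q1 \<Phi>') (compose (fst V) p2 \<Psi>')"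
    and n: "balanced_model H3 H2 H1 (span_biset H3 H2 Z p1 p2) (span_biset H2 H1 Y q1 q2)
      (span_biset H3 H1 V (compose (fst V) q1 \<Phi>') (compose (fst V) p2 \<Psi>')) n"
    by (rule span_comp[OF H Z(1) Y(1)])
  note f = finite_span_biset[OF H(1,2) Z(1)] finite_span_biset[OF H(2,3) Z'(1)]
    finite_span_biset[OF H(2,3) Y(1)] finite_span_biset[OF H(1,3) W] finite_span_biset[OF H(1,3) V]
  show ?thesis
    unfolding Z(2) Y(2) Z'(2) biset_cls_mult[OF H(2,3) f(2,3)]
      biset_cls_comp_model[OF H f(1,2,4) m] biset_cls_comp_model[OF H f(1,3,5) n]
      biset_cls_mult[OF H(1,3) f(4,5)]
    by (rule biset_cls_comp_model[OF H f(1) finite_biset_sum[OF f(2,3)] finite_biset_sum[OF f(4,5)]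
          balanced_model_sumr[OF m n]])
qed

lemma virtual_comp_cls:
  assumes H: "subgroup H3 G" "subgroup H2 G" "subgroup H1 G"
    and a: "a \<in> carrier (biset_monoid G H3 H2)" "b \<in> carrier (biset_monoid G H3 H2)"
    and c: "c \<in> carrier (biset_monoid G H2 H1)" "d \<in> carrier (biset_monoid G H2 H1)"
  shows "virtual_comp G H3 H2 H1 (groth_cls (biset_monoid G H3 H2) a b)
      (groth_cls (biset_monoid G H2 H1) c d) =
    groth_cls (biset_monoid G H3 H1)
      (biset_cls_comp G H3 H2 H1 a c \<otimes>\<^bsub>biset_monoid G H3 H1\<^esub> biset_cls_comp G H3 H2 H1 b d)
      (biset_cls_comp G H3 H2 H1 a d \<otimes>\<^bsub>biset_monoid G H3 H1\<^esub> biset_cls_comp G H3 H2 H1 b c)"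
  unfolding virtual_comp_def
  by (intro groth_bilinear biset_monoid_comm_monoid H biset_cls_comp_closed
      biset_cls_comp_mult_left biset_cls_comp_mult_right a c)

lemma virtual_bisets_comm_group:
  "subgroup H2 G \<Longrightarrow> subgroup H1 G \<Longrightarrow> comm_group (virtual_bisets G H2 H1)"
  unfolding virtual_bisets_def by (intro comm_monoid.groth_comm_group biset_monoid_comm_monoid)

lemma virtual_bisetsE:
  assumes "subgroup H2 G" "subgroup H1 G" "\<xi> \<in> carrier (virtual_bisets G H2 H1)"
  obtains a b where "a \<in> carrier (biset_monoid G H2 H1)" "b \<in> carrier (biset_monoid G H2 H1)"
    "\<xi> = groth_cls (biset_monoid G H2 H1) a b"
  using comm_monoid.groth_carrierE[OF biset_monoid_comm_monoid[OF assms(1,2)]] assms(3)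
  unfolding virtual_bisets_def by blast

lemma virtual_comp_closed:
  assumes H: "subgroup H3 G" "subgroup H2 G" "subgroup H1 G"
    and \<xi>: "\<xi> \<in> carrier (virtual_bisets G H3 H2)" and \<eta>: "\<eta> \<in> carrier (virtual_bisets G H2 H1)"
  shows "virtual_comp G H3 H2 H1 \<xi> \<eta> \<in> carrier (virtual_bisets G H3 H1)"
proof -
  obtain a b where ab: "a \<in> carrier (biset_monoid G H3 H2)" "b \<in> carrier (biset_monoid G H3 H2)"
    "\<xi> = groth_cls (biset_monoid G H3 H2) a b" by (rule virtual_bisetsE[OF H(1,2) \<xi>])
  obtain c d where cd: "c \<in> carrier (biset_monoid G H2 H1)" "d \<in> carrier (biset_monoid G H2 H1)"
    "\<eta> = groth_cls (biset_monoid G H2 H1) c d" by (rule virtual_bisetsE[OF H(2,3) \<eta>])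
  interpret C: comm_monoid "biset_monoid G H3 H1" by (rule biset_monoid_comm_monoid[OF H(1,3)])
  show ?thesis
    unfolding ab(3) cd(3) virtual_comp_cls[OF H ab(1,2) cd(1,2)] virtual_bisets_def
    by (intro C.groth_cls_closed C.m_closed biset_cls_comp_closed[OF H] ab cd)
qed

lemma virtual_cls_eq:
  "virtual_cls G H2 H1 X = groth_cls (biset_monoid G H2 H1) (biset_cls G H2 H1 X) \<one>\<^bsub>biset_monoid G H2 H1\<^esub>"
  by (simp add: virtual_cls_def groth_of_def groth_cls_def)

lemma virtual_cls_closed:
  assumes H: "subgroup H2 G" "subgroup H1 G" and X: "conj_biset G H2 H1 X"
  shows "virtual_cls G H2 H1 X \<in> carrier (virtual_bisets G H2 H1)"
proof -
  interpret C: comm_monoid "biset_monoid G H2 H1" by (rule biset_monoid_comm_monoid[OF H])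
  show ?thesis unfolding virtual_cls_eq virtual_bisets_def
    by (intro C.groth_cls_closed biset_cls_closed H X C.one_closed)
qed

end

section \<open>Spans acting on a Mackey functor\<close>

context mackey
begin

definition span_val ::
    "'g set \<Rightarrow> 'g set \<Rightarrow> 'g gset \<Rightarrow> ('g pt \<Rightarrow> 'g pt) \<Rightarrow> ('g pt \<Rightarrow> 'g pt) \<Rightarrow> 'a \<Rightarrow> 'a" where
  "span_val H2 H1 Z p1 p2 u = cov Z (cosets H2) p2 (con Z (cosets H1) p1 u)"

lemma span_val_hom:
  assumes H: "subgroup H2 G" "subgroup H1 G" and Z: "is_span H2 H1 Z p1 p2"
  shows "span_val H2 H1 Z p1 p2 \<in> hom (Mo (cosets H1)) (Mo (cosets H2))"
proof -
  have Z: "finite_gset G Z" "p1 \<in> gmaps G Z (cosets H1)" "p2 \<in> gmaps G Z (cosets H2)"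
    using Z by (auto simp: is_span_def)
  show ?thesis
    by (rule homI) (auto simp: span_val_def Z finite_gset_cosets H con_mult cov_mult cov_closed con_closed)
qed

text \<open>The element pulled back to the sum is decomposed along the two summands, and each part
  is pushed forward separately.\<close>

lemma span_val_sum:
  assumes H: "subgroup H2 G" "subgroup H1 G" and S: "is_span H2 H1 Z p1 p2" "is_span H2 H1 Z' p1' p2'"
    and u: "u \<in> carrier (Mo (cosets H1))"
  shows "span_val H2 H1 (gset_sum G Z Z') (copair Z Z' p1 p1') (copair Z Z' p2 p2') u =
    span_val H2 H1 Z p1 p2 u \<otimes>\<^bsub>Mo (cosets H2)\<^esub> span_val H2 H1 Z' p1' p2' u"
proof -
  have Z: "finite_gset G Z" "p1 \<in> gmaps G Z (cosets H1)" "p2 \<in> gmaps G Z (cosets H2)"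
    and Z': "finite_gset G Z'" "p1' \<in> gmaps G Z' (cosets H1)" "p2' \<in> gmaps G Z' (cosets H2)"
    using S by (auto simp: is_span_def)
  let ?U = "gset_sum G Z Z'"
  have U: "finite_gset G ?U" using Z Z' finite_gset_sum by blast
  note c1 = gmaps_copair[OF Z(1) Z'(1) Z(2) Z'(2)] and c2 = gmaps_copair[OF Z(1) Z'(1) Z(3) Z'(3)]
  note L = gmaps_InL[OF Z(1), of Z'] and R = gmaps_InR[OF Z'(1), of Z]
  note C1 = finite_gset_cosets[OF H(2)] and C2 = finite_gset_cosets[OF H(1)]
  let ?w = "con ?U (cosets H1) (copair Z Z' p1 p1') u"
  have w: "?w \<in> carrier (Mo ?U)" by (rule con_closed[OF U C1 c1 u])
  have cL: "compose (fst Z) (copair Z Z' p1 p1') (\<lambda>x\<in>fst Z. InL x) = p1"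
    "compose (fst Z) (copair Z Z' p2 p2') (\<lambda>x\<in>fst Z. InL x) = p2"
    by (rule gmaps_eqI[OF gmaps_compose[OF L c1 Z(1)] Z(2)], simp add: compose_eq copair_simps,
        rule gmaps_eqI[OF gmaps_compose[OF L c2 Z(1)] Z(3)], simp add: compose_eq copair_simps)
  have cR: "compose (fst Z') (copair Z Z' p1 p1') (\<lambda>x\<in>fst Z'. InR x) = p1'"
    "compose (fst Z') (copair Z Z' p2 p2') (\<lambda>x\<in>fst Z'. InR x) = p2'"
    by (rule gmaps_eqI[OF gmaps_compose[OF R c1 Z'(1)] Z'(2)], simp add: compose_eq copair_simps,
        rule gmaps_eqI[OF gmaps_compose[OF R c2 Z'(1)] Z'(3)], simp add: compose_eq copair_simps)
  have wL: "con Z ?U (\<lambda>x\<in>fst Z. InL x) ?w = con Z (cosets H1) p1 u"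
    using con_compose[OF Z(1) U C1 L c1 u] cL by simp
  have wR: "con Z' ?U (\<lambda>x\<in>fst Z'. InR x) ?w = con Z' (cosets H1) p1' u"
    using con_compose[OF Z'(1) U C1 R c1 u] cR by simp
  have kL: "con Z (cosets H1) p1 u \<in> carrier (Mo Z)" by (rule con_closed[OF Z(1) C1 Z(2) u])
  have kR: "con Z' (cosets H1) p1' u \<in> carrier (Mo Z')" by (rule con_closed[OF Z'(1) C1 Z'(2) u])
  have "?w = cov Z ?U (\<lambda>x\<in>fst Z. InL x) (con Z (cosets H1) p1 u) \<otimes>\<^bsub>Mo ?U\<^esub>
      cov Z' ?U (\<lambda>x\<in>fst Z'. InR x) (con Z' (cosets H1) p1' u)"
    using sum_decomp[OF Z(1) Z'(1) w] unfolding wL wR .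
  then show ?thesis
    unfolding span_val_def
    using cov_mult[OF U C2 c2 cov_closed[OF Z(1) U L kL] cov_closed[OF Z'(1) U R kR]]
      cov_compose[OF Z(1) U C2 L c2 kL] cov_compose[OF Z'(1) U C2 R c2 kR] cL cR by simp
qed

text \<open>Base change across the fibre product exchanges the inner pushforward with the following
  restriction; functoriality combines the outer maps.\<close>

lemma span_val_comp:
  assumes H: "subgroup H3 G" "subgroup H2 G" "subgroup H1 G"
    and Z: "is_span H3 H2 Z p1 p2" and Z': "is_span H2 H1 Z' p1' p2'"
    and W: "finite_gset G W" "\<Psi> \<in> gmaps G W Z" "\<Phi> \<in> gmaps G W Z'"
      "\<And>w. w \<in> fst W \<Longrightarrow> p1 (\<Psi> w) = p2' (\<Phi> w)"
      "\<And>x y. x \<in> fst Z \<Longrightarrow> y \<in> fst Z' \<Longrightarrow> p1 x = p2' y \<Longrightarrow> \<exists>!w. w \<in> fst W \<and> \<Psi> w = x \<and> \<Phi> w = y"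
    and u: "u \<in> carrier (Mo (cosets H1))"
  shows "span_val H3 H1 W (compose (fst W) p1' \<Phi>) (compose (fst W) p2 \<Psi>) u =
    span_val H3 H2 Z p1 p2 (span_val H2 H1 Z' p1' p2' u)"
proof -
  have p: "finite_gset G Z" "p1 \<in> gmaps G Z (cosets H2)" "p2 \<in> gmaps G Z (cosets H3)"
    and p': "finite_gset G Z'" "p1' \<in> gmaps G Z' (cosets H1)" "p2' \<in> gmaps G Z' (cosets H2)"
    using Z Z' by (auto simp: is_span_def)
  note C = finite_gset_cosets[OF H(1)] finite_gset_cosets[OF H(2)] finite_gset_cosets[OF H(3)]
  have k: "con Z' (cosets H1) p1' u \<in> carrier (Mo Z')" by (rule con_closed[OF p'(1) C(3) p'(2) u])
  note k' = con_closed[OF W(1) p'(1) W(3) k]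
  have eq: "con Z (cosets H2) p1 (cov Z' (cosets H2) p2' (con Z' (cosets H1) p1' u)) =
      cov W Z \<Psi> (con W Z' \<Phi> (con Z' (cosets H1) p1' u))"
    by (rule base_change[OF W(1) p(1) p'(1) C(2) W(2,3) p(2) p'(3) W(4) W(5) k])
  show ?thesis
    unfolding span_val_def con_compose[OF W(1) p'(1) C(3) W(3) p'(2) u]
      cov_compose[OF W(1) p(1) C(1) W(2) p(3) k'] eq
    by (rule refl)
qed

end

section \<open>Descent of the action to virtual bisets\<close>

locale conj_mackey = mackey G M
  for G :: "('g, 'k) monoid_scheme" (structure) and M :: "('g, 'a) gset_bifunc" +
  assumes conj_inv: "conjugation_invariant G M"
begin

text \<open>Here conjugation invariance enters: the first legs agree up to \<zeta>, and restriction
  along \<zeta> is the identity. The bijection \<open>e\<close> disappears because pushforward after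
  restriction along it is the identity.\<close>

lemma span_val_iso:
  assumes H: "subgroup H2 G" "subgroup H1 G"
    and Z: "is_span H2 H1 Z p1 p2" and Z': "is_span H2 H1 Z' p1' p2'"
    and iso: "biset_isomorphic H2 H1 (span_biset H2 H1 Z p1 p2) (span_biset H2 H1 Z' p1' p2')"
    and u: "u \<in> carrier (Mo (cosets H1))"
  shows "span_val H2 H1 Z p1 p2 u = span_val H2 H1 Z' p1' p2' u"
proof -
  have p: "finite_gset G Z" "p1 \<in> gmaps G Z (cosets H1)" "p2 \<in> gmaps G Z (cosets H2)"
    and p': "finite_gset G Z'" "p1' \<in> gmaps G Z' (cosets H1)" "p2' \<in> gmaps G Z' (cosets H2)"
    using Z Z' by (auto simp: is_span_def)
  note C1 = finite_gset_cosets[OF H(2)] and C2 = finite_gset_cosets[OF H(1)]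
  obtain e \<zeta> where e: "e \<in> gmaps G Z Z'" "bij_betw e (fst Z) (fst Z')" and \<zeta>: "central_map Z \<zeta>"
    and e2: "\<And>z. z \<in> fst Z \<Longrightarrow> p2' (e z) = p2 z" and e1: "\<And>z. z \<in> fst Z \<Longrightarrow> p1' (e z) = p1 (\<zeta> z)"
    by (rule span_biset_iso[OF H Z Z' iso]) blast
  have \<zeta>g: "\<zeta> \<in> gmaps G Z Z" using \<zeta> by (simp add: central_map_def)
  have c1: "compose (fst Z) p1' e = compose (fst Z) p1 \<zeta>" using e1 by (auto simp: compose_def)
  have c2: "compose (fst Z) p2' e = p2"
    by (rule gmaps_eqI[OF gmaps_compose[OF e(1) p'(3) p(1)] p(3)]) (simp add: compose_eq e2)
  have k: "con Z (cosets H1) p1 u \<in> carrier (Mo Z)" by (rule con_closed[OF p(1) C1 p(2) u])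
  have k': "con Z' (cosets H1) p1' u \<in> carrier (Mo Z')" by (rule con_closed[OF p'(1) C1 p'(2) u])
  have "con Z Z' e (con Z' (cosets H1) p1' u) = con Z (cosets H1) (compose (fst Z) p1' e) u"
    by (rule con_compose[OF p(1) p'(1) C1 e(1) p'(2) u, symmetric])
  also have "\<dots> = con Z Z \<zeta> (con Z (cosets H1) p1 u)"
    unfolding c1 by (rule con_compose[OF p(1) p(1) C1 \<zeta>g p(2) u])
  also have "\<dots> = con Z (cosets H1) p1 u" by (rule central_con[OF conj_inv p(1) \<zeta> k])
  finally have ek: "con Z Z' e (con Z' (cosets H1) p1' u) = con Z (cosets H1) p1 u" .
  have "span_val H2 H1 Z p1 p2 u = cov Z (cosets H2) (compose (fst Z) p2' e) (con Z (cosets H1) p1 u)"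
    by (simp add: span_val_def c2)
  also have "\<dots> = cov Z' (cosets H2) p2' (cov Z Z' e (con Z Z' e (con Z' (cosets H1) p1' u)))"
    unfolding ek by (rule cov_compose[OF p(1) p'(1) C2 e(1) p'(3) k])
  also have "\<dots> = span_val H2 H1 Z' p1' p2' u"
    by (simp add: span_val_def cov_con_bij[OF p(1) p'(1) e k'])
  finally show ?thesis .
qed

text \<open>A class is presented by many spans; for \<open>u\<close> in the carrier
  \<open>span_val_iso\<close> makes the value unique and so justifies \<open>THE\<close>.\<close>

definition biset_val :: "'g set \<Rightarrow> 'g set \<Rightarrow> 'g biset_class \<Rightarrow> 'a \<Rightarrow> 'a" where
  "biset_val H2 H1 \<xi> u = (THE v. \<exists>Z p1 p2. is_span H2 H1 Z p1 p2 \<and>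
     \<xi> = biset_cls G H2 H1 (span_biset H2 H1 Z p1 p2) \<and> v = span_val H2 H1 Z p1 p2 u)"

lemma biset_val_span:
  assumes H: "subgroup H2 G" "subgroup H1 G" and Z: "is_span H2 H1 Z p1 p2"
    and u: "u \<in> carrier (Mo (cosets H1))"
  shows "biset_val H2 H1 (biset_cls G H2 H1 (span_biset H2 H1 Z p1 p2)) u = span_val H2 H1 Z p1 p2 u"
  unfolding biset_val_def
proof (rule the_equality)
  fix v assume "\<exists>Z' p1' p2'. is_span H2 H1 Z' p1' p2' \<and> biset_cls G H2 H1 (span_biset H2 H1 Z p1 p2) =
     biset_cls G H2 H1 (span_biset H2 H1 Z' p1' p2') \<and> v = span_val H2 H1 Z' p1' p2' u"
  then obtain Z' p1' p2' where Z': "is_span H2 H1 Z' p1' p2'" and v: "v = span_val H2 H1 Z' p1' p2' u"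
    and e: "biset_cls G H2 H1 (span_biset H2 H1 Z p1 p2) = biset_cls G H2 H1 (span_biset H2 H1 Z' p1' p2')"
    by blast
  show "v = span_val H2 H1 Z p1 p2 u"
    unfolding v using span_val_iso[OF H Z Z' _ u] biset_cls_eqD[OF H finite_span_biset[OF H Z]
        finite_span_biset[OF H Z'] e] by simp
qed (use Z in blast)

lemma biset_val_hom:
  assumes H: "subgroup H2 G" "subgroup H1 G" and \<xi>: "\<xi> \<in> carrier (biset_monoid G H2 H1)"
  shows "biset_val H2 H1 \<xi> \<in> hom (Mo (cosets H1)) (Mo (cosets H2))"
proof -
  obtain Z p1 p2 where Z: "is_span H2 H1 Z p1 p2" "\<xi> = biset_cls G H2 H1 (span_biset H2 H1 Z p1 p2)"
    by (rule biset_monoid_spanE[OF H \<xi>])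
  have C: "comm_group (Mo (cosets H1))" by (intro Mo_comm_group finite_gset_cosets H)
  interpret comm_group "Mo (cosets H1)" by (rule C)
  show ?thesis
    unfolding Z(2) using span_val_hom[OF H Z(1)]
    by (auto simp: hom_def Pi_def biset_val_span[OF H Z(1)])
qed

lemma biset_val_mult:
  assumes H: "subgroup H2 G" "subgroup H1 G" and \<xi>: "\<xi> \<in> carrier (biset_monoid G H2 H1)"
    and \<eta>: "\<eta> \<in> carrier (biset_monoid G H2 H1)" and u: "u \<in> carrier (Mo (cosets H1))"
  shows "biset_val H2 H1 (\<xi> \<otimes>\<^bsub>biset_monoid G H2 H1\<^esub> \<eta>) u =
    biset_val H2 H1 \<xi> u \<otimes>\<^bsub>Mo (cosets H2)\<^esub> biset_val H2 H1 \<eta> u"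
proof -
  obtain Z p1 p2 where Z: "is_span H2 H1 Z p1 p2" "\<xi> = biset_cls G H2 H1 (span_biset H2 H1 Z p1 p2)"
    by (rule biset_monoid_spanE[OF H \<xi>])
  obtain Y q1 q2 where Y: "is_span H2 H1 Y q1 q2" "\<eta> = biset_cls G H2 H1 (span_biset H2 H1 Y q1 q2)"
    by (rule biset_monoid_spanE[OF H \<eta>])
  note f = finite_span_biset[OF H Z(1)] finite_span_biset[OF H Y(1)]
  note s = span_biset_sum[OF H(1) Z(1) Y(1)]
  show ?thesis
    unfolding Z(2) Y(2) biset_cls_mult[OF H f] biset_cls_eqI[OF finite_biset_sum[OF f] s(2)]
      biset_val_span[OF H s(1) u] biset_val_span[OF H Z(1) u] biset_val_span[OF H Y(1) u]
    by (rule span_val_sum[OF H Z(1) Y(1) u])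
qed

text \<open>The composite class is presented by the fibre product of the two spans, where
  \<open>span_val_comp\<close> applies.\<close>

lemma biset_val_comp:
  assumes H: "subgroup H3 G" "subgroup H2 G" "subgroup H1 G"
    and \<xi>: "\<xi> \<in> carrier (biset_monoid G H3 H2)" and \<eta>: "\<eta> \<in> carrier (biset_monoid G H2 H1)"
    and u: "u \<in> carrier (Mo (cosets H1))"
  shows "biset_val H3 H1 (biset_cls_comp G H3 H2 H1 \<xi> \<eta>) u = biset_val H3 H2 \<xi> (biset_val H2 H1 \<eta> u)"
proof -
  obtain Z p1 p2 where Z: "is_span H3 H2 Z p1 p2" "\<xi> = biset_cls G H3 H2 (span_biset H3 H2 Z p1 p2)"
    by (rule biset_monoid_spanE[OF H(1,2) \<xi>])
  obtain Z' p1' p2' where Z': "is_span H2 H1 Z' p1' p2'" "\<eta> = biset_cls G H2 H1 (span_biset H2 H1 Z' p1' p2')"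
    by (rule biset_monoid_spanE[OF H(2,3) \<eta>])
  obtain W \<Psi> \<Phi> m where W: "finite_gset G W" "\<Psi> \<in> gmaps G W Z" "\<Phi> \<in> gmaps G W Z'"
    "\<And>w. w \<in> fst W \<Longrightarrow> p1 (\<Psi> w) = p2' (\<Phi> w)"
    "\<And>x y. x \<in> fst Z \<Longrightarrow> y \<in> fst Z' \<Longrightarrow> p1 x = p2' y \<Longrightarrow> \<exists>!w. w \<in> fst W \<and> \<Psi> w = x \<and> \<Phi> w = y"
    and S: "is_span H3 H1 W (compose (fst W) p1' \<Phi>) (compose (fst W) p2 \<Psi>)"
    and m: "balanced_model H3 H2 H1 (span_biset H3 H2 Z p1 p2) (span_biset H2 H1 Z' p1' p2')
      (span_biset H3 H1 W (compose (fst W) p1' \<Phi>) (compose (fst W) p2 \<Psi>)) m"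
    by (rule span_comp[OF H Z(1) Z'(1)]) blast
  have v: "span_val H2 H1 Z' p1' p2' u \<in> carrier (Mo (cosets H2))"
    using span_val_hom[OF H(2,3) Z'(1)] u by (rule hom_in_carrier)
  show ?thesis
    unfolding Z(2) Z'(2) biset_cls_comp_model[OF H finite_span_biset[OF H(1,2) Z(1)]
        finite_span_biset[OF H(2,3) Z'(1)] finite_span_biset[OF H(1,3) S] m]
      biset_val_span[OF H(1,3) S u] biset_val_span[OF H(2,3) Z'(1) u] biset_val_span[OF H(1,2) Z(1) v]
    by (rule span_val_comp[OF H Z(1) Z'(1) W u])
qed

text \<open>The value at the neutral class is an idempotent of a group.\<close>

lemma biset_val_one:
  assumes H: "subgroup H2 G" "subgroup H1 G" and u: "u \<in> carrier (Mo (cosets H1))"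
  shows "biset_val H2 H1 \<one>\<^bsub>biset_monoid G H2 H1\<^esub> u = \<one>\<^bsub>Mo (cosets H2)\<^esub>"
proof -
  interpret B: comm_monoid "biset_monoid G H2 H1" by (rule biset_monoid_comm_monoid[OF H])
  interpret C: comm_group "Mo (cosets H2)" by (intro Mo_comm_group finite_gset_cosets H)
  let ?v = "biset_val H2 H1 \<one>\<^bsub>biset_monoid G H2 H1\<^esub> u"
  have "?v \<in> carrier (Mo (cosets H2))" by (rule hom_in_carrier[OF biset_val_hom[OF H B.one_closed] u])
  moreover have "?v \<otimes>\<^bsub>Mo (cosets H2)\<^esub> ?v = ?v"
    using biset_val_mult[OF H B.one_closed B.one_closed u] by simp
  ultimately show ?thesis by simp
qed

definition virtual_val :: "'g set \<Rightarrow> 'g set \<Rightarrow> 'g virtual_biset \<Rightarrow> 'a \<Rightarrow> 'a" where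
  "virtual_val H2 H1 \<xi> u = groth_lift (biset_monoid G H2 H1) (Mo (cosets H2)) (\<lambda>a. biset_val H2 H1 a u) \<xi>"

lemma virtual_val_cls:
  assumes H: "subgroup H2 G" "subgroup H1 G" and u: "u \<in> carrier (Mo (cosets H1))"
    and ab: "a \<in> carrier (biset_monoid G H2 H1)" "b \<in> carrier (biset_monoid G H2 H1)"
  shows "virtual_val H2 H1 (groth_cls (biset_monoid G H2 H1) a b) u =
    biset_val H2 H1 a u \<otimes>\<^bsub>Mo (cosets H2)\<^esub> inv\<^bsub>Mo (cosets H2)\<^esub> biset_val H2 H1 b u"
  unfolding virtual_val_def
  by (rule comm_monoid.groth_lift_cls[OF biset_monoid_comm_monoid[OF H] Mo_comm_group[OF finite_gset_cosets[OF H(1)]]])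
    (auto intro: hom_in_carrier[OF biset_val_hom[OF H] u] ab simp: biset_val_mult[OF H _ _ u])

lemma virtual_val_mult:
  assumes H: "subgroup H2 G" "subgroup H1 G" and u: "u \<in> carrier (Mo (cosets H1))"
    and \<xi>: "\<xi> \<in> carrier (virtual_bisets G H2 H1)" and \<eta>: "\<eta> \<in> carrier (virtual_bisets G H2 H1)"
  shows "virtual_val H2 H1 (\<xi> \<otimes>\<^bsub>virtual_bisets G H2 H1\<^esub> \<eta>) u =
    virtual_val H2 H1 \<xi> u \<otimes>\<^bsub>Mo (cosets H2)\<^esub> virtual_val H2 H1 \<eta> u"
  using \<xi> \<eta> unfolding virtual_val_def virtual_bisets_def
  by (intro comm_monoid.groth_lift_mult(1)[OF biset_monoid_comm_monoid[OF H] Mo_comm_group[OF finite_gset_cosets[OF H(1)]]])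
    (auto intro: hom_in_carrier[OF biset_val_hom[OF H] u] simp: biset_val_mult[OF H _ _ u])

lemma virtual_val_hom:
  assumes H: "subgroup H2 G" "subgroup H1 G" and \<xi>: "\<xi> \<in> carrier (virtual_bisets G H2 H1)"
  shows "virtual_val H2 H1 \<xi> \<in> hom (Mo (cosets H1)) (Mo (cosets H2))"
proof -
  obtain a b where ab: "a \<in> carrier (biset_monoid G H2 H1)" "b \<in> carrier (biset_monoid G H2 H1)"
    "\<xi> = groth_cls (biset_monoid G H2 H1) a b" by (rule virtual_bisetsE[OF H \<xi>])
  interpret A: comm_group "Mo (cosets H1)" by (intro Mo_comm_group finite_gset_cosets H)
  interpret C: comm_group "Mo (cosets H2)" by (intro Mo_comm_group finite_gset_cosets H)
  note cl = hom_in_carrier[OF biset_val_hom[OF H ab(1)]] hom_in_carrier[OF biset_val_hom[OF H ab(2)]]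
  show ?thesis
    unfolding ab(3)
  proof (rule homI)
    fix x y assume x: "x \<in> carrier (Mo (cosets H1))"
    show "virtual_val H2 H1 (groth_cls (biset_monoid G H2 H1) a b) x \<in> carrier (Mo (cosets H2))"
      unfolding virtual_val_cls[OF H x ab(1,2)] using cl x by simp
    assume y: "y \<in> carrier (Mo (cosets H1))"
    show "virtual_val H2 H1 (groth_cls (biset_monoid G H2 H1) a b) (x \<otimes>\<^bsub>Mo (cosets H1)\<^esub> y) =
        virtual_val H2 H1 (groth_cls (biset_monoid G H2 H1) a b) x \<otimes>\<^bsub>Mo (cosets H2)\<^esub>
        virtual_val H2 H1 (groth_cls (biset_monoid G H2 H1) a b) y"
      unfolding virtual_val_cls[OF H x ab(1,2)] virtual_val_cls[OF H y ab(1,2)]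
        virtual_val_cls[OF H A.m_closed[OF x y] ab(1,2)]
        hom_mult[OF biset_val_hom[OF H ab(1)] x y] hom_mult[OF biset_val_hom[OF H ab(2)] x y]
      using cl x y by (simp add: C.inv_mult C.m_ac)
  qed
qed

text \<open>Both sides expand into the same four terms: the outer values are homomorphisms and so
  distribute over the inner difference.\<close>

lemma virtual_val_comp:
  assumes H: "subgroup H3 G" "subgroup H2 G" "subgroup H1 G"
    and \<xi>: "\<xi> \<in> carrier (virtual_bisets G H3 H2)" and \<eta>: "\<eta> \<in> carrier (virtual_bisets G H2 H1)"
    and u: "u \<in> carrier (Mo (cosets H1))"
  shows "virtual_val H3 H1 (virtual_comp G H3 H2 H1 \<xi> \<eta>) u = virtual_val H3 H2 \<xi> (virtual_val H2 H1 \<eta> u)"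
proof -
  obtain a b where ab: "a \<in> carrier (biset_monoid G H3 H2)" "b \<in> carrier (biset_monoid G H3 H2)"
    "\<xi> = groth_cls (biset_monoid G H3 H2) a b" by (rule virtual_bisetsE[OF H(1,2) \<xi>])
  obtain c d where cd: "c \<in> carrier (biset_monoid G H2 H1)" "d \<in> carrier (biset_monoid G H2 H1)"
    "\<eta> = groth_cls (biset_monoid G H2 H1) c d" by (rule virtual_bisetsE[OF H(2,3) \<eta>])
  interpret B: comm_monoid "biset_monoid G H3 H1" by (rule biset_monoid_comm_monoid[OF H(1,3)])
  interpret M2: comm_group "Mo (cosets H2)" by (intro Mo_comm_group finite_gset_cosets H)
  interpret M3: comm_group "Mo (cosets H3)" by (intro Mo_comm_group finite_gset_cosets H)
  have w: "biset_val H2 H1 c u \<in> carrier (Mo (cosets H2))" "biset_val H2 H1 d u \<in> carrier (Mo (cosets H2))"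
    using hom_in_carrier[OF biset_val_hom[OF H(2,3)] u] cd by auto
  have hA: "group_hom (Mo (cosets H2)) (Mo (cosets H3)) (biset_val H3 H2 a)"
    by unfold_locales (rule biset_val_hom[OF H(1,2) ab(1)])
  have hB: "group_hom (Mo (cosets H2)) (Mo (cosets H3)) (biset_val H3 H2 b)"
    by unfold_locales (rule biset_val_hom[OF H(1,2) ab(2)])
  interpret A: group_hom "Mo (cosets H2)" "Mo (cosets H3)" "biset_val H3 H2 a" by (rule hA)
  interpret B': group_hom "Mo (cosets H2)" "Mo (cosets H3)" "biset_val H3 H2 b" by (rule hB)
  note cc = biset_cls_comp_closed[OF H ab(1) cd(1)] biset_cls_comp_closed[OF H ab(1) cd(2)]
    biset_cls_comp_closed[OF H ab(2) cd(1)] biset_cls_comp_closed[OF H ab(2) cd(2)]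
  note vc = biset_val_comp[OF H ab(1) cd(1) u] biset_val_comp[OF H ab(1) cd(2) u]
    biset_val_comp[OF H ab(2) cd(1) u] biset_val_comp[OF H ab(2) cd(2) u]
  have "virtual_val H2 H1 \<eta> u \<in> carrier (Mo (cosets H2))"
    by (rule hom_in_carrier[OF virtual_val_hom[OF H(2,3) \<eta>] u])
  then show ?thesis
    unfolding ab(3) cd(3) virtual_comp_cls[OF H ab(1,2) cd(1,2)]
      virtual_val_cls[OF H(1,3) u B.m_closed[OF cc(1,4)] B.m_closed[OF cc(2,3)]]
      virtual_val_cls[OF H(2,3) u cd(1,2)]
    using w cc u by (simp add: biset_val_mult[OF H(1,3)] vc virtual_val_cls[OF H(1,2) _ ab(1,2)]
        M3.inv_mult M3.m_ac)
qed

text \<open>Evaluates explicit bisets, such as those in the definition of \<open>j\<close>, through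
  any span that presents them.\<close>

lemma virtual_val_virtual_cls:
  assumes H: "subgroup H2 G" "subgroup H1 G" and u: "u \<in> carrier (Mo (cosets H1))"
    and X: "finite_biset G H2 H1 X" and Z: "is_span H2 H1 Z p1 p2"
    and iso: "biset_isomorphic H2 H1 X (span_biset H2 H1 Z p1 p2)"
  shows "virtual_val H2 H1 (virtual_cls G H2 H1 X) u = span_val H2 H1 Z p1 p2 u"
proof -
  interpret B: comm_monoid "biset_monoid G H2 H1" by (rule biset_monoid_comm_monoid[OF H])
  interpret C: comm_group "Mo (cosets H2)" by (intro Mo_comm_group finite_gset_cosets H)
  have "biset_cls G H2 H1 (span_biset H2 H1 Z p1 p2) \<in> carrier (biset_monoid G H2 H1)"
    by (intro biset_cls_closed H conj_biset_span_biset Z)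
  then show ?thesis
    unfolding virtual_cls_eq biset_cls_eqI[OF X iso]
    using hom_in_carrier[OF span_val_hom[OF H Z] u]
    by (simp add: virtual_val_cls[OF H u] biset_val_one[OF H u] biset_val_span[OF H Z u])
qed

lemma virtual_val_one:
  assumes H: "subgroup H2 G" "subgroup H1 G" and u: "u \<in> carrier (Mo (cosets H1))"
  shows "virtual_val H2 H1 \<one>\<^bsub>virtual_bisets G H2 H1\<^esub> u = \<one>\<^bsub>Mo (cosets H2)\<^esub>"
proof -
  interpret B: comm_monoid "biset_monoid G H2 H1" by (rule biset_monoid_comm_monoid[OF H])
  interpret C: comm_group "Mo (cosets H2)" by (intro Mo_comm_group finite_gset_cosets H)
  show ?thesis
    unfolding virtual_bisets_def B.groth_one
    by (simp add: virtual_val_cls[OF H u] biset_val_one[OF H u])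
qed

text \<open>Entries of a matrix product are sums of virtual bisets; this lets the action pass
  through them.\<close>

lemma virtual_val_finprod:
  assumes H: "subgroup H2 G" "subgroup H1 G" and u: "u \<in> carrier (Mo (cosets H1))"
    and I: "finite I" and \<xi>: "\<And>i. i \<in> I \<Longrightarrow> \<xi> i \<in> carrier (virtual_bisets G H2 H1)"
  shows "virtual_val H2 H1 (finprod (virtual_bisets G H2 H1) \<xi> I) u =
    finprod (Mo (cosets H2)) (\<lambda>i. virtual_val H2 H1 (\<xi> i) u) I"
  by (rule finprod_hom[OF virtual_bisets_comm_group[OF H] Mo_comm_group[OF finite_gset_cosets[OF H(1)]] _ I \<xi>,
        where h = "\<lambda>\<xi>. virtual_val H2 H1 \<xi> u"])
    (auto intro!: homI hom_in_carrier[OF virtual_val_hom[OF H] u] simp: virtual_val_mult[OF H u])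

end

section \<open>Factorization through the biset category\<close>

context fin_group
begin

text \<open>A coproduct is described by its embeddings and not by a construction. The description
  fits both a chosen model for a list of subgroups and an arbitrary \<open>G\<close>-set with its
  base points.\<close>

definition is_coprod :: "'g set list \<Rightarrow> 'g gset \<Rightarrow> (nat \<Rightarrow> 'g pt \<Rightarrow> 'g pt) \<Rightarrow> bool" where
  "is_coprod Hs Z \<iota> \<longleftrightarrow> finite_gset G Z \<and>
     (\<forall>i<length Hs. \<iota> i \<in> gmaps G (cosets (Hs ! i)) Z \<and> inj_on (\<iota> i) (fst (cosets (Hs ! i)))) \<and>
     fst Z \<subseteq> (\<Union>i<length Hs. \<iota> i ` fst (cosets (Hs ! i))) \<and>
     (\<forall>i<length Hs. \<forall>j<length Hs. i \<noteq> j \<longrightarrow>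
        \<iota> i ` fst (cosets (Hs ! i)) \<inter> \<iota> j ` fst (cosets (Hs ! j)) = {})"

lemma ex_coprod:
  assumes Hs: "\<And>i. i < length Hs \<Longrightarrow> subgroup (Hs ! i) G"
  shows "\<exists>Z \<iota>. is_coprod Hs Z \<iota>"
proof -
  \<comment> \<open>Tagging points with the index keeps repeated subgroups of the list
    apart.\<close>
  define B where "B = (SIGMA i:{..<length Hs}. fst (cosets (Hs ! i)))"
  define a where "a g = (\<lambda>(i, p). (i :: nat, snd (cosets (Hs ! i)) g p))" for g
  have C: "finite_gset G (cosets (Hs ! i))" if "i < length Hs" for i
    using finite_gset_cosets[OF Hs[OF that]] .
  have fB: "finite B" unfolding B_def using C by (auto intro: finite_gset_finite)
  obtain Z q where Z: "finite_gset G Z" "fst Z = q ` B"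
    and q: "\<And>x y. x \<in> B \<Longrightarrow> y \<in> B \<Longrightarrow> q x = q y \<longleftrightarrow> id x = id y"
    and qa: "\<And>g x. g \<in> carrier G \<Longrightarrow> x \<in> B \<Longrightarrow> snd Z g (q x) = q (a g x)"
    by (rule gset_quotient[of B a id, OF fB])
      (auto simp: B_def a_def gset_closed[OF C] gset_one[OF C] gset_mult[OF C])
  define \<iota> where "\<iota> i = (\<lambda>p\<in>fst (cosets (Hs ! i)). q (i, p))" for i
  have "is_coprod Hs Z \<iota>"
    unfolding is_coprod_def
  proof (intro conjI allI impI Z(1))
    fix i assume i: "i < length Hs"
    have B: "(i, p) \<in> B" if "p \<in> fst (cosets (Hs ! i))" for p using that i by (simp add: B_def)
    show "\<iota> i \<in> gmaps G (cosets (Hs ! i)) Z"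
      by (rule gmapsI) (auto simp: \<iota>_def Z(2) B qa a_def gset_closed[OF C[OF i]])
    show "inj_on (\<iota> i) (fst (cosets (Hs ! i)))"
      by (rule inj_onI) (auto simp: \<iota>_def q B)
    fix j assume j: "j < length Hs" and "i \<noteq> j"
    moreover have "(j, p) \<in> B" if "p \<in> fst (cosets (Hs ! j))" for p using that j by (simp add: B_def)
    ultimately show "\<iota> i ` fst (cosets (Hs ! i)) \<inter> \<iota> j ` fst (cosets (Hs ! j)) = {}"
      by (auto simp: \<iota>_def q B)
  next
    show "fst Z \<subseteq> (\<Union>i<length Hs. \<iota> i ` fst (cosets (Hs ! i)))"
      unfolding Z(2) by (force simp: B_def \<iota>_def)
  qed
  then show ?thesis by blast
qed

definition coprod :: "'g set list \<Rightarrow> 'g gset \<times> (nat \<Rightarrow> 'g pt \<Rightarrow> 'g pt)" where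
  "coprod Hs = (SOME p. is_coprod Hs (fst p) (snd p))"

abbreviation coprod_set :: "'g set list \<Rightarrow> 'g gset" where "coprod_set Hs \<equiv> fst (coprod Hs)"
abbreviation coprod_inj :: "'g set list \<Rightarrow> nat \<Rightarrow> 'g pt \<Rightarrow> 'g pt" where "coprod_inj Hs \<equiv> snd (coprod Hs)"

lemma coprod:
  assumes "\<And>i. i < length Hs \<Longrightarrow> subgroup (Hs ! i) G"
  shows "is_coprod Hs (coprod_set Hs) (coprod_inj Hs)"
proof -
  obtain Z \<iota> where "is_coprod Hs Z \<iota>" using ex_coprod[OF assms] by blast
  then show ?thesis unfolding coprod_def
    using someI[of "\<lambda>p. is_coprod Hs (fst p) (snd p)" "(Z, \<iota>)"] by simp
qed

lemma is_coprodD: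
  assumes "is_coprod Hs Z \<iota>"
  shows "finite_gset G Z"
    and "\<And>i. i < length Hs \<Longrightarrow> \<iota> i \<in> gmaps G (cosets (Hs ! i)) Z"
    and "\<And>i. i < length Hs \<Longrightarrow> inj_on (\<iota> i) (fst (cosets (Hs ! i)))"
    and "fst Z \<subseteq> (\<Union>i<length Hs. \<iota> i ` fst (cosets (Hs ! i)))"
    and "\<And>i j. i < length Hs \<Longrightarrow> j < length Hs \<Longrightarrow> i \<noteq> j \<Longrightarrow>
        \<iota> i ` fst (cosets (Hs ! i)) \<inter> \<iota> j ` fst (cosets (Hs ! j)) = {}"
  using assms unfolding is_coprod_def by blast+

end

context mackey
begin

text \<open>The element of \<open>M(Z)\<close> with prescribed restrictions \<open>w i\<close>,
  assembled by pushing each of them forward.\<close>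

definition coprod_sum :: "'g set list \<Rightarrow> 'g gset \<Rightarrow> (nat \<Rightarrow> 'g pt \<Rightarrow> 'g pt) \<Rightarrow> (nat \<Rightarrow> 'a) \<Rightarrow> 'a" where
  "coprod_sum Hs Z \<iota> w = finprod (Mo Z) (\<lambda>i. cov (cosets (Hs ! i)) Z (\<iota> i) (w i)) {..<length Hs}"

context
  fixes Hs Z \<iota>
  assumes Hs: "\<And>i. i < length Hs \<Longrightarrow> subgroup (Hs ! i) G"
    and cp: "is_coprod Hs Z \<iota>"
begin

lemma coprod_eqI:
  assumes uv: "u \<in> carrier (Mo Z)" "v \<in> carrier (Mo Z)"
    and eq: "\<And>i. i < length Hs \<Longrightarrow> con (cosets (Hs ! i)) Z (\<iota> i) u = con (cosets (Hs ! i)) Z (\<iota> i) v"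
  shows "u = v"
  by (rule cover_eqI[OF is_coprodD(1)[OF cp] uv, of "{..<length Hs}" "\<lambda>i. cosets (Hs ! i)" \<iota>])
    (use is_coprodD[OF cp] finite_gset_cosets[OF Hs] eq in auto)

lemma coprod_decomp:
  assumes u: "u \<in> carrier (Mo Z)"
  shows "finprod (Mo Z) (\<lambda>i. cov (cosets (Hs ! i)) Z (\<iota> i) (con (cosets (Hs ! i)) Z (\<iota> i) u)) {..<length Hs} = u"
  by (rule cover_decomp[OF is_coprodD(1)[OF cp] u])
    (use is_coprodD[OF cp] finite_gset_cosets[OF Hs] in auto)

lemma coprod_con_closed:
  "i < length Hs \<Longrightarrow> u \<in> carrier (Mo Z) \<Longrightarrow> con (cosets (Hs ! i)) Z (\<iota> i) u \<in> carrier (Mo (cosets (Hs ! i)))"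
  by (rule con_closed[OF finite_gset_cosets[OF Hs] is_coprodD(1)[OF cp] is_coprodD(2)[OF cp]])

lemma coprod_cov_closed:
  "i < length Hs \<Longrightarrow> u \<in> carrier (Mo (cosets (Hs ! i))) \<Longrightarrow> cov (cosets (Hs ! i)) Z (\<iota> i) u \<in> carrier (Mo Z)"
  by (rule cov_closed[OF finite_gset_cosets[OF Hs] is_coprodD(1)[OF cp] is_coprodD(2)[OF cp]])

lemma coprod_sum_closed:
  assumes w: "\<And>i. i < length Hs \<Longrightarrow> w i \<in> carrier (Mo (cosets (Hs ! i)))"
  shows "coprod_sum Hs Z \<iota> w \<in> carrier (Mo Z)"
proof -
  interpret comm_group "Mo Z" by (rule Mo_comm_group[OF is_coprodD(1)[OF cp]])
  show ?thesis unfolding coprod_sum_def using w coprod_cov_closed by (intro finprod_closed) auto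
qed

text \<open>Restriction along the \<open>j\<close>-th embedding kills every term but its
  own.\<close>

lemma con_coprod_sum:
  assumes w: "\<And>i. i < length Hs \<Longrightarrow> w i \<in> carrier (Mo (cosets (Hs ! i)))" and j: "j < length Hs"
  shows "con (cosets (Hs ! j)) Z (\<iota> j) (coprod_sum Hs Z \<iota> w) = w j"
proof -
  note Z = is_coprodD(1)[OF cp] and C = finite_gset_cosets[OF Hs] and cpD = is_coprodD(2-)[OF cp]
  interpret Mj: comm_group "Mo (cosets (Hs ! j))" by (rule Mo_comm_group[OF C[OF j]])
  have "con (cosets (Hs ! j)) Z (\<iota> j) (coprod_sum Hs Z \<iota> w) =
      finprod (Mo (cosets (Hs ! j))) (\<lambda>i. con (cosets (Hs ! j)) Z (\<iota> j) (cov (cosets (Hs ! i)) Z (\<iota> i) (w i)))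
        {..<length Hs}"
    unfolding coprod_sum_def
    by (rule finprod_hom[OF Mo_comm_group[OF Z] Mo_comm_group[OF C[OF j]] con_hom(1)[OF C[OF j] Z cpD(1)[OF j]]])
      (auto intro: coprod_cov_closed w)
  also have "\<dots> = finprod (Mo (cosets (Hs ! j))) (\<lambda>i. if j = i then w j else \<one>\<^bsub>Mo (cosets (Hs ! j))\<^esub>) {..<length Hs}"
  proof (rule Mj.finprod_cong')
    fix i assume "i \<in> {..<length Hs}"
    then have i: "i < length Hs" by simp
    show "con (cosets (Hs ! j)) Z (\<iota> j) (cov (cosets (Hs ! i)) Z (\<iota> i) (w i)) =
        (if j = i then w j else \<one>\<^bsub>Mo (cosets (Hs ! j))\<^esub>)"
      using con_cov_inj[OF C[OF i] Z cpD(1)[OF i] cpD(2)[OF i] w[OF i]]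
        con_cov_disjoint[OF C[OF j] C[OF i] Z cpD(1)[OF j] cpD(1)[OF i] cpD(4)[OF j i] w[OF i]] by auto
  qed (use w j in auto)
  also have "\<dots> = w j"
    using Mj.finprod_singleton[of j "{..<length Hs}" "\<lambda>_. w j"] w j by simp
  finally show ?thesis .
qed

end

text \<open>Identifies the values of \<open>M\<close> at two coproducts of the same list by matching
  restrictions, so no isomorphism between the \<open>G\<close>-sets has to be constructed.\<close>

definition coprod_transfer ::
    "'g set list \<Rightarrow> 'g gset \<Rightarrow> (nat \<Rightarrow> 'g pt \<Rightarrow> 'g pt) \<Rightarrow> 'g gset \<Rightarrow> (nat \<Rightarrow> 'g pt \<Rightarrow> 'g pt) \<Rightarrow> 'a \<Rightarrow> 'a" where
  "coprod_transfer Hs Z \<iota> W \<kappa> =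
     (\<lambda>u\<in>carrier (Mo Z). coprod_sum Hs W \<kappa> (\<lambda>i. con (cosets (Hs ! i)) Z (\<iota> i) u))"

lemma coprod_transfer:
  assumes Hs: "\<And>i. i < length Hs \<Longrightarrow> subgroup (Hs ! i) G"
    and Z: "is_coprod Hs Z \<iota>" and W: "is_coprod Hs W \<kappa>"
  shows "coprod_transfer Hs Z \<iota> W \<kappa> \<in> hom (Mo Z) (Mo W)"
    and "\<And>i u. i < length Hs \<Longrightarrow> u \<in> carrier (Mo Z) \<Longrightarrow>
      con (cosets (Hs ! i)) W (\<kappa> i) (coprod_transfer Hs Z \<iota> W \<kappa> u) = con (cosets (Hs ! i)) Z (\<iota> i) u"
proof -
  note cc = coprod_con_closed[OF Hs Z]
  show *: "con (cosets (Hs ! i)) W (\<kappa> i) (coprod_transfer Hs Z \<iota> W \<kappa> u) = con (cosets (Hs ! i)) Z (\<iota> i) u"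
    if "i < length Hs" "u \<in> carrier (Mo Z)" for i u
    using that con_coprod_sum[OF Hs W cc that(1)] by (simp add: coprod_transfer_def)
  have cl: "coprod_transfer Hs Z \<iota> W \<kappa> u \<in> carrier (Mo W)" if "u \<in> carrier (Mo Z)" for u
    using that coprod_sum_closed[OF Hs W cc] by (simp add: coprod_transfer_def)
  interpret MZ: comm_group "Mo Z" by (rule Mo_comm_group[OF is_coprodD(1)[OF Z]])
  interpret MW: comm_group "Mo W" by (rule Mo_comm_group[OF is_coprodD(1)[OF W]])
  show "coprod_transfer Hs Z \<iota> W \<kappa> \<in> hom (Mo Z) (Mo W)"
  proof (rule homI[OF cl])
    fix u v assume uv: "u \<in> carrier (Mo Z)" "v \<in> carrier (Mo Z)"
    show "coprod_transfer Hs Z \<iota> W \<kappa> (u \<otimes>\<^bsub>Mo Z\<^esub> v) =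
        coprod_transfer Hs Z \<iota> W \<kappa> u \<otimes>\<^bsub>Mo W\<^esub> coprod_transfer Hs Z \<iota> W \<kappa> v"
    proof (rule coprod_eqI[OF Hs W])
      fix i assume i: "i < length Hs"
      note C = finite_gset_cosets[OF Hs[OF i]]
      show "con (cosets (Hs ! i)) W (\<kappa> i) (coprod_transfer Hs Z \<iota> W \<kappa> (u \<otimes>\<^bsub>Mo Z\<^esub> v)) =
          con (cosets (Hs ! i)) W (\<kappa> i) (coprod_transfer Hs Z \<iota> W \<kappa> u \<otimes>\<^bsub>Mo W\<^esub> coprod_transfer Hs Z \<iota> W \<kappa> v)"
        using uv i
        by (simp add: * con_mult[OF C is_coprodD(1)[OF W] is_coprodD(2)[OF W i]] cl
            con_mult[OF C is_coprodD(1)[OF Z] is_coprodD(2)[OF Z i]])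
    qed (use uv cl in auto)
  qed
qed

text \<open>Both transfers preserve the restrictions, and these determine an element.\<close>

lemma coprod_transfer_inverse:
  assumes Hs: "\<And>i. i < length Hs \<Longrightarrow> subgroup (Hs ! i) G"
    and Z: "is_coprod Hs Z \<iota>" and W: "is_coprod Hs W \<kappa>" and u: "u \<in> carrier (Mo Z)"
  shows "coprod_transfer Hs W \<kappa> Z \<iota> (coprod_transfer Hs Z \<iota> W \<kappa> u) = u"
proof (rule coprod_eqI[OF Hs Z _ u])
  have t: "coprod_transfer Hs Z \<iota> W \<kappa> u \<in> carrier (Mo W)"
    by (rule hom_in_carrier[OF coprod_transfer(1)[OF Hs Z W] u])
  show "coprod_transfer Hs W \<kappa> Z \<iota> (coprod_transfer Hs Z \<iota> W \<kappa> u) \<in> carrier (Mo Z)"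
    by (rule hom_in_carrier[OF coprod_transfer(1)[OF Hs W Z] t])
  show "con (cosets (Hs ! i)) Z (\<iota> i) (coprod_transfer Hs W \<kappa> Z \<iota> (coprod_transfer Hs Z \<iota> W \<kappa> u)) =
      con (cosets (Hs ! i)) Z (\<iota> i) u" if "i < length Hs" for i
    using coprod_transfer(2)[OF Hs W Z that t] coprod_transfer(2)[OF Hs Z W that u] by simp
qed

lemma coprod_transfer_iso:
  assumes Hs: "\<And>i. i < length Hs \<Longrightarrow> subgroup (Hs ! i) G"
    and Z: "is_coprod Hs Z \<iota>" and W: "is_coprod Hs W \<kappa>"
  shows "coprod_transfer Hs Z \<iota> W \<kappa> \<in> cat_iso Ab (Mo Z) (Mo W)"
proof -
  let ?f = "coprod_transfer Hs Z \<iota> W \<kappa>" and ?g = "coprod_transfer Hs W \<kappa> Z \<iota>"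
  have "compose (carrier (Mo Z)) ?g ?f = (\<lambda>x\<in>carrier (Mo Z). x)"
    "compose (carrier (Mo W)) ?f ?g = (\<lambda>x\<in>carrier (Mo W). x)"
    using coprod_transfer_inverse[OF Hs Z W] coprod_transfer_inverse[OF Hs W Z]
    by (auto simp: compose_def intro!: restrict_ext)
  moreover have "?f \<in> hom (Mo Z) (Mo W) \<inter> extensional (carrier (Mo Z))"
    "?g \<in> hom (Mo W) (Mo Z) \<inter> extensional (carrier (Mo W))"
    using coprod_transfer(1)[OF Hs Z W] coprod_transfer(1)[OF Hs W Z] by (auto simp: coprod_transfer_def)
  ultimately show ?thesis unfolding cat_iso_def Ab_def by auto
qed

end

section \<open>Matrices of virtual bisets\<close>

context fin_group
begin

lemma B_bullet_obj: "Hs \<in> cat_obj (B_bullet G) \<longleftrightarrow> (\<forall>i<length Hs. subgroup (Hs ! i) G)"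
  by (auto simp: B_bullet_def additive_completion_def B_cat_def all_set_conv_all_nth in_lists_conv_set)

lemma B_bullet_hom: "cat_hom (B_bullet G) = mat_hom (B_cat G)"
  by (simp add: B_bullet_def additive_completion_def)

lemma mat_homD:
  assumes "A \<in> mat_hom (B_cat G) Hs Ks" "l < length Ks" "i < length Hs"
  shows "A (l, i) \<in> carrier (virtual_bisets G (Ks ! l) (Hs ! i))"
proof -
  have "A (l, i) \<in> (case (l, i) of (j, i) \<Rightarrow> cat_hom (B_cat G) (Hs ! i) (Ks ! j))"
    using assms unfolding mat_hom_def by (intro PiE_mem[of A]) auto
  then show ?thesis by (simp add: B_cat_def)
qed

lemma B_bullet_comp_nth:
  assumes "l < length Ls" "i < length Hs"
  shows "cat_comp (B_bullet G) Hs Ks Ls B A (l, i) =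
    finprod (virtual_bisets G (Ls ! l) (Hs ! i))
      (\<lambda>j. virtual_comp G (Ls ! l) (Ks ! j) (Hs ! i) (B (l, j)) (A (j, i))) {..<length Ks}"
  using assms by (simp add: B_bullet_def additive_completion_def B_cat_def)

lemma B_bullet_id_nth:
  assumes "l < length Hs" "i < length Hs"
  shows "cat_id (B_bullet G) Hs (l, i) = (if i = l then virtual_cls G (Hs ! i) (Hs ! i) (reg_biset G (Hs ! i))
    else \<one>\<^bsub>virtual_bisets G (Hs ! l) (Hs ! i)\<^esub>)"
  using assms by (simp add: B_bullet_def additive_completion_def B_cat_def)

lemma B_bullet_add_nth:
  assumes "l < length Ks" "i < length Hs"
  shows "(A \<otimes>\<^bsub>hom_grp (B_bullet G) Hs Ks\<^esub> B) (l, i) = A (l, i) \<otimes>\<^bsub>virtual_bisets G (Ks ! l) (Hs ! i)\<^esub> B (l, i)"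
  using assms by (simp add: B_bullet_def additive_completion_def B_cat_def)

lemma finite_cov_biset:
  assumes H: "subgroup K G" "subgroup H G" and g: "g \<in> carrier G"
    and sub: "\<And>h. h \<in> H \<Longrightarrow> inv g \<otimes> h \<otimes> g \<in> K"
  shows "finite_biset G K H (cov_biset G K g)"
  using assms finite_subset[OF subgroup.subset[OF H(1)] fin_carrier]
    subgroup.mem_carrier[OF H(1)] subgroup.mem_carrier[OF H(2)]
  by (auto simp: finite_biset_def cov_biset_def m_assoc mult_inv_cancel subgroup.m_closed)

lemma finite_con_biset:
  assumes H: "subgroup K G" "subgroup H G" and g: "g \<in> carrier G"
    and sub: "\<And>h. h \<in> H \<Longrightarrow> inv g \<otimes> h \<otimes> g \<in> K"
  shows "finite_biset G H K (con_biset G K g)"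
proof -
  note KC = subgroup.mem_carrier[OF H(1)] and HC = subgroup.mem_carrier[OF H(2)]
  have "inv g \<otimes> (h \<otimes> (g \<otimes> k)) \<in> K" if "h \<in> H" "k \<in> K" for h k
    using subgroup.m_closed[OF H(1) sub[OF that(1)] that(2)] that KC HC g by (simp add: m_assoc)
  then show ?thesis
    using g finite_subset[OF subgroup.subset[OF H(1)] fin_carrier] KC HC
    by (auto simp: finite_biset_def con_biset_def m_assoc mult_inv_cancel subgroup.m_closed[OF H(1)])
qed

lemma finite_reg_biset: "subgroup H G \<Longrightarrow> finite_biset G H H (reg_biset G H)"
  using finite_subset[OF subgroup.subset fin_carrier] subgroup.mem_carrier
  by (fastforce simp: finite_biset_def reg_biset_def m_assoc subgroup.m_closed)

lemma conj_biset_if_iso_span: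
  assumes H: "subgroup H2 G" "subgroup H1 G" and X: "finite_biset G H2 H1 X"
    and Z: "is_span H2 H1 Z p1 p2" and iso: "biset_isomorphic H2 H1 X (span_biset H2 H1 Z p1 p2)"
  shows "conj_biset G H2 H1 X"
  by (rule conj_biset_isomorphic[OF H conj_biset_span_biset[OF H Z] biset_isomorphic_sym[OF X iso]])

text \<open>The regular biset is the covariant biset for \<open>g = \<one>\<close>, where the second
  leg becomes the identity.\<close>

lemma reg_biset_span:
  assumes H: "subgroup H G"
  shows "is_span H H (cosets H) (\<lambda>x\<in>fst (cosets H). x) (\<lambda>x\<in>fst (cosets H). x)"
    and "biset_isomorphic H H (reg_biset G H)
      (span_biset H H (cosets H) (\<lambda>x\<in>fst (cosets H). x) (\<lambda>x\<in>fst (cosets H). x))"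
proof -
  note HC = subgroup.mem_carrier[OF H]
  have one: "pc H \<one> \<in> fst (cosets H)" by (simp add: fst_cosets)
  have sub: "inv \<one> \<otimes> h \<otimes> \<one> \<in> H" if "h \<in> H" for h using that HC by simp
  note om = conj_orbit_map[OF H H one_closed sub]
  have \<psi>: "orbit_map (cosets H) H (pc H \<one>) = (\<lambda>x\<in>fst (cosets H). x)"
    by (rule gmaps_cosets_eqI[OF H om(1) gmaps_id[OF finite_gset_cosets[OF H]]])
      (simp_all add: om one)
  show "is_span H H (cosets H) (\<lambda>x\<in>fst (cosets H). x) (\<lambda>x\<in>fst (cosets H). x)"
    using cov_biset_span(1)[OF H H one_closed sub] unfolding \<psi> .
  have "biset_isomorphic H H (reg_biset G H) (cov_biset G H \<one>)"
    by (rule biset_isomorphicI[of id]) (auto simp: reg_biset_def cov_biset_def HC)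
  then show "biset_isomorphic H H (reg_biset G H)
      (span_biset H H (cosets H) (\<lambda>x\<in>fst (cosets H). x) (\<lambda>x\<in>fst (cosets H). x))"
    using biset_isomorphic_trans cov_biset_span(2)[OF H H one_closed sub] unfolding \<psi> by blast
qed

end

section \<open>The additive functor on \<open>B_bullet G\<close>\<close>

context conj_mackey
begin

definition mat_val :: "'g set list \<Rightarrow> 'g set list \<Rightarrow> (nat \<times> nat \<Rightarrow> 'g virtual_biset) \<Rightarrow> (nat \<Rightarrow> 'a) \<Rightarrow> nat \<Rightarrow> 'a" where
  "mat_val Hs Ks A w l =
     finprod (Mo (cosets (Ks ! l))) (\<lambda>i. virtual_val (Ks ! l) (Hs ! i) (A (l, i)) (w i)) {..<length Hs}"

definition restr :: "'g set list \<Rightarrow> 'a \<Rightarrow> nat \<Rightarrow> 'a" where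
  "restr Hs u i = con (cosets (Hs ! i)) (coprod_set Hs) (coprod_inj Hs i) u"

text \<open>On morphisms an element is split into components, the column is multiplied by the
  matrix, and the result is reassembled. Identities are checked on components by
  \<open>restr_eqI\<close>, where \<open>restr_farr\<close> leaves only the multiplication.\<close>

definition biset_func :: "('g set list, nat \<times> nat \<Rightarrow> 'g virtual_biset, 'a monoid, 'a \<Rightarrow> 'a) func" where
  "biset_func = \<lparr>fobj = (\<lambda>Hs. Mo (coprod_set Hs)),
     farr = (\<lambda>Hs Ks A. \<lambda>u\<in>carrier (Mo (coprod_set Hs)).
       coprod_sum Ks (coprod_set Ks) (coprod_inj Ks) (mat_val Hs Ks A (restr Hs u)))\<rparr>"

lemma restr_closed:
  assumes "Hs \<in> cat_obj (B_bullet G)" "i < length Hs" "u \<in> carrier (Mo (coprod_set Hs))"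
  shows "restr Hs u i \<in> carrier (Mo (cosets (Hs ! i)))"
  unfolding restr_def using assms by (intro coprod_con_closed[OF _ coprod]) (auto simp: B_bullet_obj)

lemma restr_eqI:
  assumes "Hs \<in> cat_obj (B_bullet G)" "u \<in> carrier (Mo (coprod_set Hs))" "v \<in> carrier (Mo (coprod_set Hs))"
    and "\<And>i. i < length Hs \<Longrightarrow> restr Hs u i = restr Hs v i"
  shows "u = v"
  using assms unfolding restr_def by (intro coprod_eqI[OF _ coprod, of Hs u v]) (auto simp: B_bullet_obj)

lemma mat_val_summand_closed:
  assumes Hs: "Hs \<in> cat_obj (B_bullet G)" and Ks: "Ks \<in> cat_obj (B_bullet G)"
    and A: "A \<in> mat_hom (B_cat G) Hs Ks" and l: "l < length Ks" and i: "i < length Hs"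
    and w: "w \<in> carrier (Mo (cosets (Hs ! i)))"
  shows "virtual_val (Ks ! l) (Hs ! i) (A (l, i)) w \<in> carrier (Mo (cosets (Ks ! l)))"
  using Hs Ks l i by (intro hom_in_carrier[OF virtual_val_hom w] mat_homD[OF A]) (auto simp: B_bullet_obj)

lemma mat_val_closed:
  assumes Hs: "Hs \<in> cat_obj (B_bullet G)" and Ks: "Ks \<in> cat_obj (B_bullet G)"
    and A: "A \<in> mat_hom (B_cat G) Hs Ks" and l: "l < length Ks"
    and w: "\<And>i. i < length Hs \<Longrightarrow> w i \<in> carrier (Mo (cosets (Hs ! i)))"
  shows "mat_val Hs Ks A w l \<in> carrier (Mo (cosets (Ks ! l)))"
proof -
  interpret comm_group "Mo (cosets (Ks ! l))"
    using Ks l by (intro Mo_comm_group finite_gset_cosets) (simp add: B_bullet_obj)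
  show ?thesis
    unfolding mat_val_def using w by (intro finprod_closed) (auto intro: mat_val_summand_closed[OF Hs Ks A l])
qed

lemma farr_closed:
  assumes Hs: "Hs \<in> cat_obj (B_bullet G)" and Ks: "Ks \<in> cat_obj (B_bullet G)"
    and A: "A \<in> mat_hom (B_cat G) Hs Ks" and u: "u \<in> carrier (Mo (coprod_set Hs))"
  shows "farr biset_func Hs Ks A u \<in> carrier (Mo (coprod_set Ks))"
proof -
  have K: "subgroup (Ks ! l) G" if "l < length Ks" for l using Ks that by (simp add: B_bullet_obj)
  show ?thesis
    using u coprod_sum_closed[OF K coprod[OF K] mat_val_closed[OF Hs Ks A _ restr_closed[OF Hs _ u]]]
    by (simp add: biset_func_def)
qed

lemma restr_farr:
  assumes Hs: "Hs \<in> cat_obj (B_bullet G)" and Ks: "Ks \<in> cat_obj (B_bullet G)"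
    and A: "A \<in> mat_hom (B_cat G) Hs Ks" and u: "u \<in> carrier (Mo (coprod_set Hs))" and l: "l < length Ks"
  shows "restr Ks (farr biset_func Hs Ks A u) l = mat_val Hs Ks A (restr Hs u) l"
proof -
  have K: "subgroup (Ks ! l) G" if "l < length Ks" for l using Ks that by (simp add: B_bullet_obj)
  show ?thesis
    using u con_coprod_sum[OF K coprod[OF K] mat_val_closed[OF Hs Ks A _ restr_closed[OF Hs _ u]] l]
    by (simp add: biset_func_def restr_def[of Ks _ l])
qed

lemma restr_mult:
  assumes Hs: "Hs \<in> cat_obj (B_bullet G)" and i: "i < length Hs"
    and uv: "u \<in> carrier (Mo (coprod_set Hs))" "v \<in> carrier (Mo (coprod_set Hs))"
  shows "restr Hs (u \<otimes>\<^bsub>Mo (coprod_set Hs)\<^esub> v) i = restr Hs u i \<otimes>\<^bsub>Mo (cosets (Hs ! i))\<^esub> restr Hs v i"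
proof -
  have H: "subgroup (Hs ! i) G" if "i < length Hs" for i using Hs that by (simp add: B_bullet_obj)
  show ?thesis
    unfolding restr_def
    by (rule con_mult[OF finite_gset_cosets[OF H[OF i]] is_coprodD(1)[OF coprod[OF H]] is_coprodD(2)[OF coprod[OF H] i] uv])
qed

lemma coprod_set_comm_group: "Hs \<in> cat_obj (B_bullet G) \<Longrightarrow> comm_group (Mo (coprod_set Hs))"
  by (rule Mo_comm_group[OF is_coprodD(1)[OF coprod]]) (simp add: B_bullet_obj)

lemma farr_hom:
  assumes Hs: "Hs \<in> cat_obj (B_bullet G)" and Ks: "Ks \<in> cat_obj (B_bullet G)"
    and A: "A \<in> mat_hom (B_cat G) Hs Ks"
  shows "farr biset_func Hs Ks A \<in> hom (Mo (coprod_set Hs)) (Mo (coprod_set Ks))"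
proof (rule homI[OF farr_closed[OF Hs Ks A]])
  interpret MH: comm_group "Mo (coprod_set Hs)" by (rule coprod_set_comm_group[OF Hs])
  interpret MK: comm_group "Mo (coprod_set Ks)" by (rule coprod_set_comm_group[OF Ks])
  note fc = farr_closed[OF Hs Ks A] and rc = restr_closed[OF Hs]
  fix u v assume uv: "u \<in> carrier (Mo (coprod_set Hs))" "v \<in> carrier (Mo (coprod_set Hs))"
  show "farr biset_func Hs Ks A (u \<otimes>\<^bsub>Mo (coprod_set Hs)\<^esub> v) =
      farr biset_func Hs Ks A u \<otimes>\<^bsub>Mo (coprod_set Ks)\<^esub> farr biset_func Hs Ks A v"
  proof (rule restr_eqI[OF Ks])
    fix l assume l: "l < length Ks"
    have K: "subgroup (Ks ! l) G" using Ks l by (simp add: B_bullet_obj)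
    interpret Ml: comm_group "Mo (cosets (Ks ! l))" by (intro Mo_comm_group finite_gset_cosets K)
    note sc = mat_val_summand_closed[OF Hs Ks A l]
    have "mat_val Hs Ks A (restr Hs (u \<otimes>\<^bsub>Mo (coprod_set Hs)\<^esub> v)) l =
        finprod (Mo (cosets (Ks ! l))) (\<lambda>i. virtual_val (Ks ! l) (Hs ! i) (A (l, i)) (restr Hs u i)
          \<otimes>\<^bsub>Mo (cosets (Ks ! l))\<^esub> virtual_val (Ks ! l) (Hs ! i) (A (l, i)) (restr Hs v i)) {..<length Hs}"
      unfolding mat_val_def
    proof (rule Ml.finprod_cong')
      fix i assume "i \<in> {..<length Hs}"
      then have i: "i < length Hs" by simp
      have "subgroup (Hs ! i) G" using Hs i by (simp add: B_bullet_obj)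
      from hom_mult[OF virtual_val_hom[OF K this mat_homD[OF A l i]] rc[OF i uv(1)] rc[OF i uv(2)]]
      show "virtual_val (Ks ! l) (Hs ! i) (A (l, i)) (restr Hs (u \<otimes>\<^bsub>Mo (coprod_set Hs)\<^esub> v) i) =
          virtual_val (Ks ! l) (Hs ! i) (A (l, i)) (restr Hs u i)
          \<otimes>\<^bsub>Mo (cosets (Ks ! l))\<^esub> virtual_val (Ks ! l) (Hs ! i) (A (l, i)) (restr Hs v i)"
        by (simp add: restr_mult[OF Hs i uv])
    qed (use uv sc rc in auto)
    also have "\<dots> = mat_val Hs Ks A (restr Hs u) l \<otimes>\<^bsub>Mo (cosets (Ks ! l))\<^esub> mat_val Hs Ks A (restr Hs v) l"
      unfolding mat_val_def using uv sc rc by (intro Ml.finprod_multf) auto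
    finally show "restr Ks (farr biset_func Hs Ks A (u \<otimes>\<^bsub>Mo (coprod_set Hs)\<^esub> v)) l =
        restr Ks (farr biset_func Hs Ks A u \<otimes>\<^bsub>Mo (coprod_set Ks)\<^esub> farr biset_func Hs Ks A v) l"
      using uv fc l by (simp add: restr_farr[OF Hs Ks A] restr_mult[OF Ks])
  qed (use uv fc in auto)
qed

lemma B_bullet_comp_closed:
  assumes Hs: "Hs \<in> cat_obj (B_bullet G)" and Ks: "Ks \<in> cat_obj (B_bullet G)" and Ls: "Ls \<in> cat_obj (B_bullet G)"
    and A: "A \<in> mat_hom (B_cat G) Hs Ks" and B: "B \<in> mat_hom (B_cat G) Ks Ls"
  shows "cat_comp (B_bullet G) Hs Ks Ls B A \<in> mat_hom (B_cat G) Hs Ls"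
proof -
  have "finprod (virtual_bisets G (Ls ! l) (Hs ! i))
      (\<lambda>j. virtual_comp G (Ls ! l) (Ks ! j) (Hs ! i) (B (l, j)) (A (j, i))) {..<length Ks}
      \<in> carrier (virtual_bisets G (Ls ! l) (Hs ! i))" if l: "l < length Ls" and i: "i < length Hs" for l i
  proof -
    have S: "subgroup (Ls ! l) G" "subgroup (Hs ! i) G" using Ls Hs l i by (auto simp: B_bullet_obj)
    interpret comm_group "virtual_bisets G (Ls ! l) (Hs ! i)" by (rule virtual_bisets_comm_group[OF S])
    show ?thesis
      using Ks l i S by (intro finprod_closed)
        (auto simp: B_bullet_obj intro!: virtual_comp_closed mat_homD[OF A] mat_homD[OF B])
  qed
  then show ?thesis
    unfolding mat_hom_def by (auto simp: B_bullet_def additive_completion_def B_cat_def)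
qed

text \<open>On components this is the associativity of matrix-vector multiplication: entries compose
  by \<open>virtual_val_comp\<close>, and the two finite sums are interchanged.\<close>

lemma farr_comp:
  assumes Hs: "Hs \<in> cat_obj (B_bullet G)" and Ks: "Ks \<in> cat_obj (B_bullet G)" and Ls: "Ls \<in> cat_obj (B_bullet G)"
    and A: "A \<in> mat_hom (B_cat G) Hs Ks" and B: "B \<in> mat_hom (B_cat G) Ks Ls"
    and u: "u \<in> carrier (Mo (coprod_set Hs))"
  shows "farr biset_func Hs Ls (cat_comp (B_bullet G) Hs Ks Ls B A) u =
    farr biset_func Ks Ls B (farr biset_func Hs Ks A u)"
proof (rule restr_eqI[OF Ls])
  note C = B_bullet_comp_closed[OF Hs Ks Ls A B]
  note Au = farr_closed[OF Hs Ks A u]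
  show "farr biset_func Hs Ls (cat_comp (B_bullet G) Hs Ks Ls B A) u \<in> carrier (Mo (coprod_set Ls))"
    by (rule farr_closed[OF Hs Ls C u])
  show "farr biset_func Ks Ls B (farr biset_func Hs Ks A u) \<in> carrier (Mo (coprod_set Ls))"
    by (rule farr_closed[OF Ks Ls B Au])
  fix l assume l: "l < length Ls"
  have L: "subgroup (Ls ! l) G" using Ls l by (simp add: B_bullet_obj)
  have SH: "subgroup (Hs ! i) G" if "i < length Hs" for i using Hs that by (simp add: B_bullet_obj)
  have SK: "subgroup (Ks ! i) G" if "i < length Ks" for i using Ks that by (simp add: B_bullet_obj)
  interpret Ml: comm_group "Mo (cosets (Ls ! l))" by (intro Mo_comm_group finite_gset_cosets L)
  let ?w = "restr Hs u"
  let ?t = "\<lambda>i j. virtual_val (Ls ! l) (Ks ! j) (B (l, j)) (virtual_val (Ks ! j) (Hs ! i) (A (j, i)) (?w i))"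
  note w = restr_closed[OF Hs _ u]
  note sA = mat_val_summand_closed[OF Hs Ks A _ _ w] and sB = mat_val_summand_closed[OF Ks Ls B l]
  have "mat_val Hs Ls (cat_comp (B_bullet G) Hs Ks Ls B A) ?w l =
      finprod (Mo (cosets (Ls ! l))) (\<lambda>i. finprod (Mo (cosets (Ls ! l))) (?t i) {..<length Ks}) {..<length Hs}"
    unfolding mat_val_def
  proof (rule Ml.finprod_cong')
    fix i assume "i \<in> {..<length Hs}"
    then have i: "i < length Hs" by simp
    have "virtual_val (Ls ! l) (Hs ! i) (cat_comp (B_bullet G) Hs Ks Ls B A (l, i)) (?w i) =
        finprod (Mo (cosets (Ls ! l))) (\<lambda>j. virtual_val (Ls ! l) (Hs ! i)
          (virtual_comp G (Ls ! l) (Ks ! j) (Hs ! i) (B (l, j)) (A (j, i))) (?w i)) {..<length Ks}"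
      unfolding B_bullet_comp_nth[OF l i]
      by (rule virtual_val_finprod[OF L SH[OF i] w[OF i]])
        (auto intro!: virtual_comp_closed L SH SK i mat_homD[OF A] mat_homD[OF B l])
    also have "\<dots> = finprod (Mo (cosets (Ls ! l))) (?t i) {..<length Ks}"
    proof (rule Ml.finprod_cong')
      fix j assume "j \<in> {..<length Ks}"
      then have j: "j < length Ks" by simp
      show "virtual_val (Ls ! l) (Hs ! i) (virtual_comp G (Ls ! l) (Ks ! j) (Hs ! i) (B (l, j)) (A (j, i))) (?w i) = ?t i j"
        by (rule virtual_val_comp[OF L SK[OF j] SH[OF i] mat_homD[OF B l j] mat_homD[OF A j i] w[OF i]])
    qed (use i sA sB in auto)
    finally show "virtual_val (Ls ! l) (Hs ! i) (cat_comp (B_bullet G) Hs Ks Ls B A (l, i)) (?w i) =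
        finprod (Mo (cosets (Ls ! l))) (?t i) {..<length Ks}" .
  qed (use sA sB in \<open>auto intro!: Ml.finprod_closed\<close>)
  also have "\<dots> = finprod (Mo (cosets (Ls ! l))) (\<lambda>j. finprod (Mo (cosets (Ls ! l))) (\<lambda>i. ?t i j) {..<length Hs}) {..<length Ks}"
    using sA sB by (intro Ml.finprod_swap) auto
  also have "\<dots> = mat_val Ks Ls B (restr Ks (farr biset_func Hs Ks A u)) l"
    unfolding mat_val_def
  proof (rule Ml.finprod_cong'[symmetric])
    fix j assume "j \<in> {..<length Ks}"
    then have j: "j < length Ks" by simp
    show "virtual_val (Ls ! l) (Ks ! j) (B (l, j)) (restr Ks (farr biset_func Hs Ks A u) j) =
        finprod (Mo (cosets (Ls ! l))) (\<lambda>i. ?t i j) {..<length Hs}"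
      unfolding restr_farr[OF Hs Ks A u j] mat_val_def
      by (rule finprod_hom[OF Mo_comm_group[OF finite_gset_cosets[OF SK[OF j]]]
            Mo_comm_group[OF finite_gset_cosets[OF L]] virtual_val_hom[OF L SK[OF j] mat_homD[OF B l j]]])
        (auto intro: sA j)
  qed (use sA sB in \<open>auto intro!: Ml.finprod_closed\<close>)
  finally show "restr Ls (farr biset_func Hs Ls (cat_comp (B_bullet G) Hs Ks Ls B A) u) l =
      restr Ls (farr biset_func Ks Ls B (farr biset_func Hs Ks A u)) l"
    unfolding restr_farr[OF Hs Ls C u l] restr_farr[OF Ks Ls B Au l] .
qed

text \<open>The regular biset is presented by the identity span.\<close>

lemma virtual_val_reg:
  assumes H: "subgroup H G" and u: "u \<in> carrier (Mo (cosets H))"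
  shows "virtual_val H H (virtual_cls G H H (reg_biset G H)) u = u"
proof -
  note C = finite_gset_cosets[OF H]
  show ?thesis
    using virtual_val_virtual_cls[OF H H u finite_reg_biset[OF H] reg_biset_span[OF H]] u
    by (simp add: span_val_def con_id[OF C] cov_id[OF C])
qed

lemma B_bullet_id_closed:
  assumes Hs: "Hs \<in> cat_obj (B_bullet G)"
  shows "cat_id (B_bullet G) Hs \<in> mat_hom (B_cat G) Hs Hs"
proof -
  have S: "subgroup (Hs ! i) G" if "i < length Hs" for i using Hs that by (simp add: B_bullet_obj)
  have "virtual_cls G (Hs ! i) (Hs ! i) (reg_biset G (Hs ! i)) \<in> carrier (virtual_bisets G (Hs ! i) (Hs ! i))"
    if "i < length Hs" for i
    by (intro virtual_cls_closed S that conj_biset_if_iso_span[OF S S finite_reg_biset reg_biset_span])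
  moreover have "\<one>\<^bsub>virtual_bisets G (Hs ! l) (Hs ! i)\<^esub> \<in> carrier (virtual_bisets G (Hs ! l) (Hs ! i))"
    if "l < length Hs" "i < length Hs" for l i
    using comm_group.axioms(1)[OF virtual_bisets_comm_group[OF S[OF that(1)] S[OF that(2)]]]
    by (simp add: comm_monoid.axioms(1) monoid.one_closed)
  ultimately show ?thesis
    unfolding mat_hom_def by (auto simp: B_bullet_def additive_completion_def B_cat_def)
qed

text \<open>Diagonal entries act as identities and the zero entries contribute neutral factors, so
  one factor of each product remains.\<close>

lemma farr_id:
  assumes Hs: "Hs \<in> cat_obj (B_bullet G)" and u: "u \<in> carrier (Mo (coprod_set Hs))"
  shows "farr biset_func Hs Hs (cat_id (B_bullet G) Hs) u = u"
proof (rule restr_eqI[OF Hs _ u])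
  note I = B_bullet_id_closed[OF Hs] and w = restr_closed[OF Hs _ u]
  show "farr biset_func Hs Hs (cat_id (B_bullet G) Hs) u \<in> carrier (Mo (coprod_set Hs))"
    by (rule farr_closed[OF Hs Hs I u])
  fix l assume l: "l < length Hs"
  have S: "subgroup (Hs ! i) G" if "i < length Hs" for i using Hs that by (simp add: B_bullet_obj)
  interpret Ml: comm_group "Mo (cosets (Hs ! l))" by (intro Mo_comm_group finite_gset_cosets S l)
  have "mat_val Hs Hs (cat_id (B_bullet G) Hs) (restr Hs u) l =
      finprod (Mo (cosets (Hs ! l))) (\<lambda>i. if l = i then restr Hs u l else \<one>\<^bsub>Mo (cosets (Hs ! l))\<^esub>) {..<length Hs}"
    unfolding mat_val_def
    using l w by (intro Ml.finprod_cong')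
      (auto simp: B_bullet_id_nth virtual_val_reg S virtual_val_one)
  also have "\<dots> = restr Hs u l"
    using Ml.finprod_singleton[of l "{..<length Hs}" "\<lambda>_. restr Hs u l"] l w by simp
  finally show "restr Hs (farr biset_func Hs Hs (cat_id (B_bullet G) Hs) u) l = restr Hs u l"
    unfolding restr_farr[OF Hs Hs I u l] .
qed

lemma B_bullet_add_closed:
  assumes Hs: "Hs \<in> cat_obj (B_bullet G)" and Ks: "Ks \<in> cat_obj (B_bullet G)"
    and A: "A \<in> mat_hom (B_cat G) Hs Ks" and B: "B \<in> mat_hom (B_cat G) Hs Ks"
  shows "A \<otimes>\<^bsub>hom_grp (B_bullet G) Hs Ks\<^esub> B \<in> mat_hom (B_cat G) Hs Ks"
proof -
  have "A (l, i) \<otimes>\<^bsub>virtual_bisets G (Ks ! l) (Hs ! i)\<^esub> B (l, i) \<in> carrier (virtual_bisets G (Ks ! l) (Hs ! i))"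
    if l: "l < length Ks" and i: "i < length Hs" for l i
  proof -
    have S: "subgroup (Ks ! l) G" "subgroup (Hs ! i) G" using Ks Hs l i by (auto simp: B_bullet_obj)
    interpret comm_group "virtual_bisets G (Ks ! l) (Hs ! i)" by (rule virtual_bisets_comm_group[OF S])
    show ?thesis using mat_homD[OF A l i] mat_homD[OF B l i] by simp
  qed
  then show ?thesis
    unfolding mat_hom_def by (auto simp: B_bullet_def additive_completion_def B_cat_def)
qed

lemma farr_add:
  assumes Hs: "Hs \<in> cat_obj (B_bullet G)" and Ks: "Ks \<in> cat_obj (B_bullet G)"
    and A: "A \<in> mat_hom (B_cat G) Hs Ks" and B: "B \<in> mat_hom (B_cat G) Hs Ks"
    and u: "u \<in> carrier (Mo (coprod_set Hs))"
  shows "farr biset_func Hs Ks (A \<otimes>\<^bsub>hom_grp (B_bullet G) Hs Ks\<^esub> B) u =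
    farr biset_func Hs Ks A u \<otimes>\<^bsub>Mo (coprod_set Ks)\<^esub> farr biset_func Hs Ks B u"
proof (rule restr_eqI[OF Ks])
  note C = B_bullet_add_closed[OF Hs Ks A B] and w = restr_closed[OF Hs _ u]
  note cl = farr_closed[OF Hs Ks A u] farr_closed[OF Hs Ks B u]
  interpret MK: comm_group "Mo (coprod_set Ks)" by (rule coprod_set_comm_group[OF Ks])
  show "farr biset_func Hs Ks (A \<otimes>\<^bsub>hom_grp (B_bullet G) Hs Ks\<^esub> B) u \<in> carrier (Mo (coprod_set Ks))"
    by (rule farr_closed[OF Hs Ks C u])
  show "farr biset_func Hs Ks A u \<otimes>\<^bsub>Mo (coprod_set Ks)\<^esub> farr biset_func Hs Ks B u \<in> carrier (Mo (coprod_set Ks))"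
    using cl by simp
  fix l assume l: "l < length Ks"
  have K: "subgroup (Ks ! l) G" using Ks l by (simp add: B_bullet_obj)
  have SH: "subgroup (Hs ! i) G" if "i < length Hs" for i using Hs that by (simp add: B_bullet_obj)
  interpret Ml: comm_group "Mo (cosets (Ks ! l))" by (intro Mo_comm_group finite_gset_cosets K)
  note sA = mat_val_summand_closed[OF Hs Ks A l _ w] and sB = mat_val_summand_closed[OF Hs Ks B l _ w]
  have "mat_val Hs Ks (A \<otimes>\<^bsub>hom_grp (B_bullet G) Hs Ks\<^esub> B) (restr Hs u) l =
      finprod (Mo (cosets (Ks ! l))) (\<lambda>i. virtual_val (Ks ! l) (Hs ! i) (A (l, i)) (restr Hs u i)
        \<otimes>\<^bsub>Mo (cosets (Ks ! l))\<^esub> virtual_val (Ks ! l) (Hs ! i) (B (l, i)) (restr Hs u i)) {..<length Hs}"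
    unfolding mat_val_def
    using sA sB w by (intro Ml.finprod_cong')
      (auto simp: B_bullet_add_nth[OF l] virtual_val_mult[OF K SH _ mat_homD[OF A l] mat_homD[OF B l]])
  also have "\<dots> = mat_val Hs Ks A (restr Hs u) l \<otimes>\<^bsub>Mo (cosets (Ks ! l))\<^esub> mat_val Hs Ks B (restr Hs u) l"
    unfolding mat_val_def using sA sB by (intro Ml.finprod_multf) auto
  finally show "restr Ks (farr biset_func Hs Ks (A \<otimes>\<^bsub>hom_grp (B_bullet G) Hs Ks\<^esub> B) u) l =
      restr Ks (farr biset_func Hs Ks A u \<otimes>\<^bsub>Mo (coprod_set Ks)\<^esub> farr biset_func Hs Ks B u) l"
    unfolding restr_mult[OF Ks l cl] restr_farr[OF Hs Ks C u l] restr_farr[OF Hs Ks A u l]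
      restr_farr[OF Hs Ks B u l] .
qed

lemma biset_func_simps:
  "fobj biset_func Hs = Mo (coprod_set Hs)"
  "farr biset_func Hs Ks A \<in> extensional (carrier (Mo (coprod_set Hs)))"
  by (simp_all add: biset_func_def)

lemma additive_functor_biset_func: "additive_functor (B_bullet G) Ab biset_func"
  unfolding additive_functor_def is_functor_def
proof (intro conjI ballI)
  fix Hs assume Hs: "Hs \<in> cat_obj (B_bullet G)"
  show "fobj biset_func Hs \<in> cat_obj Ab"
    using coprod_set_comm_group[OF Hs] by (simp add: biset_func_simps Ab_def)
  show "farr biset_func Hs Hs (cat_id (B_bullet G) Hs) = cat_id Ab (fobj biset_func Hs)"
    by (rule extensionalityI[OF biset_func_simps(2)]) (auto simp: biset_func_simps(1) Ab_def farr_id[OF Hs])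
  fix Ks assume Ks: "Ks \<in> cat_obj (B_bullet G)"
  fix A assume "A \<in> cat_hom (B_bullet G) Hs Ks"
  then have A: "A \<in> mat_hom (B_cat G) Hs Ks" by (simp add: B_bullet_hom)
  show "farr biset_func Hs Ks A \<in> cat_hom Ab (fobj biset_func Hs) (fobj biset_func Ks)"
    using farr_hom[OF Hs Ks A] biset_func_simps(2) by (simp add: biset_func_simps(1) Ab_def)
next
  fix Hs Ks Ls A B
  assume Hs: "Hs \<in> cat_obj (B_bullet G)" and Ks: "Ks \<in> cat_obj (B_bullet G)" and Ls: "Ls \<in> cat_obj (B_bullet G)"
    and "A \<in> cat_hom (B_bullet G) Hs Ks" "B \<in> cat_hom (B_bullet G) Ks Ls"
  then have A: "A \<in> mat_hom (B_cat G) Hs Ks" "B \<in> mat_hom (B_cat G) Ks Ls" by (simp_all add: B_bullet_hom)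
  show "farr biset_func Hs Ls (cat_comp (B_bullet G) Hs Ks Ls B A) =
      cat_comp Ab (fobj biset_func Hs) (fobj biset_func Ks) (fobj biset_func Ls)
        (farr biset_func Ks Ls B) (farr biset_func Hs Ks A)"
    by (rule extensionalityI[OF biset_func_simps(2)])
      (simp_all add: biset_func_simps(1) Ab_def compose_eq farr_comp[OF Hs Ks Ls A])
next
  fix Hs Ks A B
  assume Hs: "Hs \<in> cat_obj (B_bullet G)" and Ks: "Ks \<in> cat_obj (B_bullet G)"
    and "A \<in> cat_hom (B_bullet G) Hs Ks" "B \<in> cat_hom (B_bullet G) Hs Ks"
  then have A: "A \<in> mat_hom (B_cat G) Hs Ks" "B \<in> mat_hom (B_cat G) Hs Ks" by (simp_all add: B_bullet_hom)
  show "farr biset_func Hs Ks (A \<otimes>\<^bsub>hom_grp (B_bullet G) Hs Ks\<^esub> B) =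
      farr biset_func Hs Ks A \<otimes>\<^bsub>hom_grp Ab (fobj biset_func Hs) (fobj biset_func Ks)\<^esub> farr biset_func Hs Ks B"
    by (rule extensionalityI[OF biset_func_simps(2)])
      (simp_all add: biset_func_simps(1) Ab_def farr_add[OF Hs Ks A])
qed

end

section \<open>Base points and the entries of \<open>j\<close>\<close>

context fin_group
begin

lemma j_obj_simps:
  "length (j_obj G bp S) = length (bp S)"
  "i < length (bp S) \<Longrightarrow> j_obj G bp S ! i = stabilizer G (snd S) (bp S ! i)"
  by (simp_all add: j_obj_def)

context
  fixes bp :: "'g gset \<Rightarrow> 'g pt list"
  assumes bp: "base_point_choice G bp"
begin

lemma bp_mem: "finite_gset G S \<Longrightarrow> i < length (bp S) \<Longrightarrow> bp S ! i \<in> fst S"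
  using bp[unfolded base_point_choice_def, THEN conjunct1, rule_format, THEN conjunct1, of S]
  by (auto intro: nth_mem)

lemma bp_orbit: "finite_gset G S \<Longrightarrow> x \<in> fst S \<Longrightarrow> \<exists>!i. i < length (bp S) \<and> bp S ! i \<in> orbit G (snd S) x"
  using bp[unfolded base_point_choice_def, THEN conjunct1, rule_format, THEN conjunct2, rule_format,
      of S "orbit G (snd S) x"]
  by (auto simp: orbits_def)

lemma j_obj_obj: "finite_gset G S \<Longrightarrow> j_obj G bp S \<in> cat_obj (B_bullet G)"
  using stabilizer_subgroup bp_mem by (simp add: B_bullet_obj j_obj_simps)

text \<open>Each base point parametrizes its orbit by the cosets of its stabilizer; having exactly
  one base point in every orbit gives both covering and disjointness.\<close>

lemma bp_coprod:
  assumes S: "finite_gset G S"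
  shows "is_coprod (j_obj G bp S) S (\<lambda>i. stab_map S (bp S ! i))"
proof -
  note sm = stab_map[OF S bp_mem[OF S]]
  have im: "stab_map S (bp S ! i) ` fst (cosets (stabilizer G (snd S) (bp S ! i))) =
      {snd S a (bp S ! i) | a. a \<in> carrier G}" if "i < length (bp S)" for i
    unfolding fst_cosets by (auto simp: sm[OF that] image_image)
  have "fst S \<subseteq> (\<Union>i<length (bp S). stab_map S (bp S ! i) ` fst (cosets (stabilizer G (snd S) (bp S ! i))))"
  proof
    fix z assume z: "z \<in> fst S"
    obtain i g where i: "i < length (bp S)" and g: "g \<in> carrier G" "bp S ! i = snd S g z"
      using bp_orbit[OF S z] by (auto simp: orbit_def)
    have "z = snd S (inv g) (bp S ! i)" using g z S by (simp add: gset_inv)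
    then show "z \<in> (\<Union>i<length (bp S). stab_map S (bp S ! i) ` fst (cosets (stabilizer G (snd S) (bp S ! i))))"
      using i g(1) im[OF i] inv_closed[OF g(1)] by blast
  qed
  moreover have "stab_map S (bp S ! i) ` fst (cosets (stabilizer G (snd S) (bp S ! i))) \<inter>
      stab_map S (bp S ! j) ` fst (cosets (stabilizer G (snd S) (bp S ! j))) = {}"
    if i: "i < length (bp S)" and j: "j < length (bp S)" and "i \<noteq> j" for i j
  proof (rule ccontr)
    assume "\<not> ?thesis"
    then obtain a b where ab: "a \<in> carrier G" "b \<in> carrier G" "snd S a (bp S ! i) = snd S b (bp S ! j)"
      unfolding im[OF i] im[OF j] by auto
    let ?y = "snd S a (bp S ! i)"
    have y: "?y \<in> fst S" by (rule gset_closed[OF S ab(1) bp_mem[OF S i]])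
    have "bp S ! i = snd S (inv a) ?y"
      by (rule gset_inv(1)[OF S ab(1) bp_mem[OF S i], symmetric])
    moreover have "bp S ! j = snd S (inv b) ?y"
      unfolding ab(3) by (rule gset_inv(1)[OF S ab(2) bp_mem[OF S j], symmetric])
    ultimately have "bp S ! i \<in> orbit G (snd S) ?y" "bp S ! j \<in> orbit G (snd S) ?y"
      unfolding orbit_def using ab(1,2) inv_closed by blast+
    then show False using bp_orbit[OF S y] i j \<open>i \<noteq> j\<close> by blast
  qed
  ultimately show ?thesis
    using S sm by (simp add: is_coprod_def j_obj_simps)
qed

end

text \<open>If \<open>h\<close> fixes \<open>b\<close>, it fixes \<open>\<phi> b = g c\<close>,
  hence its conjugate by \<open>g\<close> fixes \<open>c\<close>. This inclusion is what the bisets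
  of \<open>j\<close> require.\<close>

lemma transporter_conj:
  assumes S: "finite_gset G S" "finite_gset G T" and \<phi>: "\<phi> \<in> gmaps G S T"
    and b: "b \<in> fst S" and c: "c \<in> fst T" and g: "g \<in> transporter G T c (\<phi> b)"
    and h: "h \<in> stabilizer G (snd S) b"
  shows "inv g \<otimes> h \<otimes> g \<in> stabilizer G (snd T) c"
proof -
  have gC: "g \<in> carrier G" and gc: "\<phi> b = snd T g c" using g by (auto simp: transporter_def)
  have hC: "h \<in> carrier G" and hb: "snd S h b = b" using stabilizerD[OF h] by auto
  have "snd T h (\<phi> b) = \<phi> b" using gmapsD(2)[OF \<phi> hC b] hb by simp
  then have "snd T (inv g) (snd T h (snd T g c)) = c" using S gC c gc by (simp add: gset_inv)
  then show ?thesis using S gC hC c by (simp add: stabilizer_def gset_mult gset_closed)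
qed

text \<open>In terms of cosets \<phi> restricted to the orbit of \<open>b\<close> is
  \<open>aH \<mapsto> a g K\<close>; both composites send the base coset to
  \<open>g c\<close>.\<close>

lemma transporter_square:
  assumes S: "finite_gset G S" "finite_gset G T" and \<phi>: "\<phi> \<in> gmaps G S T"
    and b: "b \<in> fst S" and c: "c \<in> fst T" and g: "g \<in> transporter G T c (\<phi> b)"
  defines "H \<equiv> stabilizer G (snd S) b" and "K \<equiv> stabilizer G (snd T) c"
  shows "orbit_map (cosets K) H (pc K g) \<in> gmaps G (cosets H) (cosets K)"
    and "compose (fst (cosets H)) \<phi> (stab_map S b) =
      compose (fst (cosets H)) (stab_map T c) (orbit_map (cosets K) H (pc K g))"
proof -
  have H: "subgroup H G" and K: "subgroup K G" unfolding H_def K_def using stabilizer_subgroup S b c by auto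
  have gC: "g \<in> carrier G" and gc: "\<phi> b = snd T g c" using g by (auto simp: transporter_def)
  note sub = transporter_conj[OF S \<phi> b c g, folded H_def K_def]
  note om = conj_orbit_map[OF K H gC sub]
  show o: "orbit_map (cosets K) H (pc K g) \<in> gmaps G (cosets H) (cosets K)" by (rule om(1))
  have one: "pc H \<one> \<in> fst (cosets H)" by (simp add: fst_cosets)
  have v: "orbit_map (cosets K) H (pc K g) (pc H \<one>) = pc K g" using gC by (simp add: om)
  show "compose (fst (cosets H)) \<phi> (stab_map S b) =
      compose (fst (cosets H)) (stab_map T c) (orbit_map (cosets K) H (pc K g))"
    by (rule gmaps_cosets_eqI[OF H gmaps_compose[OF stab_map(1)[OF S(1) b, folded H_def] \<phi> finite_gset_cosets[OF H]]
          gmaps_compose[OF o stab_map(1)[OF S(2) c, folded K_def] finite_gset_cosets[OF H]]])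
      (use stab_map(2)[OF S(1) b, folded H_def] stab_map(2)[OF S(2) c, folded K_def] gC gc S b
       in \<open>simp add: compose_eq one v gset_one flip: H_def K_def\<close>)
qed

text \<open>A common point would put \<open>\<phi> b\<close> into the orbit of \<open>c\<close> and
  so yield an element of the transporter.\<close>

lemma transporter_empty_disjoint:
  assumes S: "finite_gset G S" "finite_gset G T" and \<phi>: "\<phi> \<in> gmaps G S T"
    and b: "b \<in> fst S" and c: "c \<in> fst T" and e: "transporter G T c (\<phi> b) = {}"
  defines "H \<equiv> stabilizer G (snd S) b" and "K \<equiv> stabilizer G (snd T) c"
  shows "compose (fst (cosets H)) \<phi> (stab_map S b) ` fst (cosets H) \<inter> stab_map T c ` fst (cosets K) = {}"
proof (rule ccontr)
  assume "\<not> ?thesis"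
  then obtain a d where a: "a \<in> carrier G" "d \<in> carrier G"
    "compose (fst (cosets H)) \<phi> (stab_map S b) (pc H a) = stab_map T c (pc K d)"
    unfolding fst_cosets[of H] fst_cosets[of K] by blast
  then have "\<phi> (snd S a b) = snd T d c"
    using stab_map(2)[OF S(1) b, folded H_def] stab_map(2)[OF S(2) c, folded K_def]
    by (simp add: compose_eq fst_cosets flip: H_def K_def)
  then have "snd T a (\<phi> b) = snd T d c" using gmapsD(2)[OF \<phi> a(1) b] by simp
  then have "\<phi> b = snd T (inv a \<otimes> d) c"
    using gset_inv_iff[OF S(2) a(1) gmapsD(1)[OF \<phi> b] gset_closed[OF S(2) a(2) c]] a S c
    by (simp add: gset_mult)
  then have "inv a \<otimes> d \<in> transporter G T c (\<phi> b)" using a by (simp add: transporter_def)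
  then show False using e by blast
qed

lemma j_functor_simps:
  fixes \<phi> :: "'g pt \<Rightarrow> 'g pt"
  assumes "l < length (bp T)" "i < length (bp S)"
  defines "H \<equiv> stabilizer G (snd S) (bp S ! i)" and "K \<equiv> stabilizer G (snd T) (bp T ! l)"
  defines "P \<equiv> transporter G T (bp T ! l) (\<phi> (bp S ! i))"
  shows "bcov (j_functor G bp) S T \<phi> (l, i) =
      (if P \<noteq> {} then virtual_cls G K H (cov_biset G K (SOME g. g \<in> P))
       else virtual_cls G K H (empty_biset :: ('g, nat) biset))"
    and "bcon (j_functor G bp) S T \<phi> (i, l) =
      (if P \<noteq> {} then virtual_cls G H K (con_biset G K (SOME g. g \<in> P))
       else virtual_cls G H K (empty_biset :: ('g, nat) biset))"
  using assms(1,2) by (simp_all add: j_functor_def j_obj_simps Let_def H_def K_def P_def)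

lemma j_functor_obj: "bobj (j_functor G bp) = j_obj G bp"
  by (simp add: j_functor_def)

text \<open>The nonempty entries are classes of conjugation bisets because they come from
  spans.\<close>

lemma j_functor_closed:
  assumes bp: "base_point_choice G bp" and S: "finite_gset G S" "finite_gset G T" and \<phi>: "\<phi> \<in> gmaps G S T"
  shows "bcov (j_functor G bp) S T \<phi> \<in> mat_hom (B_cat G) (j_obj G bp S) (j_obj G bp T)"
    and "bcon (j_functor G bp) S T \<phi> \<in> mat_hom (B_cat G) (j_obj G bp T) (j_obj G bp S)"
proof -
  have *: "bcov (j_functor G bp) S T \<phi> (l, i) \<in> carrier (virtual_bisets G (j_obj G bp T ! l) (j_obj G bp S ! i))"
    "bcon (j_functor G bp) S T \<phi> (i, l) \<in> carrier (virtual_bisets G (j_obj G bp S ! i) (j_obj G bp T ! l))"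
    if l: "l < length (bp T)" and i: "i < length (bp S)" for l i
  proof -
    note b = bp_mem[OF bp S(1) i] and c = bp_mem[OF bp S(2) l]
    let ?P = "transporter G T (bp T ! l) (\<phi> (bp S ! i))"
    let ?H = "stabilizer G (snd S) (bp S ! i)" and ?K = "stabilizer G (snd T) (bp T ! l)"
    have H: "subgroup ?H G" by (rule stabilizer_subgroup[OF S(1) b])
    have K: "subgroup ?K G" by (rule stabilizer_subgroup[OF S(2) c])
    have "conj_biset G ?K ?H (cov_biset G ?K (SOME g. g \<in> ?P))"
      "conj_biset G ?H ?K (con_biset G ?K (SOME g. g \<in> ?P))" if "?P \<noteq> {}"
    proof -
      have g: "(SOME g. g \<in> ?P) \<in> ?P" using that by (simp add: some_in_eq)
      then have gC: "(SOME g. g \<in> ?P) \<in> carrier G" by (simp add: transporter_def)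
      note sub = transporter_conj[OF S \<phi> b c g]
      show "conj_biset G ?K ?H (cov_biset G ?K (SOME g. g \<in> ?P))"
        by (rule conj_biset_if_iso_span[OF K H finite_cov_biset[OF K H gC sub] cov_biset_span[OF K H gC sub]])
      show "conj_biset G ?H ?K (con_biset G ?K (SOME g. g \<in> ?P))"
        by (rule conj_biset_if_iso_span[OF H K finite_con_biset[OF K H gC sub] con_biset_span[OF K H gC sub]])
    qed
    then show "bcov (j_functor G bp) S T \<phi> (l, i) \<in> carrier (virtual_bisets G (j_obj G bp T ! l) (j_obj G bp S ! i))"
      "bcon (j_functor G bp) S T \<phi> (i, l) \<in> carrier (virtual_bisets G (j_obj G bp S ! i) (j_obj G bp T ! l))"
      using l i by (auto simp: j_functor_simps j_obj_simps intro!: virtual_cls_closed H K conj_biset_empty)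
  qed
  have "bcov (j_functor G bp) S T \<phi> \<in> extensional (mat_index (j_obj G bp S) (j_obj G bp T))"
    "bcon (j_functor G bp) S T \<phi> \<in> extensional (mat_index (j_obj G bp T) (j_obj G bp S))"
    by (simp_all add: j_functor_def)
  with * show "bcov (j_functor G bp) S T \<phi> \<in> mat_hom (B_cat G) (j_obj G bp S) (j_obj G bp T)"
    "bcon (j_functor G bp) S T \<phi> \<in> mat_hom (B_cat G) (j_obj G bp T) (j_obj G bp S)"
    by (auto simp: mat_hom_def PiE_iff B_cat_def j_obj_simps(1))
qed

end

context conj_mackey
begin

lemma virtual_val_empty:
  assumes H: "subgroup H2 G" "subgroup H1 G" and u: "u \<in> carrier (Mo (cosets H1))"
  shows "virtual_val H2 H1 (virtual_cls G H2 H1 (empty_biset :: ('g, nat) biset)) u = \<one>\<^bsub>Mo (cosets H2)\<^esub>"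
proof -
  interpret B: comm_monoid "biset_monoid G H2 H1" by (rule biset_monoid_comm_monoid[OF H])
  have "biset_cls G H2 H1 (empty_biset :: ('g, nat) biset) = \<one>\<^bsub>biset_monoid G H2 H1\<^esub>"
    by (simp add: biset_monoid_def)
  then show ?thesis
    using virtual_val_one[OF H u] unfolding virtual_cls_eq virtual_bisets_def B.groth_one by simp
qed

context
  fixes bp S T \<phi> l i
  assumes bp: "base_point_choice G bp" and S: "finite_gset G S" "finite_gset G T"
    and \<phi>: "\<phi> \<in> gmaps G S T" and l: "l < length (bp T)" and i: "i < length (bp S)"
begin

text \<open>Relative to the orbit decompositions, the matrix entries of \<open>M\<close> at \<phi>
  are the actions of the entries of \<open>j\<close>. If \<open>\<phi> b\<close> misses the orbit of
  \<open>c\<close>, both are trivial by disjointness; otherwise \<phi> becomes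
  \<open>aH \<mapsto> a g K\<close>, a leg of the span that presents the biset.\<close>

lemma j_functor_entry:
  defines "H \<equiv> stabilizer G (snd S) (bp S ! i)" and "K \<equiv> stabilizer G (snd T) (bp T ! l)"
  shows "\<And>w. w \<in> carrier (Mo (cosets H)) \<Longrightarrow>
      con (cosets K) T (stab_map T (bp T ! l)) (cov S T \<phi> (cov (cosets H) S (stab_map S (bp S ! i)) w)) =
      virtual_val K H (bcov (j_functor G bp) S T \<phi> (l, i)) w"
    and "\<And>w. w \<in> carrier (Mo (cosets K)) \<Longrightarrow>
      con (cosets H) S (stab_map S (bp S ! i)) (con S T \<phi> (cov (cosets K) T (stab_map T (bp T ! l)) w)) =
      virtual_val H K (bcon (j_functor G bp) S T \<phi> (i, l)) w"
proof -
  note b = bp_mem[OF bp S(1) i] and c = bp_mem[OF bp S(2) l]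
  let ?P = "transporter G T (bp T ! l) (\<phi> (bp S ! i))"
  have H: "subgroup H G" unfolding H_def by (rule stabilizer_subgroup[OF S(1) b])
  have K: "subgroup K G" unfolding K_def by (rule stabilizer_subgroup[OF S(2) c])
  note CH = finite_gset_cosets[OF H] and CK = finite_gset_cosets[OF K]
  let ?\<tau> = "stab_map S (bp S ! i)" and ?\<sigma> = "stab_map T (bp T ! l)"
  have \<tau>: "?\<tau> \<in> gmaps G (cosets H) S" and \<sigma>: "?\<sigma> \<in> gmaps G (cosets K) T"
    and \<sigma>_inj: "inj_on ?\<sigma> (fst (cosets K))"
    using stab_map(1)[OF S(1) b] stab_map(1,3)[OF S(2) c] by (simp_all add: H_def K_def)
  note \<phi>\<tau> = gmaps_compose[OF \<tau> \<phi> CH]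
  let ?g = "SOME g. g \<in> ?P"
  let ?\<psi> = "orbit_map (cosets K) H (pc K ?g)" and ?id = "\<lambda>x\<in>fst (cosets H). x"
  have g: "?g \<in> ?P" if "?P \<noteq> {}" using that by (simp add: some_in_eq)
  have gC: "?g \<in> carrier G" if "?P \<noteq> {}" using g[OF that] by (simp add: transporter_def)
  note sub = transporter_conj[OF S \<phi> b c g, folded H_def K_def]
  note sq = transporter_square[OF S \<phi> b c g, folded H_def K_def]
  note j = j_functor_simps[of l bp T i S \<phi>, OF l i, folded H_def K_def]
  show "con (cosets K) T ?\<sigma> (cov S T \<phi> (cov (cosets H) S ?\<tau> w)) =
      virtual_val K H (bcov (j_functor G bp) S T \<phi> (l, i)) w" if w: "w \<in> carrier (Mo (cosets H))" for w
  proof -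
    have e: "cov S T \<phi> (cov (cosets H) S ?\<tau> w) = cov (cosets H) T (compose (fst (cosets H)) \<phi> ?\<tau>) w"
      by (rule cov_compose[OF CH S \<tau> \<phi> w, symmetric])
    show ?thesis
    proof (cases "?P = {}")
      case True
      have "?\<sigma> ` fst (cosets K) \<inter> compose (fst (cosets H)) \<phi> ?\<tau> ` fst (cosets H) = {}"
        by (subst Int_commute) (rule transporter_empty_disjoint[OF S \<phi> b c True, folded H_def K_def])
      from con_cov_disjoint[OF CK CH S(2) \<sigma> \<phi>\<tau> this w] show ?thesis
        unfolding e j using True by (simp add: virtual_val_empty[OF K H w])
    next
      case False
      note \<psi> = sq(1)[OF False]
      \<comment> \<open>The orbit embedding into \<open>T\<close> is injective, so pushing forward
        along it and restricting again changes nothing.\<close>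
      have "con (cosets K) T ?\<sigma> (cov (cosets H) T (compose (fst (cosets H)) \<phi> ?\<tau>) w) = cov (cosets H) (cosets K) ?\<psi> w"
        unfolding sq(2)[OF False] cov_compose[OF CH CK S(2) \<psi> \<sigma> w]
        by (rule con_cov_inj[OF CK S(2) \<sigma> \<sigma>_inj cov_closed[OF CH CK \<psi> w]])
      also have "\<dots> = span_val K H (cosets H) ?id ?\<psi> w"
        by (simp add: span_val_def con_id[OF CH w])
      also have "\<dots> = virtual_val K H (virtual_cls G K H (cov_biset G K ?g)) w"
        by (rule virtual_val_virtual_cls[OF K H w finite_cov_biset[OF K H gC[OF False] sub[OF False]]
              cov_biset_span[OF K H gC[OF False] sub[OF False]], symmetric])
      finally show ?thesis unfolding e j using False by simp
    qed
  qed
  show "con (cosets H) S ?\<tau> (con S T \<phi> (cov (cosets K) T ?\<sigma> w)) =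
      virtual_val H K (bcon (j_functor G bp) S T \<phi> (i, l)) w" if w: "w \<in> carrier (Mo (cosets K))" for w
  proof -
    note cw = cov_closed[OF CK S(2) \<sigma> w]
    have e: "con (cosets H) S ?\<tau> (con S T \<phi> (cov (cosets K) T ?\<sigma> w)) =
        con (cosets H) T (compose (fst (cosets H)) \<phi> ?\<tau>) (cov (cosets K) T ?\<sigma> w)"
      by (rule con_compose[OF CH S \<tau> \<phi> cw, symmetric])
    show ?thesis
    proof (cases "?P = {}")
      case True
      from con_cov_disjoint[OF CH CK S(2) \<phi>\<tau> \<sigma> transporter_empty_disjoint[OF S \<phi> b c True, folded H_def K_def] w]
      show ?thesis unfolding e j using True by (simp add: virtual_val_empty[OF H K w])
    next
      case False
      note \<psi> = sq(1)[OF False]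
      have "con (cosets H) T (compose (fst (cosets H)) \<phi> ?\<tau>) (cov (cosets K) T ?\<sigma> w) = con (cosets H) (cosets K) ?\<psi> w"
        unfolding sq(2)[OF False] con_compose[OF CH CK S(2) \<psi> \<sigma> cw] con_cov_inj[OF CK S(2) \<sigma> \<sigma>_inj w] ..
      also have "\<dots> = span_val H K (cosets H) ?\<psi> ?id w"
        by (simp add: span_val_def cov_id[OF CH con_closed[OF CH CK \<psi> w]])
      also have "\<dots> = virtual_val H K (virtual_cls G H K (con_biset G K ?g)) w"
        by (rule virtual_val_virtual_cls[OF H K w finite_con_biset[OF K H gC[OF False] sub[OF False]]
              con_biset_span[OF K H gC[OF False] sub[OF False]], symmetric])
      finally show ?thesis unfolding e j using False by simp
    qed
  qed
qed

end

section \<open>The natural isomorphism between \<open>M\<close> and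
  \<open>F \<circ> j\<close>\<close>

context
  fixes bp
  assumes bp: "base_point_choice G bp"
begin

text \<open>The component at \<open>S\<close> of the natural isomorphism. Both \<open>S\<close> and
  the chosen model are coproducts of the list \<open>j_obj G bp S\<close>, so a transfer between
  them is available.\<close>

definition unit_map :: "'g gset \<Rightarrow> 'a \<Rightarrow> 'a" where
  "unit_map S = coprod_transfer (j_obj G bp S) S (\<lambda>i. stab_map S (bp S ! i))
     (coprod_set (j_obj G bp S)) (coprod_inj (j_obj G bp S))"

context
  fixes S
  assumes S: "finite_gset G S"
begin

lemma j_obj_subgroup: "i < length (j_obj G bp S) \<Longrightarrow> subgroup (j_obj G bp S ! i) G"
  using j_obj_obj[OF bp S] by (simp add: B_bullet_obj)

lemma unit_map_iso: "unit_map S \<in> cat_iso Ab (Mo S) (Mo (coprod_set (j_obj G bp S)))"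
  unfolding unit_map_def
  by (rule coprod_transfer_iso[OF j_obj_subgroup bp_coprod[OF bp S] coprod[OF j_obj_subgroup]])

lemma unit_map_closed: "u \<in> carrier (Mo S) \<Longrightarrow> unit_map S u \<in> carrier (Mo (coprod_set (j_obj G bp S)))"
  unfolding unit_map_def
  by (rule hom_in_carrier[OF coprod_transfer(1)[OF j_obj_subgroup bp_coprod[OF bp S] coprod[OF j_obj_subgroup]]])

lemma restr_unit_map:
  "i < length (bp S) \<Longrightarrow> u \<in> carrier (Mo S) \<Longrightarrow> restr (j_obj G bp S) (unit_map S u) i =
    con (cosets (stabilizer G (snd S) (bp S ! i))) S (stab_map S (bp S ! i)) u"
  unfolding unit_map_def restr_def
  using coprod_transfer(2)[OF j_obj_subgroup bp_coprod[OF bp S] coprod[OF j_obj_subgroup], of i u]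
  by (simp add: j_obj_simps)

text \<open>Computes a homomorphism out of \<open>M(S)\<close> on the contributions of the orbits;
  this turns naturality into a comparison of matrix entries.\<close>

lemma hom_bp_decomp:
  assumes A: "comm_group A" and f: "f \<in> hom (Mo S) A" and u: "u \<in> carrier (Mo S)"
  shows "f u = finprod A (\<lambda>i. f (cov (cosets (stabilizer G (snd S) (bp S ! i))) S (stab_map S (bp S ! i))
    (restr (j_obj G bp S) (unit_map S u) i))) {..<length (bp S)}"
proof -
  let ?c = "\<lambda>i. cov (cosets (j_obj G bp S ! i)) S (stab_map S (bp S ! i))
    (con (cosets (j_obj G bp S ! i)) S (stab_map S (bp S ! i)) u)"
  have cl: "?c i \<in> carrier (Mo S)" if "i < length (j_obj G bp S)" for i
    by (rule coprod_cov_closed[OF j_obj_subgroup bp_coprod[OF bp S] that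
          coprod_con_closed[OF j_obj_subgroup bp_coprod[OF bp S] that u]])
  interpret A: comm_group A by (rule A)
  have "f u = f (finprod (Mo S) ?c {..<length (j_obj G bp S)})"
    using coprod_decomp[OF j_obj_subgroup bp_coprod[OF bp S] u] by simp
  also have "\<dots> = finprod A (\<lambda>i. f (?c i)) {..<length (j_obj G bp S)}"
    by (rule finprod_hom[OF Mo_comm_group[OF S] A f]) (auto intro: cl)
  also have "\<dots> = finprod A (\<lambda>i. f (cov (cosets (stabilizer G (snd S) (bp S ! i))) S (stab_map S (bp S ! i))
    (restr (j_obj G bp S) (unit_map S u) i))) {..<length (bp S)}"
    using cl hom_in_carrier[OF f] restr_unit_map u
    by (intro A.finprod_cong') (auto simp: j_obj_simps)
  finally show ?thesis .
qed

end

text \<open>One component is compared at a time. Decomposing the argument over the orbits leaves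
  exactly the entries computed in \<open>j_functor_entry\<close>, for the covariant and the
  contravariant part alike.\<close>

lemma unit_map_natural:
  assumes S: "finite_gset G S" "finite_gset G T" and \<phi>: "\<phi> \<in> gmaps G S T"
  shows "\<And>u. u \<in> carrier (Mo S) \<Longrightarrow> unit_map T (cov S T \<phi> u) =
      farr biset_func (j_obj G bp S) (j_obj G bp T) (bcov (j_functor G bp) S T \<phi>) (unit_map S u)"
    and "\<And>v. v \<in> carrier (Mo T) \<Longrightarrow> unit_map S (con S T \<phi> v) =
      farr biset_func (j_obj G bp T) (j_obj G bp S) (bcon (j_functor G bp) S T \<phi>) (unit_map T v)"
proof -
  let ?J = "j_obj G bp"
  note oS = j_obj_obj[OF bp S(1)] and oT = j_obj_obj[OF bp S(2)]
  note jc = j_functor_closed[OF bp S \<phi>]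
  have stS: "subgroup (stabilizer G (snd S) (bp S ! i)) G" if "i < length (bp S)" for i
    by (rule stabilizer_subgroup[OF S(1) bp_mem[OF bp S(1) that]])
  have stT: "subgroup (stabilizer G (snd T) (bp T ! i)) G" if "i < length (bp T)" for i
    by (rule stabilizer_subgroup[OF S(2) bp_mem[OF bp S(2) that]])
  note smS = stab_map(1)[OF S(1) bp_mem[OF bp S(1)]] and smT = stab_map(1)[OF S(2) bp_mem[OF bp S(2)]]
  show "unit_map T (cov S T \<phi> u) = farr biset_func (?J S) (?J T) (bcov (j_functor G bp) S T \<phi>) (unit_map S u)"
    if u: "u \<in> carrier (Mo S)" for u
  proof (rule restr_eqI[OF oT])
    note cu = cov_closed[OF S \<phi> u] and tu = unit_map_closed[OF S(1) u]
    show "unit_map T (cov S T \<phi> u) \<in> carrier (Mo (coprod_set (?J T)))" by (rule unit_map_closed[OF S(2) cu])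
    show "farr biset_func (?J S) (?J T) (bcov (j_functor G bp) S T \<phi>) (unit_map S u) \<in> carrier (Mo (coprod_set (?J T)))"
      by (rule farr_closed[OF oS oT jc(1) tu])
    fix l assume l': "l < length (?J T)"
    then have l: "l < length (bp T)" by (simp add: j_obj_simps)
    let ?K = "stabilizer G (snd T) (bp T ! l)"
    let ?f = "\<lambda>u. con (cosets ?K) T (stab_map T (bp T ! l)) (cov S T \<phi> u)"
    note CK = finite_gset_cosets[OF stT[OF l]]
    have f: "?f \<in> hom (Mo S) (Mo (cosets ?K))"
      by (rule homI) (simp_all add: CK S \<phi> smT[OF l] cov_closed con_closed cov_mult con_mult)
    interpret MK: comm_group "Mo (cosets ?K)" by (rule Mo_comm_group[OF CK])
    have r: "restr (?J S) (unit_map S u) i \<in> carrier (Mo (cosets (stabilizer G (snd S) (bp S ! i))))"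
      if "i < length (bp S)" for i
      using restr_closed[OF oS _ tu, of i] that by (simp add: j_obj_simps)
    have "?f u = finprod (Mo (cosets ?K)) (\<lambda>i. ?f (cov (cosets (stabilizer G (snd S) (bp S ! i))) S (stab_map S (bp S ! i))
        (restr (?J S) (unit_map S u) i))) {..<length (bp S)}"
      by (rule hom_bp_decomp[OF S(1) Mo_comm_group[OF CK] f u])
    also have "\<dots> = mat_val (?J S) (?J T) (bcov (j_functor G bp) S T \<phi>) (restr (?J S) (unit_map S u)) l"
      unfolding mat_val_def j_obj_simps(1) j_obj_simps(2)[of l bp T, OF l]
    proof (rule MK.finprod_cong')
      show "(\<lambda>i. virtual_val ?K (?J S ! i) (bcov (j_functor G bp) S T \<phi> (l, i)) (restr (?J S) (unit_map S u) i))
          \<in> {..<length (bp S)} \<rightarrow> carrier (Mo (cosets ?K))"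
        using mat_val_summand_closed[OF oS oT jc(1) l'] restr_closed[OF oS _ tu] by (auto simp: j_obj_simps l)
      fix i assume "i \<in> {..<length (bp S)}"
      then have i: "i < length (bp S)" by simp
      show "con (cosets ?K) T (stab_map T (bp T ! l)) (cov S T \<phi>
          (cov (cosets (stabilizer G (snd S) (bp S ! i))) S (stab_map S (bp S ! i)) (restr (?J S) (unit_map S u) i))) =
        virtual_val ?K (?J S ! i) (bcov (j_functor G bp) S T \<phi> (l, i)) (restr (?J S) (unit_map S u) i)"
        using j_functor_entry(1)[of bp S T \<phi> l i, OF bp S \<phi> l i r[OF i]] by (simp add: j_obj_simps l i)
    qed simp
    finally show "restr (?J T) (unit_map T (cov S T \<phi> u)) l =
        restr (?J T) (farr biset_func (?J S) (?J T) (bcov (j_functor G bp) S T \<phi>) (unit_map S u)) l"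
      unfolding restr_farr[OF oS oT jc(1) tu l'] restr_unit_map[OF S(2) l cu] .
  qed
  show "unit_map S (con S T \<phi> v) = farr biset_func (?J T) (?J S) (bcon (j_functor G bp) S T \<phi>) (unit_map T v)"
    if v: "v \<in> carrier (Mo T)" for v
  proof (rule restr_eqI[OF oS])
    note cv = con_closed[OF S \<phi> v] and tv = unit_map_closed[OF S(2) v]
    show "unit_map S (con S T \<phi> v) \<in> carrier (Mo (coprod_set (?J S)))" by (rule unit_map_closed[OF S(1) cv])
    show "farr biset_func (?J T) (?J S) (bcon (j_functor G bp) S T \<phi>) (unit_map T v) \<in> carrier (Mo (coprod_set (?J S)))"
      by (rule farr_closed[OF oT oS jc(2) tv])
    fix i assume i': "i < length (?J S)"
    then have i: "i < length (bp S)" by (simp add: j_obj_simps)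
    let ?H = "stabilizer G (snd S) (bp S ! i)"
    let ?f = "\<lambda>v. con (cosets ?H) S (stab_map S (bp S ! i)) (con S T \<phi> v)"
    note CH = finite_gset_cosets[OF stS[OF i]]
    have f: "?f \<in> hom (Mo T) (Mo (cosets ?H))"
      by (rule homI) (simp_all add: CH S \<phi> smS[OF i] con_closed con_mult)
    interpret MH: comm_group "Mo (cosets ?H)" by (rule Mo_comm_group[OF CH])
    have r: "restr (?J T) (unit_map T v) l \<in> carrier (Mo (cosets (stabilizer G (snd T) (bp T ! l))))"
      if "l < length (bp T)" for l
      using restr_closed[OF oT _ tv, of l] that by (simp add: j_obj_simps)
    have "?f v = finprod (Mo (cosets ?H)) (\<lambda>l. ?f (cov (cosets (stabilizer G (snd T) (bp T ! l))) T (stab_map T (bp T ! l))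
        (restr (?J T) (unit_map T v) l))) {..<length (bp T)}"
      by (rule hom_bp_decomp[OF S(2) Mo_comm_group[OF CH] f v])
    also have "\<dots> = mat_val (?J T) (?J S) (bcon (j_functor G bp) S T \<phi>) (restr (?J T) (unit_map T v)) i"
      unfolding mat_val_def j_obj_simps(1) j_obj_simps(2)[of i bp S, OF i]
    proof (rule MH.finprod_cong')
      show "(\<lambda>l. virtual_val ?H (?J T ! l) (bcon (j_functor G bp) S T \<phi> (i, l)) (restr (?J T) (unit_map T v) l))
          \<in> {..<length (bp T)} \<rightarrow> carrier (Mo (cosets ?H))"
        using mat_val_summand_closed[OF oT oS jc(2) i'] restr_closed[OF oT _ tv] by (auto simp: j_obj_simps i)
      fix l assume "l \<in> {..<length (bp T)}"
      then have l: "l < length (bp T)" by simp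
      show "con (cosets ?H) S (stab_map S (bp S ! i)) (con S T \<phi>
          (cov (cosets (stabilizer G (snd T) (bp T ! l))) T (stab_map T (bp T ! l)) (restr (?J T) (unit_map T v) l))) =
        virtual_val ?H (?J T ! l) (bcon (j_functor G bp) S T \<phi> (i, l)) (restr (?J T) (unit_map T v) l)"
        using j_functor_entry(2)[of bp S T \<phi> l i, OF bp S \<phi> l i r[OF l]] by (simp add: j_obj_simps l i)
    qed simp
    finally show "restr (?J S) (unit_map S (con S T \<phi> v)) i =
        restr (?J S) (farr biset_func (?J T) (?J S) (bcon (j_functor G bp) S T \<phi>) (unit_map T v)) i"
      unfolding restr_farr[OF oT oS jc(2) tv i'] restr_unit_map[OF S(1) i cv] .
  qed
qed

lemma factors_through_j_if_conj_inv: "factors_through_j G bp M"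
  unfolding factors_through_j_def bifunc_isomorphic_def
proof (intro exI conjI ballI, rule additive_functor_biset_func)
  let ?F = "func_bifunc_comp biset_func (j_functor G bp)"
  have Fo: "bobj ?F S = Mo (coprod_set (j_obj G bp S))" for S
    by (simp add: func_bifunc_comp_def biset_func_simps j_functor_obj)
  fix S assume "S \<in> cat_obj (Gsets G)"
  then have S: "finite_gset G S" by (simp add: Gsets_def)
  show "unit_map S \<in> cat_iso Ab (Mo S) (bobj ?F S)"
    unfolding Fo by (rule unit_map_iso[OF S])
  fix T \<phi> assume "T \<in> cat_obj (Gsets G)" "\<phi> \<in> cat_hom (Gsets G) S T"
  then have T: "finite_gset G T" and \<phi>: "\<phi> \<in> gmaps G S T" by (simp_all add: Gsets_def)
  show "cat_comp Ab (Mo S) (Mo T) (bobj ?F T) (unit_map T) (cov S T \<phi>) =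
      cat_comp Ab (Mo S) (bobj ?F S) (bobj ?F T) (bcov ?F S T \<phi>) (unit_map S)"
    by (auto simp: Ab_def compose_def func_bifunc_comp_def j_functor_obj unit_map_natural[OF S T \<phi>] intro!: restrict_ext)
  show "cat_comp Ab (Mo T) (Mo S) (bobj ?F S) (unit_map S) (con S T \<phi>) =
      cat_comp Ab (Mo T) (bobj ?F T) (bobj ?F S) (bcon ?F S T \<phi>) (unit_map T)"
    by (auto simp: Ab_def compose_def func_bifunc_comp_def j_functor_obj unit_map_natural[OF S T \<phi>] intro!: restrict_ext)
qed

end

end

section \<open>Conjugation invariance from a factorization\<close>

context fin_group
begin

text \<open>The biset of conjugation by an element centralizing the stabilizer is the regular one.\<close>

lemma j_functor_central:
  assumes bp: "base_point_choice G bp" and H: "subgroup H G" and z: "z \<in> centralizer G H"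
    and \<phi>: "\<phi> \<in> gmaps G (cosets H) (cosets H)" and \<phi>z: "\<phi> (Coset H) = Coset (z <# H)"
  shows "bcov (j_functor G bp) (cosets H) (cosets H) \<phi> = cat_id (B_bullet G) (j_obj G bp (cosets H))"
proof -
  let ?S = "cosets H"
  have S: "finite_gset G ?S" by (rule finite_gset_cosets[OF H])
  have zC: "z \<in> carrier G" and zH: "\<And>h. h \<in> H \<Longrightarrow> z \<otimes> h = h \<otimes> z"
    using z by (auto simp: centralizer_def)
  note HC = subgroup.mem_carrier[OF H]
  have one: "pc H \<one> \<in> fst ?S" by (simp add: fst_cosets)
  \<comment> \<open>A coset space is a single orbit, so the matrix has at most one row and one
    column.\<close>
  have len: "l = i" if l: "l < length (bp ?S)" and i: "i < length (bp ?S)" for l i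
  proof -
    have "bp ?S ! k \<in> orbit G (snd ?S) (pc H \<one>)" if k: "k < length (bp ?S)" for k
    proof -
      obtain a where "a \<in> carrier G" "bp ?S ! k = pc H a" using bp_mem[OF bp S k] by (auto simp: fst_cosets)
      then show ?thesis by (auto simp: orbit_def snd_cosets H intro!: exI[of _ a])
    qed
    then show ?thesis using bp_orbit[OF bp S one] l i by blast
  qed
  have \<phi>a: "\<phi> (pc H a) = pc H (a \<otimes> z)" if a: "a \<in> carrier G" for a
  proof -
    have "pc H a = snd ?S a (pc H \<one>)" using a by (simp add: snd_cosets H)
    then have "\<phi> (pc H a) = snd ?S a (\<phi> (pc H \<one>))" using gmapsD(2)[OF \<phi> a one] by simp
    also have "\<phi> (pc H \<one>) = pc H z" using \<phi>z by (simp add: pc_one[OF H]) (simp add: pc_def)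
    finally show ?thesis using a zC by (simp add: snd_cosets H)
  qed
  have entry: "bcov (j_functor G bp) ?S ?S \<phi> (i, i) = cat_id (B_bullet G) (j_obj G bp ?S) (i, i)"
    if i: "i < length (bp ?S)" for i
  proof -
    let ?b = "bp ?S ! i"
    let ?K = "stabilizer G (snd ?S) ?b" and ?P = "transporter G ?S ?b (\<phi> ?b)"
    note b = bp_mem[OF bp S i]
    have K: "subgroup ?K G" by (rule stabilizer_subgroup[OF S b])
    note KC = subgroup.mem_carrier[OF K]
    obtain a where a: "a \<in> carrier G" "?b = pc H a" using b by (auto simp: fst_cosets)
    \<comment> \<open>The base point may be \<open>aH\<close> with \<open>a\<close> outside
      \<open>H\<close>; its stabilizer is the conjugate of \<open>H\<close> by \<open>a\<close>, and
      \<open>z\<close> is conjugated accordingly.\<close>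
    define c where "c = a \<otimes> z \<otimes> inv a"
    have cC: "c \<in> carrier G" using a zC by (simp add: c_def)
    have "\<phi> ?b = snd ?S c ?b" using a zC cC by (simp add: \<phi>a snd_cosets H) (simp add: c_def m_assoc)
    then have cP: "c \<in> ?P" using cC by (simp add: transporter_def)
    have cK: "c \<otimes> h = h \<otimes> c" if h: "h \<in> ?K" for h
    proof -
      have hC: "h \<in> carrier G" using KC h .
      have "pc H (h \<otimes> a) = pc H a" using stabilizerD(2)[OF h] a hC by (simp add: snd_cosets H)
      then obtain h' where h': "h' \<in> H" "h \<otimes> a = a \<otimes> h'"
        using pc_eq_iff[OF H a(1), of "h \<otimes> a"] a hC by auto
      have h'C: "h' \<in> carrier G" using HC h'(1) .
      have h: "h = a \<otimes> h' \<otimes> inv a" using a hC by (simp add: m_assoc flip: h'(2))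
      have "c \<otimes> h = a \<otimes> (z \<otimes> h') \<otimes> inv a"
        unfolding c_def h using a zC h'C by (simp add: m_assoc mult_inv_cancel)
      also have "\<dots> = h \<otimes> c"
        unfolding c_def h zH[OF h'(1)] using a zC h'C by (simp add: m_assoc mult_inv_cancel)
      finally show ?thesis .
    qed
    let ?g = "SOME g. g \<in> ?P"
    have gP: "?g \<in> ?P" using cP by (rule someI)
    then have gC: "?g \<in> carrier G" by (simp add: transporter_def)
    \<comment> \<open>The definition of \<open>j\<close> selects some element of the transporter,
      not necessarily \<open>c\<close>; the two differ by \<open>k\<close> in the
      stabilizer.\<close>
    define k where "k = inv c \<otimes> ?g"
    have kC: "k \<in> carrier G" using cC gC by (simp add: k_def)
    have "snd ?S ?g ?b = snd ?S c ?b" using gP cP by (simp add: transporter_def)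
    then have "snd ?S k ?b = ?b"
      using S gC cC b by (simp add: k_def gset_mult gset_inv)
    then have kK: "k \<in> ?K" using kC by (simp add: stabilizer_def)
    have g: "?g = c \<otimes> k" using cC gC by (simp add: k_def mult_inv_cancel)
    \<comment> \<open>Since \<open>c\<close> centralizes the stabilizer, conjugation by
      \<open>?g\<close> is conjugation by \<open>k\<close> alone, and right multiplication by
      \<open>inv k\<close> removes this twist from the biset.\<close>
    have conj: "inv ?g \<otimes> h \<otimes> ?g = inv k \<otimes> h \<otimes> k" if h: "h \<in> ?K" for h
    proof -
      have hC: "h \<in> carrier G" using KC h .
      have "inv ?g \<otimes> h \<otimes> ?g = inv k \<otimes> (inv c \<otimes> (h \<otimes> c)) \<otimes> k"
        unfolding g using cC kC hC by (simp add: inv_mult_group m_assoc)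
      then show ?thesis using cC kC hC by (simp add: mult_inv_cancel m_assoc flip: cK[OF h])
    qed
    have ikK: "inv k \<in> ?K" using subgroup.m_inv_closed[OF K kK] .
    have "biset_isomorphic ?K ?K (cov_biset G ?K ?g) (reg_biset G ?K)"
    proof (rule biset_isomorphicI[of "\<lambda>x. x \<otimes> inv k"])
      show "bij_betw (\<lambda>x. x \<otimes> inv k) (bpts (cov_biset G ?K ?g)) (bpts (reg_biset G ?K))"
        by (rule bij_betw_byWitness[of _ "\<lambda>x. x \<otimes> k"])
          (auto simp: cov_biset_def reg_biset_def m_assoc KC kC subgroup.m_closed[OF K] ikK kK)
      fix h x assume h: "h \<in> ?K" and "x \<in> bpts (cov_biset G ?K ?g)"
      then have xC: "x \<in> carrier G" and hC: "h \<in> carrier G" using KC by (auto simp: cov_biset_def)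
      show "lact (cov_biset G ?K ?g) h x \<otimes> inv k = lact (reg_biset G ?K) h (x \<otimes> inv k)"
        using xC hC kC by (simp add: cov_biset_def reg_biset_def m_assoc)
      show "ract (cov_biset G ?K ?g) x h \<otimes> inv k = ract (reg_biset G ?K) (x \<otimes> inv k) h"
        using xC hC kC by (simp add: cov_biset_def reg_biset_def conj[OF h] m_assoc)
    qed
    from biset_cls_eqI[OF finite_cov_biset[OF K K gC transporter_conj[OF S S \<phi> b b gP]] this]
    show ?thesis
      using i cP by (auto simp: j_functor_simps B_bullet_id_nth j_obj_simps virtual_cls_eq)
  qed
  show ?thesis
  proof (rule extensionalityI)
    show "bcov (j_functor G bp) ?S ?S \<phi> \<in> extensional (mat_index (j_obj G bp ?S) (j_obj G bp ?S))"
      by (simp add: j_functor_def)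
    show "cat_id (B_bullet G) (j_obj G bp ?S) \<in> extensional (mat_index (j_obj G bp ?S) (j_obj G bp ?S))"
      by (simp add: B_bullet_def additive_completion_def)
    fix p assume "p \<in> mat_index (j_obj G bp ?S) (j_obj G bp ?S)"
    then obtain l i where "p = (l, i)" "l < length (bp ?S)" "i < length (bp ?S)" by (auto simp: j_obj_simps)
    then show "bcov (j_functor G bp) ?S ?S \<phi> p = cat_id (B_bullet G) (j_obj G bp ?S) p"
      using len entry by blast
  qed
qed

end

context mackey
begin

text \<open>\<open>F\<close> preserves the identity to which \<open>j\<close> sends the map, so
  naturality of \<theta> says that pushforward does not change the image under \<theta>; and
  \<theta> is injective.\<close>

lemma conj_inv_if_factors_through_j:
  assumes bp: "base_point_choice G bp" and fac: "factors_through_j G bp M"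
  shows "conjugation_invariant G M"
  unfolding conjugation_invariant_def
proof (intro allI impI ballI)
  fix H z \<phi>
  assume H: "subgroup H G" and z: "z \<in> centralizer G H"
    and \<phi>: "\<phi> \<in> gmaps G (cosets H) (cosets H)" and \<phi>z: "\<phi> (Coset H) = Coset (z <# H)"
  let ?S = "cosets H" and ?J = "j_obj G bp (cosets H)"
  have S: "finite_gset G ?S" by (rule finite_gset_cosets[OF H])
  obtain F \<theta> where F: "additive_functor (B_bullet G) Ab F"
    and \<theta>: "\<And>X. X \<in> cat_obj (Gsets G) \<Longrightarrow> \<theta> X \<in> cat_iso Ab (Mo X) (bobj (func_bifunc_comp F (j_functor G bp)) X)"
    and nat: "\<And>X Y f. X \<in> cat_obj (Gsets G) \<Longrightarrow> Y \<in> cat_obj (Gsets G) \<Longrightarrow> f \<in> cat_hom (Gsets G) X Y \<Longrightarrow>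
      cat_comp Ab (Mo X) (Mo Y) (bobj (func_bifunc_comp F (j_functor G bp)) Y) (\<theta> Y) (cov X Y f) =
      cat_comp Ab (Mo X) (bobj (func_bifunc_comp F (j_functor G bp)) X) (bobj (func_bifunc_comp F (j_functor G bp)) Y)
        (bcov (func_bifunc_comp F (j_functor G bp)) X Y f) (\<theta> X)"
    using fac unfolding factors_through_j_def bifunc_isomorphic_def by blast
  have SG: "?S \<in> cat_obj (Gsets G)" "\<phi> \<in> cat_hom (Gsets G) ?S ?S" using S \<phi> by (simp_all add: Gsets_def)
  have oF: "bobj (func_bifunc_comp F (j_functor G bp)) ?S = fobj F ?J"
    by (simp add: func_bifunc_comp_def j_functor_obj)
  have "farr F ?J ?J (cat_id (B_bullet G) ?J) = cat_id Ab (fobj F ?J)"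
    using F j_obj_obj[OF bp S] unfolding additive_functor_def by (blast intro: is_functorD(3))
  then have Fid: "bcov (func_bifunc_comp F (j_functor G bp)) ?S ?S \<phi> = (\<lambda>x\<in>carrier (fobj F ?J). x)"
    by (simp add: func_bifunc_comp_def j_functor_obj j_functor_central[OF bp H z \<phi> \<phi>z] Ab_def)
  obtain \<theta>' where \<theta>h: "\<theta> ?S \<in> hom (Mo ?S) (fobj F ?J)"
    and inv: "compose (carrier (Mo ?S)) \<theta>' (\<theta> ?S) = (\<lambda>x\<in>carrier (Mo ?S). x)"
    using \<theta>[OF SG(1)] unfolding oF by (auto simp: cat_iso_def Ab_def)
  have inv': "\<theta>' (\<theta> ?S u) = u" if "u \<in> carrier (Mo ?S)" for u
    using fun_cong[OF inv, of u] that by (simp add: compose_eq)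
  show "cov ?S ?S \<phi> = cat_id Ab (Mo ?S)"
  proof (rule extensionalityI[OF cov_hom(2)[OF S S \<phi>]])
    show "cat_id Ab (Mo ?S) \<in> extensional (carrier (Mo ?S))" by (simp add: Ab_def)
    fix u assume u: "u \<in> carrier (Mo ?S)"
    note cu = cov_closed[OF S S \<phi> u]
    have "\<theta> ?S (cov ?S ?S \<phi> u) = \<theta> ?S u"
      using fun_cong[OF nat[OF SG(1) SG(1) SG(2)], of u] u hom_in_carrier[OF \<theta>h u]
      by (simp add: Ab_def compose_eq oF Fid)
    then have "cov ?S ?S \<phi> u = u" using inv'[OF cu] inv'[OF u] by simp
    then show "cov ?S ?S \<phi> u = cat_id Ab (Mo ?S) u" using u by (simp add: Ab_def)
  qed
qed

end

theorem theoremA: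
  fixes G :: "('g, 'k) monoid_scheme"
    and bp :: "'g gset \<Rightarrow> 'g pt list"
    and M :: "('g, 'a) gset_bifunc"
  assumes "group G"
    and "finite (carrier G)"
    and "base_point_choice G bp"
    and "mackey_functor G M"
  shows "factors_through_j G bp M \<longleftrightarrow> conjugation_invariant G M"
proof -
  interpret mackey G M
    using assms by (simp add: mackey_def mackey_axioms_def fin_group_def fin_group_axioms_def)
  show ?thesis
  proof
    show "factors_through_j G bp M \<Longrightarrow> conjugation_invariant G M"
      by (rule conj_inv_if_factors_through_j[OF assms(3)])
    assume "conjugation_invariant G M"
    then interpret conj_mackey G M by unfold_locales
    show "factors_through_j G bp M" by (rule factors_through_j_if_conj_inv[OF assms(3)])
  qed
qed

end
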